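(* Consider the closed-loop system consisting of the plant $$\dot x = A_m x + B_m(\omega u + f(x,t)),\quad y = C_m x,\quad x(0)=x_0,\quad \|x_0\|\le\rho_0,$$ and the $\mathcal{L}_1$ adaptive output feedback controller (control law, predictor and adaptive laws) described in the context, subject to the design constraints in the context. Let $(x_{ref},u_{ref},y_{ref})$ be the solution of the reference system in the context. Suppose the adaptation gains are chosen so that $$\Gamma > \frac{\theta_1}{\epsilon_\gamma^2},$$ where $\Gamma=\min(\Gamma_\omega,\Gamma_\theta,\Gamma_\sigma)$, and $\theta_1$, $\epsilon_\gamma$ are given in the context. Then $$\|x_{ref}-x\|_{\mathcal{L}_\infty}\le\rho_{dx},\qquad \|u_{ref}-u\|_{\mathcal{L}_\infty}\le\rho_{du},$$ $$\|y_{ref}-y\|_{\mathcal{L}_\infty}\le\|C_m\|\rho_{dx},\qquad \|x\|_{\mathcal{L}_\infty}\le\rho_x,\qquad \|u\|_{\mathcal{L}_\infty}\le\rho_u .$$ Moreover, for each $\omega\in\mathcal{C}_\omega$ there exist positive constants $\gamma_{dx},\gamma_{dy}$ and strictly decreasing functions $\upsilon_{dx}(t),\upsilon_{dy}(t)$ such that for all $t\ge0$ $$\|x_{ref}(t)-x(t)\|\le\upsilon_{dx}(t)\|x_0\|+\frac{\gamma_{dx}}{\sqrt\Gamma},\qquad \|y_{ref}(t)-y(t)\|\le\upsilon_{dy}(t)\|x_0\|+\frac{\gamma_{dy}}{\sqrt\Gamma}.$$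
   Context: **Norms.** $\|\cdot\|$ is the vector (or induced matrix) $\infty$-norm, $\|\cdot\|_2$ the 2-norm. $\|x\|_{\mathcal{L}_\infty}$ is the $\mathcal{L}_\infty$ norm on $[0,\infty)$ and $\|x_\tau\|_{\mathcal{L}_\infty}$ the one on $[0,\tau]$. For a stable proper transfer matrix $G(s)$, $\|G(s)\|_{\mathcal{L}_1}$ is its $\mathcal{L}_1$ norm (maximal row sum of the $\mathcal L_1$ norms of the entries of the impulse response). $N^\dagger$ is the generalized (Moore–Penrose) inverse; for $N$ of full column rank $N^\dagger N=\mathbb{I}$. Signals and their Laplace transforms share the same letter. "Unstable" zeros are those not in the open left half-plane. **Plant.** $x(t)\in\mathbb{R}^n$, $u(t)\in\mathbb{R}^m$, $y(t)\in\mathbb{R}^p$, $m\le p\le n$; $A_m$ is Hurwitz, $(A_m,B_m,C_m)$ is a minimal realization of $M(s)=C_m(s\mathbb{I}_n-A_m)^{-1}B_m$, which has full normal column rank $m$ and no unstable transmission zeros. $\omega$ is an unknown constant in the known set $\mathcal{C}_\omega=[\omega_l,\omega_u]$, $0<\omega_l<\omega_u$. The unknown $f:\mathbb{R}^n\times\mathbb{R}\to\mathbb{R}^m$ satisfies $\|f(0,t)\|<b_0$ for all $t\ge0$ and, for every $\delta>0$, $\|\partial f/\partial x\|\le d_\delta$, $\|\partial f/\partial t\|\le b_\delta$ for all $\|x\|<\delta$, with known constants $b_0,d_\delta,b_\delta>0$. $r(t)\in\mathbb{R}^{m_r}$ is a bounded reference signal and $K_g\in\mathbb{R}^{m\times m_r}$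 a feed-forward gain. $y_0=C_mx_0$ is known, and $\rho_0>0$ is a given constant. **Interactor.** $Z^{-1}(s)$ is a right interactor of $sM(s)$, i.e. $\lim_{s\to\infty}sM(s)Z^{-1}(s)$ has full rank, with $Z(s)=C_z(s\mathbb{I}_{n_z}-A_z)^{-1}B_z+D_z$ a minimal realization, $A_z$ Hurwitz, $\det\begin{bmatrix}-s\mathbb{I}_{n_z}+A_z&B_z\\C_z&D_z\end{bmatrix}\ne0$ for all $s\in\mathbb{C}$. $T_z\in\mathbb{R}^{n\times n_z}$ (full column rank) and $\bar B\in\mathbb{R}^{n\times m}$ satisfy: $(A_m,\bar B)$ controllable, $C_m\bar B$ of full rank, $C_m(s\mathbb{I}_n-A_m)^{-1}\bar B=M(s)Z^{-1}(s)$, and $$A_mT_z=T_zA_z+\bar BC_z,\quad C_mA_mT_z=C_m\bar BC_z,\quad B_m=T_zB_z+\bar BD_z,\quad C_mB_m=C_m\bar BD_z.$$ (If $C_mB_m$ has full rank, $Z=\mathbb{I}_m$, $\bar B=B_m$ and the state of $Z$ is absent.) **Design constants.** $\bar\gamma>0$ is an arbitrarily small constant; $\bar\delta(\delta)=\delta+\bar\gamma$, $L_\delta=\frac{\bar\delta(\delta)}{\delta}d_{\bar\delta(\delta)}$. $H=\bar B(C_m\bar B)^\dagger$, $A_H=(\mathbb{I}_n-HC_m)A_m$, and $K_v\in\mathbb{R}^{n\times p}$ is such that $A_v=A_H+K_vC_m$ is Hurwitz. $P_y\in\mathbb{R}^{p\times p}$ is positive definite with Cholesky factorization $P_y=\sqrt{P_y}^\top\sqrt{P_y}$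 ($\sqrt{P_y}$ upper triangular); $P_v$ is the positive definite solution of $A_v^\top P_v+P_vA_v=-Q$, $Q$ positive definite, $0<\epsilon_q<\lambda_{\min}(Q)$. $\bar P_v=(\mathbb{I}_n-HC_m)^\top P_v(\mathbb{I}_n-HC_m)$, $$\kappa_m=\sup_{t\ge0}\|e^{A_mt}\|,\quad\kappa_y=\sqrt{n\frac{\lambda_{\max}(\bar P_v)}{\lambda_{\min}(P_y)}},\quad\kappa_v=\sqrt{n\frac{\lambda_{\max}(\bar P_v)}{\lambda_{\min}(P_v)}}.$$ $D(s)$ is an $m\times m$ transfer matrix such that, for all $\omega\in\mathcal{C}_\omega$, with $C_0(s)=D(s)(\mathbb{I}_m+\omega D(s))^{-1}$, $C(s)=\omega C_0(s)$ is stable, $C(0)=\mathbb{I}_m$, and $C(s)Z^{-1}(s)$ is strictly proper. Define $$H_0=(s\mathbb{I}_n-A_m)^{-1}B_m,\ H_r=H_0CK_g,\ G=H_0(\mathbb{I}_m-C),\ H_1=\omega H_0C_1,\ H_2=\omega H_0C_2,$$ $$C_1=(s+\alpha)C_0Z^{-1}(C_m\bar B)^\dagger,\quad C_2=C_0Z^{-1}(C_m\bar B)^\dagger C_mA_m,$$ $$\kappa_x=\|H_1\|_{\mathcal{L}_1}\kappa_y+\|H_2\|_{\mathcal{L}_1}\kappa_v,\ \rho_{ext}=\|H_r\|_{\mathcal{L}_1}\|r\|_{\mathcal{L}_\infty}+\|G\|_{\mathcal{L}_1}b_0,\ \rho_{int}=(\kappa_m+\kappa_x)\rho_0.$$ It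 is assumed that there is $\rho_r>0$ with $$\|G(s)\|_{\mathcal{L}_1}<\frac{\rho_r-\rho_{ext}-\rho_{int}}{L_{\rho_r}\rho_r}\quad\text{for all }\omega\in\mathcal{C}_\omega .$$ Put $\rho_x=\rho_r+\bar\gamma$, $T_g=[\mathbb{I}_n,\ \omega T_z]$, $T(s)=T_z(s\mathbb{I}_{n_z}-A_z)^{-1}B_z$, $$\bar d_{\rho_x}=\max_{\omega\in\mathcal{C}_\omega}\big(\|C_zT_z^\dagger T_g\|+\|D_z\|\|T_g\|d_{\rho_x}\big),$$ $$\bar b_{\rho_x}=\|C_zT_z^\dagger\|\rho_x+\|D_z\|\|T\|_{\mathcal{L}_1}d_{\rho_x}^2\rho_x+\|D_z\|(\|T\|_{\mathcal{L}_1}d_{\rho_x}+1)b_0 .$$ The constant $\alpha>0$ satisfies $\alpha_y=2\alpha-\alpha_\phi>0$, $\alpha_\phi=\frac{m\bar d_{\rho_x}^2}{\epsilon_q}\|\sqrt{P_y}C_m\bar B\|_2^2$. **Reference system.** $\dot x_{ref}=A_mx_{ref}+B_m(\omega u_{ref}+f(x_{ref},t))$, $y_{ref}=C_mx_{ref}$, $x_{ref}(0)=0$, $u_{ref}(s)=C_0(s)(K_gr(s)-\eta_{ref}(s))$, $\eta_{ref}(s)$ the Laplace transform of $f(x_{ref}(t),t)$. **Controller.** $u(s)=-D(s)Z^{-1}(s)(\hat\eta_t(s)-r_z(s))$, $r_z(s)=Z(s)K_gr(s)$, where $\hat\eta_t(t)=\hat\omega u_z+\hat\theta\|\hat x_g\|+\hat\sigma$;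 $\dot x_u=A_zx_u+B_zu$, $u_z=C_zx_u+D_zu$, $x_u(0)=0$; $\hat x_g=[\hat x_v^\top,x_u^\top]^\top$, $\hat x_v=\hat v+Hy$. Predictor, with $\tilde y=\hat y-y$: $$\dot{\hat v}=A_v\hat x_v-K_vy-P_v^{-1}A_m^\top C_m^\top P_y\tilde y,\quad\dot{\hat y}=-\alpha\tilde y+C_mA_m\hat x_v+C_m\bar B\hat\eta_t,\quad\hat v(0)=0,\ \hat y(0)=y_0 .$$ Adaptive laws, with $e_y=\bar B^\top C_m^\top P_y\tilde y$ and gains $\Gamma_\omega,\Gamma_\theta,\Gamma_\sigma>0$: $$\dot{\hat\omega}=\Gamma_\omega\mathrm{Proj}(\hat\omega,-u_z^\top e_y),\quad\dot{\hat\theta}=\Gamma_\theta\mathrm{Proj}(\hat\theta,-\|\hat x_g\|e_y),\quad\dot{\hat\sigma}=\Gamma_\sigma\mathrm{Proj}(\hat\sigma,-e_y),$$ $\hat\omega(0)=1$, $\hat\theta(0)=0$, $\hat\sigma(0)=0$. Proj is the standard projection operator of adaptive control for the a priori sets $\omega\in\mathcal{C}_\omega$ (with $1\in\mathcal C_\omega$), $\|\theta\|\le\bar d_{\rho_x}$, $\|\sigma\|\le\bar b_{\rho_x}$: it keeps each estimate in its set, and $(\hat q-q)^\top(\mathrm{Proj}(\hat q,z)-z)\le0$ for all $q$, $\hat q$ in the set and all $z$. **Constants in the conclusion.** $$\rho_{rx}=\rho_r-\frac{\rho_{int}}{1-\|G\|_{\mathcal{L}_1}L_{\rho_r}},\quad\rho_{ru}=\|C_0\|_{\mathcal{L}_1}(L_{\rho_r}\rho_{rx}+b_0)+\|C_0K_g\|_{\mathcal{L}_1}\|r\|_{\mathcal{L}_\infty},$$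 $$\gamma_{x_0}=\frac{\kappa_x+\kappa_m}{1-\|G\|_{\mathcal{L}_1}L_{\rho_r}},\quad\gamma_{u_0}=\|C_0\|_{\mathcal{L}_1}L_{\rho_r}\gamma_{x_0}+\|C_1\|_{\mathcal{L}_1}\kappa_y+\|C_2\|_{\mathcal{L}_1}\kappa_v,$$ $$\gamma_x=\frac{\lambda_{\min}(P_y)^{-1/2}\|H_1\|_{\mathcal{L}_1}+\lambda_{\min}(P_v)^{-1/2}\|H_2\|_{\mathcal{L}_1}}{1-\|G\|_{\mathcal{L}_1}L_{\rho_r}},\quad\gamma_u=\|C_0\|_{\mathcal{L}_1}L_{\rho_r}\gamma_x+\frac{\|C_1\|_{\mathcal{L}_1}}{\sqrt{\lambda_{\min}(P_y)}}+\frac{\|C_2\|_{\mathcal{L}_1}}{\sqrt{\lambda_{\min}(P_v)}},$$ $\rho_{dx}=\gamma_{x_0}\rho_0+\bar\gamma$, $\rho_{du}=\gamma_{u_0}\rho_0+\bar\gamma$, $\rho_u=\rho_{ru}+\rho_{du}$. $\epsilon_\gamma>0$ is a small constant with $\gamma_x\epsilon_\gamma<\bar\gamma$ and $\gamma_u\epsilon_\gamma<\bar\gamma$ for all $\omega\in\mathcal{C}_\omega$. Further $$\lambda_1=\min\Big(\frac{\lambda_{\min}(Q_v)}{\lambda_{\max}(P_v)},\alpha_y\Big),\ Q_v=Q-\epsilon_q\mathbb{I}_n,\quad\theta_0=4(\omega_u^2+m\bar d_{\rho_x}^2+m\bar b_{\rho_x}^2),\quad\theta_1=\theta_0+4m\frac{\bar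 d_{\rho_x}\bar l_\theta+\bar b_{\rho_x}\bar l_\sigma}{\lambda_1}.$$ Here $\bar l_\theta,\bar l_\sigma$ are the finite computable constants of the following parametrization. Let $x_v,x_f$ solve $\dot x_v=A_mx_v+\bar B(\omega u_z+\bar f)$, $x_v(0)=x_0$, and $\dot x_f=A_zx_f+B_zf(T_gx_g+T_zx_f,t)$, $x_f(0)=0$, with $x_g=[x_v^\top,x_u^\top]^\top$ and $\bar f=C_zx_f+D_zf(T_gx_g+T_zx_f,t)$ (so that $x=T_gx_g+T_zx_f$). Whenever $\|x_\tau\|_{\mathcal{L}_\infty}\le\rho_x$ and $\|u_\tau\|_{\mathcal{L}_\infty}\le\rho_u$, one can write $\bar f=\theta(t)\|x_g(t)\|+\sigma(t)$ on $[0,\tau]$ with continuous, piecewise differentiable $\theta,\sigma$ satisfying $\|\theta\|\le\bar d_{\rho_x}$, $\|\dot\theta\|\le\bar l_\theta$, $\|\sigma\|\le\bar b_{\rho_x}$, $\|\dot\sigma\|\le\bar l_\sigma$. *)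

theory Defs
  imports
    "HOL-Analysis.Analysis"
    "HOL-Computational_Algebra.Computational_Algebra"
    "HOL-Computational_Algebra.Field_as_Ring"
begin

section \<open>Matrices\<close>

text \<open>
  On \<^typ>\<open>real^'n^'m\<close> the symbols \<open>*\<close>, \<open>1\<close> and \<open>\<le>\<close> are componentwise; the matrix product,
  the matrix-vector product and the identity are \<open>**\<close>, \<open>*v\<close> and \<^term>\<open>mat 1\<close>.  The vector
  \<open>\<infinity>\<close>-norm is the library's \<^const>\<open>infnorm\<close>, and the induced 2-norm of \<open>A\<close> is
  \<open>onorm ((*v) A)\<close>.
\<close>

definition mat_infnorm :: "real^'n^'m \<Rightarrow> real" where
  "mat_infnorm A = (SUP x\<in>{x. infnorm x = 1}. infnorm (A *v x))"

definition mat_exp :: "real^'n^'n \<Rightarrow> real^'n^'n" where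
  "mat_exp A = (\<Sum>k. (1 / fact k) *\<^sub>R (((\<lambda>X. A ** X) ^^ k) (mat 1)))"

definition complex_mat :: "real^'n^'m \<Rightarrow> complex^'n^'m" where
  "complex_mat = map_matrix complex_of_real"

definition hurwitz :: "real^'n^'n \<Rightarrow> bool" where
  "hurwitz A \<longleftrightarrow> (\<forall>s v. v \<noteq> 0 \<and> complex_mat A *v v = s *s v \<longrightarrow> Re s < 0)"

definition pos_def :: "real^'n^'n \<Rightarrow> bool" where
  "pos_def P \<longleftrightarrow> transpose P = P \<and> (\<forall>x. x \<noteq> 0 \<longrightarrow> x \<bullet> (P *v x) > 0)"

text \<open>Only applied to symmetric matrices, whose eigenvalues are all real.\<close>

definition real_eigenvalues :: "real^'n^'n \<Rightarrow> real set" where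
  "real_eigenvalues A = {l. \<exists>v. v \<noteq> 0 \<and> A *v v = l *\<^sub>R v}"

definition lambda_min :: "real^'n^'n \<Rightarrow> real" where
  "lambda_min A = Min (real_eigenvalues A)"

definition lambda_max :: "real^'n^'n \<Rightarrow> real" where
  "lambda_max A = Max (real_eigenvalues A)"

text \<open>Moore--Penrose inverse, characterised by the four Penrose equations.\<close>

definition pinv :: "real^'n^'m \<Rightarrow> real^'m^'n" where
  "pinv N = (THE X. N ** X ** N = N \<and> X ** N ** X = X \<and>
                    transpose (N ** X) = N ** X \<and> transpose (X ** N) = X ** N)"

definition upper_triangular_mat :: "real^('n::{finite,linorder})^('n::{finite,linorder}) \<Rightarrow> bool" where
  "upper_triangular_mat U \<longleftrightarrow> (\<forall>i j. j < i \<longrightarrow> U $ i $ j = 0)"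

definition hcat :: "'a^'n^'k \<Rightarrow> 'a^'m^'k \<Rightarrow> 'a^('n + 'm)^'k" where
  "hcat A B = (\<chi> i j. case j of Inl k \<Rightarrow> A $ i $ k | Inr k \<Rightarrow> B $ i $ k)"

definition vstack :: "'a^'n \<Rightarrow> 'a^'m \<Rightarrow> 'a^('n + 'm)" where
  "vstack v w = (\<chi> i. case i of Inl k \<Rightarrow> v $ k | Inr k \<Rightarrow> w $ k)"

section \<open>State-space realizations\<close>

definition controllable :: "real^'n^'n \<Rightarrow> real^'m^'n \<Rightarrow> bool" where
  "controllable A B \<longleftrightarrow>
     span {(((*v) A) ^^ k) (B *v axis j 1) | k j. k < CARD('n)} = (UNIV :: (real^'n) set)"

definition observable :: "real^'n^'n \<Rightarrow> real^'n^'p \<Rightarrow> bool" where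
  "observable A C \<longleftrightarrow> controllable (transpose A) (transpose C)"

definition minimal_realization :: "real^'n^'n \<Rightarrow> real^'m^'n \<Rightarrow> real^'n^'p \<Rightarrow> bool" where
  "minimal_realization A B C \<longleftrightarrow> controllable A B \<and> observable A C"

text \<open>The block matrix with rows \<open>[-sI + A, B]\<close> and \<open>[C, D]\<close>.\<close>

definition rosenbrock ::
  "real^'n^'n \<Rightarrow> real^'m^'n \<Rightarrow> real^'n^'p \<Rightarrow> real^'m^'p \<Rightarrow> complex \<Rightarrow> complex^('n + 'm)^('n + 'p)"
  where
  "rosenbrock A B C D s =
     (\<chi> i. case i of
        Inl k \<Rightarrow> hcat (complex_mat A - mat s) (complex_mat B) $ k
      | Inr k \<Rightarrow> hcat (complex_mat C) (complex_mat D) $ k)"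

text \<open>
  Transmission zeros of a minimal realization: the points where the rank of the system matrix
  drops below its generic (maximal) value.
\<close>

definition transmission_zero ::
  "real^'n^'n \<Rightarrow> real^'m^'n \<Rightarrow> real^'n^'p \<Rightarrow> real^'m^'p \<Rightarrow> complex \<Rightarrow> bool" where
  "transmission_zero A B C D s \<longleftrightarrow>
     (\<exists>s'. rank (rosenbrock A B C D s) < rank (rosenbrock A B C D s'))"

section \<open>Transfer matrices\<close>

text \<open>
  Transfer matrices are matrices over the field of real rational functions in \<open>s\<close>.  For
  \<open>g :: real poly fract\<close>, the pair \<^term>\<open>quot_of_fract g\<close> is the reduced
  fraction with monic denominator.
\<close>

type_synonym ratfun = "real poly fract"

definition rf_num :: "ratfun \<Rightarrow> real poly" where "rf_num g = fst (quot_of_fract g)"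
definition rf_den :: "ratfun \<Rightarrow> real poly" where "rf_den g = snd (quot_of_fract g)"

definition rf_eval :: "ratfun \<Rightarrow> complex \<Rightarrow> complex" where
  "rf_eval g s = poly (map_poly of_real (rf_num g)) s / poly (map_poly of_real (rf_den g)) s"

definition rf_pole :: "ratfun \<Rightarrow> complex \<Rightarrow> bool" where
  "rf_pole g s \<longleftrightarrow> poly (map_poly of_real (rf_den g)) s = 0"

definition rf_s :: ratfun where "rf_s = to_fract [:0, 1:]"
definition rf_const :: "real \<Rightarrow> ratfun" where "rf_const c = to_fract [:c:]"

definition tf_const :: "real^'n^'m \<Rightarrow> ratfun^'n^'m" where
  "tf_const = map_matrix rf_const"

definition tf_scale :: "ratfun \<Rightarrow> ratfun^'n^'m \<Rightarrow> ratfun^'n^'m" where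
  "tf_scale g = map_matrix ((*) g)"

definition resolvent :: "real^'n^'n \<Rightarrow> ratfun^'n^'n" where
  "resolvent A = matrix_inv (mat rf_s - tf_const A)"

definition tf_stable :: "ratfun^'n^'m \<Rightarrow> bool" where
  "tf_stable G \<longleftrightarrow> (\<forall>i j s. rf_pole (G $ i $ j) s \<longrightarrow> Re s < 0)"

definition tf_strictly_proper :: "ratfun^'n^'m \<Rightarrow> bool" where
  "tf_strictly_proper G \<longleftrightarrow>
     (\<forall>i j. G $ i $ j = 0 \<or> degree (rf_num (G $ i $ j)) < degree (rf_den (G $ i $ j)))"

definition tf_eval :: "ratfun^'n^'m \<Rightarrow> complex \<Rightarrow> complex^'n^'m" where
  "tf_eval G s = map_matrix (\<lambda>g. rf_eval g s) G"

text \<open>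
  A proper \<open>g\<close> splits as \<open>g(s) = g\<^sub>\<infinity> + h(s)\<close> with \<open>h\<close> strictly proper.  Its impulse
  response consists of a Dirac impulse of weight \<open>g\<^sub>\<infinity>\<close> (\<open>feedthrough g\<close>) and of the
  inverse Laplace transform of \<open>h\<close> (\<open>impulse_response g\<close>); the Laplace integral is only required
  on some right half-plane, so \<open>g\<close> may be unstable.  The function is set to 0 for negative times so
  that it is uniquely determined.
\<close>

definition feedthrough :: "ratfun \<Rightarrow> real" where
  "feedthrough g = coeff (rf_num g) (degree (rf_den g)) / lead_coeff (rf_den g)"

definition impulse_response :: "ratfun \<Rightarrow> real \<Rightarrow> real" where
  "impulse_response g = (THE h.
     continuous_on {0..} h \<and> (\<forall>t<0. h t = 0) \<and>
     (\<exists>c. \<forall>s. Re s > c \<longrightarrow>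
        (\<lambda>t. exp (- (s * of_real t)) * complex_of_real (h t)) absolutely_integrable_on {0..} \<and>
        integral {0..} (\<lambda>t. exp (- (s * of_real t)) * complex_of_real (h t))
          = rf_eval g s - of_real (feedthrough g)))"

definition L1_norm :: "ratfun^'n^'m \<Rightarrow> real" where
  "L1_norm G = (MAX i. \<Sum>j\<in>UNIV.
     \<bar>feedthrough (G $ i $ j)\<bar> + integral {0..} (\<lambda>t. \<bar>impulse_response (G $ i $ j) t\<bar>))"

section \<open>Signals\<close>

definition Linf_on :: "real set \<Rightarrow> (real \<Rightarrow> real^'n) \<Rightarrow> ereal" where
  "Linf_on T x = (SUP t\<in>T. ereal (infnorm (x t)))"

text \<open>
  \<open>ode_sol x F x0\<close>: \<open>x' = F(t)\<close>, \<open>x(0) = x0\<close> on \<open>[0,\<infinity>)\<close> in the sense of Caratheodory.  The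
  integral form is needed since the projection in the adaptive laws is in general discontinuous
  at the boundary of the parameter set, where classical derivatives fail to exist.
\<close>

definition ode_sol :: "(real \<Rightarrow> 'a::euclidean_space) \<Rightarrow> (real \<Rightarrow> 'a) \<Rightarrow> 'a \<Rightarrow> bool" where
  "ode_sol x F x0 \<longleftrightarrow>
     (\<forall>t\<ge>0. F absolutely_integrable_on {0..t} \<and> x t = x0 + integral {0..t} F)"

text \<open>\<open>tf_response G v w\<close>: \<open>w(s) = G(s) v(s)\<close>, i.e. \<open>w\<close> is the convolution of \<open>v\<close> with the
  impulse response of \<open>G\<close> (zero initial state).\<close>

definition tf_response :: "ratfun^'k^'l \<Rightarrow> (real \<Rightarrow> real^'k) \<Rightarrow> (real \<Rightarrow> real^'l) \<Rightarrow> bool" where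
  "tf_response G v w \<longleftrightarrow>
     (\<forall>t\<ge>0. v absolutely_integrable_on {0..t} \<and>
        w t = (\<chi> i. \<Sum>j\<in>UNIV. feedthrough (G $ i $ j) * v t $ j +
          integral {0..t} (\<lambda>\<tau>. impulse_response (G $ i $ j) (t - \<tau>) * v \<tau> $ j)))"

definition projection_operator ::
  "('a::euclidean_space) set \<Rightarrow> ('a \<Rightarrow> 'a \<Rightarrow> 'a) \<Rightarrow> bool" where
  "projection_operator K P \<longleftrightarrow>
     (\<forall>qh\<in>K. \<forall>q\<in>K. \<forall>z. (qh - q) \<bullet> (P qh z - z) \<le> 0) \<and>
     (\<forall>g>0. \<forall>z qh q0. continuous_on {0..} z \<and> q0 \<in> K \<and>
        ode_sol qh (\<lambda>t. g *\<^sub>R P (qh t) (z t)) q0 \<longrightarrow> (\<forall>t\<ge>0. qh t \<in> K))"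

section \<open>Design data\<close>

text \<open>
  \<open>'n\<close>, \<open>'m\<close>, \<open>'p\<close>, \<open>'z\<close>, \<open>'r\<close> index the plant state, input, output, interactor state and
  reference.  \<open>'p\<close> is linearly ordered in order to speak of upper triangular matrices.
  \<open>sqrtPy\<close> is the Cholesky factor of \<open>Py\<close>, \<open>dfun\<close> and \<open>bfun\<close> are
  \<open>\<delta> \<mapsto> d\<^sub>\<delta>\<close> and \<open>\<delta> \<mapsto> b\<^sub>\<delta>\<close>.
\<close>

record ('n::finite, 'm::finite, 'p::finite, 'z::finite, 'r::finite) l1_design =
  Am :: "real^'n^'n"
  Bm :: "real^'m^'n"
  Cm :: "real^'n^'p"
  omega_l :: real
  omega_u :: real
  b0 :: real
  dfun :: "real \<Rightarrow> real"
  bfun :: "real \<Rightarrow> real"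
  ref_sig :: "real \<Rightarrow> real^'r"
  Kg :: "real^'r^'m"
  rho0 :: real
  Az :: "real^'z^'z"
  Bz :: "real^'m^'z"
  Cz :: "real^'z^'m"
  Dz :: "real^'m^'m"
  Tz :: "real^'z^'n"
  Bbar :: "real^'m^'n"
  gbar :: real
  Kv :: "real^'p^'n"
  Py :: "real^'p^'p"
  sqrtPy :: "real^'p^'p"
  Pv :: "real^'n^'n"
  Qmat :: "real^'n^'n"
  eps_q :: real
  Dtf :: "ratfun^'m^'m"
  alpha :: real
  rho_r :: real
  proj_omega :: "real \<Rightarrow> real \<Rightarrow> real"
  proj_theta :: "real^'m \<Rightarrow> real^'m \<Rightarrow> real^'m"
  proj_sigma :: "real^'m \<Rightarrow> real^'m \<Rightarrow> real^'m"
  eps_gamma :: real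
  l_theta :: real
  l_sigma :: real

definition C_omega where "C_omega S = {omega_l S..omega_u S}"

definition M_tf where "M_tf S = tf_const (Cm S) ** resolvent (Am S) ** tf_const (Bm S)"

definition Z_tf where
  "Z_tf S = tf_const (Cz S) ** resolvent (Az S) ** tf_const (Bz S) + tf_const (Dz S)"

definition Zinv_tf where "Zinv_tf S = matrix_inv (Z_tf S)"

definition T_tf where "T_tf S = tf_const (Tz S) ** resolvent (Az S) ** tf_const (Bz S)"

definition CBinv where "CBinv S = pinv (Cm S ** Bbar S)"
definition H_mat where "H_mat S = Bbar S ** CBinv S"
definition A_H where "A_H S = (mat 1 - H_mat S ** Cm S) ** Am S"
definition A_v where "A_v S = A_H S + Kv S ** Cm S"

definition Pv_bar where
  "Pv_bar S = transpose (mat 1 - H_mat S ** Cm S) ** Pv S ** (mat 1 - H_mat S ** Cm S)"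

definition kappa_m where "kappa_m S = (SUP t\<in>{0..}. mat_infnorm (mat_exp (t *\<^sub>R Am S)))"

definition kappa_y :: "('n::finite,'m::finite,'p::finite,'z::finite,'r::finite) l1_design \<Rightarrow> real"
  where "kappa_y S = sqrt (real CARD('n) * (lambda_max (Pv_bar S) / lambda_min (Py S)))"

definition kappa_v :: "('n::finite,'m::finite,'p::finite,'z::finite,'r::finite) l1_design \<Rightarrow> real"
  where "kappa_v S = sqrt (real CARD('n) * (lambda_max (Pv_bar S) / lambda_min (Pv S)))"

definition L_delta where
  "L_delta S \<delta> = (\<delta> + gbar S) / \<delta> * dfun S (\<delta> + gbar S)"

subsection \<open>Transfer matrices depending on the input gain \<open>w\<close>\<close>

definition C0_tf where
  "C0_tf S w = Dtf S ** matrix_inv (mat 1 + tf_scale (rf_const w) (Dtf S))"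

definition C_tf where "C_tf S w = tf_scale (rf_const w) (C0_tf S w)"

definition H0_tf where "H0_tf S = resolvent (Am S) ** tf_const (Bm S)"

definition Hr_tf where "Hr_tf S w = H0_tf S ** C_tf S w ** tf_const (Kg S)"

definition G_tf where "G_tf S w = H0_tf S ** (mat 1 - C_tf S w)"

definition C1_tf where
  "C1_tf S w = tf_scale (rf_s + rf_const (alpha S)) (C0_tf S w ** Zinv_tf S ** tf_const (CBinv S))"

definition C2_tf where
  "C2_tf S w = C0_tf S w ** Zinv_tf S ** tf_const (CBinv S ** Cm S ** Am S)"

definition H1_tf where "H1_tf S w = tf_scale (rf_const w) (H0_tf S ** C1_tf S w)"

definition H2_tf where "H2_tf S w = tf_scale (rf_const w) (H0_tf S ** C2_tf S w)"

subsection \<open>Constants\<close>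

definition kappa_x where
  "kappa_x S w = L1_norm (H1_tf S w) * kappa_y S + L1_norm (H2_tf S w) * kappa_v S"

definition r_Linf where "r_Linf S = real_of_ereal (Linf_on {0..} (ref_sig S))"

definition rho_ext where
  "rho_ext S w = L1_norm (Hr_tf S w) * r_Linf S + L1_norm (G_tf S w) * b0 S"

definition rho_int where "rho_int S w = (kappa_m S + kappa_x S w) * rho0 S"

definition rho_x where "rho_x S = rho_r S + gbar S"

definition T_g where "T_g S w = hcat (mat 1) (w *\<^sub>R Tz S)"

definition d_bar where
  "d_bar S = (SUP w\<in>C_omega S.
     mat_infnorm (Cz S ** pinv (Tz S) ** T_g S w)
     + mat_infnorm (Dz S) * mat_infnorm (T_g S w) * dfun S (rho_x S))"

definition b_bar where
  "b_bar S = mat_infnorm (Cz S ** pinv (Tz S)) * rho_x S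
     + mat_infnorm (Dz S) * L1_norm (T_tf S) * (dfun S (rho_x S))\<^sup>2 * rho_x S
     + mat_infnorm (Dz S) * (L1_norm (T_tf S) * dfun S (rho_x S) + 1) * b0 S"

definition alpha_phi ::
  "('n::finite,'m::finite,'p::finite,'z::finite,'r::finite) l1_design \<Rightarrow> real" where
  "alpha_phi S = real CARD('m) * (d_bar S)\<^sup>2 / eps_q S
     * (onorm ((*v) (sqrtPy S ** Cm S ** Bbar S)))\<^sup>2"

definition alpha_y where "alpha_y S = 2 * alpha S - alpha_phi S"

definition gain_gap where "gain_gap S w = 1 - L1_norm (G_tf S w) * L_delta S (rho_r S)"

definition rho_rx where "rho_rx S w = rho_r S - rho_int S w / gain_gap S w"

definition rho_ru where
  "rho_ru S w = L1_norm (C0_tf S w) * (L_delta S (rho_r S) * rho_rx S w + b0 S)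
     + L1_norm (C0_tf S w ** tf_const (Kg S)) * r_Linf S"

definition gamma_x0 where "gamma_x0 S w = (kappa_x S w + kappa_m S) / gain_gap S w"

definition gamma_u0 where
  "gamma_u0 S w = L1_norm (C0_tf S w) * L_delta S (rho_r S) * gamma_x0 S w
     + L1_norm (C1_tf S w) * kappa_y S + L1_norm (C2_tf S w) * kappa_v S"

definition gamma_x where
  "gamma_x S w = (L1_norm (H1_tf S w) / sqrt (lambda_min (Py S))
     + L1_norm (H2_tf S w) / sqrt (lambda_min (Pv S))) / gain_gap S w"

definition gamma_u where
  "gamma_u S w = L1_norm (C0_tf S w) * L_delta S (rho_r S) * gamma_x S w
     + L1_norm (C1_tf S w) / sqrt (lambda_min (Py S))
     + L1_norm (C2_tf S w) / sqrt (lambda_min (Pv S))"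

definition rho_dx where "rho_dx S w = gamma_x0 S w * rho0 S + gbar S"
definition rho_du where "rho_du S w = gamma_u0 S w * rho0 S + gbar S"
definition rho_u where "rho_u S w = rho_ru S w + rho_du S w"

definition lambda_1 where
  "lambda_1 S = min (lambda_min (Qmat S - eps_q S *\<^sub>R mat 1) / lambda_max (Pv S)) (alpha_y S)"

definition theta_0 ::
  "('n::finite,'m::finite,'p::finite,'z::finite,'r::finite) l1_design \<Rightarrow> real" where
  "theta_0 S = 4 * ((omega_u S)\<^sup>2 + real CARD('m) * (d_bar S)\<^sup>2 + real CARD('m) * (b_bar S)\<^sup>2)"

definition theta_1 ::
  "('n::finite,'m::finite,'p::finite,'z::finite,'r::finite) l1_design \<Rightarrow> real" where
  "theta_1 S = theta_0 S
     + 4 * real CARD('m) * ((d_bar S * l_theta S + b_bar S * l_sigma S) / lambda_1 S)"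

section \<open>Standing assumptions\<close>

definition plant_assumptions ::
  "('n::finite,'m::finite,'p::finite,'z::finite,'r::finite) l1_design \<Rightarrow> bool" where
  "plant_assumptions S \<longleftrightarrow>
     CARD('m) \<le> CARD('p) \<and> CARD('p) \<le> CARD('n) \<and>
     hurwitz (Am S) \<and> minimal_realization (Am S) (Bm S) (Cm S) \<and>
     rank (M_tf S) = CARD('m) \<and>
     (\<forall>s. transmission_zero (Am S) (Bm S) (Cm S) 0 s \<longrightarrow> Re s < 0) \<and>
     0 < omega_l S \<and> omega_l S < omega_u S \<and>
     0 < b0 S \<and> (\<forall>\<delta>>0. 0 < dfun S \<delta> \<and> 0 < bfun S \<delta>) \<and>
     ref_sig S \<in> borel_measurable (lebesgue_on {0..}) \<and> bounded (ref_sig S ` {0..}) \<and>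
     0 < rho0 S"

text \<open>
  Types cannot be empty, so an absent interactor state (\<open>n\<^sub>z = 0\<close>) is represented in
  \<open>state_absent\<close> by a decoupled dummy state: \<open>Bz\<close>, \<open>Cz\<close>, \<open>Tz\<close> vanish, so that
  \<open>Z = I\<close>, \<open>x\<^sub>u = 0\<close>, \<open>T = 0\<close>, \<open>\<parallel>x\<^sub>g\<parallel> = \<parallel>x\<^sub>v\<parallel>\<close> and \<open>\<parallel>T\<^sub>g\<parallel> = 1\<close>, and every
  derived quantity has the value it has without the state.
\<close>

definition state_absent ::
  "('n::finite,'m::finite,'p::finite,'z::finite,'r::finite) l1_design \<Rightarrow> bool" where
  "state_absent S \<longleftrightarrow>
     rank (Cm S ** Bm S) = CARD('m) \<and>
     Az S = - mat 1 \<and> Bz S = 0 \<and> Cz S = 0 \<and> Dz S = mat 1 \<and> Tz S = 0 \<and> Bbar S = Bm S"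

definition state_present ::
  "('n::finite,'m::finite,'p::finite,'z::finite,'r::finite) l1_design \<Rightarrow> bool" where
  "state_present S \<longleftrightarrow>
     minimal_realization (Az S) (Bz S) (Cz S) \<and> hurwitz (Az S) \<and>
     (\<forall>s. det (rosenbrock (Az S) (Bz S) (Cz S) (Dz S) s) \<noteq> 0) \<and>
     rank (Tz S) = CARD('z) \<and>
     (\<exists>L. rank L = CARD('m) \<and>
        ((\<lambda>s. tf_eval (tf_scale rf_s (M_tf S ** Zinv_tf S)) s) \<longlongrightarrow> L) at_infinity) \<and>
     controllable (Am S) (Bbar S) \<and> rank (Cm S ** Bbar S) = CARD('m) \<and>
     tf_const (Cm S) ** resolvent (Am S) ** tf_const (Bbar S) = M_tf S ** Zinv_tf S \<and>
     Am S ** Tz S = Tz S ** Az S + Bbar S ** Cz S \<and>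
     Cm S ** Am S ** Tz S = Cm S ** Bbar S ** Cz S \<and>
     Bm S = Tz S ** Bz S + Bbar S ** Dz S \<and>
     Cm S ** Bm S = Cm S ** Bbar S ** Dz S"

definition interactor_assumptions where
  "interactor_assumptions S \<longleftrightarrow> state_absent S \<or> state_present S"

definition design_assumptions where
  "design_assumptions S \<longleftrightarrow>
     0 < gbar S \<and> hurwitz (A_v S) \<and>
     pos_def (Py S) \<and> upper_triangular_mat (sqrtPy S) \<and> Py S = transpose (sqrtPy S) ** sqrtPy S \<and>
     pos_def (Pv S) \<and> pos_def (Qmat S) \<and>
     transpose (A_v S) ** Pv S + Pv S ** A_v S = - Qmat S \<and>
     0 < eps_q S \<and> eps_q S < lambda_min (Qmat S) \<and>
     (\<forall>w\<in>C_omega S.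
        invertible (mat 1 + tf_scale (rf_const w) (Dtf S)) \<and>
        tf_stable (C_tf S w) \<and> tf_eval (C_tf S w) 0 = mat 1 \<and>
        tf_strictly_proper (C_tf S w ** Zinv_tf S)) \<and>
     0 < alpha S \<and> 0 < alpha_y S \<and>
     0 < rho_r S \<and>
     (\<forall>w\<in>C_omega S. L1_norm (G_tf S w) <
        (rho_r S - rho_ext S w - rho_int S w) / (L_delta S (rho_r S) * rho_r S)) \<and>
     1 \<in> C_omega S \<and>
     projection_operator (C_omega S) (proj_omega S) \<and>
     projection_operator {q. infnorm q \<le> d_bar S} (proj_theta S) \<and>
     projection_operator {q. infnorm q \<le> b_bar S} (proj_sigma S) \<and>
     0 < eps_gamma S \<and>
     (\<forall>w\<in>C_omega S. gamma_x S w * eps_gamma S < gbar S \<and> gamma_u S w * eps_gamma S < gbar S)"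

section \<open>Uncertainty and its parametrization\<close>

definition uncertainty ::
  "('n::finite,'m::finite,'p::finite,'z::finite,'r::finite) l1_design \<Rightarrow>
   (real^'n \<Rightarrow> real \<Rightarrow> real^'m) \<Rightarrow> bool" where
  "uncertainty S f \<longleftrightarrow>
     (\<forall>t\<ge>0. infnorm (f 0 t) < b0 S) \<and>
     (\<forall>\<delta>>0. \<forall>x. \<forall>t\<ge>0. infnorm x < \<delta> \<longrightarrow>
        (\<exists>J. ((\<lambda>y. f y t) has_derivative (\<lambda>h. J *v h)) (at x) \<and> mat_infnorm J \<le> dfun S \<delta>) \<and>
        (\<exists>v. ((\<lambda>s. f x s) has_vector_derivative v) (at t within {0..}) \<and>
             infnorm v \<le> bfun S \<delta>))"

text \<open>Continuous, differentiable outside a countable set of times with derivative bounded by \<open>c\<close>;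
  in particular satisfied if there are only finitely many such times.\<close>

definition pw_diff_bounded :: "real \<Rightarrow> real \<Rightarrow> (real \<Rightarrow> real^'m) \<Rightarrow> bool" where
  "pw_diff_bounded \<tau> c q \<longleftrightarrow> continuous_on {0..\<tau>} q \<and>
     (\<exists>N. countable N \<and> (\<forall>t\<in>{0..\<tau>} - N. \<exists>v.
        (q has_vector_derivative v) (at t within {0..\<tau>}) \<and> infnorm v \<le> c))"

text \<open>\<open>l_theta\<close> and \<open>l_sigma\<close> are admissible for the uncertainty \<open>f\<close> and the input gain \<open>w\<close>.\<close>

definition parametrization ::
  "('n::finite,'m::finite,'p::finite,'z::finite,'r::finite) l1_design \<Rightarrow> real \<Rightarrow>
   (real^'n \<Rightarrow> real \<Rightarrow> real^'m) \<Rightarrow> bool" where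
  "parametrization S w f \<longleftrightarrow>
     0 \<le> l_theta S \<and> 0 \<le> l_sigma S \<and>
     (\<forall>x0 u xu xv xf xg x uz fbar.
        infnorm x0 \<le> rho0 S \<and> continuous_on {0..} u \<and>
        (\<forall>t. xg t = vstack (xv t) (xu t)) \<and>
        (\<forall>t. x t = T_g S w *v xg t + Tz S *v xf t) \<and>
        (\<forall>t. uz t = Cz S *v xu t + Dz S *v u t) \<and>
        (\<forall>t. fbar t = Cz S *v xf t + Dz S *v f (x t) t) \<and>
        ode_sol xu (\<lambda>t. Az S *v xu t + Bz S *v u t) 0 \<and>
        ode_sol xv (\<lambda>t. Am S *v xv t + Bbar S *v (w *\<^sub>R uz t + fbar t)) x0 \<and>
        ode_sol xf (\<lambda>t. Az S *v xf t + Bz S *v f (x t) t) 0 \<longrightarrow>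
        (\<forall>\<tau>>0. Linf_on {0..\<tau>} x \<le> ereal (rho_x S) \<and> Linf_on {0..\<tau>} u \<le> ereal (rho_u S w) \<longrightarrow>
          (\<exists>\<theta> \<sigma>. pw_diff_bounded \<tau> (l_theta S) \<theta> \<and> pw_diff_bounded \<tau> (l_sigma S) \<sigma> \<and>
             (\<forall>t\<in>{0..\<tau>}. fbar t = infnorm (xg t) *\<^sub>R \<theta> t + \<sigma> t \<and>
                infnorm (\<theta> t) \<le> d_bar S \<and> infnorm (\<sigma> t) \<le> b_bar S))))"

section \<open>Closed loop and reference system\<close>

definition closed_loop ::
  "('n::finite,'m::finite,'p::finite,'z::finite,'r::finite) l1_design \<Rightarrow> real \<Rightarrow>
   (real^'n \<Rightarrow> real \<Rightarrow> real^'m) \<Rightarrow> real^'n \<Rightarrow> real \<Rightarrow> real \<Rightarrow> real \<Rightarrow>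
   (real \<Rightarrow> real^'n) \<Rightarrow> (real \<Rightarrow> real^'m) \<Rightarrow> (real \<Rightarrow> real^'p) \<Rightarrow> bool" where
  "closed_loop S w f x0 \<Gamma>\<omega> \<Gamma>\<theta> \<Gamma>\<sigma> x u y \<longleftrightarrow>
     ode_sol x (\<lambda>t. Am S *v x t + Bm S *v (w *\<^sub>R u t + f (x t) t)) x0 \<and>
     (\<forall>t\<ge>0. y t = Cm S *v x t) \<and>
     (\<exists>xu uz vh yh xvh xgh \<omega>h \<theta>h \<sigma>h \<eta>h rz ey.
        ode_sol xu (\<lambda>t. Az S *v xu t + Bz S *v u t) 0 \<and>
        (\<forall>t\<ge>0. uz t = Cz S *v xu t + Dz S *v u t) \<and>
        (\<forall>t\<ge>0. xvh t = vh t + H_mat S *v y t) \<and>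
        (\<forall>t\<ge>0. xgh t = vstack (xvh t) (xu t)) \<and>
        (\<forall>t\<ge>0. \<eta>h t = \<omega>h t *\<^sub>R uz t + infnorm (xgh t) *\<^sub>R \<theta>h t + \<sigma>h t) \<and>
        (\<forall>t\<ge>0. ey t = transpose (Bbar S) *v (transpose (Cm S) *v (Py S *v (yh t - y t)))) \<and>
        tf_response (Z_tf S) (\<lambda>t. Kg S *v ref_sig S t) rz \<and>
        tf_response (- (Dtf S ** Zinv_tf S)) (\<lambda>t. \<eta>h t - rz t) u \<and>
        ode_sol vh (\<lambda>t. A_v S *v xvh t - Kv S *v y t
          - matrix_inv (Pv S) *v (transpose (Am S) *v (transpose (Cm S) *v
              (Py S *v (yh t - y t))))) 0 \<and>
        ode_sol yh (\<lambda>t. - (alpha S *\<^sub>R (yh t - y t)) + Cm S *v (Am S *v xvh t)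
          + Cm S *v (Bbar S *v \<eta>h t)) (Cm S *v x0) \<and>
        ode_sol \<omega>h (\<lambda>t. \<Gamma>\<omega> *\<^sub>R proj_omega S (\<omega>h t) (- (uz t \<bullet> ey t))) 1 \<and>
        ode_sol \<theta>h (\<lambda>t. \<Gamma>\<theta> *\<^sub>R proj_theta S (\<theta>h t) (- (infnorm (xgh t) *\<^sub>R ey t))) 0 \<and>
        ode_sol \<sigma>h (\<lambda>t. \<Gamma>\<sigma> *\<^sub>R proj_sigma S (\<sigma>h t) (- ey t)) 0)"

definition reference_system ::
  "('n::finite,'m::finite,'p::finite,'z::finite,'r::finite) l1_design \<Rightarrow> real \<Rightarrow>
   (real^'n \<Rightarrow> real \<Rightarrow> real^'m) \<Rightarrow>
   (real \<Rightarrow> real^'n) \<Rightarrow> (real \<Rightarrow> real^'m) \<Rightarrow> (real \<Rightarrow> real^'p) \<Rightarrow> bool" where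
  "reference_system S w f xr ur yr \<longleftrightarrow>
     ode_sol xr (\<lambda>t. Am S *v xr t + Bm S *v (w *\<^sub>R ur t + f (xr t) t)) 0 \<and>
     (\<forall>t\<ge>0. yr t = Cm S *v xr t) \<and>
     tf_response (C0_tf S w) (\<lambda>t. Kg S *v ref_sig S t - f (xr t) t) ur"

definition admissible_run ::
  "('n::finite,'m::finite,'p::finite,'z::finite,'r::finite) l1_design \<Rightarrow> real \<Rightarrow>
   (real^'n \<Rightarrow> real \<Rightarrow> real^'m) \<Rightarrow> real^'n \<Rightarrow> real \<Rightarrow> real \<Rightarrow> real \<Rightarrow>
   (real \<Rightarrow> real^'n) \<Rightarrow> (real \<Rightarrow> real^'m) \<Rightarrow> (real \<Rightarrow> real^'p) \<Rightarrow>
   (real \<Rightarrow> real^'n) \<Rightarrow> (real \<Rightarrow> real^'m) \<Rightarrow> (real \<Rightarrow> real^'p) \<Rightarrow> bool" where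
  "admissible_run S w f x0 \<Gamma>\<omega> \<Gamma>\<theta> \<Gamma>\<sigma> x u y xr ur yr \<longleftrightarrow>
     uncertainty S f \<and> parametrization S w f \<and> infnorm x0 \<le> rho0 S \<and>
     0 < \<Gamma>\<omega> \<and> 0 < \<Gamma>\<theta> \<and> 0 < \<Gamma>\<sigma> \<and>
     min \<Gamma>\<omega> (min \<Gamma>\<theta> \<Gamma>\<sigma>) > theta_1 S / (eps_gamma S)\<^sup>2 \<and>
     closed_loop S w f x0 \<Gamma>\<omega> \<Gamma>\<theta> \<Gamma>\<sigma> x u y \<and>
     reference_system S w f xr ur yr"

end

theory Submission
  imports Defs
begin

text \<open>All transfer matrices of the loop act on signals by convolution with their impulse responses.
  Injectivity of the Laplace transform turns algebra of rational functions into algebra of these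
  operators, so that the signals satisfy
  \<open>x\<^sub>r - x + e\<^sup>A\<^sup>t x\<^sub>0 = G (\<eta>\<^sub>r - \<eta>) + H\<^sub>1 y - H\<^sub>2 v\<close>, where \<open>y\<close> and \<open>v\<close> are the prediction errors.
  As long as \<open>x\<close> and \<open>u\<close> respect their a priori bounds, the Lyapunov function
  \<open>y\<^sup>T P\<^sub>y y + v\<^sup>T P\<^sub>v v\<close> plus the squared parameter errors divided by the gains bounds \<open>y\<close> and \<open>v\<close> by
  a multiple of \<open>\<parallel>x\<^sub>0\<parallel>\<close> plus \<open>sqrt (\<theta>\<^sub>1 / \<Gamma>)\<close>. Since \<open>\<parallel>G\<parallel> L < 1\<close>, the identity then bounds \<open>x\<^sub>r - x\<close>,
  and the gain condition makes these bounds strictly better than the a priori ones, which therefore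
  hold for all times by continuity.\<close>

text \<open>Only \<open>C_tf\<close> is known to be stable; \<open>Dtf\<close> need not be. Signals
  are therefore treated as merely locally integrable and impulse responses as of exponential growth;
  the algebra takes place among proper rational functions, and stability enters only where an
  \<open>L1_norm\<close> bounds a response. The factor \<open>s + \<alpha>\<close> of
  \<open>C1_tf\<close> looks like a differentiation, but strict properness of C Z^-1 absorbs it. In
  this way the mismatch between estimated and true input, for which no direct bound is at hand, acts
  on the loop only through the two prediction errors. The projections make the adaptive laws
  discontinuous and the true parameters are only Lipschitz in time, so the Lyapunov argument
  compares increments with integrals. Its function need not decrease everywhere: the motion of the
  parameters can raise it at a rate proportional to 1/\<Gamma>, and \<open>theta_1\<close> marks the
  level above which the decay wins. The a priori bounds close because
  \<open>rho_rx + rho_dx = rho_x\<close> and \<open>rho_u = rho_ru + rho_du\<close>: a bound for the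
  reference system plus an error bound that \<open>eps_gamma\<close> makes strict.\<close>

no_notation fps_nth (infixl \<open>$\<close> 75)

section \<open>Evaluation of rational functions at finite points and at infinity\<close>

abbreviation cpoly :: "real poly \<Rightarrow> complex poly" where
  "cpoly \<equiv> map_poly of_real"

lemma cpoly_mult: "cpoly (p * q) = cpoly p * cpoly q"
  by (intro poly_eqI) (simp add: coeff_map_poly coeff_mult of_real_sum)

lemma cpoly_add: "cpoly (p + q) = cpoly p + cpoly q"
  by (intro poly_eqI) (simp add: coeff_map_poly)

lemma cpoly_0: "cpoly p = 0 \<longleftrightarrow> p = 0"
  by (auto simp: poly_eq_iff coeff_map_poly)

lemma rf_num_den: "g = to_fract (rf_num g) / to_fract (rf_den g)"
  by (metis Fract_conv_to_fract Fract_quot_of_fract rf_den_def rf_num_def)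

lemma rf_den_nonzero: "rf_den g \<noteq> 0"
  by (simp add: rf_den_def)

lemma rf_common_factor:
  assumes "g = to_fract p / to_fract q" "q \<noteq> 0"
  obtains k where "p = rf_num g * k" "q = rf_den g * k"
proof -
  have "to_fract (rf_num g) / to_fract (rf_den g) = to_fract p / to_fract q"
    using assms rf_num_den by metis
  then have e: "rf_num g * q = p * rf_den g"
    using assms(2) rf_den_nonzero
    by (simp add: frac_eq_eq flip: to_fract_mult)
  have "coprime (rf_num g) (rf_den g)"
    by (simp add: rf_num_def rf_den_def coprime_quot_of_fract)
  moreover have "rf_den g dvd rf_num g * q" using e by simp
  ultimately have "rf_den g dvd q"
    by (simp add: coprime_commute coprime_dvd_mult_right_iff)
  then obtain k where k: "q = rf_den g * k" by (elim dvdE)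
  then have "p * rf_den g = (rf_num g * k) * rf_den g" using e k by (metis mult.assoc mult.commute)
  then have "p = rf_num g * k" using rf_den_nonzero mult_right_cancel by blast
  with k show ?thesis using that by blast
qed

lemma rf_eval_fract:
  assumes "g = to_fract p / to_fract q" "poly (cpoly q) s \<noteq> 0"
  shows "\<not> rf_pole g s" "rf_eval g s = poly (cpoly p) s / poly (cpoly q) s"
proof -
  have "q \<noteq> 0" using assms(2) by auto
  then obtain k where k: "p = rf_num g * k" "q = rf_den g * k"
    using rf_common_factor assms(1) by blast
  show "\<not> rf_pole g s"
    using assms(2) by (simp add: k(2) rf_pole_def cpoly_mult)
  show "rf_eval g s = poly (cpoly p) s / poly (cpoly q) s"
    using assms(2) unfolding k rf_eval_def cpoly_mult poly_mult by simp
qed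

definition rf_proper :: "ratfun \<Rightarrow> bool" where
  "rf_proper g \<longleftrightarrow> degree (rf_num g) \<le> degree (rf_den g)"

lemma rf_proper_fract:
  assumes "g = to_fract p / to_fract q" "q \<noteq> 0" "degree p \<le> degree q"
  shows "rf_proper g" "feedthrough g = coeff p (degree q) / lead_coeff q"
proof -
  obtain k where k: "p = rf_num g * k" "q = rf_den g * k"
    using rf_common_factor assms(1,2) by blast
  have k0: "k \<noteq> 0" using assms(2) k by auto
  have dq: "degree q = degree (rf_den g) + degree k"
    unfolding k(2) using k0 rf_den_nonzero by (simp add: degree_mult_eq)
  have c: "degree (rf_num g) \<le> degree (rf_den g)"
  proof (cases "rf_num g = 0")
    case False
    then have "degree p = degree (rf_num g) + degree k"
      unfolding k(1) using k0 by (simp add: degree_mult_eq)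
    then show ?thesis using dq assms(3) by simp
  qed simp
  then show "rf_proper g" by (simp add: rf_proper_def)
  have "coeff p (degree q) = coeff (rf_num g) (degree (rf_den g)) * lead_coeff k"
  proof (cases "degree (rf_num g) = degree (rf_den g)")
    case True
    then show ?thesis unfolding dq k(1) using coeff_mult_degree_sum[of "rf_num g" k] by simp
  next
    case False
    then have "degree (rf_num g) < degree (rf_den g)" using c by simp
    moreover then have "degree p < degree q"
      unfolding dq k(1) using degree_mult_le[of "rf_num g" k] by linarith
    ultimately show ?thesis by (simp add: coeff_eq_0)
  qed
  moreover have "lead_coeff q = lead_coeff (rf_den g) * lead_coeff k"
    unfolding k(2) by (rule lead_coeff_mult)
  ultimately show "feedthrough g = coeff p (degree q) / lead_coeff q"
    using k0 by (simp add: feedthrough_def)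
qed

text \<open>A valuation ring \<open>R\<close> of the field of rational functions with its residue
  map \<open>ev\<close>. The instances are a point of the complex plane (no pole there, evaluation)
  and the point at infinity (properness, feedthrough), so determinants and inverses of matrices are
  treated once for stability and for properness.\<close>

locale rf_place =
  fixes R :: "ratfun \<Rightarrow> bool" and ev :: "ratfun \<Rightarrow> 'b::field"
  assumes const: "R (rf_const c)" and ev_0: "ev 0 = 0" and ev_1: "ev 1 = 1"
    and add: "R g \<Longrightarrow> R h \<Longrightarrow> R (g + h)" and ev_add: "R g \<Longrightarrow> R h \<Longrightarrow> ev (g + h) = ev g + ev h"
    and mult: "R g \<Longrightarrow> R h \<Longrightarrow> R (g * h)" and ev_mult: "R g \<Longrightarrow> R h \<Longrightarrow> ev (g * h) = ev g * ev h"
    and inverse: "R g \<Longrightarrow> ev g \<noteq> 0 \<Longrightarrow> R (inverse g)"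

lemma rf_const_simps: "rf_const 0 = 0" "rf_const 1 = 1" "rf_const (- c) = - rf_const c"
  "rf_const (a + b) = rf_const a + rf_const b" "rf_const (a * b) = rf_const a * rf_const b"
  "rf_const (a - b) = rf_const a - rf_const b"
  by (simp_all add: rf_const_def flip: to_fract_add to_fract_mult to_fract_uminus to_fract_diff)
    (metis one_pCons to_fract_1)

lemma matrix_inv_mult:
  fixes A :: "'a::semiring_1^'n^'n"
  assumes "invertible A"
  shows "A ** matrix_inv A = mat 1" "matrix_inv A ** A = mat 1"
  using someI_ex[of "\<lambda>A'. A ** A' = mat 1 \<and> A' ** A = mat 1"] assms
  by (simp_all add: invertible_def matrix_inv_def)

lemma matrix_inv_eqI:
  fixes A :: "'a::semiring_1^'n^'n"
  assumes "A ** B = mat 1" "B ** A = mat 1"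
  shows "matrix_inv A = B"
  by (metis assms invertible_def matrix_inv_mult(1) matrix_mul_assoc matrix_mul_lid matrix_mul_rid)

context rf_place begin

lemma zero: "R 0" and one: "R 1"
  using const[of 0] const[of 1] by (simp_all add: rf_const_simps)

lemma minus_one: "R (-1)" using const[of "-1"] by (simp add: rf_const_simps)

lemma ev_minus_one: "ev (-1) = -1"
  using ev_add[OF one minus_one] by (simp add: ev_0 ev_1 eq_neg_iff_add_eq_0 add.commute)

lemma uminus: "R g \<Longrightarrow> R (- g)" and ev_uminus: "R g \<Longrightarrow> ev (- g) = - ev g"
  using mult[OF minus_one, of g] ev_mult[OF minus_one, of g] by (simp_all add: ev_minus_one)

lemma diff: "R g \<Longrightarrow> R h \<Longrightarrow> R (g - h)" and ev_diff: "R g \<Longrightarrow> R h \<Longrightarrow> ev (g - h) = ev g - ev h"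
  using add[of g "- h"] ev_add[of g "- h"] by (simp_all add: uminus ev_uminus)

lemma ev_inverse:
  assumes "R g" "ev g \<noteq> 0"
  shows "ev (inverse g) = inverse (ev g)"
proof -
  have "g \<noteq> 0" using assms ev_0 by auto
  then have "ev g * ev (inverse g) = 1"
    using ev_mult[OF assms(1) inverse[OF assms]] ev_1 by simp
  then show ?thesis by (metis inverse_unique)
qed

lemma sum: "(\<And>i. i \<in> A \<Longrightarrow> R (f i)) \<Longrightarrow> R (sum f A)"
  by (induction A rule: infinite_finite_induct) (simp_all add: zero add)

lemma ev_sum: "(\<And>i. i \<in> A \<Longrightarrow> R (f i)) \<Longrightarrow> ev (sum f A) = (\<Sum>i\<in>A. ev (f i))"
  by (induction A rule: infinite_finite_induct) (simp_all add: ev_0 ev_add sum)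

lemma prod: "(\<And>i. i \<in> A \<Longrightarrow> R (f i)) \<Longrightarrow> R (prod f A)"
  by (induction A rule: infinite_finite_induct) (simp_all add: one mult)

lemma ev_prod: "(\<And>i. i \<in> A \<Longrightarrow> R (f i)) \<Longrightarrow> ev (prod f A) = (\<Prod>i\<in>A. ev (f i))"
  by (induction A rule: infinite_finite_induct) (simp_all add: ev_1 ev_mult prod)

lemma of_int_sign: "R (of_int (sign p))" "ev (of_int (sign p)) = of_int (sign p)"
  by (simp_all add: sign_def one minus_one ev_1 ev_minus_one)

definition Rmat :: "ratfun^'i^'k \<Rightarrow> bool" where
  "Rmat A \<longleftrightarrow> (\<forall>i j. R (A $ i $ j))"

lemma RmatD: "Rmat A \<Longrightarrow> R (A $ i $ j)"
  by (simp add: Rmat_def)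

lemma det: "Rmat A \<Longrightarrow> R (det A)"
  unfolding det_def by (intro sum mult of_int_sign prod RmatD)

lemma ev_det: "Rmat A \<Longrightarrow> ev (det A) = det (map_matrix ev A)"
  unfolding det_def
  by (subst ev_sum; (intro sum mult of_int_sign prod RmatD)?)
    (simp_all add: ev_mult of_int_sign prod RmatD ev_prod map_matrix_def)

lemma matrix_mult: "Rmat A \<Longrightarrow> Rmat B \<Longrightarrow> Rmat (A ** B)"
  by (simp add: Rmat_def matrix_matrix_mult_def sum mult)

lemma ev_matrix_mult:
  "Rmat A \<Longrightarrow> Rmat B \<Longrightarrow> map_matrix ev (A ** B) = map_matrix ev A ** map_matrix ev B"
  by (simp add: Rmat_def matrix_matrix_mult_def map_matrix_def vec_eq_iff ev_sum mult ev_mult)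

lemma matrix_add: "Rmat A \<Longrightarrow> Rmat B \<Longrightarrow> Rmat (A + B)"
  by (simp add: Rmat_def add)

lemma matrix_diff: "Rmat A \<Longrightarrow> Rmat B \<Longrightarrow> Rmat (A - B)"
  by (simp add: Rmat_def diff)

lemma ev_matrix_diff: "Rmat A \<Longrightarrow> Rmat B \<Longrightarrow> map_matrix ev (A - B) = map_matrix ev A - map_matrix ev B"
  by (simp add: Rmat_def map_matrix_def vec_eq_iff ev_diff)

lemma matrix_const: "Rmat (tf_const A)"
  by (simp add: Rmat_def tf_const_def map_matrix_def const)

lemma matrix_mat: "R g \<Longrightarrow> Rmat (mat g)"
  by (simp add: Rmat_def mat_def zero)

lemma matrix_scale: "R g \<Longrightarrow> Rmat A \<Longrightarrow> Rmat (tf_scale g A)"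
  by (simp add: Rmat_def tf_scale_def map_matrix_def mult)

text \<open>Cramer's rule writes the entries of the inverse as determinants divided by
  \<open>det A\<close>, so the only thing to invert inside \<open>R\<close> is \<open>det A\<close>,
  whose residue is the determinant of the residues.\<close>

lemma matrix_inv:
  assumes A: "Rmat A" and d: "det (map_matrix ev A) \<noteq> 0"
  shows "Rmat (matrix_inv A)" and "invertible A"
proof -
  have R: "R (det A)" and e: "ev (det A) \<noteq> 0"
    using det[OF A] ev_det[OF A] d by auto
  then have d0: "det A \<noteq> 0" using ev_0 by auto
  then show inv: "invertible A" by (simp add: invertible_det_nz)
  have "R (matrix_inv A $ i $ k)" for i k
  proof -
    let ?x = "matrix_inv A *v axis k 1"
    let ?A = "\<lambda>l. \<chi> i j. if j = l then axis k (1::ratfun) $ i else A $ i $ j"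
    have "A *v ?x = axis k 1"
      using inv by (simp add: matrix_vector_mul_assoc matrix_inv_mult)
    then have "?x = (\<chi> l. det (?A l) / det A)"
      using cramer[OF d0] by blast
    moreover have "?x $ i = matrix_inv A $ i $ k"
      by (simp add: matrix_vector_mult_def axis_def if_distrib cong: if_cong)
    ultimately have "matrix_inv A $ i $ k = det (?A i) * inverse (det A)"
      by (simp add: divide_inverse)
    moreover have "Rmat (?A i)" using A by (auto simp: Rmat_def axis_def zero one)
    ultimately show ?thesis using mult[OF det[of "?A i"] inverse[OF R e]] by simp
  qed
  then show "Rmat (matrix_inv A)" by (simp add: Rmat_def)
qed

end

interpretation fin: rf_place "\<lambda>g. \<not> rf_pole g s" "\<lambda>g. rf_eval g s" for s
proof
  fix c g h
  have c: "rf_const c = to_fract [:c:] / to_fract 1" for c by (simp add: rf_const_def)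
  show "\<not> rf_pole (rf_const c) s"
    by (rule rf_eval_fract[OF c]) (simp add: map_poly_1)
  have z: "0 = to_fract 0 / to_fract 1" by simp
  show "rf_eval 0 s = 0"
    by (subst rf_eval_fract[OF z]) (simp_all add: map_poly_1)
  have o: "1 = to_fract 1 / to_fract 1" by simp
  show "rf_eval 1 s = 1"
    by (subst rf_eval_fract[OF o]) (simp_all add: map_poly_1)
  let ?n = "\<lambda>g. to_fract (rf_num g)" and ?d = "\<lambda>g. to_fract (rf_den g)"
  let ?N = "\<lambda>g. poly (cpoly (rf_num g)) s" and ?D = "\<lambda>g. poly (cpoly (rf_den g)) s"
  assume g: "\<not> rf_pole g s"
  then have g0: "?D g \<noteq> 0" by (simp add: rf_pole_def)
  show "\<not> rf_pole (Fields.inverse g) s" if "rf_eval g s \<noteq> 0"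
  proof (rule rf_eval_fract)
    show "Fields.inverse g = ?d g / ?n g" by (subst rf_num_den) simp
    show "?N g \<noteq> 0" using that by (auto simp: rf_eval_def)
  qed
  assume h: "\<not> rf_pole h s"
  then have h0: "?D h \<noteq> 0" by (simp add: rf_pole_def)
  have a: "g + h = to_fract (rf_num g * rf_den h + rf_num h * rf_den g) / to_fract (rf_den g * rf_den h)"
    using rf_den_nonzero by (subst (1) rf_num_den[of g], subst (1) rf_num_den[of h]) (simp add: field_simps)
  show "\<not> rf_pole (g + h) s"
    using g0 h0 by (intro rf_eval_fract[OF a]) (simp add: cpoly_mult)
  show "rf_eval (g + h) s = rf_eval g s + rf_eval h s"
    using g0 h0 rf_eval_fract(2)[OF a, of s]
    by (simp add: cpoly_mult cpoly_add rf_eval_def add_frac_eq)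
  have m: "g * h = to_fract (rf_num g * rf_num h) / to_fract (rf_den g * rf_den h)"
    using rf_den_nonzero by (subst (1) rf_num_den[of g], subst (1) rf_num_den[of h]) (simp add: field_simps)
  show "\<not> rf_pole (g * h) s"
    using g0 h0 by (intro rf_eval_fract[OF m]) (simp add: cpoly_mult)
  show "rf_eval (g * h) s = rf_eval g s * rf_eval h s"
    using g0 h0 rf_eval_fract(2)[OF m, of s] by (simp add: cpoly_mult rf_eval_def)
qed

text \<open>On proper functions \<open>feedthrough\<close> is the value at infinity. If it does not
  vanish, numerator and denominator have equal degree, and the reciprocal is proper as well.\<close>

interpretation inf: rf_place rf_proper feedthrough
proof
  fix c g h
  have c: "rf_const c = to_fract [:c:] / to_fract 1" for c by (simp add: rf_const_def)
  show "rf_proper (rf_const c)" by (rule rf_proper_fract[OF c]) auto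
  have z: "0 = to_fract 0 / to_fract 1" by simp
  show "feedthrough 0 = 0" by (subst rf_proper_fract[OF z]) auto
  have o: "1 = to_fract 1 / to_fract 1" by simp
  show "feedthrough 1 = 1" by (subst rf_proper_fract[OF o]) auto
  let ?n = "\<lambda>g. to_fract (rf_num g)" and ?d = "\<lambda>g. to_fract (rf_den g)"
  assume g: "rf_proper g"
  show "rf_proper (Fields.inverse g)" if "feedthrough g \<noteq> 0"
  proof (rule rf_proper_fract)
    show "Fields.inverse g = ?d g / ?n g" by (subst rf_num_den) simp
    have "coeff (rf_num g) (degree (rf_den g)) \<noteq> 0" using that by (auto simp: feedthrough_def)
    then show "rf_num g \<noteq> 0" "degree (rf_den g) \<le> degree (rf_num g)"
      by (auto intro: le_degree)
  qed
  assume h: "rf_proper h"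
  let ?D = "rf_den g * rf_den h"
  have D0: "?D \<noteq> 0" using rf_den_nonzero by simp
  have dD: "degree ?D = degree (rf_den g) + degree (rf_den h)"
    using rf_den_nonzero by (simp add: degree_mult_eq)
  \<comment> \<open>Read at the position given by the degree bounds rather than by the actual
    degrees, the leading coefficient of a product stays multiplicative: if a bound is not attained,
    both sides are zero.\<close>
  have cf: "coeff (p * q) (m + n) = coeff p m * coeff q n" if "degree p \<le> m" "degree q \<le> n"
    for p q :: "real poly" and m n
  proof (cases "degree p = m \<and> degree q = n")
    case True
    then show ?thesis using coeff_mult_degree_sum[of p q] by simp
  next
    case False
    then have "degree (p * q) < m + n" "degree p < m \<or> degree q < n"
      using degree_mult_le[of p q] that by linarith+
    then show ?thesis by (auto simp: coeff_eq_0)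
  qed
  have gd: "degree (rf_num g) \<le> degree (rf_den g)" and hd: "degree (rf_num h) \<le> degree (rf_den h)"
    using g h by (simp_all add: rf_proper_def)
  have a: "g + h = to_fract (rf_num g * rf_den h + rf_num h * rf_den g) / to_fract ?D"
    using rf_den_nonzero by (subst (1) rf_num_den[of g], subst (1) rf_num_den[of h]) (simp add: field_simps)
  have da: "degree (rf_num g * rf_den h + rf_num h * rf_den g) \<le> degree ?D"
    unfolding dD using gd hd
    by (intro degree_add_le order_trans[OF degree_mult_le]) auto
  show "rf_proper (g + h)" by (rule rf_proper_fract[OF a D0 da])
  show "feedthrough (g + h) = feedthrough g + feedthrough h"
  proof -
    have "coeff (rf_num h * rf_den g) (degree (rf_den g) + degree (rf_den h))
        = coeff (rf_num h) (degree (rf_den h)) * lead_coeff (rf_den g)"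
      using cf[OF hd order_refl, of "rf_den g"] by (simp only: add.commute)
    then show ?thesis
      using rf_proper_fract(2)[OF a D0 da] cf[OF gd order_refl, of "rf_den h"]
        cf[of "rf_den g" _ "rf_den h", OF order_refl order_refl] rf_den_nonzero[of g] rf_den_nonzero[of h]
      unfolding coeff_add lead_coeff_mult dD feedthrough_def by (simp add: add_frac_eq)
  qed
  have m: "g * h = to_fract (rf_num g * rf_num h) / to_fract ?D"
    using rf_den_nonzero by (subst (1) rf_num_den[of g], subst (1) rf_num_den[of h]) (simp add: field_simps)
  have dm: "degree (rf_num g * rf_num h) \<le> degree ?D"
    unfolding dD using gd hd by (intro order_trans[OF degree_mult_le]) auto
  show "rf_proper (g * h)" by (rule rf_proper_fract[OF m D0 dm])
  show "feedthrough (g * h) = feedthrough g * feedthrough h"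
    using rf_proper_fract(2)[OF m D0 dm] cf[OF gd hd] rf_den_nonzero
      cf[of "rf_den g" _ "rf_den h", OF order_refl order_refl]
    unfolding lead_coeff_mult dD feedthrough_def by simp
qed

section \<open>The function s, strictly proper matrices, resolvents and inverse interactors\<close>

lemma rf_s_fract: "rf_s = to_fract [:0, 1:] / to_fract 1"
  by (simp add: rf_s_def)

lemma rf_s_nonzero: "rf_s \<noteq> 0"
  by (simp add: rf_s_def)

lemma rf_s_eval: "\<not> rf_pole rf_s s" "rf_eval rf_s s = s"
proof -
  have "poly (cpoly 1) s \<noteq> 0" by (simp add: map_poly_1)
  from rf_eval_fract[OF rf_s_fract this] show "\<not> rf_pole rf_s s" "rf_eval rf_s s = s"
    by (simp_all add: map_poly_1 map_poly_pCons)
qed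

lemma rf_const_eval: "rf_eval (rf_const c) s = of_real c"
proof -
  have "rf_const c = to_fract [:c:] / to_fract 1" by (simp add: rf_const_def)
  from rf_eval_fract(2)[OF this, of s] show ?thesis by (simp add: map_poly_1 map_poly_pCons)
qed

lemma feedthrough_const: "feedthrough (rf_const c) = c"
proof -
  have "rf_const c = to_fract [:c:] / to_fract 1" by (simp add: rf_const_def)
  from rf_proper_fract(2)[OF this] show ?thesis by simp
qed

lemma rf_inverse_s: "rf_proper (inverse rf_s)" "feedthrough (inverse rf_s) = 0"
proof -
  have "inverse rf_s = to_fract 1 / to_fract [:0, 1:]"
    by (simp add: rf_s_def divide_inverse)
  from rf_proper_fract[OF this] show "rf_proper (inverse rf_s)" "feedthrough (inverse rf_s) = 0"
    by simp_all
qed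

lemma rf_strictly_proper_iff:
  "g = 0 \<or> degree (rf_num g) < degree (rf_den g) \<longleftrightarrow> rf_proper g \<and> feedthrough g = 0"
proof -
  have z: "rf_num g = 0 \<Longrightarrow> g = 0" by (subst rf_num_den) simp
  have "feedthrough g = 0 \<longleftrightarrow> coeff (rf_num g) (degree (rf_den g)) = 0"
    by (simp add: feedthrough_def rf_den_nonzero)
  moreover have "g = 0 \<Longrightarrow> rf_proper g \<and> feedthrough g = 0"
    using inf.ev_0 inf.zero by simp
  moreover have "coeff (rf_num g) (degree (rf_den g)) = 0 \<longleftrightarrow> degree (rf_num g) < degree (rf_den g)"
    if "rf_proper g" "g \<noteq> 0"
    using that z leading_coeff_0_iff[of "rf_num g"]
    by (cases "degree (rf_num g) = degree (rf_den g)") (auto simp: rf_proper_def coeff_eq_0)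
  ultimately show ?thesis by (auto simp: rf_proper_def coeff_eq_0)
qed

text \<open>The factor s + a costs one degree, and strict properness has one to spare. This is what
  makes s (s - A)^-1 and the factor \<open>s + \<alpha>\<close> of \<open>C1_tf\<close> act on
  signals without differentiating them.\<close>

lemma rf_proper_s_mult:
  assumes "rf_proper g" "feedthrough g = 0"
  shows "rf_proper ((rf_s + rf_const a) * g)"
proof (cases "g = 0")
  case False
  then have d: "degree (rf_num g) < degree (rf_den g)"
    using assms rf_strictly_proper_iff by blast
  have e: "(rf_s + rf_const a) * g = to_fract ([:a, 1:] * rf_num g) / to_fract (rf_den g)"
    by (subst (1) rf_num_den[of g])
      (simp add: rf_s_def rf_const_def flip: to_fract_add to_fract_mult)
  show ?thesis
  proof (rule rf_proper_fract(1)[OF e rf_den_nonzero])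
    show "degree ([:a, 1:] * rf_num g) \<le> degree (rf_den g)"
      using d degree_mult_le[of "[:a, 1:]" "rf_num g"] by simp
  qed
qed (simp add: inf.zero)

lemma tf_strictly_proper_iff:
  "tf_strictly_proper G \<longleftrightarrow> inf.Rmat G \<and> map_matrix feedthrough G = 0"
  by (simp add: tf_strictly_proper_def rf_strictly_proper_iff inf.Rmat_def vec_eq_iff map_matrix_def)
    blast

lemma tf_strictly_proper_mult_left:
  assumes "inf.Rmat F" "tf_strictly_proper G"
  shows "tf_strictly_proper (F ** G)"
  using assms by (simp add: tf_strictly_proper_iff inf.matrix_mult inf.ev_matrix_mult)

lemma tf_strictly_proper_mult_right:
  assumes "tf_strictly_proper F" "inf.Rmat G"
  shows "tf_strictly_proper (F ** G)"
  using assms by (simp add: tf_strictly_proper_iff inf.matrix_mult inf.ev_matrix_mult)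

lemma tf_stable_iff: "tf_stable G \<longleftrightarrow> (\<forall>s. Re s \<ge> 0 \<longrightarrow> fin.Rmat s G)"
  unfolding tf_stable_def fin.Rmat_def by (meson not_le)

lemma tf_scale_mult: "tf_scale g (A ** B) = tf_scale g A ** B"
  "tf_scale g (A ** B) = A ** tf_scale g B"
  by (simp_all add: tf_scale_def map_matrix_def matrix_matrix_mult_def vec_eq_iff sum_distrib_left ac_simps)

lemma tf_scale_simps: "tf_scale g (A + B) = tf_scale g A + tf_scale g B"
  "tf_scale g (A - B) = tf_scale g A - tf_scale g B"
  "tf_scale g (tf_scale h A) = tf_scale (g * h) A" "tf_scale 1 A = A" "tf_scale g (mat h) = mat (g * h)"
  by (simp_all add: tf_scale_def map_matrix_def vec_eq_iff algebra_simps mat_def)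

lemma tf_const_simps: "tf_const (A ** B) = tf_const A ** tf_const B" "tf_const (A + B) = tf_const A + tf_const B"
  "tf_const (A - B) = tf_const A - tf_const B" "tf_const (mat c) = mat (rf_const c)"
  "tf_const (c *\<^sub>R A) = tf_scale (rf_const c) (tf_const A)"
proof -
  have s: "rf_const (\<Sum>i\<in>I. f i) = (\<Sum>i\<in>I. rf_const (f i))" for I and f :: "'x \<Rightarrow> real"
    by (induction I rule: infinite_finite_induct) (simp_all add: rf_const_simps)
  show "tf_const (A ** B) = tf_const A ** tf_const B"
    by (simp add: tf_const_def map_matrix_def matrix_matrix_mult_def vec_eq_iff s rf_const_simps)
qed (simp_all add: tf_const_def tf_scale_def map_matrix_def vec_eq_iff rf_const_simps mat_def)

text \<open>Write s - A = s E with E = 1 - s^-1 A. At infinity E is the identity, so its inverse is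
  proper; the remaining factor s^-1 makes the resolvent strictly proper.\<close>

lemma resolvent_proper: "tf_strictly_proper (resolvent A)"
  and resolvent_inverse: "(mat rf_s - tf_const A) ** resolvent A = mat 1"
    "resolvent A ** (mat rf_s - tf_const A) = mat 1"
proof -
  define E where "E = (mat 1 :: ratfun^'a^'a) - tf_scale (inverse rf_s) (tf_const A)"
  have R: "inf.Rmat (tf_scale (inverse rf_s) (tf_const A))"
    by (intro inf.matrix_scale inf.matrix_const rf_inverse_s)
  have E: "inf.Rmat E"
    unfolding E_def by (intro inf.matrix_diff inf.matrix_mat inf.one R)
  have "map_matrix feedthrough (tf_scale (inverse rf_s) (tf_const A)) = 0"
    by (simp add: map_matrix_def tf_scale_def vec_eq_iff tf_const_def inf.ev_mult rf_inverse_s inf.const)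
  then have "map_matrix feedthrough E = mat 1"
    unfolding E_def
    by (subst inf.ev_matrix_diff[OF inf.matrix_mat[OF inf.one] R])
      (simp add: map_matrix_def mat_def vec_eq_iff inf.ev_0 inf.ev_1)
  then have i: "inf.Rmat (matrix_inv E)" "invertible E"
    using inf.matrix_inv[OF E] by (simp_all add: det_I)
  have e: "mat rf_s - tf_const A = tf_scale rf_s E"
    by (simp add: E_def tf_scale_simps rf_s_nonzero)
  define X where "X = tf_scale (inverse rf_s) (matrix_inv E)"
  have X: "(mat rf_s - tf_const A) ** X = mat 1" "X ** (mat rf_s - tf_const A) = mat 1"
    unfolding e X_def using matrix_inv_mult[OF i(2)]
    by (simp_all add: tf_scale_mult[symmetric] tf_scale_simps rf_s_nonzero)
  then have r: "resolvent A = X"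
    unfolding resolvent_def by (rule matrix_inv_eqI)
  show "(mat rf_s - tf_const A) ** resolvent A = mat 1" "resolvent A ** (mat rf_s - tf_const A) = mat 1"
    using X r by simp_all
  show "tf_strictly_proper (resolvent A)"
    unfolding r X_def tf_strictly_proper_iff
  proof
    show "inf.Rmat (tf_scale (inverse rf_s) (matrix_inv E))"
      using i(1) by (intro inf.matrix_scale rf_inverse_s)
    show "map_matrix feedthrough (tf_scale (inverse rf_s) (matrix_inv E)) = 0"
      using i(1) by (simp add: map_matrix_def tf_scale_def vec_eq_iff inf.ev_mult inf.Rmat_def rf_inverse_s)
  qed
qed

lemma tf_eval_const: "map_matrix (\<lambda>g. rf_eval g s) (tf_const A) = complex_mat A"
  by (simp add: map_matrix_def tf_const_def complex_mat_def vec_eq_iff rf_const_eval)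

lemma tf_eval_mat_s: "map_matrix (\<lambda>g. rf_eval g s) (mat rf_s) = mat s"
  by (simp add: map_matrix_def mat_def vec_eq_iff rf_s_eval fin.ev_0)

lemma resolvent_stable:
  assumes "hurwitz A"
  shows "tf_stable (resolvent A)"
  unfolding tf_stable_iff
proof (intro allI impI)
  fix s :: complex assume s: "Re s \<ge> 0"
  have R: "fin.Rmat s (mat rf_s)" "fin.Rmat s (tf_const A)"
    by (rule fin.matrix_mat[OF rf_s_eval(1)], rule fin.matrix_const)
  have "det (mat s - complex_mat A) \<noteq> 0"
  proof
    assume "det (mat s - complex_mat A) = 0"
    then obtain v where v: "v \<noteq> 0" "(mat s - complex_mat A) *v v = 0"
      by (metis invertible_det_nz invertible_left_inverse matrix_left_invertible_ker)
    have "mat s *v v = s *s v"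
      by (simp add: vec_eq_iff matrix_vector_mult_def mat_def if_distrib if_distribR cong: if_cong)
    then have "complex_mat A *v v = s *s v"
      using v(2) by (simp only: matrix_vector_mult_diff_rdistrib right_minus_eq)
    with v(1) assms s show False by (force simp: hurwitz_def)
  qed
  then show "fin.Rmat s (resolvent A)"
    unfolding resolvent_def
    by (intro fin.matrix_inv fin.matrix_diff R) (simp add: fin.ev_matrix_diff[OF R] tf_eval_const tf_eval_mat_s)
qed

lemma tf_const_entry: "\<not> rf_pole (tf_const M $ i $ j) s"
  "rf_eval (tf_const M $ i $ j) s = complex_mat M $ i $ j"
  using fin.matrix_const[of s M] tf_eval_const[of s M]
  by (simp_all add: fin.Rmat_def map_matrix_def vec_eq_iff)

lemma matrix_add_rdistrib: "(A + B) ** C = A ** C + B ** (C :: 'a::semiring_1^'n^'m)"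
  by (simp add: matrix_matrix_mult_def vec_eq_iff distrib_right sum.distrib)

lemma sum_UNIV_sum:
  "(\<Sum>k\<in>(UNIV :: ('a::finite + 'b::finite) set). f k) = (\<Sum>k\<in>UNIV. f (Inl k)) + (\<Sum>k\<in>UNIV. f (Inr k))"
  by (subst UNIV_Plus_UNIV[symmetric], subst sum.Plus) (simp_all add: comp_def)

text \<open>Since the Rosenbrock determinant vanishes nowhere, the inverse of the Rosenbrock matrix, whose
  lower right block is the inverse of the transfer matrix, has no finite poles.\<close>

lemma rosenbrock_inverse:
  fixes A :: "real^'z^'z" and B :: "real^'m^'z" and C :: "real^'z^'m" and D :: "real^'m^'m"
  assumes d: "\<And>s. det (rosenbrock A B C D s) \<noteq> 0"
  defines "Z \<equiv> tf_const C ** resolvent A ** tf_const B + tf_const D"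
  shows "fin.Rmat s (matrix_inv Z)" and "invertible Z"
proof -
  define R :: "ratfun^('z + 'm)^('z + 'm)" where
    "R = (\<chi> i. case i of Inl k \<Rightarrow> hcat (tf_const A - mat rf_s) (tf_const B) $ k
                      | Inr k \<Rightarrow> hcat (tf_const C) (tf_const D) $ k)"
  have cs: "\<not> rf_pole ((tf_const A - mat rf_s) $ i $ j) s" for i j s
    using fin.matrix_diff[OF fin.matrix_const fin.matrix_mat[OF rf_s_eval(1)]] by (auto simp: fin.Rmat_def)
  note c = tf_const_entry(1) and ec = tf_const_entry(2)
  have es: "rf_eval ((tf_const A - mat rf_s) $ i $ j) s = (complex_mat A - mat s) $ i $ j" for i j s
  proof -
    have "\<not> rf_pole ((mat rf_s :: ratfun^'z^'z) $ i $ j) s"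
      "rf_eval ((mat rf_s :: ratfun^'z^'z) $ i $ j) s = mat s $ i $ j"
      by (auto simp: mat_def rf_s_eval fin.ev_0 fin.zero)
    then show ?thesis by (simp add: fin.ev_diff c ec)
  qed
  have RR: "fin.Rmat s R" for s
    unfolding fin.Rmat_def
  proof (intro allI)
    fix i j show "\<not> rf_pole (R $ i $ j) s"
      by (cases i; cases j) (simp_all only: R_def hcat_def vec_lambda_beta sum.case c cs simp_thms)
  qed
  have eR: "map_matrix (\<lambda>g. rf_eval g s) R = rosenbrock A B C D s" for s
  proof -
    have "rf_eval (R $ i $ j) s = rosenbrock A B C D s $ i $ j" for i j
      by (cases i; cases j) (simp_all only: R_def rosenbrock_def hcat_def vec_lambda_beta sum.case ec es)
    then show ?thesis by (simp add: map_matrix_def vec_eq_iff)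
  qed
  have X: "fin.Rmat s (matrix_inv R)" "invertible R" for s
    using fin.matrix_inv[OF RR] d by (simp_all add: eR)
  \<comment> \<open>Only the last block column of the inverse matters. The upper block row gives X12
    = (s - A)^-1 B X22, and substituting this into the lower row C X12 + D X22 = 1 yields Z X22 =
    1.\<close>
  define X12 :: "ratfun^'m^'z" where "X12 = (\<chi> i j. matrix_inv R $ Inl i $ Inr j)"
  define X22 :: "ratfun^'m^'m" where "X22 = (\<chi> i j. matrix_inv R $ Inr i $ Inr j)"
  have RX: "(\<Sum>k\<in>UNIV. R $ i $ k * matrix_inv R $ k $ j) = (if i = j then 1 else 0)" for i j
    using matrix_inv_mult(1)[OF X(2)] by (simp add: matrix_matrix_mult_def mat_def vec_eq_iff)
  have RX': "(\<Sum>k\<in>UNIV. R $ i $ Inl k * matrix_inv R $ Inl k $ j) + (\<Sum>k\<in>UNIV. R $ i $ Inr k * matrix_inv R $ Inr k $ j)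
      = (if i = j then 1 else 0)" for i j
    unfolding RX[symmetric] sum_UNIV_sum ..
  have R_entries: "R $ Inl i $ Inl k = (tf_const A - mat rf_s) $ i $ k" "R $ Inl i $ Inr j = tf_const B $ i $ j"
    "R $ Inr l $ Inl k = tf_const C $ l $ k" "R $ Inr l $ Inr j = tf_const D $ l $ j" for i k j l
    by (simp_all add: R_def hcat_def)
  have 1: "(tf_const A - mat rf_s) ** X12 + tf_const B ** X22 = 0"
    using RX'[of "Inl _" "Inr _", unfolded R_entries]
    by (simp add: X12_def X22_def matrix_matrix_mult_def vec_eq_iff)
  have 2: "tf_const C ** X12 + tf_const D ** X22 = mat 1"
    using RX'[of "Inr _" "Inr _", unfolded R_entries]
    by (simp add: X12_def X22_def matrix_matrix_mult_def vec_eq_iff mat_def)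
  have "(mat rf_s - tf_const A) ** X12 + (tf_const A - mat rf_s) ** X12 = 0"
    unfolding matrix_add_rdistrib[symmetric] by simp
  then have "(mat rf_s - tf_const A) ** X12 = tf_const B ** X22"
    using 1 by (metis add_left_cancel add.commute)
  then have "resolvent A ** ((mat rf_s - tf_const A) ** X12) = resolvent A ** (tf_const B ** X22)"
    by simp
  then have x12: "X12 = resolvent A ** tf_const B ** X22"
    by (simp add: matrix_mul_assoc resolvent_inverse)
  have zx: "Z ** X22 = mat 1"
    unfolding Z_def using 2 x12 by (simp add: matrix_add_rdistrib matrix_mul_assoc)
  then have "det Z * det X22 = 1" by (metis det_I det_mul)
  then show "invertible Z" by (auto simp: invertible_det_nz)
  then have "matrix_inv Z = X22"
    by (metis zx matrix_inv_mult(2) matrix_mul_assoc matrix_mul_lid matrix_mul_rid)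
  then show "fin.Rmat s (matrix_inv Z)"
    using X(1) by (simp add: X22_def fin.Rmat_def)
qed

section \<open>Convolution and Laplace transforms\<close>

text \<open>Fubini for the kernel f(\<sigma>) g(\<sigma> - \<tau>) v(\<tau>). Boundedness of
  \<open>f\<close> is enough, which admits f = 1 (the integral of a convolution is the product of
  the integrals) as well as a truncated impulse response read backwards (associativity of
  convolution).\<close>

lemma conv_assoc_lborel:
  fixes f g v :: "real \<Rightarrow> 'a::{real_normed_field,banach,second_countable_topology}"
  assumes f [measurable]: "f \<in> borel_measurable borel" and B: "\<And>x. norm (f x) \<le> B"
    and g: "integrable lborel g" and v: "integrable lborel v"
  shows "integrable lborel (\<lambda>\<sigma>. f \<sigma> * (LINT \<tau>|lborel. g (\<sigma> - \<tau>) * v \<tau>))"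
    and "(LINT \<sigma>|lborel. f \<sigma> * (LINT \<tau>|lborel. g (\<sigma> - \<tau>) * v \<tau>))
       = (LINT \<tau>|lborel. (LINT \<rho>|lborel. f (\<tau> + \<rho>) * g \<rho>) * v \<tau>)"
proof -
  have [measurable]: "g \<in> borel_measurable borel" "v \<in> borel_measurable borel"
    using g v by (auto dest: borel_measurable_integrable)
  have B0: "B \<ge> 0" using B[of 0] norm_ge_zero order_trans by blast
  have gs: "integrable lborel (\<lambda>\<sigma>. g (\<sigma> - \<tau>))" for \<tau>
    using lborel_integrable_real_affine[OF g, of 1 "- \<tau>"] by simp
  have gn: "(LINT \<sigma>|lborel. norm (g (\<sigma> - \<tau>))) = (LINT \<sigma>|lborel. norm (g \<sigma>))" for \<tau>
    using lborel_integral_real_affine[of 1 "\<lambda>x. norm (g x)" "- \<tau>"] by simp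
  define K where "K \<tau> \<sigma> = f \<sigma> * (g (\<sigma> - \<tau>) * v \<tau>)" for \<tau> \<sigma>
  have Km [measurable]: "case_prod K \<in> borel_measurable (lborel \<Otimes>\<^sub>M lborel)"
    unfolding K_def by measurable
  have Ki: "integrable lborel (K \<tau>)" for \<tau>
  proof (rule Bochner_Integration.integrable_bound)
    show "integrable lborel (\<lambda>\<sigma>. (B * norm (v \<tau>)) * norm (g (\<sigma> - \<tau>)))"
      by (intro integrable_mult_right integrable_norm gs)
    show "AE \<sigma> in lborel. norm (K \<tau> \<sigma>) \<le> norm ((B * norm (v \<tau>)) * norm (g (\<sigma> - \<tau>)))"
      using B B0 unfolding K_def
      by (intro AE_I2) (auto simp: norm_mult abs_mult mult_ac intro!: mult_right_mono)
  qed (simp add: K_def)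
  have Kn: "(LINT \<sigma>|lborel. norm (K \<tau> \<sigma>)) \<le> B * (LINT \<sigma>|lborel. norm (g \<sigma>)) * norm (v \<tau>)" for \<tau>
  proof -
    have "(LINT \<sigma>|lborel. norm (K \<tau> \<sigma>)) \<le> (LINT \<sigma>|lborel. (B * norm (v \<tau>)) * norm (g (\<sigma> - \<tau>)))"
      using B B0 unfolding K_def
      by (intro integral_mono integrable_norm Ki[unfolded K_def] integrable_mult_right gs)
        (auto simp: norm_mult abs_mult mult_ac intro!: mult_right_mono)
    also have "\<dots> = B * norm (v \<tau>) * (LINT \<sigma>|lborel. norm (g \<sigma>))"
      using gn by simp
    finally show ?thesis by (simp add: mult_ac)
  qed
  have int: "integrable (lborel \<Otimes>\<^sub>M lborel) (case_prod K)"
  proof (rule lborel_pair.Fubini_integrable)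
    show "integrable lborel (\<lambda>\<tau>. LINT \<sigma>|lborel. norm (case_prod K (\<tau>, \<sigma>)))"
    proof (rule Bochner_Integration.integrable_bound)
      show "integrable lborel (\<lambda>\<tau>. B * (LINT \<sigma>|lborel. norm (g \<sigma>)) * norm (v \<tau>))"
        by (intro integrable_mult_right integrable_norm v)
      show "AE \<tau> in lborel. norm (LINT \<sigma>|lborel. norm (case_prod K (\<tau>, \<sigma>)))
          \<le> norm (B * (LINT \<sigma>|lborel. norm (g \<sigma>)) * norm (v \<tau>))"
      proof (rule AE_I2)
        fix \<tau>
        have "norm (LINT \<sigma>|lborel. norm (K \<tau> \<sigma>)) = (LINT \<sigma>|lborel. norm (K \<tau> \<sigma>))"
          by simp
        also have "\<dots> \<le> norm (B * (LINT \<sigma>|lborel. norm (g \<sigma>)) * norm (v \<tau>))"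
          using Kn[of \<tau>] by (metis abs_ge_self order_trans real_norm_def)
        finally show "norm (LINT \<sigma>|lborel. norm (case_prod K (\<tau>, \<sigma>)))
          \<le> norm (B * (LINT \<sigma>|lborel. norm (g \<sigma>)) * norm (v \<tau>))" by simp
      qed
    qed simp
  qed (use Ki in auto)
  have "(LINT \<sigma>|lborel. LINT \<tau>|lborel. K \<tau> \<sigma>) = (LINT \<tau>|lborel. LINT \<sigma>|lborel. K \<tau> \<sigma>)"
    by (rule lborel_pair.Fubini_integral[OF int])
  moreover have "(LINT \<tau>|lborel. K \<tau> \<sigma>) = f \<sigma> * (LINT \<tau>|lborel. g (\<sigma> - \<tau>) * v \<tau>)" for \<sigma>
    unfolding K_def by simp
  moreover have "(LINT \<sigma>|lborel. K \<tau> \<sigma>) = (LINT \<rho>|lborel. f (\<tau> + \<rho>) * g \<rho>) * v \<tau>" for \<tau>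
  proof -
    have "(LINT \<sigma>|lborel. K \<tau> \<sigma>) = (LINT \<sigma>|lborel. f \<sigma> * g (\<sigma> - \<tau>)) * v \<tau>"
      unfolding K_def by (simp flip: mult.assoc)
    also have "(LINT \<sigma>|lborel. f \<sigma> * g (\<sigma> - \<tau>)) = (LINT \<rho>|lborel. f (\<tau> + \<rho>) * g \<rho>)"
      using lborel_integral_real_affine[of 1 "\<lambda>\<sigma>. f \<sigma> * g (\<sigma> - \<tau>)" \<tau>] by simp
    finally show ?thesis .
  qed
  ultimately show "(LINT \<sigma>|lborel. f \<sigma> * (LINT \<tau>|lborel. g (\<sigma> - \<tau>) * v \<tau>))
       = (LINT \<tau>|lborel. (LINT \<rho>|lborel. f (\<tau> + \<rho>) * g \<rho>) * v \<tau>)"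
    by simp
  have "integrable lborel (\<lambda>\<sigma>. LINT \<tau>|lborel. K \<tau> \<sigma>)"
    by (rule lborel_pair.integrable_snd[OF int])
  then show "integrable lborel (\<lambda>\<sigma>. f \<sigma> * (LINT \<tau>|lborel. g (\<sigma> - \<tau>) * v \<tau>))"
    unfolding K_def by simp
qed

text \<open>A bridge between the two integrals in use: transforms and responses are gauge integrals,
  whereas Fubini and limits of integrals are applied over \<open>lborel\<close>. Continuity supplies
  the Borel measurability under which both agree.\<close>

lemma absolutely_integrable_lborel:
  fixes f :: "real \<Rightarrow> 'a::euclidean_space"
  assumes "continuous_on S f" "S \<in> sets borel"
  shows "f absolutely_integrable_on S \<longleftrightarrow> set_integrable lborel S f"
    and "f absolutely_integrable_on S \<Longrightarrow> integral S f = (LINT x:S|lborel. f x)"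
proof -
  have m: "(\<lambda>x. indicator S x *\<^sub>R f x) \<in> borel_measurable borel"
    using assms by (simp add: borel_measurable_continuous_on_indicator)
  then show *: "f absolutely_integrable_on S \<longleftrightarrow> set_integrable lborel S f"
    unfolding set_integrable_def by (subst integrable_completion) auto
  show "integral S f = (LINT x:S|lborel. f x)" if "f absolutely_integrable_on S"
    using that * set_borel_integral_eq_integral(2) by metis
qed

lemma exp_decay_absolutely_integrable:
  fixes f :: "real \<Rightarrow> 'a::euclidean_space"
  assumes "continuous_on {0..} f" "\<And>t. t \<ge> 0 \<Longrightarrow> norm (f t) \<le> M * exp (c * t)" "c < 0"
  shows "f absolutely_integrable_on {0..}"
proof (rule measurable_bounded_by_integrable_imp_absolutely_integrable)
  show "f \<in> borel_measurable (lebesgue_on {0..})"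
    by (rule continuous_imp_measurable_on_sets_lebesgue[OF assms(1)]) simp
  show "(\<lambda>t. M * exp (c * t)) integrable_on {0..}"
    using integrable_on_exp_minus_to_infinity[of "-c" 0] assms(3) by (intro integrable_on_mult_right) simp
qed (use assms in auto)

section \<open>Laplace transforms and causal convolution\<close>

definition has_laplace :: "(real \<Rightarrow> complex) \<Rightarrow> complex \<Rightarrow> complex \<Rightarrow> bool" where
  "has_laplace h s L \<longleftrightarrow>
     (\<lambda>t. exp (- (s * of_real t)) * h t) absolutely_integrable_on {0..} \<and>
     integral {0..} (\<lambda>t. exp (- (s * of_real t)) * h t) = L"

lemma has_laplace_add: "has_laplace f s F \<Longrightarrow> has_laplace g s G \<Longrightarrow> has_laplace (\<lambda>t. f t + g t) s (F + G)"
  unfolding has_laplace_def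
  by (auto simp: distrib_left set_integral_add(1) Henstock_Kurzweil_Integration.integral_add
      set_lebesgue_integral_eq_integral(1))

lemma has_laplace_mult: "has_laplace f s F \<Longrightarrow> has_laplace (\<lambda>t. k * f t) s (k * F)"
  unfolding has_laplace_def
  by (auto simp: mult.left_commute[of _ k] set_integrable_mult_right)

lemma has_laplace_cong: "(\<And>t. t \<ge> 0 \<Longrightarrow> f t = g t) \<Longrightarrow> has_laplace f s F \<longleftrightarrow> has_laplace g s F"
  unfolding has_laplace_def
  by (intro arg_cong2[of _ _ _ _ "(\<and>)"] set_integrable_cong arg_cong2[of _ _ _ _ "(=)"] 
      Henstock_Kurzweil_Integration.integral_cong) auto

definition conv :: "(real \<Rightarrow> 'a::{real_normed_field,euclidean_space}) \<Rightarrow> (real \<Rightarrow> 'a) \<Rightarrow> real \<Rightarrow> 'a" where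
  "conv h v t = integral {0..t} (\<lambda>\<tau>. h (t - \<tau>) * v \<tau>)"

text \<open>Truncation to [0, T] turns the causal convolution into one over the whole line:
  \<open>H (t - \<tau>)\<close> vanishes for \<tau> > t and \<open>V\<close> for almost all \<tau> <
  0. \<open>V\<close> may differ from the truncated \<open>v\<close> on a null set, so that it can
  be taken Borel measurable.\<close>

lemma conv_eq_lborel:
  fixes h v :: "real \<Rightarrow> 'a::{real_normed_field,euclidean_space}"
  assumes h: "continuous_on {0..} h" and v: "v absolutely_integrable_on {0..T}" and t: "0 \<le> t" "t \<le> T"
    and V: "integrable lborel V" and VA: "AE \<tau> in lebesgue. V \<tau> = (if \<tau> \<in> {0..T} then v \<tau> else 0)"
    and H: "\<And>\<tau>. H \<tau> = (if \<tau> \<in> {0..T} then h \<tau> else 0)"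
  shows "conv h v t = (LINT \<tau>|lborel. H (t - \<tau>) * V \<tau>)"
    and "(\<lambda>\<tau>. h (t - \<tau>) * v \<tau>) absolutely_integrable_on {0..t}"
    and "integrable lborel (\<lambda>\<tau>. H (t - \<tau>) * V \<tau>)"
proof -
  have Hm: "H \<in> borel_measurable borel"
  proof -
    have "(\<lambda>x. indicator {0..T} x *\<^sub>R h x) \<in> borel_measurable borel"
      by (intro borel_measurable_continuous_on_indicator continuous_on_subset[OF h]) auto
    moreover have "H = (\<lambda>x. indicator {0..T} x *\<^sub>R h x)"
      by (auto simp: H fun_eq_iff)
    ultimately show ?thesis by simp
  qed
  note [measurable] = Hm
  have [measurable]: "V \<in> borel_measurable borel" using V by (auto dest: borel_measurable_integrable)
  have "bounded (h ` {0..T})"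
    by (intro compact_imp_bounded compact_continuous_image continuous_on_subset[OF h]) auto
  then obtain B where B: "\<And>\<tau>. \<tau> \<in> {0..T} \<Longrightarrow> norm (h \<tau>) \<le> B" "B > 0"
    by (force simp: bounded_pos)
  then have HB: "norm (H \<tau>) \<le> B" for \<tau> by (auto simp: H)
  show i: "integrable lborel (\<lambda>\<tau>. H (t - \<tau>) * V \<tau>)"
  proof (rule Bochner_Integration.integrable_bound)
    show "integrable lborel (\<lambda>\<tau>. B * norm (V \<tau>))"
      by (intro integrable_mult_right integrable_norm V)
    show "AE \<tau> in lborel. norm (H (t - \<tau>) * V \<tau>) \<le> norm (B * norm (V \<tau>))"
      using HB B(2) by (intro AE_I2) (auto simp: norm_mult intro!: mult_right_mono)
  qed simp
  have ae: "AE \<tau> in lebesgue. H (t - \<tau>) * V \<tau> = indicator {0..t} \<tau> *\<^sub>R (h (t - \<tau>) * v \<tau>)"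
    using VA by eventually_elim (use t in \<open>auto simp: H indicator_def\<close>)
  have i': "integrable lebesgue (\<lambda>\<tau>. H (t - \<tau>) * V \<tau>)"
    using i by (subst integrable_completion) auto
  show ai: "(\<lambda>\<tau>. h (t - \<tau>) * v \<tau>) absolutely_integrable_on {0..t}"
  proof (rule absolutely_integrable_bounded_measurable_product[OF bilinear_times])
    have c: "continuous_on {0..t} (\<lambda>\<tau>. h (t - \<tau>))"
      using t by (intro continuous_on_compose2[OF h] continuous_intros) auto
    then show "(\<lambda>\<tau>. h (t - \<tau>)) \<in> borel_measurable (lebesgue_on {0..t})"
      by (rule continuous_imp_measurable_on_sets_lebesgue) simp
    show "bounded ((\<lambda>\<tau>. h (t - \<tau>)) ` {0..t})"
      using c by (intro compact_imp_bounded compact_continuous_image) auto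
    show "v absolutely_integrable_on {0..t}"
      using t by (intro set_integrable_subset[OF v]) auto
  qed simp
  then have m: "(\<lambda>\<tau>. indicator {0..t} \<tau> *\<^sub>R (h (t - \<tau>) * v \<tau>)) \<in> borel_measurable lebesgue"
    unfolding set_integrable_def by (rule borel_measurable_integrable)
  have "conv h v t = (LINT \<tau>|lebesgue. indicator {0..t} \<tau> *\<^sub>R (h (t - \<tau>) * v \<tau>))"
    using set_lebesgue_integral_eq_integral(2)[OF ai] by (simp add: conv_def set_lebesgue_integral_def)
  also have "\<dots> = (LINT \<tau>|lebesgue. H (t - \<tau>) * V \<tau>)"
    by (rule integral_cong_AE[OF m borel_measurable_integrable[OF i']]) (use ae in \<open>eventually_elim, simp\<close>)
  also have "\<dots> = (LINT \<tau>|lborel. H (t - \<tau>) * V \<tau>)"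
    by (rule integral_completion) simp
  finally show "conv h v t = (LINT \<tau>|lborel. H (t - \<tau>) * V \<tau>)" .
qed

text \<open>Signals are only Lebesgue measurable, whereas Fubini's theorem is stated for Borel functions.\<close>

lemma absolutely_integrable_borel_version:
  fixes v :: "real \<Rightarrow> real"
  assumes v: "v absolutely_integrable_on {0..T}"
  obtains V where "integrable lborel V" "AE \<tau> in lebesgue. V \<tau> = (if \<tau> \<in> {0..T} then v \<tau> else 0)"
    "\<And>\<tau>. \<tau> \<notin> {0..T} \<Longrightarrow> V \<tau> = 0"
proof -
  have i: "integrable lebesgue (\<lambda>\<tau>. indicator {0..T} \<tau> *\<^sub>R v \<tau>)"
    using v by (simp add: set_integrable_def)
  obtain U where U: "U \<in> borel_measurable lborel" "AE \<tau> in lborel. indicator {0..T} \<tau> *\<^sub>R v \<tau> = U \<tau>"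
    using completion_ex_borel_measurable_real[OF borel_measurable_integrable[OF i]] by blast
  define V where "V \<tau> = indicator {0..T} \<tau> * U \<tau>" for \<tau>
  have V: "V \<in> borel_measurable lborel" using U(1) unfolding V_def by simp
  have ae: "AE \<tau> in lebesgue. indicator {0..T} \<tau> *\<^sub>R v \<tau> = V \<tau>"
    using AE_completion[OF U(2)] by eventually_elim (auto simp: V_def split: split_indicator)
  have "integrable lebesgue V"
    by (rule integrable_cong_AE_imp[OF i measurable_completion[OF V]])
      (use ae in \<open>eventually_elim, simp\<close>)
  then have "integrable lborel V"
    using V by (subst (asm) integrable_completion) auto
  moreover have "AE \<tau> in lebesgue. V \<tau> = (if \<tau> \<in> {0..T} then v \<tau> else 0)"
    using ae by eventually_elim (auto simp: indicator_def split: if_splits)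
  ultimately show ?thesis using that by (simp add: V_def)
qed

lemma continuous_borel_version:
  fixes v :: "real \<Rightarrow> 'a::euclidean_space"
  assumes v: "continuous_on {0..} v"
  shows "v absolutely_integrable_on {0..T}" "integrable lborel (\<lambda>\<tau>. if \<tau> \<in> {0..T} then v \<tau> else 0)"
proof -
  have c: "continuous_on {0..T} v" by (rule continuous_on_subset[OF v]) auto
  show "v absolutely_integrable_on {0..T}"
    using absolutely_integrable_continuous[of 0 T v] c by (simp add: cbox_interval)
  have "set_integrable lborel {0..T} v" by (rule borel_integrable_atLeastAtMost'[OF c])
  then show "integrable lborel (\<lambda>\<tau>. if \<tau> \<in> {0..T} then v \<tau> else 0)"
    unfolding set_integrable_def
    by (rule Bochner_Integration.integrable_cong[THEN iffD1, rotated -1]) (auto simp: indicator_def)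
qed

text \<open>Dominated convergence along sequences. The integrand converges except possibly at \<tau>
  = t, where the truncated \<open>H\<close> jumps, and a single point is null; continuity of
  \<open>v\<close> plays no part in this, only integrability.\<close>

lemma conv_continuous_aux:
  fixes h v :: "real \<Rightarrow> 'a::{real_normed_field,euclidean_space}"
  assumes h: "continuous_on {0..} h" and v: "v absolutely_integrable_on {0..T}"
    and V: "integrable lborel V" and VA: "AE \<tau> in lebesgue. V \<tau> = (if \<tau> \<in> {0..T} then v \<tau> else 0)"
    and V0: "\<And>\<tau>. \<tau> \<notin> {0..T} \<Longrightarrow> V \<tau> = 0"
  shows "continuous_on {0..T} (conv h v)"
proof -
  define H where "H \<tau> = (if \<tau> \<in> {0..T} then h \<tau> else 0)" for \<tau>
  have "(\<lambda>x. indicator {0..T} x *\<^sub>R h x) \<in> borel_measurable borel"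
    by (intro borel_measurable_continuous_on_indicator continuous_on_subset[OF h]) auto
  moreover have "H = (\<lambda>x. indicator {0..T} x *\<^sub>R h x)"
    by (auto simp: H_def fun_eq_iff)
  ultimately have [measurable]: "H \<in> borel_measurable borel" by simp
  have [measurable]: "V \<in> borel_measurable borel" using V by (auto dest: borel_measurable_integrable)
  have "bounded (h ` {0..T})"
    by (intro compact_imp_bounded compact_continuous_image continuous_on_subset[OF h]) auto
  then obtain B where B: "\<And>\<tau>. \<tau> \<in> {0..T} \<Longrightarrow> norm (h \<tau>) \<le> B" "B > 0"
    by (force simp: bounded_pos)
  then have HB: "norm (H \<tau>) \<le> B" for \<tau> by (auto simp: H_def)
  have c: "conv h v t = (LINT \<tau>|lborel. H (t - \<tau>) * V \<tau>)" if "t \<in> {0..T}" for t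
    using that by (intro conv_eq_lborel(1)[OF h v _ _ V VA]) (auto simp: H_def)
  show ?thesis
    unfolding continuous_on_sequentially comp_def
  proof (intro allI ballI impI, elim conjE)
    fix u t assume t: "t \<in> {0..T}" and u: "\<forall>n. u n \<in> {0..T}" "u \<longlonglongrightarrow> t"
    have "(\<lambda>n. LINT \<tau>|lborel. H (u n - \<tau>) * V \<tau>) \<longlonglongrightarrow> (LINT \<tau>|lborel. H (t - \<tau>) * V \<tau>)"
    proof (rule integral_dominated_convergence)
      show "integrable lborel (\<lambda>\<tau>. B * norm (V \<tau>))"
        by (intro integrable_mult_right integrable_norm V)
      show "AE \<tau> in lborel. norm (H (u n - \<tau>) * V \<tau>) \<le> B * norm (V \<tau>)" for n
        using HB B(2) by (intro AE_I2) (auto simp: norm_mult intro!: mult_right_mono)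
      have "AE \<tau> in lborel. \<tau> \<noteq> t" by (rule AE_lborel_singleton)
      then show "AE \<tau> in lborel. (\<lambda>n. H (u n - \<tau>) * V \<tau>) \<longlonglongrightarrow> H (t - \<tau>) * V \<tau>"
      proof eventually_elim
        fix \<tau> assume \<tau>: "\<tau> \<noteq> t"
        consider "\<tau> < 0" | "\<tau> > t" | "0 \<le> \<tau>" "\<tau> < t" using \<tau> by linarith
        then show "(\<lambda>n. H (u n - \<tau>) * V \<tau>) \<longlonglongrightarrow> H (t - \<tau>) * V \<tau>"
        proof cases
          case 1
          then show ?thesis using V0[of \<tau>] by simp
        next
          case 2
          then have "\<forall>\<^sub>F n in sequentially. u n < \<tau>" using u(2) order_tendstoD(2) by blast
          then have "\<forall>\<^sub>F n in sequentially. H (u n - \<tau>) = 0" by eventually_elim (simp add: H_def)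
          then have "(\<lambda>n. H (u n - \<tau>)) \<longlonglongrightarrow> 0" by (rule tendsto_eventually)
          then show ?thesis using 2 by (auto simp: H_def intro!: tendsto_eq_intros)
        next
          case 3
          then have "\<forall>\<^sub>F n in sequentially. u n > \<tau>" using u(2) order_tendstoD(1) by blast
          then have e: "\<forall>\<^sub>F n in sequentially. h (u n - \<tau>) = H (u n - \<tau>)"
          proof eventually_elim
            case (elim n)
            then show ?case using u(1)[rule_format, of n] 3 by (simp add: H_def)
          qed
          have "isCont h (t - \<tau>)"
            using h 3 by (intro continuous_on_interior[OF h]) simp
          then have "(\<lambda>n. h (u n - \<tau>)) \<longlonglongrightarrow> h (t - \<tau>)"
            by (rule isCont_tendsto_compose) (intro tendsto_intros u)
          then have "(\<lambda>n. H (u n - \<tau>)) \<longlonglongrightarrow> h (t - \<tau>)"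
            by (rule Lim_transform_eventually[OF _ e])
          moreover have "h (t - \<tau>) = H (t - \<tau>)" using 3 t by (simp add: H_def)
          ultimately show ?thesis by (auto intro!: tendsto_intros)
        qed
      qed
    qed auto
    then show "(\<lambda>n. conv h v (u n)) \<longlonglongrightarrow> conv h v t"
      using c[OF t] c u(1) by simp
  qed
qed

lemma continuous_on_atLeast_zeroI:
  assumes "\<And>T. T \<ge> 0 \<Longrightarrow> continuous_on {0..T} f"
  shows "continuous_on {0::real..} f"
  unfolding continuous_on_eq_continuous_within
proof
  fix t :: real assume "t \<in> {0..}"
  then have t: "t \<ge> 0" by simp
  then have "continuous (at t within {0..t + 1}) f"
    using assms[of "t + 1"] by (simp add: continuous_on_eq_continuous_within)
  moreover have "at t within {0..t + 1} = at t within {0..}"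
    by (rule at_within_nhd[of t "{..<t + 1}"]) auto
  ultimately show "continuous (at t within {0..}) f" by simp
qed

lemma conv_continuous:
  fixes h v :: "real \<Rightarrow> real"
  assumes "continuous_on {0..} h" "\<And>T. T \<ge> 0 \<Longrightarrow> v absolutely_integrable_on {0..T}"
  shows "continuous_on {0..} (conv h v)"
proof (rule continuous_on_atLeast_zeroI)
  fix T :: real assume T: "T \<ge> 0"
  show "continuous_on {0..T} (conv h v)"
    by (rule absolutely_integrable_borel_version[OF assms(2)[OF T]],
      rule conv_continuous_aux[OF assms(1) assms(2)[OF T]])
qed

lemma conv_continuous_complex:
  fixes h v :: "real \<Rightarrow> complex"
  assumes "continuous_on {0..} h" "continuous_on {0..} v"
  shows "continuous_on {0..} (conv h v)"
proof (rule continuous_on_atLeast_zeroI)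
  fix T :: real assume T: "T \<ge> 0"
  show "continuous_on {0..T} (conv h v)"
    by (rule conv_continuous_aux[OF assms(1) continuous_borel_version[OF assms(2), of T]]) auto
qed

text \<open>With all functions truncated to [0, T] the claim becomes Fubini on the line.
  \<open>W\<close> is the untruncated convolution of \<open>k\<close> and \<open>v\<close>; it
  agrees with \<open>conv k v\<close> on [0, T], and outside this interval the reversed factor
  \<open>R h (T - \<sigma>)\<close> vanishes, so its values there do not count.\<close>

lemma conv_assoc:
  fixes h k v :: "real \<Rightarrow> real"
  assumes h: "continuous_on {0..} h" and k: "continuous_on {0..} k"
    and v: "v absolutely_integrable_on {0..T}" and T: "0 \<le> T"
  shows "conv k v absolutely_integrable_on {0..T}"
    and "conv h (conv k v) T = conv (conv h k) v T"
proof -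
  obtain V where V: "integrable lborel V" "AE \<tau> in lebesgue. V \<tau> = (if \<tau> \<in> {0..T} then v \<tau> else 0)"
    and V0: "\<And>\<tau>. \<tau> \<notin> {0..T} \<Longrightarrow> V \<tau> = 0"
    by (rule absolutely_integrable_borel_version[OF v]) blast
  have [measurable]: "V \<in> borel_measurable borel" using V(1) by (auto dest: borel_measurable_integrable)
  define R where "R g \<tau> = (if \<tau> \<in> {0..T} then g \<tau> else (0::real))" for g \<tau>
  have Rm [measurable]: "R g \<in> borel_measurable borel" if "continuous_on {0..} g" for g
  proof -
    have "(\<lambda>x. indicator {0..T} x *\<^sub>R g x) \<in> borel_measurable borel"
      by (intro borel_measurable_continuous_on_indicator continuous_on_subset[OF that]) auto
    moreover have "R g = (\<lambda>x. indicator {0..T} x *\<^sub>R g x)"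
      by (auto simp: R_def fun_eq_iff)
    ultimately show ?thesis by simp
  qed
  note [measurable] = Rm[OF h] Rm[OF k]
  have ki: "integrable lborel (R k)"
    using continuous_borel_version(2)[OF k, of T] unfolding R_def .
  define W where "W \<sigma> = (LINT \<tau>|lborel. R k (\<sigma> - \<tau>) * V \<tau>)" for \<sigma>
  have W: "conv k v \<sigma> = W \<sigma>" if "\<sigma> \<in> {0..T}" for \<sigma>
    unfolding W_def using that by (intro conv_eq_lborel(1)[OF k v _ _ V]) (auto simp: R_def)
  have W0: "W \<sigma> = 0" if "\<sigma> < 0" for \<sigma>
  proof -
    have "R k (\<sigma> - \<tau>) * V \<tau> = 0" for \<tau>
      using that V0 by (cases "\<tau> \<in> {0..T}") (auto simp: R_def)
    then have "(\<lambda>\<tau>. R k (\<sigma> - \<tau>) * V \<tau>) = (\<lambda>_. 0)" by (rule ext)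
    then show ?thesis by (simp add: W_def)
  qed
  have Wi: "integrable lborel W"
    unfolding W_def using conv_assoc_lborel(1)[of "\<lambda>_. 1" 1, OF _ _ ki V(1)] by simp
  then have Wi': "integrable lborel (\<lambda>\<sigma>. indicator {0..T} \<sigma> * W \<sigma>)"
    by (subst mult.commute) (intro integrable_real_mult_indicator, simp)
  from Wi have "set_integrable lborel {0..T} W"
    using Wi' by (simp add: set_integrable_def)
  then have Wa: "W absolutely_integrable_on {0..T}"
    unfolding set_integrable_def by (subst integrable_completion) (auto intro: borel_measurable_integrable)
  then show ca: "conv k v absolutely_integrable_on {0..T}"
    by (rule set_integrable_cong[THEN iffD1, rotated -1]) (auto simp: W)
  have "bounded (h ` {0..T})"
    by (intro compact_imp_bounded compact_continuous_image continuous_on_subset[OF h]) auto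
  then obtain B where B: "\<And>\<tau>. \<tau> \<in> {0..T} \<Longrightarrow> norm (h \<tau>) \<le> B" "B > 0"
    by (force simp: bounded_pos)
  then have HB: "norm (R h (T - \<tau>)) \<le> B" for \<tau> by (auto simp: R_def)
  have "conv h (conv k v) T = conv h W T"
    unfolding conv_def by (intro Henstock_Kurzweil_Integration.integral_cong) (auto simp: W[unfolded conv_def])
  also have "\<dots> = (LINT \<sigma>|lborel. R h (T - \<sigma>) * (indicator {0..T} \<sigma> * W \<sigma>))"
    by (rule conv_eq_lborel(1)[OF h Wa T order_refl])
      (auto simp: R_def Wi' split: split_indicator)
  also have "\<dots> = (LINT \<sigma>|lborel. R h (T - \<sigma>) * W \<sigma>)"
  proof (rule Bochner_Integration.integral_cong[OF refl])
    fix \<sigma> show "R h (T - \<sigma>) * (indicator {0..T} \<sigma> * W \<sigma>) = R h (T - \<sigma>) * W \<sigma>"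
      by (cases "\<sigma> \<in> {0..T}") (auto simp: R_def W0)
  qed
  also have "\<dots> = (LINT \<tau>|lborel. (LINT \<rho>|lborel. R h (T - (\<tau> + \<rho>)) * R k \<rho>) * V \<tau>)"
    unfolding W_def by (rule conv_assoc_lborel(2)[of "\<lambda>\<sigma>. R h (T - \<sigma>)", OF _ HB ki V(1)]) simp
  also have "\<dots> = (LINT \<tau>|lborel. R (conv h k) (T - \<tau>) * V \<tau>)"
  proof (rule Bochner_Integration.integral_cong[OF refl])
    fix \<tau>
    show "(LINT \<rho>|lborel. R h (T - (\<tau> + \<rho>)) * R k \<rho>) * V \<tau> = R (conv h k) (T - \<tau>) * V \<tau>"
    proof (cases "\<tau> \<in> {0..T}")
      case True
      have "conv h k (T - \<tau>) = (LINT \<rho>|lborel. R h (T - \<tau> - \<rho>) * R k \<rho>)"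
        using True by (intro conv_eq_lborel(1)[OF h continuous_borel_version(1)[OF k] _ _ ki, of _ T])
          (auto simp: R_def)
      then show ?thesis using True by (simp add: R_def diff_diff_eq)
    qed (simp add: V0)
  qed
  also have "\<dots> = conv (conv h k) v T"
  proof (rule conv_eq_lborel(1)[symmetric, OF _ v T order_refl V])
    show "continuous_on {0..} (conv h k)"
      by (intro conv_continuous h continuous_borel_version(1)[OF k])
  qed (simp add: R_def)
  finally show "conv h (conv k v) T = conv (conv h k) v T" .
qed

text \<open>The weight is multiplicative, e^(-s\<sigma>) = e^(-s(\<sigma> - \<tau>)) e^(-s\<tau>),
  so damping a convolution is the same as convolving the damped functions \<open>E f\<close> and
  \<open>E g\<close>. Its integral is then the product of theirs.\<close>

lemma has_laplace_conv:
  assumes f: "continuous_on {0..} f" and g: "continuous_on {0..} g"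
    and F: "has_laplace f s F" and G: "has_laplace g s G"
  shows "has_laplace (conv f g) s (F * G)"
proof -
  define E where "E h t = (if t \<ge> 0 then exp (- (s * of_real t)) * h t else 0)" for h :: "real \<Rightarrow> complex" and t :: real
  have Ei: "integrable lborel (E h)" "(LINT t|lborel. E h t) = L"
    if "continuous_on {0..} h" "has_laplace h s L" for h L
  proof -
    have c: "continuous_on {0..} (\<lambda>t. exp (- (s * of_real t)) * h t)"
      by (intro continuous_intros that)
    have a: "(\<lambda>t. exp (- (s * of_real t)) * h t) absolutely_integrable_on {0..}"
      using that(2) by (simp add: has_laplace_def)
    have "E h = (\<lambda>t. indicator {0..} t *\<^sub>R (exp (- (s * of_real t)) * h t))"
      by (auto simp: E_def fun_eq_iff)
    then show "integrable lborel (E h)" "(LINT t|lborel. E h t) = L"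
      using absolutely_integrable_lborel[OF c, of] a that(2)
      by (simp_all add: set_integrable_def set_lebesgue_integral_def has_laplace_def)
  qed
  note Fi = Ei[OF f F] and Gi = Ei[OF g G]
  define W where "W \<sigma> = (LINT \<tau>|lborel. E f (\<sigma> - \<tau>) * E g \<tau>)" for \<sigma>
  have cc: "continuous_on {0..} (conv f g)" by (rule conv_continuous_complex[OF f g])
  have W: "W \<sigma> = indicator {0..} \<sigma> *\<^sub>R (exp (- (s * of_real \<sigma>)) * conv f g \<sigma>)" for \<sigma>
  proof (cases "\<sigma> \<ge> 0")
    case True
    have c: "continuous_on {0..\<sigma>} (\<lambda>\<tau>. f (\<sigma> - \<tau>) * g \<tau>)"
      by (intro continuous_intros continuous_on_compose2[OF f] continuous_on_subset[OF g]) auto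
    have a: "(\<lambda>\<tau>. f (\<sigma> - \<tau>) * g \<tau>) absolutely_integrable_on {0..\<sigma>}"
      using absolutely_integrable_continuous[of 0 \<sigma>] c by (simp add: cbox_interval)
    have "W \<sigma> = (LINT \<tau>|lborel. exp (- (s * of_real \<sigma>)) * (indicator {0..\<sigma>} \<tau> *\<^sub>R (f (\<sigma> - \<tau>) * g \<tau>)))"
      unfolding W_def
      by (intro Bochner_Integration.integral_cong refl)
        (auto simp: E_def indicator_def algebra_simps simp flip: exp_add)
    also have "\<dots> = exp (- (s * of_real \<sigma>)) * (LINT \<tau>|lborel. indicator {0..\<sigma>} \<tau> *\<^sub>R (f (\<sigma> - \<tau>) * g \<tau>))"
      by (rule integral_mult_right_zero)
    also have "\<dots> = exp (- (s * of_real \<sigma>)) * conv f g \<sigma>"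
      using absolutely_integrable_lborel(2)[OF c _ a]
      by (simp add: conv_def set_lebesgue_integral_def)
    finally show ?thesis using True by simp
  next
    case False
    then have "E f (\<sigma> - \<tau>) * E g \<tau> = 0" for \<tau> by (auto simp: E_def)
    then have "(\<lambda>\<tau>. E f (\<sigma> - \<tau>) * E g \<tau>) = (\<lambda>_. 0)" by (rule ext)
    then show ?thesis using False by (simp add: W_def)
  qed
  note A = conv_assoc_lborel[of "\<lambda>_. 1" 1, OF _ _ Fi(1) Gi(1)]
  have Wi: "integrable lborel W" and "(LINT \<sigma>|lborel. W \<sigma>) = F * G"
    using A by (simp_all add: W_def[abs_def] Fi(2) Gi(2))
  then have Wl: "(LINT \<sigma>:{0..}|lborel. exp (- (s * of_real \<sigma>)) * conv f g \<sigma>) = F * G"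
    unfolding set_lebesgue_integral_def W[symmetric] by simp
  have c: "continuous_on {0..} (\<lambda>t. exp (- (s * of_real t)) * conv f g t)"
    by (intro continuous_intros cc)
  have "set_integrable lborel {0..} (\<lambda>\<sigma>. exp (- (s * of_real \<sigma>)) * conv f g \<sigma>)"
    unfolding set_integrable_def W[symmetric] by (rule Wi)
  then have a: "(\<lambda>\<sigma>. exp (- (s * of_real \<sigma>)) * conv f g \<sigma>) absolutely_integrable_on {0..}"
    using absolutely_integrable_lborel(1)[OF c] by simp
  then show ?thesis
    using absolutely_integrable_lborel(2)[OF c _ a] Wl by (simp add: has_laplace_def)
qed

lemma has_laplace_exp:
  assumes "Re s > Re a"
  shows "has_laplace (\<lambda>t. exp (a * of_real t)) s (1 / (s - a))"
proof -
  define f where "f t = exp (- ((s - a) * of_real t))" for t :: real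
  have c: "continuous_on {0..} f" unfolding f_def by (intro continuous_intros)
  have nz: "s - a \<noteq> 0" using assms by auto
  have e: "exp (- (s * of_real t)) * exp (a * of_real t) = f t" for t
    unfolding f_def by (simp add: algebra_simps flip: exp_add)
  have n: "cmod (f t) = exp ((Re a - Re s) * t)" for t
    by (simp add: f_def algebra_simps)
  have ai: "f absolutely_integrable_on {0..}"
    by (rule exp_decay_absolutely_integrable[OF c, of 1 "Re a - Re s"]) (use n assms in auto)
  then have sl: "set_integrable lborel {0..} f"
    using absolutely_integrable_lborel(1)[OF c] by simp
  have "((\<lambda>b. LINT t:{0..b}|lborel. f t) \<longlongrightarrow> (LINT t:{0..}|lborel. f t)) at_top"
    by (rule tendsto_set_lebesgue_integral_at_top[OF _ sl]) auto
  moreover have "((\<lambda>b. LINT t:{0..b}|lborel. f t) \<longlongrightarrow> 1 / (s - a)) at_top"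
  proof (rule Lim_transform_eventually)
    have "((\<lambda>b. exp ((Re a - Re s) * b)) \<longlongrightarrow> 0) at_top"
      using assms by (auto intro!: filterlim_compose[OF exp_at_bot] filterlim_tendsto_neg_mult_at_bot filterlim_ident tendsto_const)
    then have "(f \<longlongrightarrow> 0) at_top"
      by (subst tendsto_norm_zero_iff[symmetric]) (simp add: n)
    then show "((\<lambda>b. (1 - f b) / (s - a)) \<longlongrightarrow> 1 / (s - a)) at_top"
      using nz by (auto intro!: tendsto_eq_intros)
    show "\<forall>\<^sub>F b in at_top. (1 - f b) / (s - a) = (LINT t:{0..b}|lborel. f t)"
      using eventually_ge_at_top[of 0]
    proof eventually_elim
      fix b :: real assume b: "0 \<le> b"
      have "(f has_integral (- f b / (s - a) - - f 0 / (s - a))) {0..b}"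
      proof (rule fundamental_theorem_of_calculus[OF b])
        fix x
        have "((\<lambda>x. - exp (- (z * x)) / z) has_field_derivative exp (- (z * y))) (at y)" if "z \<noteq> 0" for z y :: complex
          using that by (auto intro!: derivative_eq_intros)
        from this[OF nz, of "of_real x"]
        show "((\<lambda>x. - f x / (s - a)) has_vector_derivative f x) (at x within {0..b})"
          using nz unfolding f_def by (intro has_vector_derivative_real_field) simp
      qed
      then have "integral {0..b} f = (1 - f b) / (s - a)"
        by (simp add: integral_unique f_def diff_divide_distrib)
      moreover have "set_integrable lborel {0..b} f"
        by (rule set_integrable_subset[OF sl]) auto
      ultimately show "(1 - f b) / (s - a) = (LINT t:{0..b}|lborel. f t)"
        using set_borel_integral_eq_integral(2) by metis
    qed
  qed
  ultimately have "(LINT t:{0..}|lborel. f t) = 1 / (s - a)"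
    by (rule tendsto_unique[rotated]) simp
  then show ?thesis
    using ai absolutely_integrable_lborel(2)[OF c _ ai] by (simp add: has_laplace_def e)
qed

lemma conv_exp_bound:
  assumes "Re a < c" "continuous_on {0..} g" "\<And>t. t \<ge> 0 \<Longrightarrow> cmod (g t) \<le> N * exp (c * t)" "t \<ge> 0"
  shows "cmod (conv (\<lambda>t. exp (a * of_real t)) g t) \<le> N / (c - Re a) * exp (c * t)"
proof -
  have N: "N \<ge> 0" using order_trans[OF norm_ge_zero assms(3)[of 0]] by simp
  define d where "d = c - Re a"
  have d: "d > 0" using assms(1) by (simp add: d_def)
  define K where "K = N * exp (c * t)"
  have I: "((\<lambda>\<tau>. K * exp (d * (\<tau> - t))) has_integral K / d * exp (d * (t - t)) - K / d * exp (d * (0 - t))) {0..t}"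
  proof (rule fundamental_theorem_of_calculus[OF assms(4)])
    fix \<tau>
    have "((\<lambda>\<tau>. K / d * exp (d * (\<tau> - t))) has_real_derivative K / d * (exp (d * (\<tau> - t)) * d)) (at \<tau> within {0..t})"
      by (auto intro!: derivative_eq_intros)
    moreover have "K / d * (exp (d * (\<tau> - t)) * d) = K * exp (d * (\<tau> - t))" using d by simp
    ultimately show "((\<lambda>\<tau>. K / d * exp (d * (\<tau> - t))) has_vector_derivative K * exp (d * (\<tau> - t))) (at \<tau> within {0..t})"
      by (simp only: has_real_derivative_iff_has_vector_derivative)
  qed
  have c: "continuous_on {0..t} (\<lambda>\<tau>. exp (a * of_real (t - \<tau>)) * g \<tau>)"
    by (intro continuous_intros continuous_on_subset[OF assms(2)]) auto
  have "cmod (conv (\<lambda>t. exp (a * of_real t)) g t) \<le>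
      integral {0..t} (\<lambda>\<tau>. K * exp (d * (\<tau> - t)))"
    unfolding conv_def
  proof (rule integral_norm_bound_integral)
    show "(\<lambda>\<tau>. exp (a * of_real (t - \<tau>)) * g \<tau>) integrable_on {0..t}"
      by (rule integrable_continuous_interval[OF c])
    show "(\<lambda>\<tau>. K * exp (d * (\<tau> - t))) integrable_on {0..t}"
      using I by blast
    fix \<tau> assume "\<tau> \<in> {0..t}"
    then have "cmod (exp (a * of_real (t - \<tau>)) * g \<tau>) \<le> exp (Re a * (t - \<tau>)) * (N * exp (c * \<tau>))"
      using assms(3)[of \<tau>] by (simp add: norm_mult)
    also have "\<dots> = K * exp (d * (\<tau> - t))"
      by (simp add: K_def d_def algebra_simps flip: exp_add)
    finally show "cmod (exp (a * of_real (t - \<tau>)) * g \<tau>) \<le> K * exp (d * (\<tau> - t))" .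
  qed
  also have "\<dots> = K / d - K / d * exp (d * (0 - t))"
    using integral_unique[OF I] by simp
  also have "\<dots> \<le> K / d"
    using d N by (simp add: K_def)
  finally show ?thesis by (simp add: K_def d_def)
qed

text \<open>Partial fractions, one root at a time: \<open>p = (X - a) p\<^sub>1 + k\<close> with a constant \<open>k\<close>.\<close>

lemma inverse_laplace_exists:
  assumes "\<And>a. a \<in> set as \<Longrightarrow> Re a < c" "p = 0 \<or> degree p < length as"
  shows "\<exists>h M. continuous_on {0..} h \<and> (\<forall>t\<ge>0. cmod (h t) \<le> M * exp (c * t)) \<and>
    (\<forall>s. Re s > c \<longrightarrow> has_laplace h s (poly p s / (\<Prod>a\<leftarrow>as. s - a)))"
  using assms
proof (induction as arbitrary: p)
  case Nil
  then have "p = 0" by simp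
  then show ?case
    by (intro exI[of _ "\<lambda>_. 0"] exI[of _ 0]) (auto simp: has_laplace_def)
next
  case (Cons a as)
  define p1 where "p1 = synthetic_div p a"
  define k where "k = poly p a"
  have p: "poly p s = (s - a) * poly p1 s + k" for s
    using arg_cong[OF synthetic_div_correct'[of a p], of "\<lambda>q. poly q s"]
    by (simp add: p1_def k_def algebra_simps)
  have "p1 = 0 \<or> degree p1 < length as"
    using Cons.prems(2) synthetic_div_eq_0_iff[of p a]
    by (auto simp: p1_def degree_synthetic_div)
  from Cons.IH[OF _ this] obtain h1 M1 where
    h1: "continuous_on {0..} h1" "\<And>t. t\<ge>0 \<Longrightarrow> cmod (h1 t) \<le> M1 * exp (c * t)"
      "\<And>s. Re s > c \<Longrightarrow> has_laplace h1 s (poly p1 s / (\<Prod>a\<leftarrow>as. s - a))"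
    using Cons.prems(1) by auto
  have a: "Re a < c" using Cons.prems(1) by simp
  \<comment> \<open>The remainder is k divided by all factors. If other roots are left, k over their
    product is strictly proper and is inverted by induction; the factor 1/(s - a) is then a
    convolution with an exponential, so repeated roots need no case of their own. For a single root
    the exponential itself is the answer.\<close>
  obtain h2 M2 where
    h2: "continuous_on {0..} h2" "\<And>t. t\<ge>0 \<Longrightarrow> cmod (h2 t) \<le> M2 * exp (c * t)"
      "\<And>s. Re s > c \<Longrightarrow> has_laplace h2 s (k / ((s - a) * (\<Prod>a\<leftarrow>as. s - a)))"
  proof (cases "as = []")
    case True
    show ?thesis
    proof (rule that[of "\<lambda>t. k * exp (a * of_real t)" "cmod k"])
      fix s assume "Re s > c"
      then show "has_laplace (\<lambda>t. k * exp (a * of_real t)) s (k / ((s - a) * (\<Prod>a\<leftarrow>as. s - a)))"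
        using has_laplace_mult[OF has_laplace_exp[of a s], of k] a True by simp
    qed (use a in \<open>auto simp: norm_mult intro!: continuous_intros mult_left_mono mult_right_mono\<close>)
  next
    case False
    then have "[:k:] = 0 \<or> degree [:k:] < length as" by auto
    from Cons.IH[OF _ this] obtain h M where
      h: "continuous_on {0..} h" "\<And>t. t\<ge>0 \<Longrightarrow> cmod (h t) \<le> M * exp (c * t)"
        "\<And>s. Re s > c \<Longrightarrow> has_laplace h s (k / (\<Prod>a\<leftarrow>as. s - a))"
      using Cons.prems(1) by auto
    have ce: "continuous_on {0..} (\<lambda>t. exp (a * of_real t))" by (intro continuous_intros)
    show ?thesis
    proof (rule that[of "conv (\<lambda>t. exp (a * of_real t)) h" "M / (c - Re a)"])
      show "continuous_on {0..} (conv (\<lambda>t. exp (a * of_real t)) h)"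
        by (rule conv_continuous_complex[OF ce h(1)])
      show "cmod (conv (\<lambda>t. exp (a * of_real t)) h t) \<le> M / (c - Re a) * exp (c * t)" if "t \<ge> 0" for t
        by (rule conv_exp_bound[OF a h(1,2) that])
      fix s assume s: "Re s > c"
      then have "has_laplace (\<lambda>t. exp (a * of_real t)) s (1 / (s - a))"
        using a by (intro has_laplace_exp) simp
      from has_laplace_conv[OF ce h(1) this h(3)[OF s]]
      show "has_laplace (conv (\<lambda>t. exp (a * of_real t)) h) s (k / ((s - a) * (\<Prod>a\<leftarrow>as. s - a)))"
        by simp
    qed
  qed
  show ?case
  proof (intro exI[of _ "\<lambda>t. h1 t + h2 t"] exI[of _ "M1 + M2"] conjI allI impI)
    show "continuous_on {0..} (\<lambda>t. h1 t + h2 t)" by (intro continuous_intros h1 h2)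
    show "cmod (h1 t + h2 t) \<le> (M1 + M2) * exp (c * t)" if "t \<ge> 0" for t
      using norm_triangle_ineq[of "h1 t" "h2 t"] h1(2)[OF that] h2(2)[OF that] by (simp add: distrib_right)
    fix s assume s: "Re s > c"
    then have "s - a \<noteq> 0" using a by auto
    moreover have "(\<Prod>a\<leftarrow>as. s - a) \<noteq> 0"
      using s Cons.prems(1) by (force simp: prod_list_zero_iff)
    ultimately have "poly p1 s / (\<Prod>a\<leftarrow>as. s - a) + k / ((s - a) * (\<Prod>a\<leftarrow>as. s - a))
        = poly p s / (\<Prod>a\<leftarrow>a # as. s - a)"
      by (simp add: p field_simps)
    then show "has_laplace (\<lambda>t. h1 t + h2 t) s (poly p s / (\<Prod>a\<leftarrow>a # as. s - a))"
      using has_laplace_add[OF h1(3)[OF s] h2(3)[OF s]] by simp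
  qed
qed

section \<open>Impulse responses\<close>

text \<open>Lerch's theorem: by Weierstrass' theorem in the variable \<open>x = e\<^sup>-\<^sup>t\<close>, vanishing of the
  transform at \<open>c', c' + 1, \<dots>\<close> makes the function orthogonal to every bump function.\<close>

lemma laplace_eq_zero_imp_nonpos:
  fixes \<phi> :: "real \<Rightarrow> real"
  assumes \<phi>: "continuous_on {0..} \<phi>"
    and A: "\<And>s. s > c \<Longrightarrow> (\<lambda>t. exp (- (s * t)) * \<phi> t) absolutely_integrable_on {0..}"
    and Z: "\<And>s. s > c \<Longrightarrow> integral {0..} (\<lambda>t. exp (- (s * t)) * \<phi> t) = 0"
    and t0: "t0 > 0"
  shows "\<phi> t0 \<le> 0"
proof (rule ccontr)
  assume pos: "\<not> \<phi> t0 \<le> 0"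
  have "isCont \<phi> t0" using t0 by (intro continuous_on_interior[OF \<phi>]) simp
  then have "\<forall>\<^sub>F t in at t0. \<phi> t > 0"
    using pos by (intro order_tendstoD(1)) (auto simp: isCont_def)
  then obtain r where r: "r > 0" "\<And>t. t \<noteq> t0 \<Longrightarrow> dist t t0 < r \<Longrightarrow> \<phi> t > 0"
    by (auto simp: eventually_at)
  define d where "d = min (r / 2) (t0 / 2)"
  have d: "d > 0" "d < r" "d < t0" using r t0 by (auto simp: d_def)
  have \<phi>pos: "\<phi> t > 0" if "t \<in> {t0 - d..t0 + d}" for t
    using r(2)[of t] that d pos by (cases "t = t0") (auto simp: dist_real_def)
  \<comment> \<open>Shifting by c + 1 makes every moment of \<open>\<psi>\<close> against x^n with x
    = e^(-t) a transform value at c + 1 + n, which lies beyond c for n = 0 too.\<close>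
  define \<psi> where "\<psi> t = exp (- ((c + 1) * t)) * \<phi> t" for t
  \<comment> \<open>In the variable x = e^(-t) this is a quadratic bump, positive exactly for |t -
    t0| < d, where \<open>\<phi>\<close> is positive.\<close>
  define k where "k x = max 0 ((exp (- (t0 - d)) - x) * (x - exp (- (t0 + d))))" for x :: real
  have kc: "continuous_on {0..1} k" unfolding k_def by (intro continuous_intros)
  have \<psi>a: "\<psi> absolutely_integrable_on {0..}" unfolding \<psi>_def by (rule A) simp
  then have \<psi>n: "(\<lambda>t. norm (\<psi> t)) integrable_on {0..}"
    by (simp only: absolutely_integrable_on_def)
  have mono: "(\<lambda>t. exp (- t) ^ n * \<psi> t) integrable_on {0..}"
    "integral {0..} (\<lambda>t. exp (- t) ^ n * \<psi> t) = 0" for n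
  proof -
    have e: "exp (- t) ^ n * \<psi> t = exp (- ((c + 1 + real n) * t)) * \<phi> t" for t
      by (simp add: \<psi>_def algebra_simps flip: exp_of_nat_mult exp_add)
    show "(\<lambda>t. exp (- t) ^ n * \<psi> t) integrable_on {0..}"
      unfolding e by (rule set_lebesgue_integral_eq_integral(1)[OF A]) simp
    show "integral {0..} (\<lambda>t. exp (- t) ^ n * \<psi> t) = 0"
      unfolding e by (rule Z) simp
  qed
  have kc': "continuous_on {0..} (\<lambda>t. k (exp (- t)))"
    by (intro continuous_on_compose2[OF kc] continuous_intros) auto
  have k\<psi>c: "continuous_on {0..} (\<lambda>t. k (exp (- t)) * \<psi> t)"
    unfolding \<psi>_def by (intro continuous_intros kc' \<phi>)
  have "bounded (k ` {0..1})" using kc by (intro compact_imp_bounded compact_continuous_image) auto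
  then have kb: "bounded ((\<lambda>t. k (exp (- t))) ` {0..})"
    by (rule bounded_subset) (auto intro!: imageI)
  have k\<psi>a: "(\<lambda>t. k (exp (- t)) * \<psi> t) absolutely_integrable_on {0..}"
    by (rule absolutely_integrable_bounded_measurable_product_real[OF _ _ kb \<psi>a])
      (auto intro: continuous_imp_measurable_on_sets_lebesgue[OF kc'])
  then have k\<psi>i: "(\<lambda>t. k (exp (- t)) * \<psi> t) integrable_on {0..}"
    by (rule set_lebesgue_integral_eq_integral(1))
  have *: "\<bar>integral {0..} (\<lambda>t. k (exp (- t)) * \<psi> t)\<bar> \<le> e * integral {0..} (\<lambda>t. norm (\<psi> t))" if e: "e > 0" for e
  proof -
    obtain g where g: "real_polynomial_function g" "\<And>x. x \<in> {0..1} \<Longrightarrow> \<bar>k x - g x\<bar> < e"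
      using Stone_Weierstrass_real_polynomial_function[OF compact_Icc kc e] by blast
    obtain a n where an: "g = (\<lambda>x. \<Sum>i\<le>n. a i * x ^ i)"
      using g(1) unfolding real_polynomial_function_iff_sum by auto
    have gs: "g (exp (- t)) * \<psi> t = (\<Sum>i\<le>n. a i * (exp (- t) ^ i * \<psi> t))" for t
      by (simp add: an sum_distrib_right mult.assoc)
    have gi: "(\<lambda>t. g (exp (- t)) * \<psi> t) integrable_on {0..}"
      unfolding gs by (intro integrable_sum integrable_on_mult_right mono) auto
    have g0: "integral {0..} (\<lambda>t. g (exp (- t)) * \<psi> t) = 0"
      unfolding gs by (subst Henstock_Kurzweil_Integration.integral_sum)
        (auto intro!: integrable_on_mult_right mono simp: mono(2))
    have "integral {0..} (\<lambda>t. k (exp (- t)) * \<psi> t) =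
        integral {0..} (\<lambda>t. k (exp (- t)) * \<psi> t - g (exp (- t)) * \<psi> t)"
      by (subst Henstock_Kurzweil_Integration.integral_diff[OF k\<psi>i gi]) (simp add: g0)
    also have "\<bar>\<dots>\<bar> \<le> integral {0..} (\<lambda>t. e * norm (\<psi> t))"
      unfolding real_norm_def[symmetric]
    proof (rule integral_norm_bound_integral)
      fix t :: real assume "t \<in> {0..}"
      then have "\<bar>k (exp (- t)) - g (exp (- t))\<bar> \<le> e" by (intro less_imp_le g(2)) auto
      then show "norm (k (exp (- t)) * \<psi> t - g (exp (- t)) * \<psi> t) \<le> e * norm (\<psi> t)"
        by (simp add: left_diff_distrib[symmetric] abs_mult mult_right_mono)
    qed (auto intro!: Henstock_Kurzweil_Integration.integrable_diff k\<psi>i gi integrable_on_mult_right \<psi>n[unfolded real_norm_def])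
    finally show ?thesis by simp
  qed
  have "\<bar>integral {0..} (\<lambda>t. k (exp (- t)) * \<psi> t)\<bar> \<le> 0"
  proof (rule field_le_epsilon)
    let ?N = "integral {0..} (\<lambda>t. norm (\<psi> t))"
    have N: "?N \<ge> 0" by (intro Henstock_Kurzweil_Integration.integral_nonneg \<psi>n) auto
    fix e :: real assume e: "e > 0"
    have "e / (?N + 1) * ?N \<le> e" using N e by (simp add: field_simps)
    moreover have "e / (?N + 1) > 0" using N e by simp
    ultimately show "\<bar>integral {0..} (\<lambda>t. k (exp (- t)) * \<psi> t)\<bar> \<le> 0 + e"
      using *[of "e / (?N + 1)"] by linarith
  qed
  then have I0: "integral {0..} (\<lambda>t. k (exp (- t)) * \<psi> t) = 0" by simp
  have k0: "k (exp (- t)) = 0" if "t \<notin> {t0 - d..t0 + d}" for t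
  proof -
    have "exp (- t) \<ge> exp (- (t0 - d)) \<and> exp (- t) \<ge> exp (- (t0 + d)) \<or>
      exp (- t) \<le> exp (- (t0 - d)) \<and> exp (- t) \<le> exp (- (t0 + d))"
      using that d by auto
    then have "(exp (- (t0 - d)) - exp (- t)) * (exp (- t) - exp (- (t0 + d))) \<le> 0"
      by (metis diff_ge_0_iff_ge diff_le_0_iff_le mult_nonneg_nonpos mult_nonpos_nonneg)
    then show ?thesis by (simp add: k_def)
  qed
  have nn: "k (exp (- t)) * \<psi> t \<ge> 0" for t
    using \<phi>pos[of t] k0[of t] by (cases "t \<in> {t0 - d..t0 + d}") (auto simp: k_def \<psi>_def)
  have kpos: "k (exp (- t0)) * \<psi> t0 > 0"
    using \<phi>pos[of t0] d by (auto simp: k_def \<psi>_def less_max_iff_disj intro!: mult_pos_pos)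
  have sub: "integral {t0 - d..t0 + d} (\<lambda>t. k (exp (- t)) * \<psi> t) \<le> integral {0..} (\<lambda>t. k (exp (- t)) * \<psi> t)"
    using d nn by (intro integral_subset_le k\<psi>i integrable_on_subinterval[OF k\<psi>i]) auto
  moreover have i: "(\<lambda>t. k (exp (- t)) * \<psi> t) integrable_on {t0 - d..t0 + d}"
    using d by (intro integrable_on_subinterval[OF k\<psi>i]) auto
  moreover have "integral {t0 - d..t0 + d} (\<lambda>t. k (exp (- t)) * \<psi> t) \<ge> 0"
    using nn by (intro Henstock_Kurzweil_Integration.integral_nonneg i) auto
  ultimately have "((\<lambda>t. k (exp (- t)) * \<psi> t) has_integral 0) (cbox (t0 - d) (t0 + d))"
    using I0 by (auto simp: cbox_interval has_integral_iff)
  then have "k (exp (- t0)) * \<psi> t0 = 0"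
    using d nn by (intro has_integral_0_cbox_imp_0[of "t0 - d" "t0 + d" "\<lambda>t. k (exp (- t)) * \<psi> t" t0])
      (auto intro!: continuous_on_subset[OF k\<psi>c])
  with kpos show False by simp
qed

section \<open>Uniqueness, existence and algebra of impulse responses\<close>

lemma has_laplace_cnj:
  assumes "has_laplace h (cnj s) L"
  shows "has_laplace (\<lambda>t. cnj (h t)) s (cnj L)"
proof -
  let ?f = "\<lambda>t. exp (- (cnj s * of_real t)) * h t"
  have a: "?f absolutely_integrable_on {0..}" and L: "integral {0..} ?f = L"
    using assms by (simp_all add: has_laplace_def)
  have e: "cnj (?f t) = exp (- (s * of_real t)) * cnj (h t)" for t
    by (simp add: exp_cnj)
  show ?thesis
    using absolutely_integrable_linear[OF a bounded_linear_cnj]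
      integral_linear[OF set_lebesgue_integral_eq_integral(1)[OF a] bounded_linear_cnj] L
    by (simp only: comp_def e has_laplace_def simp_thms)
qed

lemma cnj_cpoly: "cnj (poly (cpoly p) (cnj s)) = poly (cpoly p) s"
  by (induction p) (auto simp: map_poly_pCons)

definition is_impulse :: "ratfun \<Rightarrow> (real \<Rightarrow> real) \<Rightarrow> bool" where
  "is_impulse g h \<longleftrightarrow> continuous_on {0..} h \<and> (\<forall>t<0. h t = 0) \<and>
     (\<exists>c. \<forall>s. Re s > c \<longrightarrow> has_laplace (\<lambda>t. of_real (h t)) s (rf_eval g s - of_real (feedthrough g)))"

lemma is_impulseI:
  assumes "continuous_on {0..} h" "\<And>t. t < 0 \<Longrightarrow> h t = 0"
    "\<And>s. Re s > c \<Longrightarrow> has_laplace (\<lambda>t. of_real (h t)) s (rf_eval g s - of_real (feedthrough g))"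
  shows "is_impulse g h"
  using assms unfolding is_impulse_def by blast

lemma is_impulse_diff_nonpos:
  assumes "is_impulse g h" "is_impulse g h'" "t > 0"
  shows "h t - h' t \<le> 0"
proof -
  obtain c c' where c: "\<And>s. Re s > c \<Longrightarrow> has_laplace (\<lambda>t. of_real (h t)) s (rf_eval g s - of_real (feedthrough g))"
    and c': "\<And>s. Re s > c' \<Longrightarrow> has_laplace (\<lambda>t. of_real (h' t)) s (rf_eval g s - of_real (feedthrough g))"
    using assms by (auto simp: is_impulse_def)
  have L: "has_laplace (\<lambda>t. of_real (h t - h' t)) s 0" if "Re s > max c c'" for s
  proof -
    have "has_laplace (\<lambda>t. - 1 * of_real (h' t)) s (- 1 * (rf_eval g s - of_real (feedthrough g)))"
      using that by (intro has_laplace_mult c') simp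
    from has_laplace_add[OF c this] show ?thesis using that by simp
  qed
  have e: "Re (exp (- (of_real s * of_real t)) * of_real (h t - h' t)) = exp (- (s * t)) * (h t - h' t)" for s t
    by (simp add: Re_exp)
  show ?thesis
  proof (rule laplace_eq_zero_imp_nonpos[OF _ _ _ assms(3), of _ "max c c'"])
    show "continuous_on {0..} (\<lambda>t. h t - h' t)"
      using assms by (intro continuous_intros) (simp_all add: is_impulse_def)
    fix s :: real assume "s > max c c'"
    then have s: "Re (of_real s) > max c c'" by simp
    let ?f = "\<lambda>t. exp (- (of_real s * of_real t)) * complex_of_real (h t - h' t)"
    have a: "?f absolutely_integrable_on {0..}" and i: "integral {0..} ?f = 0"
      using L[OF s] by (simp_all only: has_laplace_def)
    show "(\<lambda>t. exp (- (s * t)) * (h t - h' t)) absolutely_integrable_on {0..}"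
      using absolutely_integrable_linear[OF a bounded_linear_Re] by (simp only: comp_def e)
    show "integral {0..} (\<lambda>t. exp (- (s * t)) * (h t - h' t)) = 0"
      using integral_linear[OF set_lebesgue_integral_eq_integral(1)[OF a] bounded_linear_Re]
      by (simp only: comp_def e i zero_complex.simps)
  qed
qed

text \<open>Lerch's theorem, applied to both differences, settles t > 0. The value at 0 follows by
  continuity from the right, and negative times are fixed by convention.\<close>

lemma impulse_response_eqI:
  assumes "is_impulse g h"
  shows "impulse_response g = h"
proof -
  have u: "h' = h" if "is_impulse g h'" for h'
  proof -
    have e: "h' t = h t" if "t > 0" for t
      using is_impulse_diff_nonpos[OF assms \<open>is_impulse g h'\<close> that]
        is_impulse_diff_nonpos[OF \<open>is_impulse g h'\<close> assms that] by simp
    have l: "(f \<longlongrightarrow> f 0) (at_right 0)" if "is_impulse g f" for f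
    proof -
      have "(f \<longlongrightarrow> f 0) (at 0 within {0..})"
        using that by (auto simp: is_impulse_def continuous_on_def)
      then show ?thesis by (rule tendsto_within_subset) auto
    qed
    have "(h' \<longlongrightarrow> h 0) (at_right 0)"
      by (rule Lim_transform_eventually[OF l[OF assms]])
        (auto simp: eventually_at_right_less e intro: eventually_mono[OF eventually_at_right_less])
    then have "h' 0 = h 0"
      using l[OF \<open>is_impulse g h'\<close>] by (intro tendsto_unique[of "at_right (0::real)"]) auto
    moreover have "h' t = h t" if "t < 0" for t
      using assms \<open>is_impulse g h'\<close> that by (simp add: is_impulse_def)
    ultimately show ?thesis using e by (intro ext) (metis linorder_cases)
  qed
  have "impulse_response g = (THE h. is_impulse g h)"
    by (simp add: impulse_response_def is_impulse_def has_laplace_def)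
  also have "\<dots> = h" by (rule the_equality[of "is_impulse g", OF assms]) (rule u)
  finally show ?thesis .
qed

text \<open>Subtracting the feedthrough leaves a strictly proper function, whose denominator splits
  over the complex numbers. The growth rate may be any c to the right of the poles; for a stable
  \<open>g\<close> it can be negative, which is where the exponential decay of stable impulse
  responses comes from.\<close>

lemma impulse_exists:
  assumes g: "rf_proper g" and c: "\<And>s. rf_pole g s \<Longrightarrow> Re s < c"
  shows "\<exists>h M. continuous_on {0..} h \<and> (\<forall>t<0. h t = 0) \<and> (\<forall>t\<ge>0. \<bar>h t\<bar> \<le> M * exp (c * t)) \<and>
    (\<forall>s. Re s > c \<longrightarrow> has_laplace (\<lambda>t. of_real (h t)) s (rf_eval g s - of_real (feedthrough g)))"
proof -
  define q where "q = rf_den g"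
  define p where "p = rf_num g - smult (feedthrough g) q"
  have q0: "q \<noteq> 0" by (simp add: q_def rf_den_nonzero)
  have dp: "p = 0 \<or> degree p < degree q"
  proof -
    have "degree p \<le> degree q"
      unfolding p_def using g by (intro degree_diff_le) (auto simp: rf_proper_def q_def)
    moreover have "coeff p (degree q) = 0"
      using q0 by (simp add: p_def q_def feedthrough_def)
    ultimately show ?thesis
      by (metis leading_coeff_0_iff order_le_less)
  qed
  have cq0: "cpoly q \<noteq> 0" using q0 by (simp add: cpoly_0)
  obtain A where A: "size A = degree (cpoly q)"
    "cpoly q = smult (lead_coeff (cpoly q)) (\<Prod>x\<in>#A. [:- x, 1:])"
    using alg_closed_imp_factorization[OF cq0] by blast
  obtain as where as: "mset as = A" using ex_mset by blast
  define l where "l = lead_coeff (cpoly q)"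
  have l0: "l \<noteq> 0" using cq0 by (simp add: l_def)
  have dq: "degree (cpoly q) = degree q" by (simp add: degree_map_poly)
  have ev: "poly (cpoly q) s = l * (\<Prod>a\<leftarrow>as. s - a)" for s
  proof -
    have "poly (\<Prod>x\<in>#mset as. [:- x, 1:]) s = (\<Prod>a\<leftarrow>as. s - a)"
      by (induction as) (auto simp: algebra_simps)
    then show ?thesis by (subst A(2)) (simp add: l_def as)
  qed
  have 1: "Re a < c" if "a \<in> set as" for a
  proof (rule c)
    show "rf_pole g a" using that ev[of a] by (force simp: rf_pole_def q_def prod_list_zero_iff)
  qed
  have 2: "smult (inverse l) (cpoly p) = 0 \<or> degree (smult (inverse l) (cpoly p)) < length as"
    using dp A(1) as dq l0 by (auto simp: cpoly_0 degree_map_poly)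
  obtain H M where H: "continuous_on {0..} H" "\<And>t. t \<ge> 0 \<Longrightarrow> cmod (H t) \<le> M * exp (c * t)"
    "\<And>s. Re s > c \<Longrightarrow> has_laplace H s (poly (smult (inverse l) (cpoly p)) s / (\<Prod>a\<leftarrow>as. s - a))"
    using inverse_laplace_exists[OF 1 2] by blast
  have val: "poly (smult (inverse l) (cpoly p)) s / (\<Prod>a\<leftarrow>as. s - a) = rf_eval g s - of_real (feedthrough g)"
    if "Re s > c" for s
  proof -
    have nz: "poly (cpoly q) s \<noteq> 0" using c[of s] that by (auto simp: rf_pole_def q_def)
    have "rf_num g = p + [:feedthrough g:] * q" by (simp add: p_def)
    then have "poly (cpoly (rf_num g)) s = poly (cpoly p) s + of_real (feedthrough g) * poly (cpoly q) s"
      by (simp only: cpoly_add cpoly_mult poly_add poly_mult) (simp add: map_poly_pCons)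
    then have "rf_eval g s - of_real (feedthrough g) = poly (cpoly p) s / poly (cpoly q) s"
      using nz by (simp add: rf_eval_def q_def[symmetric] add_divide_distrib)
    then show ?thesis unfolding ev by (simp add: divide_inverse mult_ac)
  qed
  \<comment> \<open>Since \<open>g\<close> has real coefficients, \<open>H\<close> and its conjugate
    have the same transform. Their mean, the real part of \<open>H\<close>, is therefore a real
    inverse transform.\<close>
  have sym: "cnj (rf_eval g (cnj s) - of_real (feedthrough g)) = rf_eval g s - of_real (feedthrough g)" for s
    by (simp add: rf_eval_def cnj_cpoly)
  define h where "h t = (if t < 0 then 0 else Re (H t))" for t
  have hH: "1 / 2 * (H t + cnj (H t)) = of_real (h t)" if "t \<ge> 0" for t
    using that by (simp add: h_def complex_eq_iff)
  show ?thesis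
  proof (intro exI[of _ h] exI[of _ M] conjI allI impI)
    have "continuous_on {0..} (\<lambda>t. Re (H t))" by (intro continuous_intros H)
    then show "continuous_on {0..} h"
      by (rule continuous_on_cong[THEN iffD1, rotated -1]) (auto simp: h_def)
    show "\<bar>h t\<bar> \<le> M * exp (c * t)" if "t \<ge> 0" for t
      using H(2)[OF that] abs_Re_le_cmod[of "H t"] that by (simp add: h_def)
    fix s assume s: "Re s > c"
    then have s': "Re (cnj s) > c" by simp
    show "has_laplace (\<lambda>t. of_real (h t)) s (rf_eval g s - of_real (feedthrough g))"
    proof -
      let ?v = "rf_eval g s - of_real (feedthrough g)"
      have "has_laplace (\<lambda>t. 1 / 2 * (H t + cnj (H t))) s (1 / 2 * (?v + ?v))"
        using has_laplace_mult[OF has_laplace_add[OF H(3)[OF s] has_laplace_cnj[OF H(3)[OF s']]], of "1 / 2"]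
        unfolding val[OF s] val[OF s'] sym .
      then have "has_laplace (\<lambda>t. of_real (h t)) s (1 / 2 * (?v + ?v))"
        by (rule has_laplace_cong[THEN iffD1, rotated]) (rule hH)
      then show ?thesis by simp
    qed
  qed (simp add: h_def)
qed

lemma impulse_response_properties:
  assumes g: "rf_proper g" and c: "\<And>s. rf_pole g s \<Longrightarrow> Re s < c"
  shows "continuous_on {0..} (impulse_response g)" "t < 0 \<Longrightarrow> impulse_response g t = 0"
    "\<exists>M. \<forall>t\<ge>0. \<bar>impulse_response g t\<bar> \<le> M * exp (c * t)"
    "Re s > c \<Longrightarrow> has_laplace (\<lambda>t. of_real (impulse_response g t)) s (rf_eval g s - of_real (feedthrough g))"
proof -
  obtain h M where h: "continuous_on {0..} h" "\<forall>t<0. h t = 0" "\<forall>t\<ge>0. \<bar>h t\<bar> \<le> M * exp (c * t)"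
    "\<forall>s. Re s > c \<longrightarrow> has_laplace (\<lambda>t. of_real (h t)) s (rf_eval g s - of_real (feedthrough g))"
    using impulse_exists[OF assms] by blast
  then have "impulse_response g = h" by (intro impulse_response_eqI) (auto simp: is_impulse_def)
  then show "continuous_on {0..} (impulse_response g)" "t < 0 \<Longrightarrow> impulse_response g t = 0"
    "\<exists>M. \<forall>t\<ge>0. \<bar>impulse_response g t\<bar> \<le> M * exp (c * t)"
    "Re s > c \<Longrightarrow> has_laplace (\<lambda>t. of_real (impulse_response g t)) s (rf_eval g s - of_real (feedthrough g))"
    using h by auto
qed

text \<open>There are finitely many poles, so their real parts have a maximum m. Halving a negative
  m keeps c strictly between the poles and the imaginary axis.\<close>

lemma rf_pole_bound:
  obtains c where "\<And>s. rf_pole g s \<Longrightarrow> Re s < c" "\<And>s. rf_pole g s \<Longrightarrow> (\<And>s. rf_pole g s \<Longrightarrow> Re s < 0) \<Longrightarrow> c < 0"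
proof -
  have fin: "finite {s. rf_pole g s}"
    unfolding rf_pole_def by (rule poly_roots_finite) (simp add: cpoly_0 rf_den_nonzero)
  show ?thesis
  proof (cases "\<exists>s. rf_pole g s")
    case True
    define m where "m = Max (Re ` {s. rf_pole g s})"
    have le: "Re s \<le> m" if "rf_pole g s" for s
      unfolding m_def using fin that by (intro Max_ge) auto
    have "m \<in> Re ` {s. rf_pole g s}"
      unfolding m_def using fin True by (intro Max_in) auto
    then have neg: "m < 0" if "\<And>s. rf_pole g s \<Longrightarrow> Re s < 0" using that by auto
    show ?thesis
    proof (rule that[of "if m < 0 then m / 2 else m + 1"])
      show "Re s < (if m < 0 then m / 2 else m + 1)" if "rf_pole g s" for s
        using le[OF that] by auto
    qed (use neg in auto)
  qed (use that in blast)
qed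

lemma is_impulse_impulse_response: "rf_proper g \<Longrightarrow> is_impulse g (impulse_response g)"
  using rf_pole_bound[of g] impulse_response_properties[of g] unfolding is_impulse_def by metis

lemma impulse_response_continuous: "rf_proper g \<Longrightarrow> continuous_on {0..} (impulse_response g)"
  and impulse_response_neg: "rf_proper g \<Longrightarrow> t < 0 \<Longrightarrow> impulse_response g t = 0"
  using is_impulse_impulse_response by (auto simp: is_impulse_def)

lemma impulse_response_stable:
  assumes g: "rf_proper g" and c: "\<And>s. rf_pole g s \<Longrightarrow> Re s < 0"
  obtains M c where "c < 0" "\<And>t. t \<ge> 0 \<Longrightarrow> \<bar>impulse_response g t\<bar> \<le> M * exp (c * t)"
proof -
  obtain d where d: "\<And>s. rf_pole g s \<Longrightarrow> Re s < d" "\<And>s. rf_pole g s \<Longrightarrow> (\<And>s. rf_pole g s \<Longrightarrow> Re s < 0) \<Longrightarrow> d < 0"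
    using rf_pole_bound[of g] by metis
  \<comment> \<open>Without poles the bound d carries no information about its sign, hence the
    default rate -1.\<close>
  have "\<And>s. rf_pole g s \<Longrightarrow> Re s < (if \<exists>s. rf_pole g s then d else -1)"
    using d by auto
  from impulse_response_properties(3)[OF g this] obtain M where
    "\<forall>t\<ge>0. \<bar>impulse_response g t\<bar> \<le> M * exp ((if \<exists>s. rf_pole g s then d else -1) * t)" by blast
  moreover have "(if \<exists>s. rf_pole g s then d else -1) < 0" using d(2) c by auto
  ultimately show ?thesis using that by blast
qed

lemma is_impulse_poles:
  assumes "rf_proper g"
  obtains c where "\<And>s. Re s > c \<Longrightarrow> \<not> rf_pole g s"
    "\<And>s. Re s > c \<Longrightarrow> has_laplace (\<lambda>t. of_real (impulse_response g t)) s (rf_eval g s - of_real (feedthrough g))"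
proof -
  obtain d where d: "\<And>s. rf_pole g s \<Longrightarrow> Re s < d" using rf_pole_bound[of g] by metis
  show ?thesis
    using that[of d] d impulse_response_properties(4)[OF assms d] by force
qed

lemma impulse_response_const: "impulse_response (rf_const a) = (\<lambda>t. 0)"
proof (rule impulse_response_eqI)
  show "is_impulse (rf_const a) (\<lambda>t. 0)"
    by (auto simp: is_impulse_def has_laplace_def rf_const_eval feedthrough_const)
qed

lemma impulse_response_add:
  assumes "rf_proper f" "rf_proper g"
  shows "impulse_response (f + g) = (\<lambda>t. impulse_response f t + impulse_response g t)"
proof (rule impulse_response_eqI)
  obtain c where c: "\<And>s. Re s > c \<Longrightarrow> \<not> rf_pole f s"
    "\<And>s. Re s > c \<Longrightarrow> has_laplace (\<lambda>t. of_real (impulse_response f t)) s (rf_eval f s - of_real (feedthrough f))"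
    using is_impulse_poles[OF assms(1)] by metis
  obtain d where d: "\<And>s. Re s > d \<Longrightarrow> \<not> rf_pole g s"
    "\<And>s. Re s > d \<Longrightarrow> has_laplace (\<lambda>t. of_real (impulse_response g t)) s (rf_eval g s - of_real (feedthrough g))"
    using is_impulse_poles[OF assms(2)] by metis
  have "has_laplace (\<lambda>t. of_real (impulse_response f t + impulse_response g t)) s
      (rf_eval (f + g) s - of_real (feedthrough (f + g)))" if "Re s > max c d" for s
    using has_laplace_add[OF c(2) d(2), of s] that c(1) d(1) assms
    by (simp add: fin.ev_add inf.ev_add algebra_simps)
  then show "is_impulse (f + g) (\<lambda>t. impulse_response f t + impulse_response g t)"
    using assms
    by (intro is_impulseI[where c = "max c d"]) (auto intro!: continuous_intros impulse_response_continuous simp: impulse_response_neg)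
qed

text \<open>With feedthroughs k and l, the transforms multiply as (k + F)(l + G). The product k l is
  the weight of the Dirac part, and k G + l F + F G is the transform of the stated function;
  uniqueness of impulse responses does the rest.\<close>

lemma impulse_response_mult:
  assumes "rf_proper f" "rf_proper g"
  shows "impulse_response (f * g) = (\<lambda>t. if t < 0 then 0 else feedthrough f * impulse_response g t +
     (feedthrough g * impulse_response f t + conv (impulse_response f) (impulse_response g) t))"
proof (rule impulse_response_eqI)
  let ?f = "impulse_response f" and ?g = "impulse_response g"
  let ?h = "\<lambda>t. if t < 0 then 0 else feedthrough f * ?g t + (feedthrough g * ?f t + conv ?f ?g t)"
  obtain c where c: "\<And>s. Re s > c \<Longrightarrow> \<not> rf_pole f s"
    "\<And>s. Re s > c \<Longrightarrow> has_laplace (\<lambda>t. of_real (?f t)) s (rf_eval f s - of_real (feedthrough f))"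
    using is_impulse_poles[OF assms(1)] by metis
  obtain d where d: "\<And>s. Re s > d \<Longrightarrow> \<not> rf_pole g s"
    "\<And>s. Re s > d \<Longrightarrow> has_laplace (\<lambda>t. of_real (?g t)) s (rf_eval g s - of_real (feedthrough g))"
    using is_impulse_poles[OF assms(2)] by metis
  have fc: "continuous_on {0..} ?f" and gc: "continuous_on {0..} ?g"
    using assms by (simp_all add: impulse_response_continuous)
  have cc: "continuous_on {0..} (conv ?f ?g)"
    by (rule conv_continuous[OF fc continuous_borel_version(1)[OF gc]])
  have cplx: "conv (\<lambda>t. complex_of_real (?f t)) (\<lambda>t. complex_of_real (?g t)) t = of_real (conv ?f ?g t)" for t
  proof -
    have "continuous_on {0..t} (\<lambda>\<tau>. ?f (t - \<tau>) * ?g \<tau>)"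
      by (intro continuous_intros continuous_on_compose2[OF fc] continuous_on_subset[OF gc]) auto
    then have "(\<lambda>\<tau>. ?f (t - \<tau>) * ?g \<tau>) integrable_on {0..t}"
      by (rule integrable_continuous_interval)
    from integral_linear[OF this bounded_linear_of_real[where 'a = complex]] show ?thesis
      by (simp add: conv_def comp_def)
  qed
  have "has_laplace (\<lambda>t. of_real (?h t)) s (rf_eval (f * g) s - of_real (feedthrough (f * g)))" if s: "Re s > max c d" for s
  proof -
    let ?F = "rf_eval f s" and ?G = "rf_eval g s" and ?k = "complex_of_real (feedthrough f)" and ?l = "complex_of_real (feedthrough g)"
    have "has_laplace (conv (\<lambda>t. complex_of_real (?f t)) (\<lambda>t. complex_of_real (?g t))) s ((?F - ?k) * (?G - ?l))"
      using s by (intro has_laplace_conv continuous_intros fc gc c d) auto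
    then have 1: "has_laplace (\<lambda>t. of_real (conv ?f ?g t)) s ((?F - ?k) * (?G - ?l))"
      unfolding cplx[abs_def] .
    have "has_laplace (\<lambda>t. ?k * of_real (?g t) + (?l * of_real (?f t) + of_real (conv ?f ?g t))) s
        (?k * (?G - ?l) + (?l * (?F - ?k) + (?F - ?k) * (?G - ?l)))"
      using s by (intro has_laplace_add has_laplace_mult c d 1) auto
    moreover have "?k * (?G - ?l) + (?l * (?F - ?k) + (?F - ?k) * (?G - ?l)) = rf_eval (f * g) s - of_real (feedthrough (f * g))"
      using s assms by (simp add: fin.ev_mult[OF c(1) d(1)] inf.ev_mult algebra_simps)
    ultimately have "has_laplace (\<lambda>t. ?k * of_real (?g t) + (?l * of_real (?f t) + of_real (conv ?f ?g t))) s
        (rf_eval (f * g) s - of_real (feedthrough (f * g)))" by simp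
    then show ?thesis by (rule has_laplace_cong[THEN iffD1, rotated]) simp
  qed
  moreover have "continuous_on {0..} ?h"
  proof (rule continuous_on_cong[THEN iffD1, OF refl])
    show "continuous_on {0..} (\<lambda>t. feedthrough f * ?g t + (feedthrough g * ?f t + conv ?f ?g t))"
      by (intro continuous_intros fc gc cc)
  qed simp
  ultimately show "is_impulse (f * g) ?h"
    by (intro is_impulseI[where c = "max c d"]) auto
qed

lemma impulse_response_integrator: "impulse_response (inverse rf_s) = (\<lambda>t. if t < 0 then 0 else 1)"
proof (rule impulse_response_eqI)
  have "has_laplace (\<lambda>t. of_real (if t < 0 then 0 else 1)) s (rf_eval (inverse rf_s) s - of_real (feedthrough (inverse rf_s)))"
    if "Re s > 0" for s
  proof -
    have "s \<noteq> 0" using that by auto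
    then have "rf_eval (inverse rf_s) s = 1 / s"
      by (simp add: fin.ev_inverse rf_s_eval divide_inverse)
    moreover have "has_laplace (\<lambda>t. exp (0 * of_real t)) s (1 / (s - 0))"
      by (rule has_laplace_exp) (use that in simp)
    ultimately show ?thesis
      unfolding rf_inverse_s by (subst has_laplace_cong[where g = "\<lambda>t. exp (0 * of_real t)"]) auto
  qed
  moreover have "continuous_on {0..} (\<lambda>t::real. if t < 0 then 0 else 1 :: real)"
    by (rule continuous_on_cong[THEN iffD1, OF refl _ continuous_on_const[of _ 1]]) simp
  ultimately show "is_impulse (inverse rf_s) (\<lambda>t. if t < 0 then 0 else 1)"
    by (auto simp: is_impulse_def)
qed

section \<open>Operational calculus for transfer matrices\<close>

definition loc_int :: "(real \<Rightarrow> 'a::euclidean_space) \<Rightarrow> bool" where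
  "loc_int v \<longleftrightarrow> (\<forall>T\<ge>0. v absolutely_integrable_on {0..T})"

lemma loc_intD: "loc_int v \<Longrightarrow> v absolutely_integrable_on {0..T}"
  by (cases "T \<ge> 0") (auto simp: loc_int_def set_integrable_def)

lemma loc_int_continuous: "continuous_on {0..} v \<Longrightarrow> loc_int v"
  by (simp add: loc_int_def continuous_borel_version)

lemma loc_int_add: "loc_int v \<Longrightarrow> loc_int w \<Longrightarrow> loc_int (\<lambda>t. v t + w t)"
  by (simp add: loc_int_def)

lemma loc_int_linear: "loc_int v \<Longrightarrow> bounded_linear f \<Longrightarrow> loc_int (\<lambda>t. f (v t))"
  using absolutely_integrable_linear[where f = v and h = f] by (simp add: loc_int_def comp_def)

lemma loc_int_cong: "(\<And>t. t \<ge> 0 \<Longrightarrow> v t = w t) \<Longrightarrow> loc_int v \<longleftrightarrow> loc_int w"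
  unfolding loc_int_def by (intro all_cong1 imp_cong set_integrable_cong refl) auto

lemma loc_int_diff: "loc_int v \<Longrightarrow> loc_int w \<Longrightarrow> loc_int (\<lambda>t. v t - w t)"
  by (simp add: loc_int_def)

lemma loc_int_scaleR: "loc_int v \<Longrightarrow> loc_int (\<lambda>t. c *\<^sub>R v t)"
  by (rule loc_int_linear[OF _ bounded_linear_scaleR_right])

lemma loc_int_mat: "loc_int v \<Longrightarrow> loc_int (\<lambda>t. (A :: real^'n^'m) *v v t)"
  by (rule loc_int_linear) (simp_all add: matrix_vector_mul_bounded_linear)

lemma loc_int_vec: "loc_int (v :: real \<Rightarrow> real^'n) \<longleftrightarrow> (\<forall>i. loc_int (\<lambda>t. v t $ i))"
  unfolding loc_int_def
  by (subst absolutely_integrable_componentwise_iff) (auto simp: Basis_vec_def inner_axis)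

section \<open>Proper rational functions and matrices as operators on signals\<close>

definition rf_op :: "ratfun \<Rightarrow> (real \<Rightarrow> real) \<Rightarrow> real \<Rightarrow> real" where
  "rf_op g v t = feedthrough g * v t + conv (impulse_response g) v t"

lemma tf_response_iff:
  "tf_response G v w \<longleftrightarrow> loc_int v \<and> (\<forall>t\<ge>0. \<forall>i. w t $ i = (\<Sum>j\<in>UNIV. rf_op (G $ i $ j) (\<lambda>\<tau>. v \<tau> $ j) t))"
  by (auto simp: tf_response_def loc_int_def rf_op_def conv_def vec_eq_iff)

lemma conv_integrable:
  fixes h v :: "real \<Rightarrow> real"
  assumes "continuous_on {0..} h" "loc_int v" "t \<ge> 0"
  shows "(\<lambda>\<tau>. h (t - \<tau>) * v \<tau>) absolutely_integrable_on {0..t}"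
proof (rule absolutely_integrable_borel_version[OF loc_intD[OF assms(2), of t]])
  fix V assume "integrable lborel V" "AE \<tau> in lebesgue. V \<tau> = (if \<tau> \<in> {0..t} then v \<tau> else 0)"
  then show ?thesis
    by (rule conv_eq_lborel(2)[OF assms(1) loc_intD[OF assms(2)] assms(3) order_refl]) (rule refl)
qed

lemma conv_add_right:
  fixes h v w :: "real \<Rightarrow> real"
  assumes "continuous_on {0..} h" "loc_int v" "loc_int w" "t \<ge> 0"
  shows "conv h (\<lambda>t. v t + w t) t = conv h v t + conv h w t"
  using conv_integrable[OF assms(1,2,4)] conv_integrable[OF assms(1,3,4)]
  by (simp add: conv_def distrib_left Henstock_Kurzweil_Integration.integral_add set_lebesgue_integral_eq_integral(1))

lemma conv_mult_right: "conv h (\<lambda>t. c * v t) t = c * conv h v t" for h v :: "real \<Rightarrow> real"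
  by (simp add: conv_def mult.left_commute[of _ c])

lemma conv_mult_left: "conv (\<lambda>t. c * h t) v t = c * conv h v t" for h v :: "real \<Rightarrow> real"
  by (simp add: conv_def mult.assoc)

lemma conv_add_left:
  fixes h k v :: "real \<Rightarrow> real"
  assumes "continuous_on {0..} h" "continuous_on {0..} k" "loc_int v" "t \<ge> 0"
  shows "conv (\<lambda>t. h t + k t) v t = conv h v t + conv k v t"
  using conv_integrable[OF assms(1,3,4)] conv_integrable[OF assms(2,3,4)]
  by (simp add: conv_def distrib_right Henstock_Kurzweil_Integration.integral_add set_lebesgue_integral_eq_integral(1))

lemma conv_cong:
  "(\<And>\<tau>. 0 \<le> \<tau> \<Longrightarrow> \<tau> \<le> t \<Longrightarrow> h \<tau> = k \<tau>) \<Longrightarrow> (\<And>\<tau>. 0 \<le> \<tau> \<Longrightarrow> \<tau> \<le> t \<Longrightarrow> v \<tau> = w \<tau>) \<Longrightarrow> conv h v t = conv k w t"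
  unfolding conv_def by (intro Henstock_Kurzweil_Integration.integral_cong) auto

lemma rf_op_cong:
  "(\<And>\<tau>. 0 \<le> \<tau> \<Longrightarrow> \<tau> \<le> t \<Longrightarrow> v \<tau> = w \<tau>) \<Longrightarrow> t \<ge> 0 \<Longrightarrow> rf_op g v t = rf_op g w t"
  unfolding rf_op_def by (simp cong: conv_cong)

lemma rf_op_loc_int:
  assumes "rf_proper g" "loc_int v"
  shows "loc_int (rf_op g v)"
  unfolding loc_int_def rf_op_def
proof (intro allI impI set_integral_add(1))
  fix T :: real assume "T \<ge> 0"
  show "conv (impulse_response g) v absolutely_integrable_on {0..T}"
    by (rule conv_assoc(1)[OF impulse_response_continuous impulse_response_continuous]) (use assms \<open>T \<ge> 0\<close> in \<open>auto intro: loc_intD\<close>)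
qed (use loc_intD[OF assms(2)] in auto)

lemma rf_op_add_right:
  assumes "rf_proper g" "loc_int v" "loc_int w" "t \<ge> 0"
  shows "rf_op g (\<lambda>t. v t + w t) t = rf_op g v t + rf_op g w t"
  using assms by (simp add: rf_op_def conv_add_right impulse_response_continuous distrib_left)

lemma rf_op_mult_right: "rf_op g (\<lambda>t. c * v t) t = c * rf_op g v t"
  by (simp add: rf_op_def conv_mult_right distrib_left)

lemma rf_op_add_left:
  assumes "rf_proper f" "rf_proper g" "loc_int v" "t \<ge> 0"
  shows "rf_op (f + g) v t = rf_op f v t + rf_op g v t"
  using assms by (simp add: rf_op_def impulse_response_add conv_add_left impulse_response_continuous
      inf.ev_add distrib_right)

lemma rf_op_const: "rf_op (rf_const c) v t = c * v t"
  by (simp add: rf_op_def impulse_response_const feedthrough_const conv_def)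

text \<open>Expanding both Dirac parts leaves one double convolution, which is reassociated by
  \<open>conv_assoc\<close>. Together with additivity, this represents the ring of proper rational
  functions by operators on locally integrable signals, so that identities of transfer matrices
  become identities of signals.\<close>

lemma rf_op_mult:
  assumes f: "rf_proper f" and g: "rf_proper g" and v: "loc_int v" and t: "t \<ge> 0"
  shows "rf_op (f * g) v t = rf_op f (rf_op g v) t"
proof -
  let ?f = "impulse_response f" and ?g = "impulse_response g"
  note fc = impulse_response_continuous[OF f] and gc = impulse_response_continuous[OF g]
  have cc: "continuous_on {0..} (conv ?f ?g)"
    by (rule conv_continuous[OF fc continuous_borel_version(1)[OF gc]])
  have gv: "loc_int (conv ?g v)"
    unfolding loc_int_def using conv_assoc(1)[OF gc gc loc_intD[OF v]] by simp
  have "conv (impulse_response (f * g)) v t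
      = conv (\<lambda>t. feedthrough f * ?g t + (feedthrough g * ?f t + conv ?f ?g t)) v t"
    by (intro conv_cong) (auto simp: impulse_response_mult[OF f g])
  also have "\<dots> = feedthrough f * conv ?g v t + (feedthrough g * conv ?f v t + conv (conv ?f ?g) v t)"
    by (simp add: conv_add_left conv_mult_left fc gc cc v t continuous_intros)
  finally have "conv (impulse_response (f * g)) v t = feedthrough f * conv ?g v t + (feedthrough g * conv ?f v t + conv (conv ?f ?g) v t)" .
  moreover have "conv ?f (rf_op g v) t = feedthrough g * conv ?f v t + conv ?f (conv ?g v) t"
  proof -
    have "loc_int (\<lambda>t. feedthrough g * v t)" using loc_int_scaleR[OF v] by simp
    from conv_add_right[OF fc this gv t] show ?thesis
      by (simp add: rf_op_def[abs_def] conv_mult_right)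
  qed
  moreover have "conv ?f (conv ?g v) t = conv (conv ?f ?g) v t"
    by (rule conv_assoc(2)[OF fc gc loc_intD[OF v] t])
  ultimately show ?thesis
    unfolding rf_op_def[of "f * g"] rf_op_def[of f] by (simp add: inf.ev_mult f g rf_op_def algebra_simps)
qed

lemma rf_op_sum_right:
  assumes "finite I" "rf_proper g" "\<And>i. i \<in> I \<Longrightarrow> loc_int (v i)" "t \<ge> 0"
  shows "loc_int (\<lambda>t. \<Sum>i\<in>I. v i t) \<and> rf_op g (\<lambda>t. \<Sum>i\<in>I. v i t) t = (\<Sum>i\<in>I. rf_op g (v i) t)"
  using assms(1,3)
proof (induction I)
  case empty
  then show ?case by (simp add: loc_int_def rf_op_def conv_def)
next
  case (insert x I)
  then show ?case
    using rf_op_add_right[OF assms(2) _ _ assms(4), of "v x" "\<lambda>t. \<Sum>i\<in>I. v i t"]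
    by (simp add: loc_int_add)
qed

lemma rf_op_sum_left:
  assumes "finite I" "\<And>i. i \<in> I \<Longrightarrow> rf_proper (g i)" "loc_int v" "t \<ge> 0"
  shows "rf_op (\<Sum>i\<in>I. g i) v t = (\<Sum>i\<in>I. rf_op (g i) v t)"
  using assms(1,2)
proof (induction I)
  case empty
  then show ?case using rf_op_const[of 0] by (simp add: rf_const_simps)
next
  case (insert x I)
  then show ?case
    by (simp add: rf_op_add_left inf.sum assms(3,4))
qed

lemma tf_response_loc_int:
  assumes "tf_response G v w" "inf.Rmat G"
  shows "loc_int v" "loc_int w"
proof -
  show v: "loc_int v" using assms by (simp add: tf_response_iff)
  have "loc_int (\<lambda>t. w t $ i)" for i
  proof -
    have "loc_int (\<lambda>t. \<Sum>j\<in>UNIV. rf_op (G $ i $ j) (\<lambda>\<tau>. v \<tau> $ j) t)"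
      using rf_op_sum_right[of UNIV 0 "\<lambda>j. rf_op (G $ i $ j) (\<lambda>\<tau>. v \<tau> $ j)" 0] v assms(2)
      by (simp add: inf.zero rf_op_loc_int inf.RmatD loc_int_vec)
    then show ?thesis
      by (rule loc_int_cong[THEN iffD1, rotated]) (use assms(1) in \<open>simp add: tf_response_iff\<close>)
  qed
  then show "loc_int w" by (simp add: loc_int_vec)
qed

lemma tf_response_mult:
  assumes F: "inf.Rmat F" and G: "inf.Rmat G" and Gv: "tf_response G v w" and Fw: "tf_response F w z"
  shows "tf_response (F ** G) v z"
  unfolding tf_response_iff
proof (intro conjI allI impI)
  show v: "loc_int v" using Gv by (simp add: tf_response_iff)
  then have vj: "loc_int (\<lambda>\<tau>. v \<tau> $ j)" for j by (simp add: loc_int_vec)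
  fix t :: real and i assume t: "t \<ge> 0"
  have "z t $ i = (\<Sum>k\<in>UNIV. rf_op (F $ i $ k) (\<lambda>\<tau>. w \<tau> $ k) t)"
    using Fw t by (simp add: tf_response_iff)
  also have "\<dots> = (\<Sum>k\<in>UNIV. \<Sum>j\<in>UNIV. rf_op (F $ i $ k * G $ k $ j) (\<lambda>\<tau>. v \<tau> $ j) t)"
  proof (rule sum.cong[OF refl])
    fix k
    have "rf_op (F $ i $ k) (\<lambda>\<tau>. w \<tau> $ k) t =
        rf_op (F $ i $ k) (\<lambda>\<tau>. \<Sum>j\<in>UNIV. rf_op (G $ k $ j) (\<lambda>\<tau>. v \<tau> $ j) \<tau>) t"
      using Gv t by (intro rf_op_cong) (auto simp: tf_response_iff)
    also have "\<dots> = (\<Sum>j\<in>UNIV. rf_op (F $ i $ k) (rf_op (G $ k $ j) (\<lambda>\<tau>. v \<tau> $ j)) t)"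
      using rf_op_sum_right[of UNIV "F $ i $ k" "\<lambda>j. rf_op (G $ k $ j) (\<lambda>\<tau>. v \<tau> $ j)" t] t F G vj
      by (simp add: inf.RmatD rf_op_loc_int)
    also have "\<dots> = (\<Sum>j\<in>UNIV. rf_op (F $ i $ k * G $ k $ j) (\<lambda>\<tau>. v \<tau> $ j) t)"
      by (simp add: rf_op_mult inf.RmatD F G vj t)
    finally show "rf_op (F $ i $ k) (\<lambda>\<tau>. w \<tau> $ k) t
      = (\<Sum>j\<in>UNIV. rf_op (F $ i $ k * G $ k $ j) (\<lambda>\<tau>. v \<tau> $ j) t)" .
  qed
  also have "\<dots> = (\<Sum>j\<in>UNIV. \<Sum>k\<in>UNIV. rf_op (F $ i $ k * G $ k $ j) (\<lambda>\<tau>. v \<tau> $ j) t)"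
    by (rule sum.swap)
  also have "\<dots> = (\<Sum>j\<in>UNIV. rf_op ((F ** G) $ i $ j) (\<lambda>\<tau>. v \<tau> $ j) t)"
    unfolding matrix_matrix_mult_def
    by (simp add: rf_op_sum_left inf.RmatD F G inf.mult vj t)
  finally show "z t $ i = (\<Sum>j\<in>UNIV. rf_op ((F ** G) $ i $ j) (\<lambda>\<tau>. v \<tau> $ j) t)" .
qed

lemma tf_response_cong:
  assumes "tf_response G v w" "\<And>t. t \<ge> 0 \<Longrightarrow> v t = v' t" "\<And>t. t \<ge> 0 \<Longrightarrow> w t = w' t"
  shows "tf_response G v' w'"
  unfolding tf_response_iff
proof (intro conjI allI impI)
  show "loc_int v'" using assms(1,2) loc_int_cong[of v v'] by (simp add: tf_response_iff)
  fix t :: real and i assume t: "t \<ge> 0"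
  have "w' t $ i = (\<Sum>j\<in>UNIV. rf_op (G $ i $ j) (\<lambda>\<tau>. v \<tau> $ j) t)"
    using assms(1,3) t by (simp add: tf_response_iff)
  also have "\<dots> = (\<Sum>j\<in>UNIV. rf_op (G $ i $ j) (\<lambda>\<tau>. v' \<tau> $ j) t)"
    using assms(2) t by (intro sum.cong refl rf_op_cong) auto
  finally show "w' t $ i = (\<Sum>j\<in>UNIV. rf_op (G $ i $ j) (\<lambda>\<tau>. v' \<tau> $ j) t)" .
qed

lemma tf_response_exists:
  assumes "loc_int v"
  obtains w where "tf_response G v w"
  by (rule that[of "\<lambda>t. \<chi> i. \<Sum>j\<in>UNIV. rf_op (G $ i $ j) (\<lambda>\<tau>. v \<tau> $ j) t"]) (simp add: tf_response_iff assms)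

lemma tf_response_unique:
  "tf_response G v w \<Longrightarrow> tf_response G v w' \<Longrightarrow> t \<ge> 0 \<Longrightarrow> w t = w' t"
  by (simp add: tf_response_iff vec_eq_iff)

lemma tf_response_add:
  assumes "inf.Rmat G" "tf_response G v w" "tf_response G v' w'"
  shows "tf_response G (\<lambda>t. v t + v' t) (\<lambda>t. w t + w' t)"
  using assms by (auto simp: tf_response_iff loc_int_add loc_int_vec rf_op_add_right inf.RmatD sum.distrib)

lemma tf_response_add_left:
  assumes "inf.Rmat F" "inf.Rmat G" "tf_response F v w" "tf_response G v w'"
  shows "tf_response (F + G) v (\<lambda>t. w t + w' t)"
  using assms by (auto simp: tf_response_iff loc_int_vec rf_op_add_left inf.RmatD sum.distrib)

lemma tf_response_scaleR:
  assumes "tf_response G v w"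
  shows "tf_response G (\<lambda>t. c *\<^sub>R v t) (\<lambda>t. c *\<^sub>R w t)"
  using assms by (simp add: tf_response_iff loc_int_scaleR rf_op_mult_right sum_distrib_left)

lemma tf_response_diff:
  assumes "inf.Rmat G" "tf_response G v w" "tf_response G v' w'"
  shows "tf_response G (\<lambda>t. v t - v' t) (\<lambda>t. w t - w' t)"
  using tf_response_add[OF assms(1,2) tf_response_scaleR[OF assms(3), of "-1"]] by simp

lemma tf_response_const:
  assumes "loc_int v"
  shows "tf_response (tf_const A) v (\<lambda>t. A *v v t)"
  using assms by (simp add: tf_response_iff tf_const_def map_matrix_def rf_op_const matrix_vector_mult_def)

lemma tf_response_scale_const:
  assumes "inf.Rmat G" "tf_response G v w"
  shows "tf_response (tf_scale (rf_const c) G) v (\<lambda>t. c *\<^sub>R w t)"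
proof -
  have "tf_response (tf_const (c *\<^sub>R mat 1)) w (\<lambda>t. (c *\<^sub>R mat 1) *v w t)"
    using assms by (intro tf_response_const) (simp add: tf_response_loc_int)
  from tf_response_mult[OF inf.matrix_const assms this]
  have "tf_response (tf_const (c *\<^sub>R mat 1) ** G) v (\<lambda>t. (c *\<^sub>R mat 1) *v w t)" .
  moreover have "tf_const (c *\<^sub>R mat 1) ** G = tf_scale (rf_const c) G"
    by (simp add: tf_const_simps rf_const_simps flip: tf_scale_mult(1))
  ultimately show ?thesis by (simp add: scaleR_matrix_vector_assoc[symmetric])
qed

lemma tf_response_continuous:
  assumes G: "tf_strictly_proper G" and w: "tf_response G v w"
  shows "continuous_on {0..} w" "w 0 = 0"
proof -
  have ft: "feedthrough (G $ i $ j) = 0" and p: "rf_proper (G $ i $ j)" for i j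
    using G by (simp_all add: tf_strictly_proper_iff inf.Rmat_def map_matrix_def vec_eq_iff)
  have v: "loc_int (\<lambda>t. v t $ j)" for j using w by (simp add: tf_response_iff loc_int_vec)
  have c: "continuous_on {0..} (rf_op (G $ i $ j) (\<lambda>\<tau>. v \<tau> $ j))" for i j
    unfolding rf_op_def ft using conv_continuous[OF impulse_response_continuous[OF p] loc_intD[OF v]] by simp
  have e: "w t = (\<chi> i. \<Sum>j\<in>UNIV. rf_op (G $ i $ j) (\<lambda>\<tau>. v \<tau> $ j) t)" if "t \<ge> 0" for t
    using w that by (simp add: tf_response_iff vec_eq_iff)
  have "continuous_on {0..} (\<lambda>t. \<chi> i. \<Sum>j\<in>UNIV. rf_op (G $ i $ j) (\<lambda>\<tau>. v \<tau> $ j) t)"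
    by (intro continuous_intros c)
  then show "continuous_on {0..} w"
    by (rule continuous_on_cong[THEN iffD1, OF refl, rotated]) (use e in auto)
  show "w 0 = 0"
    by (simp add: e vec_eq_iff rf_op_def ft conv_def)
qed

subsection \<open>Linear differential equations\<close>

definition integrator :: "ratfun^'n^'n" where
  "integrator = tf_scale (inverse rf_s) (mat 1)"

lemma integrator_proper: "inf.Rmat integrator"
  unfolding integrator_def by (intro inf.matrix_scale rf_inverse_s inf.matrix_mat inf.one)

lemma integrator_mult: "integrator ** X = tf_scale (inverse rf_s) X" "Y ** integrator = tf_scale (inverse rf_s) Y"
  by (simp_all only: integrator_def tf_scale_mult[symmetric] matrix_mul_lid matrix_mul_rid)

lemma rf_op_integrator: "rf_op (inverse rf_s) v t = integral {0..t} v"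
proof -
  have "integral {0..t} (\<lambda>\<tau>. (if t - \<tau> < 0 then 0 else 1) * v \<tau>) = integral {0..t} v"
    by (rule Henstock_Kurzweil_Integration.integral_cong) auto
  then show ?thesis unfolding rf_op_def conv_def impulse_response_integrator rf_inverse_s by simp
qed

lemma integral_vec_nth:
  fixes v :: "real \<Rightarrow> real^'n"
  assumes "v integrable_on S"
  shows "integral S v $ i = integral S (\<lambda>t. v t $ i)"
  using integral_linear[OF assms bounded_linear_vec_nth[of i]] by (simp add: comp_def)

lemma tf_response_integrator: "tf_response integrator v w \<longleftrightarrow> ode_sol w v 0"
proof -
  have "(\<Sum>j\<in>UNIV. rf_op (integrator $ i $ j) (\<lambda>\<tau>. v \<tau> $ j) t) = integral {0..t} (\<lambda>\<tau>. v \<tau> $ i)"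
    for i :: 'a and t
  proof -
    have "rf_op (integrator $ i $ j) (\<lambda>\<tau>. v \<tau> $ j) t = (if i = j then integral {0..t} (\<lambda>\<tau>. v \<tau> $ j) else 0)" for j
      using rf_op_const[of 0] rf_op_integrator
      by (simp add: integrator_def tf_scale_def map_matrix_def mat_def rf_const_simps)
    then show ?thesis by simp
  qed
  moreover have "integral {0..t} v $ i = integral {0..t} (\<lambda>\<tau>. v \<tau> $ i)" if "loc_int v" for t i
    by (rule integral_vec_nth[OF set_lebesgue_integral_eq_integral(1)[OF loc_intD[OF that]]])
  moreover have "ode_sol w v 0 \<longleftrightarrow> loc_int v \<and> (\<forall>t\<ge>0. w t = integral {0..t} v)"
    by (auto simp: ode_sol_def loc_int_def)
  ultimately show ?thesis by (auto simp: tf_response_iff vec_eq_iff)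
qed

lemma ode_sol_continuous: "ode_sol x F x0 \<Longrightarrow> continuous_on {0..} x"
proof (rule continuous_on_atLeast_zeroI)
  fix T :: real assume x: "ode_sol x F x0" and T: "T \<ge> 0"
  then have "F integrable_on {0..T}" by (auto simp: ode_sol_def set_lebesgue_integral_eq_integral(1))
  then have "continuous_on {0..T} (\<lambda>t. x0 + integral {0..t} F)"
    by (intro continuous_intros indefinite_integral_continuous_1)
  then show "continuous_on {0..T} x"
    by (rule continuous_on_cong[THEN iffD1, OF refl, rotated]) (use x in \<open>auto simp: ode_sol_def\<close>)
qed

lemma ode_sol_loc_int: "ode_sol x F x0 \<Longrightarrow> loc_int F"
  by (simp add: ode_sol_def loc_int_def)

lemma ode_sol_0: "ode_sol x F x0 \<Longrightarrow> x 0 = x0"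
  by (simp add: ode_sol_def)

lemma ode_sol_cong:
  assumes "ode_sol x F x0" "\<And>t. t \<ge> 0 \<Longrightarrow> x t = x' t" "\<And>t. t \<ge> 0 \<Longrightarrow> F t = F' t" "x0 = x0'"
  shows "ode_sol x' F' x0'"
  unfolding ode_sol_def
proof (intro allI impI conjI)
  fix t :: real assume t: "t \<ge> 0"
  show "F' absolutely_integrable_on {0..t}"
    using assms t by (intro set_integrable_cong[THEN iffD1, of lebesgue lebesgue "{0..t}" "{0..t}" F F']) (auto simp: ode_sol_def)
  have "integral {0..t} F = integral {0..t} F'"
    using assms(3) by (intro Henstock_Kurzweil_Integration.integral_cong) auto
  then show "x' t = x0' + integral {0..t} F'"
    using assms t by (simp add: ode_sol_def)
qed

lemma ode_sol_add:
  assumes "ode_sol x F x0" "ode_sol y G y0"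
  shows "ode_sol (\<lambda>t. x t + y t) (\<lambda>t. F t + G t) (x0 + y0)"
  using assms by (simp add: ode_sol_def Henstock_Kurzweil_Integration.integral_add set_lebesgue_integral_eq_integral(1))

lemma ode_sol_linear:
  assumes "ode_sol x F x0" "bounded_linear L"
  shows "ode_sol (\<lambda>t. L (x t)) (\<lambda>t. L (F t)) (L x0)"
  unfolding ode_sol_def
proof (intro allI impI conjI)
  fix t :: real assume t: "t \<ge> 0"
  then have F: "F absolutely_integrable_on {0..t}" and x: "x t = x0 + integral {0..t} F"
    using assms by (auto simp: ode_sol_def)
  show "(\<lambda>t. L (F t)) absolutely_integrable_on {0..t}"
    using absolutely_integrable_linear[OF F assms(2)] by (simp add: comp_def)
  have "integral {0..t} (\<lambda>t. L (F t)) = L (integral {0..t} F)"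
    using integral_linear[OF set_lebesgue_integral_eq_integral(1)[OF F] assms(2)] by (simp add: comp_def)
  then show "L (x t) = L x0 + integral {0..t} (\<lambda>t. L (F t))"
    using x by (simp add: linear_simps[OF assms(2)])
qed

lemma ode_sol_mat: "ode_sol x F x0 \<Longrightarrow> ode_sol (\<lambda>t. (A :: real^'n^'m) *v x t) (\<lambda>t. A *v F t) (A *v x0)"
  by (rule ode_sol_linear) (simp_all add: matrix_vector_mul_bounded_linear)

lemma ode_sol_scaleR: "ode_sol x F x0 \<Longrightarrow> ode_sol (\<lambda>t. c *\<^sub>R x t) (\<lambda>t. c *\<^sub>R F t) (c *\<^sub>R x0)"
  by (rule ode_sol_linear[OF _ bounded_linear_scaleR_right])

lemma ode_sol_diff:
  assumes "ode_sol x F x0" "ode_sol y G y0"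
  shows "ode_sol (\<lambda>t. x t - y t) (\<lambda>t. F t - G t) (x0 - y0)"
  using ode_sol_add[OF assms(1) ode_sol_scaleR[OF assms(2), of "-1"]] by simp

lemma minus_one_mat_mult: "((-1) *\<^sub>R mat 1) *v x = - (x :: real^'n)"
  by (metis scaleR_matrix_vector_assoc matrix_vector_mul_lid scaleR_minus1_left)

text \<open>With \<open>z = s\<^sup>-\<^sup>1 (A z + v)\<close>, the operator \<open>s (s - A)\<^sup>-\<^sup>1\<close> inverts \<open>1 - s\<^sup>-\<^sup>1 A\<close>.\<close>

lemma ode_sol_imp_response:
  assumes z: "ode_sol z (\<lambda>t. A *v z t + v t) 0" and v: "loc_int v"
  shows "tf_response (resolvent A) v z"
proof -
  have zl: "loc_int z" using ode_sol_continuous[OF z] by (rule loc_int_continuous)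
  obtain w where w: "tf_response integrator (\<lambda>t. A *v z t) w"
    using tf_response_exists[OF loc_int_mat[OF zl]] .
  have zi: "tf_response integrator (\<lambda>t. A *v z t + v t) z" using z by (simp add: tf_response_integrator)
  have 1: "tf_response integrator v (\<lambda>t. z t - w t)"
    using tf_response_diff[OF integrator_proper zi w] by simp
  let ?I = "integrator ** tf_const A" and ?P = "tf_scale rf_s (resolvent A)"
  have Ip: "inf.Rmat ?I" by (intro inf.matrix_mult inf.matrix_const integrator_proper)
  have Aw: "tf_response ?I z w"
    by (rule tf_response_mult[OF integrator_proper inf.matrix_const tf_response_const[OF zl] w])
  have zz: "tf_response (mat 1) z z"
    using tf_response_const[OF zl, of "mat 1"] by (simp add: tf_const_simps rf_const_simps)
  have "tf_response (tf_const ((-1) *\<^sub>R mat 1) ** ?I) z (\<lambda>t. ((-1) *\<^sub>R mat 1) *v w t)"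
    by (rule tf_response_mult[OF inf.matrix_const Ip Aw tf_response_const[OF tf_response_loc_int(2)[OF Aw Ip]]])
  from tf_response_add_left[OF inf.matrix_mat[OF inf.one] inf.matrix_mult[OF inf.matrix_const Ip] zz this]
  have 2: "tf_response (mat 1 + tf_const ((-1) *\<^sub>R mat 1) ** ?I) z (\<lambda>t. z t - w t)"
    unfolding minus_one_mat_mult add_uminus_conv_diff .
  have rp: "inf.Rmat ?P"
  proof -
    have "rf_proper ((rf_s + rf_const 0) * resolvent A $ i $ j)" for i j
      using resolvent_proper[of A]
      by (intro rf_proper_s_mult) (simp_all add: tf_strictly_proper_iff inf.Rmat_def map_matrix_def vec_eq_iff)
    then show ?thesis by (simp add: inf.Rmat_def tf_scale_def map_matrix_def rf_const_simps)
  qed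
  obtain y where y: "tf_response ?P (\<lambda>t. z t - w t) y"
    using tf_response_exists[OF tf_response_loc_int(2)[OF 1 integrator_proper]] .
  have "tf_response (?P ** integrator) v y"
    by (rule tf_response_mult[OF rp integrator_proper 1 y])
  moreover have "?P ** integrator = resolvent A"
    by (simp add: integrator_mult tf_scale_simps rf_s_nonzero)
  moreover have "tf_response (?P ** (mat 1 + tf_const ((-1) *\<^sub>R mat 1) ** ?I)) z y"
    by (rule tf_response_mult[OF rp _ 2 y])
      (intro inf.matrix_add inf.matrix_mat inf.one inf.matrix_mult inf.matrix_const Ip)
  moreover have "?P ** (mat 1 + tf_const ((-1) *\<^sub>R mat 1) ** ?I) = mat 1"
  proof -
    have "tf_scale rf_s (mat 1 + tf_const ((-1) *\<^sub>R mat 1) ** ?I) = mat rf_s - tf_const A"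
    proof -
      have "tf_const ((-1) *\<^sub>R mat 1) ** X = tf_scale (rf_const (-1)) X" for X :: "ratfun^'a^'a"
        by (simp only: tf_const_simps(4,5) rf_const_simps(2) tf_scale_mult(1)[symmetric] matrix_mul_lid)
      then show ?thesis
        using rf_s_nonzero
        by (simp add: integrator_mult tf_scale_simps rf_const_simps)
          (simp add: vec_eq_iff tf_scale_def map_matrix_def)
    qed
    then show ?thesis
      using resolvent_inverse(2)[of A] by (metis tf_scale_mult)
  qed
  ultimately have "tf_response (resolvent A) v y" "tf_response (mat 1) z y" by simp_all
  then show ?thesis
    using tf_response_unique[OF zz] by (auto intro: tf_response_cong)
qed

text \<open>Because s (s - A)^-1 = A (s - A)^-1 + 1, the response \<open>z\<close> is the integrator
  applied to A z + v. This also provides existence of solutions of linear equations with locally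
  integrable input.\<close>

lemma response_imp_ode_sol:
  assumes r: "tf_response (resolvent A) v z"
  shows "ode_sol z (\<lambda>t. A *v z t + v t) 0"
proof -
  have rp: "inf.Rmat (resolvent A)" using resolvent_proper by (auto simp: tf_strictly_proper_iff)
  note l = tf_response_loc_int[OF r rp]
  have "tf_response (tf_const A ** resolvent A) v (\<lambda>t. A *v z t)"
    by (rule tf_response_mult[OF inf.matrix_const rp r tf_response_const[OF l(2)]])
  moreover have "tf_response (mat 1) v v"
    using tf_response_const[OF l(1), of "mat 1"] by (simp add: tf_const_simps rf_const_simps)
  ultimately have 1: "tf_response (tf_const A ** resolvent A + mat 1) v (\<lambda>t. A *v z t + v t)"
    by (intro tf_response_add_left inf.matrix_mult inf.matrix_const rp inf.matrix_mat inf.one)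
  have p: "inf.Rmat (tf_const A ** resolvent A + mat 1)"
    by (intro inf.matrix_add inf.matrix_mult inf.matrix_const rp inf.matrix_mat inf.one)
  obtain y where y: "tf_response integrator (\<lambda>t. A *v z t + v t) y"
    using tf_response_exists[OF tf_response_loc_int(2)[OF 1 p]] .
  have "tf_response (integrator ** (tf_const A ** resolvent A + mat 1)) v y"
    by (rule tf_response_mult[OF integrator_proper p 1 y])
  moreover have "integrator ** (tf_const A ** resolvent A + mat 1) = resolvent A"
  proof -
    have "tf_const A ** resolvent A + (mat rf_s - tf_const A) ** resolvent A = tf_scale rf_s (resolvent A)"
      unfolding matrix_add_rdistrib[symmetric] by (simp flip: tf_scale_mult(1) add: tf_scale_mult(1)[of _ "mat 1", simplified tf_scale_simps, simplified, symmetric])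
    then have "tf_const A ** resolvent A + mat 1 = tf_scale rf_s (resolvent A)"
      by (simp add: resolvent_inverse)
    then show ?thesis
      by (simp add: integrator_mult tf_scale_simps rf_s_nonzero)
  qed
  ultimately have "tf_response (resolvent A) v y" by simp
  then have "tf_response integrator (\<lambda>t. A *v z t + v t) z"
    using tf_response_unique[OF _ r] by (intro tf_response_cong[OF y]) auto
  then show ?thesis by (simp add: tf_response_integrator)
qed

subsection \<open>The \<open>L\<^sub>1\<close> norm\<close>

lemma infnorm_le_iff: "infnorm (x :: real^'n) \<le> b \<longleftrightarrow> (\<forall>i. \<bar>x $ i\<bar> \<le> b)"
  unfolding infnorm_Max by (auto simp: Basis_vec_def inner_axis)

lemma impulse_response_absolutely_integrable:
  assumes "rf_proper g" "\<And>s. rf_pole g s \<Longrightarrow> Re s < 0"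
  shows "impulse_response g absolutely_integrable_on {0..}"
proof -
  obtain M c where "c < 0" "\<And>t. t \<ge> 0 \<Longrightarrow> \<bar>impulse_response g t\<bar> \<le> M * exp (c * t)"
    using impulse_response_stable[OF assms] by metis
  then show ?thesis
    by (intro exp_decay_absolutely_integrable[of _ M c] impulse_response_continuous assms(1)) auto
qed

lemma rf_op_bound:
  assumes g: "rf_proper g" "\<And>s. rf_pole g s \<Longrightarrow> Re s < 0" and v: "loc_int v" and t: "t \<ge> 0"
    and M: "\<And>\<tau>. 0 \<le> \<tau> \<Longrightarrow> \<tau> \<le> t \<Longrightarrow> \<bar>v \<tau>\<bar> \<le> M"
  shows "\<bar>rf_op g v t\<bar> \<le> (\<bar>feedthrough g\<bar> + integral {0..} (\<lambda>t. \<bar>impulse_response g t\<bar>)) * M"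
proof -
  let ?h = "impulse_response g"
  have M0: "M \<ge> 0" using M[of 0] t by linarith
  note hc = impulse_response_continuous[OF g(1)]
  have ai: "(\<lambda>t. \<bar>?h t\<bar>) integrable_on {0..}"
    using impulse_response_absolutely_integrable[OF g] absolutely_integrable_on_def[where f = ?h] by auto
  have ac: "continuous_on {0..t} (\<lambda>\<tau>. \<bar>?h \<tau>\<bar>)"
    by (intro continuous_intros continuous_on_subset[OF hc]) auto
  have I: "((\<lambda>\<tau>. \<bar>?h \<tau>\<bar>) has_integral integral {0..t} (\<lambda>\<tau>. \<bar>?h \<tau>\<bar>)) (cbox 0 t)"
    using integrable_integral[OF integrable_continuous_interval[OF ac]] by simp
  have "((\<lambda>\<tau>. \<bar>?h (t - \<tau>)\<bar>) has_integral integral {0..t} (\<lambda>\<tau>. \<bar>?h \<tau>\<bar>)) {0..t}"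
  proof -
    have "(\<lambda>x. (1 / (- 1)) *\<^sub>R x + - ((1 / (- 1)) *\<^sub>R t)) = (-) t"
      by (auto simp: fun_eq_iff)
    then show ?thesis using has_integral_affinity[OF I, of "-1" t] by simp
  qed
  then have R: "((\<lambda>\<tau>. \<bar>?h (t - \<tau>)\<bar> * M) has_integral integral {0..t} (\<lambda>\<tau>. \<bar>?h \<tau>\<bar>) * M) {0..t}"
    by (rule has_integral_mult_left)
  have "norm (conv ?h v t) \<le> integral {0..t} (\<lambda>\<tau>. \<bar>?h (t - \<tau>)\<bar> * M)"
    unfolding conv_def
  proof (rule integral_norm_bound_integral)
    show "(\<lambda>\<tau>. ?h (t - \<tau>) * v \<tau>) integrable_on {0..t}"
      by (rule set_lebesgue_integral_eq_integral(1)[OF conv_integrable[OF hc v t]])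
    show "(\<lambda>\<tau>. \<bar>?h (t - \<tau>)\<bar> * M) integrable_on {0..t}" using R by blast
  qed (auto simp: abs_mult intro!: mult_left_mono M)
  also have "\<dots> = integral {0..t} (\<lambda>\<tau>. \<bar>?h \<tau>\<bar>) * M" using R by (rule integral_unique)
  also have "\<dots> \<le> integral {0..} (\<lambda>\<tau>. \<bar>?h \<tau>\<bar>) * M"
    by (intro mult_right_mono integral_subset_le ai M0 integrable_continuous_interval ac) auto
  finally have "\<bar>conv ?h v t\<bar> \<le> integral {0..} (\<lambda>\<tau>. \<bar>?h \<tau>\<bar>) * M" by simp
  moreover have "\<bar>feedthrough g * v t\<bar> \<le> \<bar>feedthrough g\<bar> * M"
    using M[of t] t by (simp add: abs_mult mult_left_mono)
  ultimately show ?thesis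
    unfolding rf_op_def by (simp add: distrib_right)
qed

text \<open>A class on which the integrals in \<open>L1_norm\<close> converge, so that it really is
  a gain; a divergent integral would have the default value 0.\<close>

definition stable_proper :: "ratfun^'n^'m \<Rightarrow> bool" where
  "stable_proper G \<longleftrightarrow> inf.Rmat G \<and> tf_stable G"

lemma L1_norm_nonneg: "L1_norm G \<ge> 0"
proof -
  have "0 \<le> (\<Sum>j\<in>UNIV. \<bar>feedthrough (G $ i $ j)\<bar> + integral {0..} (\<lambda>t. \<bar>impulse_response (G $ i $ j) t\<bar>))" for i
  proof (intro sum_nonneg add_nonneg_nonneg abs_ge_zero)
    fix j show "0 \<le> integral {0..} (\<lambda>t. \<bar>impulse_response (G $ i $ j) t\<bar>)"
      by (cases "(\<lambda>t. \<bar>impulse_response (G $ i $ j) t\<bar>) integrable_on {0..}")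
        (auto intro: Henstock_Kurzweil_Integration.integral_nonneg simp: not_integrable_integral)
  qed
  then show ?thesis unfolding L1_norm_def
    by (subst Max_ge_iff) auto
qed

text \<open>The output at time t depends only on the input up to t. Stating the gain on [0, t]
  allows its use before any bound for all times is known.\<close>

lemma tf_response_L1_bound:
  assumes G: "stable_proper G" and w: "tf_response G v w" and t: "t \<ge> 0"
    and M: "\<And>\<tau>. 0 \<le> \<tau> \<Longrightarrow> \<tau> \<le> t \<Longrightarrow> infnorm (v \<tau>) \<le> M"
  shows "infnorm (w t) \<le> L1_norm G * M"
  unfolding infnorm_le_iff
proof
  fix i
  let ?b = "\<lambda>i j. \<bar>feedthrough (G $ i $ j)\<bar> + integral {0..} (\<lambda>t. \<bar>impulse_response (G $ i $ j) t\<bar>)"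
  have M0: "M \<ge> 0" using M[of 0] t order_trans[OF infnorm_pos_le] by auto
  have vb: "\<bar>v \<tau> $ j\<bar> \<le> M" if "0 \<le> \<tau>" "\<tau> \<le> t" for \<tau> j
    using M[OF that] by (simp add: infnorm_le_iff)
  have v: "loc_int (\<lambda>t. v t $ j)" for j using w by (simp add: tf_response_iff loc_int_vec)
  have gs: "rf_proper (G $ i $ j)" "rf_pole (G $ i $ j) s \<Longrightarrow> Re s < 0" for j s
    using G by (auto simp: stable_proper_def inf.Rmat_def tf_stable_def)
  have "\<bar>w t $ i\<bar> \<le> (\<Sum>j\<in>UNIV. \<bar>rf_op (G $ i $ j) (\<lambda>\<tau>. v \<tau> $ j) t\<bar>)"
    using w t by (simp add: tf_response_iff)
  also have "\<dots> \<le> (\<Sum>j\<in>UNIV. ?b i j * M)"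
    by (intro sum_mono rf_op_bound gs v t vb)
  also have "\<dots> = (\<Sum>j\<in>UNIV. ?b i j) * M" by (simp add: sum_distrib_right)
  also have "\<dots> \<le> L1_norm G * M"
    unfolding L1_norm_def by (intro mult_right_mono M0 Max_ge) auto
  finally show "\<bar>w t $ i\<bar> \<le> L1_norm G * M" .
qed

lemma stable_proper_mult: "stable_proper F \<Longrightarrow> stable_proper G \<Longrightarrow> stable_proper (F ** G)"
  by (auto simp: stable_proper_def inf.matrix_mult tf_stable_iff fin.matrix_mult)

lemma stable_proper_const: "stable_proper (tf_const A)"
  by (auto simp: stable_proper_def inf.matrix_const tf_stable_iff fin.matrix_const)

lemma stable_proper_diff: "stable_proper F \<Longrightarrow> stable_proper G \<Longrightarrow> stable_proper (F - G)"
  by (auto simp: stable_proper_def inf.matrix_diff tf_stable_iff fin.matrix_diff)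

lemma stable_proper_mat_1: "stable_proper (mat 1)"
  by (auto simp: stable_proper_def inf.matrix_mat inf.one tf_stable_iff fin.matrix_mat fin.one)

lemma stable_proper_scale_const: "stable_proper G \<Longrightarrow> stable_proper (tf_scale (rf_const c) G)"
  by (auto simp: stable_proper_def inf.matrix_scale inf.const tf_stable_iff fin.matrix_scale fin.const)

lemma stable_proper_resolvent: "hurwitz A \<Longrightarrow> stable_proper (resolvent A)"
  using resolvent_proper resolvent_stable by (auto simp: stable_proper_def tf_strictly_proper_iff)

section \<open>Matrix facts\<close>

lemma infnorm_mat_le: "infnorm ((A :: real^'n^'m) *v x) \<le> (\<Sum>i\<in>UNIV. \<Sum>j\<in>UNIV. \<bar>A $ i $ j\<bar>) * infnorm x"
  unfolding infnorm_le_iff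
proof
  fix i
  have "\<bar>(A *v x) $ i\<bar> \<le> (\<Sum>j\<in>UNIV. \<bar>A $ i $ j * x $ j\<bar>)"
    by (simp add: matrix_vector_mult_def)
  also have "\<dots> \<le> (\<Sum>j\<in>UNIV. \<bar>A $ i $ j\<bar> * infnorm x)"
    by (intro sum_mono) (simp add: abs_mult mult_left_mono component_le_infnorm_cart)
  also have "\<dots> \<le> (\<Sum>i\<in>UNIV. \<Sum>j\<in>UNIV. \<bar>A $ i $ j\<bar>) * infnorm x"
    unfolding sum_distrib_right[symmetric]
    by (intro mult_right_mono infnorm_pos_le member_le_sum sum_nonneg) auto
  finally show "\<bar>(A *v x) $ i\<bar> \<le> (\<Sum>i\<in>UNIV. \<Sum>j\<in>UNIV. \<bar>A $ i $ j\<bar>) * infnorm x" .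
qed

lemma ex_infnorm_1: "\<exists>x :: real^'n. infnorm x = 1"
proof -
  define a :: "real^'n" where "a = axis undefined 1"
  have "infnorm a > 0" by (simp add: infnorm_pos_lt a_def)
  then have "infnorm (inverse (infnorm a) *\<^sub>R a) = 1"
    by (simp add: infnorm_mul real_abs_infnorm)
  then show ?thesis by blast
qed

lemma mat_infnorm_bdd: "bdd_above ((\<lambda>x. infnorm ((A :: real^'n^'m) *v x)) ` {x. infnorm x = 1})"
proof (rule bdd_aboveI2)
  fix x :: "real^'n" assume "x \<in> {x. infnorm x = 1}"
  then show "infnorm (A *v x) \<le> (\<Sum>i\<in>UNIV. \<Sum>j\<in>UNIV. \<bar>A $ i $ j\<bar>)"
    using infnorm_mat_le[of A x] by simp
qed

lemma mat_infnorm_nonneg: "mat_infnorm (A :: real^'n^'m) \<ge> 0"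
proof -
  obtain x :: "real^'n" where "infnorm x = 1" using ex_infnorm_1 by blast
  then have "infnorm (A *v x) \<le> mat_infnorm A"
    unfolding mat_infnorm_def by (intro cSUP_upper mat_infnorm_bdd) simp
  then show ?thesis using infnorm_pos_le order_trans by blast
qed

lemma infnorm_mat_infnorm: "infnorm ((A :: real^'n^'m) *v x) \<le> mat_infnorm A * infnorm x"
proof (cases "x = 0")
  case False
  then have p: "infnorm x > 0" by (simp add: infnorm_pos_lt)
  have "infnorm (A *v (inverse (infnorm x) *\<^sub>R x)) \<le> mat_infnorm A"
    unfolding mat_infnorm_def using p by (intro cSUP_upper mat_infnorm_bdd) (simp add: infnorm_mul)
  then have "inverse (infnorm x) * infnorm (A *v x) \<le> mat_infnorm A"
    using p by (simp add: matrix_vector_mult_scaleR infnorm_mul)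
  then show ?thesis using p by (simp add: field_simps)
qed (simp add: infnorm_0)

lemma mat_infnorm_le:
  assumes "\<And>x. infnorm x = 1 \<Longrightarrow> infnorm ((A :: real^'n^'m) *v x) \<le> b"
  shows "mat_infnorm A \<le> b"
  unfolding mat_infnorm_def using ex_infnorm_1 assms by (intro cSUP_least) auto

subsection \<open>Extremal eigenvalues of symmetric matrices\<close>

lemma sym_dot: "transpose A = A \<Longrightarrow> x \<bullet> (A *v y) = (A *v x) \<bullet> (y :: real^'n)"
  by (metis dot_lmul_matrix vector_transpose_matrix)

text \<open>A maximiser v of the Rayleigh quotient on the unit sphere is an eigenvector: the form
  \<open>q\<close> is nonnegative and vanishes at v, while a short step from v against w = l v - A v
  would make it negative unless w = 0.\<close>

lemma sym_max_eigenvalue: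
  fixes A :: "real^'n^'n"
  assumes A: "transpose A = A"
  obtains l where "l \<in> real_eigenvalues A" "\<And>x. x \<bullet> (A *v x) \<le> l * (x \<bullet> x)"
proof -
  obtain v where v: "v \<in> sphere 0 1" "\<And>x. x \<in> sphere 0 1 \<Longrightarrow> x \<bullet> (A *v x) \<le> v \<bullet> (A *v v)"
  proof -
    have cont: "continuous_on (sphere 0 1) (\<lambda>x. x \<bullet> (A *v x))"
      by (rule continuous_on_inner[OF continuous_on_id linear_continuous_on[OF matrix_vector_mul_bounded_linear]])
    have ne: "sphere (0 :: real^'n) 1 \<noteq> {}" by simp
    show ?thesis
      using bexE[OF continuous_attains_sup[OF compact_sphere ne cont]] that by metis
  qed
  define l where "l = v \<bullet> (A *v v)"
  have v1: "v \<bullet> v = 1" using v(1) by (simp add: dot_square_norm)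
  have le: "x \<bullet> (A *v x) \<le> l * (x \<bullet> x)" for x
  proof (cases "x = 0")
    case False
    let ?y = "inverse (norm x) *\<^sub>R x"
    have "?y \<bullet> (A *v ?y) \<le> l"
      unfolding l_def using False by (intro v(2)) simp
    then have "inverse (norm x) * inverse (norm x) * (x \<bullet> (A *v x)) \<le> l"
      by (simp add: matrix_vector_mult_scaleR)
    then show ?thesis using False by (simp add: field_simps dot_square_norm power2_eq_square)
  qed simp
  define w where "w = l *\<^sub>R v - A *v v"
  define q where "q x = l * (x \<bullet> x) - x \<bullet> (A *v x)" for x
  have q: "q x \<ge> 0" for x using le[of x] by (simp add: q_def)
  have ex: "q (v + t *\<^sub>R w) = 2 * t * (w \<bullet> w) + t\<^sup>2 * q w" for t
  proof -
    have "w \<bullet> w = l * (v \<bullet> w) - v \<bullet> (A *v w)"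
      by (simp add: w_def[of] sym_dot[OF A, of v] inner_diff_left inner_diff_right)
    moreover have "w \<bullet> (A *v v) = v \<bullet> (A *v w)"
      by (simp add: sym_dot[OF A, of v] inner_commute)
    ultimately show ?thesis
      using v1 by (simp add: q_def matrix_vector_right_distrib matrix_vector_mult_scaleR inner_add_left
          inner_add_right l_def[symmetric] power2_eq_square algebra_simps inner_commute[of w v]) (simp flip: distrib_left distrib_right)
  qed
  have "w \<bullet> w = 0"
  proof (rule ccontr)
    assume "w \<bullet> w \<noteq> 0"
    then have p: "w \<bullet> w > 0" by simp
    \<comment> \<open>The step length |w|^2 / s would minimise \<open>ex\<close> for s = q w; adding
      1 avoids a division by zero and still leaves a negative value.\<close>
    define s where "s = q w + 1"
    have s: "s > 0" "q w < s" using q[of w] by (simp_all add: s_def)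
    have "q (v + (- (w \<bullet> w) / s) *\<^sub>R w) = (w \<bullet> w)\<^sup>2 / s * (q w / s - 2)"
      unfolding ex using s by (simp add: field_simps power2_eq_square)
    moreover have "q w / s < 1" using s by simp
    moreover have "(w \<bullet> w)\<^sup>2 / s > 0" by (intro divide_pos_pos zero_less_power p s)
    ultimately have "q (v + (- (w \<bullet> w) / s) *\<^sub>R w) < 0"
      by (simp only: mult_pos_neg)
    then show False using q by (meson not_le)
  qed
  then have "A *v v = l *\<^sub>R v" by (simp add: w_def)
  moreover have "v \<noteq> 0" using v1 by auto
  ultimately have "l \<in> real_eigenvalues A" unfolding real_eigenvalues_def by blast
  with le that show ?thesis by blast
qed

text \<open>Eigenvectors of different eigenvalues are orthogonal, hence independent, hence finitely
  many. Only with this are \<open>Min\<close> and \<open>Max\<close> in \<open>lambda_min\<close>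
  and \<open>lambda_max\<close> meaningful.\<close>

lemma real_eigenvalues_finite:
  fixes A :: "real^'n^'n"
  assumes A: "transpose A = A"
  shows "finite (real_eigenvalues A)"
proof -
  define e where "e l = (SOME v. v \<noteq> 0 \<and> A *v v = l *\<^sub>R v)" for l
  have e: "e l \<noteq> 0" "A *v e l = l *\<^sub>R e l" if "l \<in> real_eigenvalues A" for l
    using someI_ex[of "\<lambda>v. v \<noteq> 0 \<and> A *v v = l *\<^sub>R v"] that unfolding e_def real_eigenvalues_def by blast+
  have orth: "e l \<bullet> e m = 0" if "l \<in> real_eigenvalues A" "m \<in> real_eigenvalues A" "l \<noteq> m" for l m
    using sym_dot[OF A, of "e l" "e m"] e that by simp
  have inj: "inj_on e (real_eigenvalues A)"
    using orth e(1) by (intro inj_onI) (metis inner_eq_zero_iff)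
  have "pairwise orthogonal (e ` real_eigenvalues A)"
    using orth by (auto simp: pairwise_def orthogonal_def)
  moreover have "0 \<notin> e ` real_eigenvalues A" using e(1) by auto
  ultimately have "independent (e ` real_eigenvalues A)" by (rule pairwise_orthogonal_independent)
  then have "finite (e ` real_eigenvalues A)" by (simp add: independent_imp_finite)
  then show ?thesis using inj by (simp add: finite_image_iff)
qed

lemma matrix_vector_mult_minus_left: "- A *v x = - (A *v (x :: real^'n))"
  by (simp add: matrix_vector_mult_def vec_eq_iff sum_negf)

lemma real_eigenvalues_uminus: "l \<in> real_eigenvalues (- A) \<longleftrightarrow> - l \<in> real_eigenvalues (A :: real^'n^'n)"
proof -
  have "- A *v v = l *\<^sub>R v \<longleftrightarrow> A *v v = (- l) *\<^sub>R v" for v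
    by (metis add.inverse_inverse matrix_vector_mult_minus_left scaleR_minus_left)
  then show ?thesis by (simp add: real_eigenvalues_def)
qed

lemma lambda_bounds:
  fixes A :: "real^'n^'n"
  assumes A: "transpose A = A"
  shows "lambda_min A * (x \<bullet> x) \<le> x \<bullet> (A *v x)" "x \<bullet> (A *v x) \<le> lambda_max A * (x \<bullet> x)"
    and "lambda_min A \<in> real_eigenvalues A" "lambda_max A \<in> real_eigenvalues A"
proof -
  note fin = real_eigenvalues_finite[OF A]
  obtain l where l: "l \<in> real_eigenvalues A" "\<And>x. x \<bullet> (A *v x) \<le> l * (x \<bullet> x)"
    by (rule sym_max_eigenvalue[OF A]) blast
  have mA: "transpose (- A) = - A" using A by (simp add: transpose_def vec_eq_iff)
  obtain m where m: "m \<in> real_eigenvalues (- A)" "\<And>x. x \<bullet> (- A *v x) \<le> m * (x \<bullet> x)"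
    by (rule sym_max_eigenvalue[OF mA]) blast
  have m': "- m \<in> real_eigenvalues A" using m(1) by (simp add: real_eigenvalues_uminus)
  have m'': "- m * (x \<bullet> x) \<le> x \<bullet> (A *v x)" for x
    using m(2)[of x] by (simp add: matrix_vector_mult_minus_left)
  show "lambda_min A \<in> real_eigenvalues A" "lambda_max A \<in> real_eigenvalues A"
    unfolding lambda_min_def lambda_max_def using fin l(1) by (auto intro: Min_in Max_in)
  have "lambda_min A \<le> - m" "l \<le> lambda_max A"
    unfolding lambda_min_def lambda_max_def using fin l(1) m' by auto
  then show "lambda_min A * (x \<bullet> x) \<le> x \<bullet> (A *v x)" "x \<bullet> (A *v x) \<le> lambda_max A * (x \<bullet> x)"
    using m''[of x] l(2)[of x] by (meson inner_ge_zero mult_right_mono order_trans)+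
qed

lemma lambda_pos_def:
  assumes "pos_def P"
  shows "lambda_min P > 0" "lambda_max P > 0"
proof -
  have P: "transpose P = P" using assms by (simp add: pos_def_def)
  have "l > 0" if l: "l \<in> real_eigenvalues P" for l
  proof -
    obtain v where v: "v \<noteq> 0" "P *v v = l *\<^sub>R v" using l by (auto simp: real_eigenvalues_def)
    then have "l * (v \<bullet> v) > 0" using assms by (force simp: pos_def_def)
    then show ?thesis using v(1) inner_ge_zero[of v] by (auto simp: zero_less_mult_iff)
  qed
  then show "lambda_min P > 0" "lambda_max P > 0" using lambda_bounds(3,4)[OF P] by auto
qed

lemma lambda_max_nonneg:
  assumes "transpose P = P" "\<And>x. x \<bullet> (P *v x) \<ge> 0"
  shows "lambda_max P \<ge> 0"
proof -
  obtain v where v: "v \<noteq> 0" "P *v v = lambda_max P *\<^sub>R v"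
    using lambda_bounds(4)[OF assms(1)] by (auto simp: real_eigenvalues_def)
  then have "lambda_max P * (v \<bullet> v) \<ge> 0" using assms(2)[of v] by simp
  then show ?thesis using v(1) by (metis inner_gt_zero_iff mult_neg_pos not_le)
qed

lemma lambda_min_shift:
  fixes Q :: "real^'n^'n"
  assumes Q: "transpose Q = Q"
  shows "transpose (Q - e *\<^sub>R mat 1) = Q - e *\<^sub>R mat 1" "lambda_min (Q - e *\<^sub>R mat 1) = lambda_min Q - e"
proof -
  have v: "(Q - e *\<^sub>R mat 1) *v x = Q *v x - e *\<^sub>R x" for x
    by (simp add: matrix_vector_mult_diff_rdistrib scaleR_matrix_vector_assoc[symmetric])
  show s: "transpose (Q - e *\<^sub>R mat 1) = Q - e *\<^sub>R mat 1"
    using Q by (simp add: transpose_def vec_eq_iff mat_def)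
  have "real_eigenvalues (Q - e *\<^sub>R mat 1) = (\<lambda>l. l - e) ` real_eigenvalues Q"
  proof (intro set_eqI iffI)
    fix l assume "l \<in> real_eigenvalues (Q - e *\<^sub>R mat 1)"
    then obtain x where "x \<noteq> 0" "Q *v x - e *\<^sub>R x = l *\<^sub>R x" by (auto simp: real_eigenvalues_def v)
    then have "x \<noteq> 0" "Q *v x = (l + e) *\<^sub>R x" by (simp_all add: algebra_simps)
    then show "l \<in> (\<lambda>l. l - e) ` real_eigenvalues Q"
      by (intro image_eqI[of _ _ "l + e"]) (auto simp: real_eigenvalues_def)
  next
    fix l assume "l \<in> (\<lambda>l. l - e) ` real_eigenvalues Q"
    then obtain m x where "l = m - e" "x \<noteq> 0" "Q *v x = m *\<^sub>R x" by (auto simp: real_eigenvalues_def)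
    then have "x \<noteq> 0" "(Q - e *\<^sub>R mat 1) *v x = l *\<^sub>R x" by (simp_all add: v scaleR_left_diff_distrib)
    then show "l \<in> real_eigenvalues (Q - e *\<^sub>R mat 1)" by (auto simp: real_eigenvalues_def)
  qed
  moreover have "Min ((\<lambda>l. l - e) ` real_eigenvalues Q) = Min (real_eigenvalues Q) - e"
    using lambda_bounds(3)[OF Q] by (intro hom_Min_commute[symmetric] real_eigenvalues_finite Q) auto
  ultimately show "lambda_min (Q - e *\<^sub>R mat 1) = lambda_min Q - e"
    by (simp add: lambda_min_def)
qed

subsection \<open>The Moore--Penrose inverse in the full column rank case\<close>

text \<open>\<open>pinv\<close> is a definite description, so the Penrose equations must be shown to
  have exactly one solution. An injective N forces X N = 1 for every solution, and N X = (N Y N X)^T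
  = N X N Y = N Y then gives uniqueness; (N^T N)^-1 N^T is a solution.\<close>

lemma pinv_left_inverse:
  fixes N :: "real^'m^'p"
  assumes "rank N = CARD('m)"
  shows "pinv N ** N = mat 1"
proof -
  define P where "P X \<longleftrightarrow> N ** X ** N = N \<and> X ** N ** X = X \<and>
      transpose (N ** X) = N ** X \<and> transpose (X ** N) = X ** N" for X
  have inj: "inj ((*v) N)" using assms by (simp add: full_rank_injective)
  obtain L where L: "L ** N = mat 1"
    using inj by (auto simp: matrix_left_invertible_injective[symmetric])
  have left: "X ** N = mat 1" if "P X" for X
  proof -
    have "L ** (N ** X ** N) = L ** N" using that by (simp add: P_def)
    then show ?thesis by (metis L matrix_mul_assoc matrix_mul_lid)
  qed
  have uniq: "X = Y" if "P X" "P Y" for X Y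
  proof -
    have "N ** X = transpose (N ** Y ** (N ** X))"
      using that left[OF that(1)] left[OF that(2)]
      by (metis P_def matrix_mul_assoc)
    also have "\<dots> = N ** X ** (N ** Y)" using that by (simp add: matrix_transpose_mul P_def)
    also have "\<dots> = N ** Y" using left[OF that(1)] by (metis matrix_mul_assoc matrix_mul_rid)
    finally have "X ** (N ** X) = X ** (N ** Y)" by simp
    then show ?thesis using left[OF that(1)] by (simp add: matrix_mul_assoc)
  qed
  define G where "G = transpose N ** N"
  have "x = 0" if "G *v x = 0" for x
  proof -
    have "x \<bullet> (transpose N *v (N *v x)) = 0" using that by (simp add: G_def matrix_vector_mul_assoc)
    then have "(N *v x) \<bullet> (N *v x) = 0"
      by (metis dot_lmul_matrix inner_commute transpose_matrix_vector)
    then have "N *v x = N *v 0" by simp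
    then show ?thesis using inj by (metis injD)
  qed
  then have "invertible G"
    using invertible_left_inverse matrix_left_invertible_ker by blast
  note G = matrix_inv_mult[OF this]
  have Gs: "transpose G = G" by (simp add: G_def matrix_transpose_mul)
  have "transpose (matrix_inv G) = matrix_inv G"
  proof (rule matrix_inv_eqI[symmetric])
    show "G ** transpose (matrix_inv G) = mat 1" "transpose (matrix_inv G) ** G = mat 1"
      using G by (metis Gs matrix_transpose_mul transpose_mat)+
  qed
  then have t: "transpose (N ** (matrix_inv G ** transpose N)) = N ** (matrix_inv G ** transpose N)"
    by (simp only: matrix_transpose_mul transpose_transpose matrix_mul_assoc)
  have l: "matrix_inv G ** transpose N ** N = mat 1"
    using G(2) by (simp only: G_def matrix_mul_assoc)
  have "N ** (matrix_inv G ** transpose N) ** N = N"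
    using l by (metis matrix_mul_assoc matrix_mul_rid)
  with t l have Y: "P (matrix_inv G ** transpose N)"
    unfolding P_def by (simp add: transpose_mat)
  have "(THE X. P X) = matrix_inv G ** transpose N"
    by (rule the_equality[of P, OF Y]) (rule uniq[OF _ Y])
  then have "pinv N = matrix_inv G ** transpose N"
    unfolding pinv_def P_def[symmetric] .
  then show ?thesis using left[OF Y] by (simp only:)
qed

subsection \<open>The matrix exponential\<close>

lemma matrix_scaleR_mult: "(c *\<^sub>R A) ** (d *\<^sub>R B) = (c * d) *\<^sub>R ((A :: real^'n^'m) ** (B :: real^'k^'n))"
  by (simp add: matrix_matrix_mult_def vec_eq_iff sum_distrib_left mult_ac)

text \<open>Each entry is a real power series in t, dominated by the exponential series of m |t|
  with m the sum of all absolute entries of A. Termwise differentiation of scalar power series then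
  applies.\<close>

lemma mat_exp_entry:
  fixes A :: "real^'n^'n"
  defines "p k \<equiv> ((\<lambda>X. A ** X) ^^ k) (mat 1)"
  shows "summable (\<lambda>k. p k $ i $ j / fact k * t ^ k)"
    and "mat_exp (t *\<^sub>R A) $ i $ j = (\<Sum>k. p k $ i $ j / fact k * t ^ k)"
proof -
  define m where "m = (\<Sum>i\<in>UNIV. \<Sum>j\<in>UNIV. \<bar>A $ i $ j\<bar>)"
  have Am: "(\<Sum>j\<in>UNIV. \<bar>A $ i $ j\<bar>) \<le> m" for i
    unfolding m_def by (intro member_le_sum sum_nonneg) auto
  have m0: "m \<ge> 0" unfolding m_def by (intro sum_nonneg) auto
  have pb: "\<bar>p k $ i $ j\<bar> \<le> m ^ k" for k i j
  proof (induction k arbitrary: i j)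
    case 0
    then show ?case by (simp add: p_def mat_def)
  next
    case (Suc k)
    have "\<bar>p (Suc k) $ i $ j\<bar> \<le> (\<Sum>l\<in>UNIV. \<bar>A $ i $ l * p k $ l $ j\<bar>)"
      by (simp add: p_def matrix_matrix_mult_def)
    also have "\<dots> \<le> (\<Sum>l\<in>UNIV. \<bar>A $ i $ l\<bar> * m ^ k)"
      by (intro sum_mono) (simp add: abs_mult mult_left_mono Suc)
    also have "\<dots> \<le> m * m ^ k"
      unfolding sum_distrib_right[symmetric] using m0 by (intro mult_right_mono Am) auto
    finally show ?case by simp
  qed
  have sm: "summable (\<lambda>k. c * ((m * \<bar>t\<bar>) ^ k /\<^sub>R fact k))" for c t :: real
    by (intro summable_mult summable_exp_generic)
  show su: "summable (\<lambda>k. p k $ i $ j / fact k * t ^ k)" for i j t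
  proof (rule summable_comparison_test')
    show "summable (\<lambda>k. 1 * ((m * \<bar>t\<bar>) ^ k /\<^sub>R fact k))" by (rule sm)
    show "norm (p k $ i $ j / fact k * t ^ k) \<le> 1 * ((m * \<bar>t\<bar>) ^ k /\<^sub>R fact k)" for k
      using mult_right_mono[OF pb[of k i j], of "\<bar>t\<bar> ^ k / fact k"]
      by (simp add: abs_mult power_abs power_mult_distrib field_simps)
  qed
  have pk: "((\<lambda>X. (t *\<^sub>R A) ** X) ^^ k) (mat 1) = t ^ k *\<^sub>R p k" for k
    by (induction k) (simp_all add: p_def matrix_scaleR_mult)
  define F where "F k = (1 / fact k) *\<^sub>R (((\<lambda>X. (t *\<^sub>R A) ** X) ^^ k) (mat 1))" for k
  have Fe: "F k $ i $ j = p k $ i $ j / fact k * t ^ k" for k i j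
    by (simp add: F_def pk)
  have "summable F"
  proof (rule summable_comparison_test')
    show "summable (\<lambda>k. (real CARD('n) * real CARD('n)) * ((m * \<bar>t\<bar>) ^ k /\<^sub>R fact k))" by (rule sm)
    fix k
    have e: "\<bar>F k $ i $ j\<bar> \<le> (m * \<bar>t\<bar>) ^ k /\<^sub>R fact k" for i j
      using mult_right_mono[OF pb[of k i j], of "\<bar>t\<bar> ^ k / fact k"]
      by (simp add: Fe abs_mult power_abs power_mult_distrib field_simps)
    have "norm (F k) \<le> (\<Sum>i\<in>UNIV. norm (F k $ i))" by (simp add: norm_vec_def L2_set_le_sum)
    also have "\<dots> \<le> (\<Sum>i\<in>UNIV. \<Sum>j\<in>UNIV. \<bar>F k $ i $ j\<bar>)"
      by (intro sum_mono norm_le_l1_cart)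
    also have "\<dots> \<le> (\<Sum>i\<in>(UNIV :: 'n set). \<Sum>j\<in>(UNIV :: 'n set). (m * \<bar>t\<bar>) ^ k /\<^sub>R fact k)"
      by (intro sum_mono e)
    finally show "norm (F k) \<le> (real CARD('n) * real CARD('n)) * ((m * \<bar>t\<bar>) ^ k /\<^sub>R fact k)" by simp
  qed
  then have "(\<Sum>k. F k) $ i $ j = (\<Sum>k. F k $ i $ j)"
    by (simp add: bounded_linear.suminf[OF bounded_linear_vec_nth] bounded_linear.summable[OF bounded_linear_vec_nth])
  then show "mat_exp (t *\<^sub>R A) $ i $ j = (\<Sum>k. p k $ i $ j / fact k * t ^ k)"
    by (simp add: mat_exp_def F_def[symmetric] Fe)
qed

lemma mat_exp_entry_deriv:
  fixes A :: "real^'n^'n"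
  shows "((\<lambda>t. mat_exp (t *\<^sub>R A) $ i $ j) has_real_derivative (A ** mat_exp (t *\<^sub>R A)) $ i $ j) (at t)"
proof -
  define p where "p k = ((\<lambda>X. A ** X) ^^ k) (mat 1)" for k
  note E = mat_exp_entry[where A = A, folded p_def]
  have d: "diffs (\<lambda>k. p k $ i $ j / fact k) k = (\<Sum>l\<in>UNIV. A $ i $ l * (p k $ l $ j / fact k))" for k
  proof -
    have "diffs (\<lambda>k. p k $ i $ j / fact k) k = p (Suc k) $ i $ j / fact k"
      by (simp add: diffs_def del: of_nat_Suc)
    then show ?thesis by (simp add: p_def matrix_matrix_mult_def sum_divide_distrib)
  qed
  have "((\<lambda>t. \<Sum>k. p k $ i $ j / fact k * t ^ k) has_real_derivative
      (\<Sum>k. diffs (\<lambda>k. p k $ i $ j / fact k) k * t ^ k)) (at t)"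
    by (rule termdiffs_strong_converges_everywhere) (rule E(1))
  moreover have "(\<Sum>k. diffs (\<lambda>k. p k $ i $ j / fact k) k * t ^ k)
      = (\<Sum>k. \<Sum>l\<in>UNIV. A $ i $ l * (p k $ l $ j / fact k * t ^ k))"
    unfolding d by (simp add: sum_distrib_right mult.assoc)
  moreover have "\<dots> = (\<Sum>l\<in>UNIV. A $ i $ l * (\<Sum>k. p k $ l $ j / fact k * t ^ k))"
  proof -
    have "(\<Sum>k. \<Sum>l\<in>UNIV. A $ i $ l * (p k $ l $ j / fact k * t ^ k))
        = (\<Sum>l\<in>UNIV. \<Sum>k. A $ i $ l * (p k $ l $ j / fact k * t ^ k))"
      by (rule suminf_sum) (intro summable_mult E(1))
    also have "\<dots> = (\<Sum>l\<in>UNIV. A $ i $ l * (\<Sum>k. p k $ l $ j / fact k * t ^ k))"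
      by (intro sum.cong refl suminf_mult E(1))
    finally show ?thesis .
  qed
  ultimately show ?thesis
    by (simp add: E(2) matrix_matrix_mult_def)
qed

lemma mat_exp_0: "mat_exp (0 *\<^sub>R A) = mat 1"
proof -
  have "mat_exp (0 *\<^sub>R A) $ i $ j = mat 1 $ i $ j" for i j
    using mat_exp_entry(2)[of 0 A i j] unfolding powser_zero by simp
  then show ?thesis by (simp add: vec_eq_iff)
qed

lemma mat_exp_ode_sol: "ode_sol (\<lambda>t. mat_exp (t *\<^sub>R A) *v x0) (\<lambda>t. A *v (mat_exp (t *\<^sub>R A) *v x0)) x0"
proof -
  let ?z = "\<lambda>t. mat_exp (t *\<^sub>R A) *v x0"
  have D: "(?z has_vector_derivative A *v ?z t) (at t)" for t
  proof -
    have "((\<lambda>t. ?z t $ i) has_real_derivative (A *v ?z t) $ i) (at t)" for i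
    proof -
      have "((\<lambda>t. \<Sum>j\<in>UNIV. mat_exp (t *\<^sub>R A) $ i $ j * x0 $ j) has_real_derivative
          (\<Sum>j\<in>UNIV. (A ** mat_exp (t *\<^sub>R A)) $ i $ j * x0 $ j)) (at t)"
        by (intro DERIV_sum DERIV_cmult_right mat_exp_entry_deriv)
      then show ?thesis
        unfolding matrix_vector_mul_assoc by (simp add: matrix_vector_mult_def)
    qed
    then show ?thesis
      unfolding has_vector_derivative_def has_field_derivative_def
      by (subst has_derivative_componentwise_within)
        (auto simp: Basis_vec_def inner_axis mult_commute_abs)
  qed
  have c: "continuous_on {0..t} (\<lambda>t. A *v ?z t)" for t
    using D by (intro continuous_on_compose2[OF linear_continuous_on[OF matrix_vector_mul_bounded_linear]]
      continuous_at_imp_continuous_on ballI has_vector_derivative_continuous) auto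
  show ?thesis
    unfolding ode_sol_def
  proof (intro allI impI conjI)
    fix t :: real assume t: "t \<ge> 0"
    show "(\<lambda>t. A *v ?z t) absolutely_integrable_on {0..t}"
      by (rule absolutely_integrable_continuous[of 0 t, unfolded cbox_interval, OF c])
    have "((\<lambda>t. A *v ?z t) has_integral ?z t - ?z 0) {0..t}"
      using D by (intro fundamental_theorem_of_calculus t) (auto intro: has_vector_derivative_at_within)
    then show "?z t = x0 + integral {0..t} (\<lambda>t. A *v ?z t)"
      using mat_exp_0[of A] by (simp add: integral_unique)
  qed
qed

text \<open>The function e^(At) x - x starts at 0 and is the response of the resolvent to the
  constant input A x, so the gain of the resolvent bounds it. Hence \<open>kappa_m\<close> is the
  supremum of a bounded set.\<close>

lemma mat_exp_bound:
  fixes A :: "real^'n^'n"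
  assumes A: "hurwitz A" and t: "t \<ge> 0"
  shows "mat_infnorm (mat_exp (t *\<^sub>R A)) \<le> 1 + L1_norm (resolvent A) * mat_infnorm A"
proof (rule mat_infnorm_le)
  fix x :: "real^'n" assume x: "infnorm x = 1"
  let ?z = "\<lambda>t. mat_exp (t *\<^sub>R A) *v x"
  have "ode_sol (\<lambda>t. ?z t - x) (\<lambda>t. A *v ?z t - 0) (x - x)"
    by (rule ode_sol_diff[OF mat_exp_ode_sol]) (simp add: ode_sol_def)
  then have "ode_sol (\<lambda>t. ?z t - x) (\<lambda>t. A *v (?z t - x) + A *v x) 0"
    by (simp add: matrix_vector_mult_diff_distrib)
  then have r: "tf_response (resolvent A) (\<lambda>_. A *v x) (\<lambda>t. ?z t - x)"
    by (rule ode_sol_imp_response) (simp add: loc_int_continuous)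
  have "infnorm (?z t - x) \<le> L1_norm (resolvent A) * mat_infnorm A"
    by (rule tf_response_L1_bound[OF stable_proper_resolvent[OF A] r t])
      (use infnorm_mat_infnorm[of A x] x in simp)
  then show "infnorm (?z t) \<le> 1 + L1_norm (resolvent A) * mat_infnorm A"
    using infnorm_triangle[of "?z t - x" x] x by simp
qed

lemma kappa_m_bounds:
  fixes S :: "('n::finite,'m::finite,'p::finite,'z::finite,'r::finite) l1_design"
  assumes A: "hurwitz (Am S)"
  shows "kappa_m S \<ge> 1" "t \<ge> 0 \<Longrightarrow> infnorm (mat_exp (t *\<^sub>R Am S) *v x) \<le> kappa_m S * infnorm x"
proof -
  have b: "bdd_above ((\<lambda>t. mat_infnorm (mat_exp (t *\<^sub>R Am S))) ` {0..})"
    by (intro bdd_aboveI2) (use mat_exp_bound[OF A] in auto)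
  then have le: "mat_infnorm (mat_exp (t *\<^sub>R Am S)) \<le> kappa_m S" if "t \<ge> 0" for t
    unfolding kappa_m_def by (rule cSUP_upper[rotated]) (use that in simp)
  show "infnorm (mat_exp (t *\<^sub>R Am S) *v x) \<le> kappa_m S * infnorm x" if "t \<ge> 0"
    using infnorm_mat_infnorm[of "mat_exp (t *\<^sub>R Am S)" x] mult_right_mono[OF le[OF that] infnorm_pos_le[of x]]
    by linarith
  obtain x :: "real^'n" where "infnorm x = 1" using ex_infnorm_1 by blast
  then show "kappa_m S \<ge> 1"
    using infnorm_mat_infnorm[of "mat 1" x] le[of 0] mat_exp_0[of "Am S"] by simp
qed

section \<open>Products of Caratheodory solutions\<close>

text \<open>A partition argument replaces differentiation almost everywhere.\<close>

lemma increment_bound: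
  fixes \<phi> K :: "real \<Rightarrow> real"
  assumes st: "s \<le> t"
    and loc: "\<And>e. e > 0 \<Longrightarrow> \<exists>d>0. \<forall>a b. s \<le> a \<longrightarrow> a \<le> b \<longrightarrow> b \<le> t \<longrightarrow> b - a < d \<longrightarrow>
      \<bar>\<phi> b - \<phi> a\<bar> \<le> e * (K b - K a) + L * (b - a)"
    and K: "K s \<le> K t"
  shows "\<bar>\<phi> t - \<phi> s\<bar> \<le> L * (t - s)"
proof (rule field_le_epsilon)
  fix e :: real assume e: "e > 0"
  \<comment> \<open>The local errors e' (K b - K a) telescope to at most e; the summand 1 guards
    against K t = K s.\<close>
  define e' where "e' = e / (K t - K s + 1)"
  have e': "e' > 0" "e' * (K t - K s) \<le> e"
    using e K by (auto simp: e'_def field_simps)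
  obtain d where d: "d > 0" "\<And>a b. s \<le> a \<Longrightarrow> a \<le> b \<Longrightarrow> b \<le> t \<Longrightarrow> b - a < d \<Longrightarrow>
      \<bar>\<phi> b - \<phi> a\<bar> \<le> e' * (K b - K a) + L * (b - a)"
    using loc[OF e'(1)] by blast
  obtain n :: nat where n: "(t - s) / d < real n" using reals_Archimedean2 by blast
  have n0: "n > 0" using n st d(1) by (cases n) (auto simp: divide_less_0_iff)
  define h where "h = (t - s) / real n"
  define x where "x i = s + real i * h" for i
  have x0: "x 0 = s" and xn: "x n = t" using n0 by (simp_all add: x_def h_def)
  have xs: "x (Suc i) - x i = (t - s) / real n" for i
    unfolding x_def h_def[symmetric] by (simp add: distrib_right)
  have step: "(t - s) / real n \<ge> 0" "(t - s) / real n < d"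
    using n n0 st d(1) by (simp_all add: field_simps)
  have xle: "s \<le> x i" "x i \<le> t" if "i \<le> n" for i
  proof -
    have "real i * ((t - s) / real n) \<le> real n * ((t - s) / real n)"
      using that step by (intro mult_right_mono) auto
    moreover have "0 \<le> real i * h" using step by (intro mult_nonneg_nonneg) (auto simp: h_def)
    ultimately show "s \<le> x i" "x i \<le> t" using n0 step by (auto simp: x_def h_def)
  qed
  have "\<bar>\<phi> t - \<phi> s\<bar> = \<bar>\<Sum>i<n. \<phi> (x (Suc i)) - \<phi> (x i)\<bar>"
    by (simp add: sum_lessThan_telescope[of "\<lambda>i. \<phi> (x i)"] x0 xn)
  also have "\<dots> \<le> (\<Sum>i<n. \<bar>\<phi> (x (Suc i)) - \<phi> (x i)\<bar>)" by (rule sum_abs)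
  also have "\<dots> \<le> (\<Sum>i<n. e' * (K (x (Suc i)) - K (x i)) + L * (x (Suc i) - x i))"
  proof (rule sum_mono)
    fix i assume "i \<in> {..<n}"
    then have i: "s \<le> x i" "x (Suc i) \<le> t" using xle[of i] xle[of "Suc i"] by auto
    have "x i \<le> x (Suc i)" "x (Suc i) - x i < d" using step xs[of i] by linarith+
    then show "\<bar>\<phi> (x (Suc i)) - \<phi> (x i)\<bar> \<le> e' * (K (x (Suc i)) - K (x i)) + L * (x (Suc i) - x i)"
      by (rule d(2)[OF i(1) _ i(2)])
  qed
  also have "\<dots> = e' * (K t - K s) + L * (t - s)"
    by (simp add: sum.distrib sum_distrib_left[symmetric] sum_lessThan_telescope[of x]
        sum_lessThan_telescope[of "\<lambda>i. K (x i)"] x0 xn)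
  also have "\<dots> \<le> L * (t - s) + e" using e'(2) by simp
  finally show "\<bar>\<phi> t - \<phi> s\<bar> \<le> L * (t - s) + e" .
qed

lemma loc_int_mult_continuous:
  fixes f p :: "real \<Rightarrow> real"
  assumes "f absolutely_integrable_on {a..b}" "continuous_on {a..b} p"
  shows "(\<lambda>x. f x * p x) absolutely_integrable_on {a..b}"
proof -
  have "(\<lambda>x. p x * f x) absolutely_integrable_on {a..b}"
    by (rule absolutely_integrable_bounded_measurable_product_real)
      (use assms in \<open>auto intro!: compact_imp_bounded compact_continuous_image continuous_imp_measurable_on_sets_lebesgue\<close>)
  then show ?thesis by (simp add: mult.commute)
qed

text \<open>The increment of p^2 with p = F - q over a short [a, b] is (p b + p a) times the
  increment of p. By uniform continuity p b + p a may be replaced by 2 p(x) under the integral of f,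
  at the cost of e times the integral of |f|, which is the increment of \<open>K\<close>. The
  increment of q contributes at most 2 l B (b - a), so no derivative of q is ever taken.\<close>

lemma square_increment:
  fixes F f q :: "real \<Rightarrow> real"
  assumes F: "ode_sol F f F0"
    and q: "\<And>a b. 0 \<le> a \<Longrightarrow> a \<le> b \<Longrightarrow> b \<le> \<tau> \<Longrightarrow> \<bar>q b - q a\<bar> \<le> l * (b - a)"
    and B: "\<And>a. 0 \<le> a \<Longrightarrow> a \<le> \<tau> \<Longrightarrow> \<bar>F a - q a\<bar> \<le> B"
    and st: "0 \<le> s" "s \<le> t" "t \<le> \<tau>" and l: "l \<ge> 0"
  shows "\<bar>(F t - q t)\<^sup>2 - (F s - q s)\<^sup>2 - 2 * integral {s..t} (\<lambda>x. f x * (F x - q x))\<bar> \<le> 2 * l * B * (t - s)"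
proof -
  define p where "p x = F x - q x" for x
  have B0: "B \<ge> 0" using B[of 0] st by linarith
  have qc: "continuous_on {0..\<tau>} q"
  proof (rule lipschitz_on_continuous_on)
    show "l-lipschitz_on {0..\<tau>} q"
    proof (rule lipschitz_onI[OF _ l])
      show "dist (q a) (q b) \<le> l * dist a b" if "a \<in> {0..\<tau>}" "b \<in> {0..\<tau>}" for a b
        using q[of a b] q[of b a] that by (cases "a \<le> b") (auto simp: dist_real_def)
    qed
  qed
  have pc: "continuous_on {0..\<tau>} p"
    unfolding p_def by (intro continuous_intros qc continuous_on_subset[OF ode_sol_continuous[OF F]]) auto
  then have uc: "uniformly_continuous_on {0..\<tau>} p"
    by (intro compact_uniformly_continuous) auto
  have fa: "f absolutely_integrable_on {0..\<tau>}" by (rule loc_intD[OF ode_sol_loc_int[OF F]])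
  have fa': "f absolutely_integrable_on {a..b}" if "0 \<le> a" "b \<le> \<tau>" for a b
    by (rule set_integrable_subset[OF fa]) (use that in auto)
  have fpa: "(\<lambda>x. f x * p x) absolutely_integrable_on {a..b}" if "0 \<le> a" "b \<le> \<tau>" for a b
    using that by (intro loc_int_mult_continuous fa' continuous_on_subset[OF pc]) auto
  have nf: "(\<lambda>x. \<bar>f x\<bar>) integrable_on {a..b}" if "0 \<le> a" "b \<le> \<tau>" for a b
    using fa'[OF that] absolutely_integrable_on_def[where f = f] by auto
  define K where "K x = integral {0..x} (\<lambda>x. \<bar>f x\<bar>)" for x
  define \<phi> where "\<phi> x = (p x)\<^sup>2 - 2 * integral {0..x} (\<lambda>x. f x * p x)" for x
  have Kd: "K b - K a = integral {a..b} (\<lambda>x. \<bar>f x\<bar>)" if "0 \<le> a" "a \<le> b" "b \<le> \<tau>" for a b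
    unfolding K_def using Henstock_Kurzweil_Integration.integral_combine[OF that(1,2) nf[of 0 b]] that by simp
  have fpd: "integral {0..b} (\<lambda>x. f x * p x) - integral {0..a} (\<lambda>x. f x * p x) = integral {a..b} (\<lambda>x. f x * p x)"
    if "0 \<le> a" "a \<le> b" "b \<le> \<tau>" for a b
    using Henstock_Kurzweil_Integration.integral_combine[OF that(1,2) set_lebesgue_integral_eq_integral(1)[OF fpa[of 0 b]]] that by simp
  have Fd: "F b - F a = integral {a..b} f" if "0 \<le> a" "a \<le> b" "b \<le> \<tau>" for a b
    using Henstock_Kurzweil_Integration.integral_combine[OF that(1,2) set_lebesgue_integral_eq_integral(1)[OF fa'[of 0 b]]] that F
    by (simp add: ode_sol_def)
  have "\<bar>\<phi> t - \<phi> s\<bar> \<le> (2 * l * B) * (t - s)"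
  proof (rule increment_bound[where K = K])
    have "K t - K s \<ge> 0"
      using Kd[OF st] st by (auto intro!: Henstock_Kurzweil_Integration.integral_nonneg nf)
    then show "K s \<le> K t" by simp
    fix e :: real assume e: "e > 0"
    obtain d where d: "d > 0" "\<And>x y. x \<in> {0..\<tau>} \<Longrightarrow> y \<in> {0..\<tau>} \<Longrightarrow> dist x y < d \<Longrightarrow> dist (p x) (p y) < e / 2"
      using uc[unfolded uniformly_continuous_on_def, rule_format, of "e / 2"] e by (auto simp: dist_commute)
    show "\<exists>d>0. \<forall>a b. s \<le> a \<longrightarrow> a \<le> b \<longrightarrow> b \<le> t \<longrightarrow> b - a < d \<longrightarrow>
      \<bar>\<phi> b - \<phi> a\<bar> \<le> e * (K b - K a) + (2 * l * B) * (b - a)"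
    proof (intro exI[of _ d] conjI d(1) allI impI)
      fix a b assume ab: "s \<le> a" "a \<le> b" "b \<le> t" "b - a < d"
      then have ab': "0 \<le> a" "a \<le> b" "b \<le> \<tau>" using st by auto
      note i1 = set_lebesgue_integral_eq_integral(1)[OF fa'[OF ab'(1,3)]]
      note i2 = set_lebesgue_integral_eq_integral(1)[OF fpa[OF ab'(1,3)]]
      have "\<phi> b - \<phi> a = (p b)\<^sup>2 - (p a)\<^sup>2 - 2 * integral {a..b} (\<lambda>x. f x * p x)"
        unfolding \<phi>_def fpd[OF ab', symmetric] by (simp add: algebra_simps)
      also have "(p b)\<^sup>2 - (p a)\<^sup>2 = (integral {a..b} f - (q b - q a)) * (p b + p a)"
        unfolding Fd[OF ab', symmetric] by (simp add: p_def power2_eq_square algebra_simps)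
      also have "\<dots> - 2 * integral {a..b} (\<lambda>x. f x * p x) =
          ((p b + p a) * integral {a..b} f - 2 * integral {a..b} (\<lambda>x. f x * p x)) - (q b - q a) * (p b + p a)"
        by (simp add: algebra_simps)
      also have "(p b + p a) * integral {a..b} f - 2 * integral {a..b} (\<lambda>x. f x * p x)
          = integral {a..b} (\<lambda>x. (p b + p a) * f x - 2 * (f x * p x))"
        using Henstock_Kurzweil_Integration.integral_diff[OF integrable_on_mult_right[OF i1, of "p b + p a"]
            integrable_on_mult_right[OF i2, of 2]] by simp
      finally have eq: "\<phi> b - \<phi> a = integral {a..b} (\<lambda>x. (p b + p a) * f x - 2 * (f x * p x)) - (q b - q a) * (p b + p a)" .
      have "norm (integral {a..b} (\<lambda>x. (p b + p a) * f x - 2 * (f x * p x))) \<le> integral {a..b} (\<lambda>x. e * \<bar>f x\<bar>)"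
      proof (rule integral_norm_bound_integral)
        show "(\<lambda>x. (p b + p a) * f x - 2 * (f x * p x)) integrable_on {a..b}"
          using i1 i2 by (intro Henstock_Kurzweil_Integration.integrable_diff integrable_on_mult_right)
        show "(\<lambda>x. e * \<bar>f x\<bar>) integrable_on {a..b}"
          by (intro integrable_on_mult_right nf ab')
        fix x assume x: "x \<in> {a..b}"
        have "\<bar>p b - p x\<bar> < e / 2" "\<bar>p a - p x\<bar> < e / 2"
          using d(2)[of b x] d(2)[of a x] x ab ab' by (auto simp: dist_real_def)
        then have "\<bar>p b + p a - 2 * p x\<bar> \<le> e" by linarith
        then have "\<bar>f x\<bar> * \<bar>p b + p a - 2 * p x\<bar> \<le> \<bar>f x\<bar> * e" by (rule mult_left_mono) simp
        moreover have "(p b + p a) * f x - 2 * (f x * p x) = f x * (p b + p a - 2 * p x)"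
          by (simp add: algebra_simps)
        ultimately show "norm ((p b + p a) * f x - 2 * (f x * p x)) \<le> e * \<bar>f x\<bar>"
          by (simp add: abs_mult mult.commute)
      qed
      then have 1: "\<bar>integral {a..b} (\<lambda>x. (p b + p a) * f x - 2 * (f x * p x))\<bar> \<le> e * (K b - K a)"
        unfolding Kd[OF ab'] by simp
      have "\<bar>p b + p a\<bar> \<le> 2 * B" using B[of a] B[of b] ab' by (simp add: p_def)
      then have "\<bar>(q b - q a) * (p b + p a)\<bar> \<le> (l * (b - a)) * (2 * B)"
        unfolding abs_mult using q[OF ab'] l ab' by (intro mult_mono) auto
      then show "\<bar>\<phi> b - \<phi> a\<bar> \<le> e * (K b - K a) + (2 * l * B) * (b - a)"
        unfolding eq using 1 by (simp add: mult_ac)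
    qed
  qed (rule st)
  moreover have "\<phi> t - \<phi> s = (F t - q t)\<^sup>2 - (F s - q s)\<^sup>2 - 2 * integral {s..t} (\<lambda>x. f x * (F x - q x))"
    using fpd[OF st] unfolding \<phi>_def p_def[symmetric] by simp
  ultimately show ?thesis by simp
qed

text \<open>For q = 0 and l = 0 the estimate \<open>square_increment\<close> has error zero and
  becomes an identity. Polarization extends it to the product rule for Caratheodory
  solutions.\<close>

lemma ode_sol_square:
  fixes F f :: "real \<Rightarrow> real"
  assumes F: "ode_sol F f F0"
  shows "ode_sol (\<lambda>t. (F t)\<^sup>2) (\<lambda>t. 2 * (f t * F t)) (F0\<^sup>2)"
  unfolding ode_sol_def
proof (intro allI impI conjI)
  fix t :: real assume t: "t \<ge> 0"
  have c: "continuous_on {0..t} F" by (rule continuous_on_subset[OF ode_sol_continuous[OF F]]) auto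
  have "(\<lambda>x. f x * F x) absolutely_integrable_on {0..t}"
    by (rule loc_int_mult_continuous[OF loc_intD[OF ode_sol_loc_int[OF F]] c])
  then show "(\<lambda>t. 2 * (f t * F t)) absolutely_integrable_on {0..t}" by simp
  have "bounded (F ` {0..t})" using c by (intro compact_imp_bounded compact_continuous_image) auto
  then obtain B where B: "\<And>a. 0 \<le> a \<Longrightarrow> a \<le> t \<Longrightarrow> \<bar>F a - 0\<bar> \<le> B" by (force simp: bounded_iff)
  have "\<bar>(F t - 0)\<^sup>2 - (F 0 - 0)\<^sup>2 - 2 * integral {0..t} (\<lambda>x. f x * (F x - 0))\<bar> \<le> 2 * 0 * B * (t - 0)"
    by (rule square_increment[OF F _ B]) (use t in auto)
  then show "(F t)\<^sup>2 = F0\<^sup>2 + integral {0..t} (\<lambda>t. 2 * (f t * F t))"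
    using ode_sol_0[OF F] by simp
qed

lemma ode_sol_times:
  fixes F f G g :: "real \<Rightarrow> real"
  assumes F: "ode_sol F f F0" and G: "ode_sol G g G0"
  shows "ode_sol (\<lambda>t. F t * G t) (\<lambda>t. f t * G t + F t * g t) (F0 * G0)"
proof -
  have "ode_sol (\<lambda>t. (1/4) *\<^sub>R ((F t + G t)\<^sup>2 - (F t - G t)\<^sup>2))
     (\<lambda>t. (1/4) *\<^sub>R (2 * ((f t + g t) * (F t + G t)) - 2 * ((f t - g t) * (F t - G t))))
     ((1/4) *\<^sub>R ((F0 + G0)\<^sup>2 - (F0 - G0)\<^sup>2))"
    by (intro ode_sol_scaleR ode_sol_diff ode_sol_square ode_sol_add F G)
  then show ?thesis
    by (rule ode_sol_cong) (simp_all add: power2_eq_square field_simps)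
qed

lemma ode_sol_sum:
  assumes "finite I" "\<And>i. i \<in> I \<Longrightarrow> ode_sol (x i) (F i) (x0 i)"
  shows "ode_sol (\<lambda>t. \<Sum>i\<in>I. x i t) (\<lambda>t. \<Sum>i\<in>I. F i t) (\<Sum>i\<in>I. x0 i)"
  using assms by (induction I) (auto simp: ode_sol_add, simp add: ode_sol_def)

lemma ode_sol_nth: "ode_sol x F x0 \<Longrightarrow> ode_sol (\<lambda>t. x t $ i) (\<lambda>t. F t $ i) (x0 $ i :: real)"
  by (rule ode_sol_linear[OF _ bounded_linear_vec_nth])

lemma ode_sol_inner:
  fixes a b :: "real \<Rightarrow> real^'n"
  assumes "ode_sol a f a0" "ode_sol b g c0"
  shows "ode_sol (\<lambda>t. a t \<bullet> b t) (\<lambda>t. f t \<bullet> b t + a t \<bullet> g t) (a0 \<bullet> c0)"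
  unfolding inner_vec_def inner_real_def sum.distrib[symmetric]
  by (intro ode_sol_sum ode_sol_times ode_sol_nth assms) simp

lemma ode_sol_quadratic:
  fixes a :: "real \<Rightarrow> real^'n"
  assumes a: "ode_sol a f a0" and P: "transpose P = P"
  shows "ode_sol (\<lambda>t. a t \<bullet> (P *v a t)) (\<lambda>t. 2 * (f t \<bullet> (P *v a t))) (a0 \<bullet> (P *v a0))"
proof (rule ode_sol_cong[OF ode_sol_inner[OF a ode_sol_mat[OF a, of P]]])
  fix t
  have "a t \<bullet> (P *v f t) = f t \<bullet> (P *v a t)"
    by (simp add: sym_dot[OF P, of "a t"] inner_commute)
  then show "f t \<bullet> (P *v a t) + a t \<bullet> (P *v f t) = 2 * (f t \<bullet> (P *v a t))" by simp
qed simp_all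

section \<open>Lipschitz bounds from derivatives outside a countable set\<close>

lemma compact_Collect_le:
  fixes g :: "real \<Rightarrow> real"
  assumes "continuous_on {a..b} g"
  shows "compact {x \<in> {a..b}. g x \<le> y}"
proof -
  have "closed ({a..b} \<inter> g -` {..y})"
    by (intro continuous_closed_preimage assms) auto
  then have "compact ({a..b} \<inter> ({a..b} \<inter> g -` {..y}))" by (intro compact_Int_closed) auto
  moreover have "{a..b} \<inter> ({a..b} \<inter> g -` {..y}) = {x \<in> {a..b}. g x \<le> y}" by auto
  ultimately show ?thesis by simp
qed

text \<open>If the increment were too large, g(x) = q(x) - (l + e) x would satisfy g(a) < g(b).
  Among the uncountably many levels in between, one is avoided by the countable image of
  \<open>N\<close>. At the last point where g is at most this level, the derivative of g exists and
  is negative, so g stays below the level a little longer, a contradiction.\<close>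

lemma countable_exception_bound:
  fixes q :: "real \<Rightarrow> real"
  assumes c: "continuous_on {0..\<tau>} q" and N: "countable N"
    and D: "\<And>t. t \<in> {0..\<tau>} - N \<Longrightarrow> \<exists>v. (q has_vector_derivative v) (at t within {0..\<tau>}) \<and> v \<le> l"
    and ab: "0 \<le> a" "a \<le> b" "b \<le> \<tau>"
  shows "q b - q a \<le> l * (b - a)"
proof (rule ccontr)
  assume neg: "\<not> q b - q a \<le> l * (b - a)"
  then have "a < b" using ab by (cases "a = b") auto
  define D where "D = b - a"
  have D0: "D > 0" using \<open>a < b\<close> by (simp add: D_def)
  define e where "e = (q b - q a - l * D) / (2 * D)"
  have e: "e > 0" "q b - q a > (l + e) * (b - a)"
  proof -
    have "e * D = (q b - q a - l * D) / 2" using D0 by (simp add: e_def)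
    then show "q b - q a > (l + e) * (b - a)" using neg by (simp add: distrib_right flip: D_def)
    show "e > 0" using neg D0 by (simp add: e_def flip: D_def)
  qed
  define g where "g x = q x - (l + e) * x" for x
  have gc: "continuous_on {0..\<tau>} g" unfolding g_def by (intro continuous_intros c)
  have "g a < g b" using e(2) by (simp add: g_def algebra_simps)
  then have "uncountable {g a<..<g b}" by (rule uncountable_open_interval[THEN iffD2])
  moreover have "countable (g ` N)" using N by simp
  ultimately obtain y where y: "g a < y" "y < g b" "y \<notin> g ` N"
    by (metis countable_subset greaterThanLessThan_iff subsetI)
  define A where "A = {x \<in> {a..b}. g x \<le> y}"
  have gab: "continuous_on {a..b} g" by (rule continuous_on_subset[OF gc]) (use ab in auto)
  have "compact A" unfolding A_def by (rule compact_Collect_le[OF gab])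
  moreover have "a \<in> A" using y \<open>a < b\<close> by (simp add: A_def)
  ultimately obtain s where s: "s \<in> A" "\<And>x. x \<in> A \<Longrightarrow> x \<le> s"
    by (metis compact_attains_sup empty_iff)
  have sb: "a \<le> s" "s < b" "g s \<le> y" using s(1) y(2) by (auto simp: A_def order_less_le)
  have "g s = y"
  proof (rule ccontr)
    assume "g s \<noteq> y"
    then have "g s \<le> y" "y \<le> g b" using sb y by auto
    then obtain x where "s \<le> x" "x \<le> b" "g x = y"
      using IVT'[of g s y b] sb continuous_on_subset[OF gab, of "{s..b}"] by auto
    then have "x \<in> A" using sb by (simp add: A_def)
    then have "x = s" using s(2) \<open>s \<le> x\<close> by fastforce
    then show False using \<open>g s \<noteq> y\<close> \<open>g x = y\<close> by simp
  qed
  then have "s \<notin> N" using y(3) by blast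
  then obtain v where v: "(q has_vector_derivative v) (at s within {0..\<tau>})" "v \<le> l"
    using D[of s] sb ab by auto
  have "(g has_real_derivative (v - (l + e))) (at s within {0..\<tau>})"
    unfolding g_def using v(1)
    by (auto intro!: derivative_eq_intros simp: has_real_derivative_iff_has_vector_derivative)
  then obtain d where d: "d > 0" "\<And>h. h > 0 \<Longrightarrow> s + h \<in> {0..\<tau>} \<Longrightarrow> h < d \<Longrightarrow> g (s + h) < g s"
    using has_real_derivative_neg_dec_right[of g "v - (l + e)" s "{0..\<tau>}"] v(2) e(1) by auto
  define h where "h = min (d / 2) (b - s)"
  have h: "h > 0" "h < d" "s + h \<le> b" using d(1) sb by (auto simp: h_def)
  then have "g (s + h) < y" using d(2)[of h] \<open>g s = y\<close> sb ab by auto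
  then have "s + h \<in> A" using h sb by (simp add: A_def)
  then show False using s(2)[of "s + h"] h by simp
qed

lemma pw_diff_bounded_Lipschitz:
  assumes q: "pw_diff_bounded \<tau> l q" and ab: "0 \<le> a" "a \<le> b" "b \<le> \<tau>"
  shows "\<bar>q b $ i - q a $ i\<bar> \<le> l * (b - a)"
proof -
  obtain N where N: "continuous_on {0..\<tau>} q" "countable N"
    "\<And>t. t \<in> {0..\<tau>} - N \<Longrightarrow> \<exists>v. (q has_vector_derivative v) (at t within {0..\<tau>}) \<and> infnorm v \<le> l"
    using q unfolding pw_diff_bounded_def by blast
  have D: "\<exists>v. ((\<lambda>t. q t $ i) has_vector_derivative v) (at t within {0..\<tau>}) \<and> \<bar>v\<bar> \<le> l"
    if t: "t \<in> {0..\<tau>} - N" for t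
  proof -
    obtain v where v: "(q has_vector_derivative v) (at t within {0..\<tau>})" "infnorm v \<le> l"
      using N(3)[OF t] by blast
    have "((\<lambda>t. q t $ i) has_vector_derivative v $ i) (at t within {0..\<tau>})"
      by (rule bounded_linear.has_vector_derivative[OF bounded_linear_vec_nth v(1)])
    then show ?thesis using v(2) by (auto simp: infnorm_le_iff)
  qed
  have "q b $ i - q a $ i \<le> l * (b - a)"
    by (rule countable_exception_bound[OF _ N(2) _ ab]) (use D N(1) in \<open>fastforce intro: continuous_intros\<close>)+
  moreover have "(- q b $ i) - (- q a $ i) \<le> l * (b - a)"
  proof (rule countable_exception_bound[OF _ N(2) _ ab])
    show "continuous_on {0..\<tau>} (\<lambda>t. - q t $ i)" by (intro continuous_intros N)
    fix t assume "t \<in> {0..\<tau>} - N"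
    then obtain v where "((\<lambda>t. q t $ i) has_vector_derivative v) (at t within {0..\<tau>})" "\<bar>v\<bar> \<le> l"
      using D by blast
    then show "\<exists>v. ((\<lambda>t. - q t $ i) has_vector_derivative v) (at t within {0..\<tau>}) \<and> v \<le> l"
      by (intro exI[of _ "- v"]) (auto intro: has_vector_derivative_minus)
  qed
  ultimately show ?thesis by linarith
qed

text \<open>A substitute for a differential inequality: V only has to be nonincreasing on intervals
  where it is at least K. If V exceeded K at t, then from the last earlier time with V = K onwards
  this hypothesis would apply.\<close>

lemma stays_below:
  fixes V :: "real \<Rightarrow> real"
  assumes c: "continuous_on {0..\<tau>} V" and V0: "V 0 \<le> K"
    and dec: "\<And>s t. 0 \<le> s \<Longrightarrow> s \<le> t \<Longrightarrow> t \<le> \<tau> \<Longrightarrow> (\<And>x. s \<le> x \<Longrightarrow> x \<le> t \<Longrightarrow> K \<le> V x) \<Longrightarrow> V t \<le> V s"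
    and t: "0 \<le> t" "t \<le> \<tau>"
  shows "V t \<le> K"
proof (rule ccontr)
  assume neg: "\<not> V t \<le> K"
  define A where "A = {x \<in> {0..t}. V x \<le> K}"
  have cab: "continuous_on {0..t} V" by (rule continuous_on_subset[OF c]) (use t in auto)
  have "compact A" unfolding A_def by (rule compact_Collect_le[OF cab])
  moreover have "0 \<in> A" using V0 t by (simp add: A_def)
  ultimately obtain s where s: "s \<in> A" "\<And>x. x \<in> A \<Longrightarrow> x \<le> s"
    by (metis compact_attains_sup empty_iff)
  have sb: "0 \<le> s" "s < t" "V s \<le> K" using s(1) neg by (auto simp: A_def order_less_le)
  have "V s = K"
  proof (rule ccontr)
    assume "V s \<noteq> K"
    obtain x where "s \<le> x" "x \<le> t" "V x = K"
      using IVT'[of V s K t] sb neg continuous_on_subset[OF cab, of "{s..t}"] by auto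
    then have "x \<in> A" using sb by (simp add: A_def)
    then have "x = s" using s(2) \<open>s \<le> x\<close> by fastforce
    then show False using \<open>V s \<noteq> K\<close> \<open>V x = K\<close> by simp
  qed
  have "V t \<le> V s"
  proof (rule dec)
    fix x assume x: "s \<le> x" "x \<le> t"
    show "K \<le> V x"
    proof (rule ccontr)
      assume "\<not> K \<le> V x"
      then have "x \<in> A" using x sb by (simp add: A_def)
      then have "x = s" using s(2) x(1) by fastforce
      then show False using \<open>V s = K\<close> \<open>\<not> K \<le> V x\<close> by simp
    qed
  qed (use sb t in auto)
  then show False using sb neg by simp
qed

text \<open>Each component of F - q is at most 2 B in absolute value, so
  \<open>square_increment\<close> loses 4 B l (t - s) in each of the m components. This is the
  origin of the factor 4 m in \<open>theta_1\<close>.\<close>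

lemma vec_square_increment:
  fixes F f q :: "real \<Rightarrow> real^'m"
  assumes F: "ode_sol F f F0" and q: "pw_diff_bounded \<tau> l q" and l: "l \<ge> 0"
    and B: "\<And>a. 0 \<le> a \<Longrightarrow> a \<le> \<tau> \<Longrightarrow> infnorm (F a) \<le> B" "\<And>a. 0 \<le> a \<Longrightarrow> a \<le> \<tau> \<Longrightarrow> infnorm (q a) \<le> B"
    and st: "0 \<le> s" "s \<le> t" "t \<le> \<tau>"
  shows "(\<lambda>x. f x \<bullet> (F x - q x)) integrable_on {s..t}"
    and "(F t - q t) \<bullet> (F t - q t) - (F s - q s) \<bullet> (F s - q s)
      \<le> 2 * integral {s..t} (\<lambda>x. f x \<bullet> (F x - q x)) + 4 * real CARD('m) * (B * l) * (t - s)"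
proof -
  have qc: "continuous_on {0..\<tau>} q" using q by (simp add: pw_diff_bounded_def)
  have i: "(\<lambda>x. f x $ i * (F x $ i - q x $ i)) integrable_on {s..t}" for i
  proof (rule set_lebesgue_integral_eq_integral(1)[OF loc_int_mult_continuous])
    have "loc_int (\<lambda>x. f x $ i)" using ode_sol_loc_int[OF F] by (simp add: loc_int_vec)
    then show "(\<lambda>x. f x $ i) absolutely_integrable_on {s..t}"
      by (rule set_integrable_subset[OF loc_intD]) (use st in auto)
    show "continuous_on {s..t} (\<lambda>x. F x $ i - q x $ i)"
      by (intro continuous_intros continuous_on_subset[OF ode_sol_continuous[OF F]] continuous_on_subset[OF qc])
        (use st in auto)
  qed
  have e: "f x \<bullet> (F x - q x) = (\<Sum>i\<in>UNIV. f x $ i * (F x $ i - q x $ i))" for x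
    by (simp add: inner_vec_def)
  show "(\<lambda>x. f x \<bullet> (F x - q x)) integrable_on {s..t}"
    unfolding e by (intro integrable_sum i) simp
  have c: "(F t $ i - q t $ i)\<^sup>2 - (F s $ i - q s $ i)\<^sup>2
      \<le> 2 * integral {s..t} (\<lambda>x. f x $ i * (F x $ i - q x $ i)) + 2 * l * (2 * B) * (t - s)" for i
  proof -
    have "\<bar>(F t $ i - q t $ i)\<^sup>2 - (F s $ i - q s $ i)\<^sup>2 - 2 * integral {s..t} (\<lambda>x. f x $ i * (F x $ i - q x $ i))\<bar>
        \<le> 2 * l * (2 * B) * (t - s)"
    proof (rule square_increment[OF ode_sol_nth[OF F] pw_diff_bounded_Lipschitz[OF q] _ st l])
      fix a assume "0 \<le> a" "a \<le> \<tau>"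
      then have "\<bar>F a $ i\<bar> \<le> B" "\<bar>q a $ i\<bar> \<le> B" using B[of a] by (auto simp: infnorm_le_iff)
      then show "\<bar>F a $ i - q a $ i\<bar> \<le> 2 * B" by linarith
    qed
    then show ?thesis by linarith
  qed
  have "(F t - q t) \<bullet> (F t - q t) - (F s - q s) \<bullet> (F s - q s)
      = (\<Sum>i\<in>UNIV. (F t $ i - q t $ i)\<^sup>2 - (F s $ i - q s $ i)\<^sup>2)"
    by (simp add: inner_vec_def power2_eq_square sum_subtractf)
  also have "\<dots> \<le> (\<Sum>i\<in>UNIV. 2 * integral {s..t} (\<lambda>x. f x $ i * (F x $ i - q x $ i)) + 2 * l * (2 * B) * (t - s))"
    by (intro sum_mono c)
  also have "\<dots> = 2 * integral {s..t} (\<lambda>x. f x \<bullet> (F x - q x)) + 4 * real CARD('m) * (B * l) * (t - s)"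
    unfolding e by (simp add: sum.distrib sum_distrib_left[symmetric] Henstock_Kurzweil_Integration.integral_sum i)
  finally show "(F t - q t) \<bullet> (F t - q t) - (F s - q s) \<bullet> (F s - q s)
      \<le> 2 * integral {s..t} (\<lambda>x. f x \<bullet> (F x - q x)) + 4 * real CARD('m) * (B * l) * (t - s)" .
qed

section \<open>The Lyapunov argument\<close>

declare transpose_matrix_vector [simp del]

lemma mat_adjoint: "((M :: real^'n^'m) *v x) \<bullet> y = x \<bullet> (transpose M *v y)"
  by (metis dot_lmul_matrix inner_commute transpose_matrix_vector)

lemma pos_def_invertible: "pos_def P \<Longrightarrow> invertible P"
  unfolding invertible_left_inverse matrix_left_invertible_ker pos_def_def
  by (metis inner_zero_right less_irrefl)

lemma inner_self_le_infnorm: "x \<bullet> x \<le> real CARD('n) * b\<^sup>2" if "infnorm (x :: real^'n) \<le> b"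
proof -
  have "x $ i * x $ i \<le> b\<^sup>2" for i
    using that power_mono[of "\<bar>x $ i\<bar>" b 2] by (simp add: infnorm_le_iff power2_eq_square)
  then have "(\<Sum>i\<in>UNIV. x $ i * x $ i) \<le> (\<Sum>i\<in>(UNIV :: 'n set). b\<^sup>2)" by (intro sum_mono)
  then show ?thesis by (simp add: inner_vec_def)
qed

lemma adjoint_norm_bound:
  fixes M :: "real^'m^'p"
  shows "norm (transpose M *v y) \<le> onorm ((*v) M) * norm y"
proof -
  let ?z = "transpose M *v y"
  have b: "bounded_linear ((*v) M)" by (rule matrix_vector_mul_bounded_linear)
  have "norm ?z * norm ?z = (M *v ?z) \<bullet> y"
    by (simp add: mat_adjoint dot_square_norm power2_eq_square)
  also have "\<dots> \<le> norm (M *v ?z) * norm y" by (rule norm_cauchy_schwarz)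
  also have "\<dots> \<le> (onorm ((*v) M) * norm ?z) * norm y"
    by (intro mult_right_mono onorm[OF b]) simp
  finally have "norm ?z * norm ?z \<le> norm ?z * (onorm ((*v) M) * norm y)" by (simp add: mult_ac)
  then show ?thesis
    using onorm_pos_le[OF b] by (cases "norm ?z = 0") (auto simp: mult_le_cancel_left)
qed

text \<open>The indicated combination cancels the cross terms in \<open>C A v\<close>; Young's inequality with weight
  \<open>\<epsilon>\<^sub>q\<close> absorbs the mismatch of the two regressors \<open>\<parallel>x\<^sub>g\<parallel>\<close>.\<close>

lemma lyapunov_pointwise:
  fixes S :: "('n::finite,'m::finite,'p::{finite,linorder},'z::finite,'r::finite) l1_design"
  assumes D: "design_assumptions S" and w: "w \<in> C_omega S"
    and e: "e = (oh - w) *\<^sub>R uz + (nh *\<^sub>R th - n *\<^sub>R q) + (sh - r)"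
    and ey: "ey = transpose (Bbar S) *v (transpose (Cm S) *v (Py S *v y))"
    and K: "oh \<in> C_omega S" "infnorm th \<le> d_bar S" "infnorm sh \<le> b_bar S"
    and qr: "infnorm q \<le> d_bar S" "infnorm r \<le> b_bar S"
    and n: "\<bar>nh - n\<bar> \<le> infnorm v"
  shows "2 * ((- (alpha S *\<^sub>R y) + Cm S *v (Am S *v v) + Cm S *v (Bbar S *v e)) \<bullet> (Py S *v y))
     + 2 * ((A_v S *v v - matrix_inv (Pv S) *v (transpose (Am S) *v (transpose (Cm S) *v (Py S *v y)))) \<bullet> (Pv S *v v))
     + 2 * (proj_omega S oh (- (uz \<bullet> ey)) * (oh - w))
     + 2 * (proj_theta S th (- (nh *\<^sub>R ey)) \<bullet> (th - q))
     + 2 * (proj_sigma S sh (- ey) \<bullet> (sh - r))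
     \<le> - lambda_1 S * (y \<bullet> (Py S *v y) + v \<bullet> (Pv S *v v))"
    and "lambda_1 S > 0" and "y \<bullet> (Py S *v y) \<ge> 0" and "v \<bullet> (Pv S *v v) \<ge> 0"
proof -
  have Py: "pos_def (Py S)" "Py S = transpose (sqrtPy S) ** sqrtPy S"
    and Pv: "pos_def (Pv S)" and Q: "pos_def (Qmat S)"
    and lyap: "transpose (A_v S) ** Pv S + Pv S ** A_v S = - Qmat S"
    and eps: "0 < eps_q S" "eps_q S < lambda_min (Qmat S)" and ay: "0 < alpha_y S"
    and po: "projection_operator (C_omega S) (proj_omega S)"
    and pt: "projection_operator {q. infnorm q \<le> d_bar S} (proj_theta S)"
    and ps: "projection_operator {q. infnorm q \<le> b_bar S} (proj_sigma S)"
    using D unfolding design_assumptions_def by blast+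
  have Pvs: "transpose (Pv S) = Pv S" and Qs: "transpose (Qmat S) = Qmat S"
    using Pv Q by (simp_all add: pos_def_def)
  let ?Y = "y \<bullet> (Py S *v y)" and ?V = "v \<bullet> (Pv S *v v)"
  have Y: "?Y = (norm (sqrtPy S *v y))\<^sup>2"
    unfolding Py(2) by (simp add: matrix_vector_mul_assoc[symmetric] mat_adjoint[symmetric] dot_square_norm[symmetric])
  then show Y0: "?Y \<ge> 0" by simp
  show V0: "?V \<ge> 0" using Pv by (cases "v = 0") (auto simp: pos_def_def intro: less_imp_le)
  have l1: "lambda_min (Qmat S - eps_q S *\<^sub>R mat 1) > 0"
    using lambda_min_shift(2)[OF Qs] eps by simp
  then show "lambda_1 S > 0"
    using ay lambda_pos_def(2)[OF Pv] by (simp add: lambda_1_def)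
  have 1: "(- (alpha S *\<^sub>R y) + Cm S *v (Am S *v v) + Cm S *v (Bbar S *v e)) \<bullet> (Py S *v y)
      = - alpha S * ?Y + (Cm S *v (Am S *v v)) \<bullet> (Py S *v y) + e \<bullet> ey"
    by (simp add: inner_add_left inner_diff_left ey mat_adjoint[of "Cm S" "Bbar S *v e"] mat_adjoint[of "Bbar S"])
  have 2: "(matrix_inv (Pv S) *v (transpose (Am S) *v (transpose (Cm S) *v (Py S *v y)))) \<bullet> (Pv S *v v)
      = (Cm S *v (Am S *v v)) \<bullet> (Py S *v y)"
  proof -
    let ?g = "transpose (Am S) *v (transpose (Cm S) *v (Py S *v y))"
    have "(matrix_inv (Pv S) *v ?g) \<bullet> (Pv S *v v) = (Pv S *v (matrix_inv (Pv S) *v ?g)) \<bullet> v"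
      by (rule sym_dot[OF Pvs])
    also have "Pv S *v (matrix_inv (Pv S) *v ?g) = ?g"
      using matrix_inv_mult(1)[OF pos_def_invertible[OF Pv]] by (metis matrix_vector_mul_assoc matrix_vector_mul_lid)
    also have "?g \<bullet> v = (Cm S *v (Am S *v v)) \<bullet> (Py S *v y)"
      by (simp only: inner_commute[of _ v] mat_adjoint[symmetric])
    finally show ?thesis .
  qed
  have 3: "2 * ((A_v S *v v) \<bullet> (Pv S *v v)) = - (v \<bullet> (Qmat S *v v))"
  proof -
    have "v \<bullet> ((transpose (A_v S) ** Pv S + Pv S ** A_v S) *v v) = - (v \<bullet> (Qmat S *v v))"
      unfolding lyap by (simp add: matrix_vector_mult_minus_left)
    moreover have "v \<bullet> ((transpose (A_v S) ** Pv S) *v v) = (A_v S *v v) \<bullet> (Pv S *v v)"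
      by (simp only: mat_adjoint matrix_vector_mul_assoc)
    moreover have "v \<bullet> ((Pv S ** A_v S) *v v) = (A_v S *v v) \<bullet> (Pv S *v v)"
      using sym_dot[OF Pvs, of v "A_v S *v v"] by (simp add: matrix_vector_mul_assoc inner_commute)
    ultimately show ?thesis by (simp add: matrix_vector_mult_add_rdistrib inner_add_right)
  qed
  \<comment> \<open>The split nh th - n q = nh (th - q) + (nh - n) q isolates what the adaptive laws
    cannot cancel: the term with nh - n, caused by using the estimated state in the
    regressor.\<close>
  have 4: "e \<bullet> ey = (oh - w) * (uz \<bullet> ey) + nh * ((th - q) \<bullet> ey) + (nh - n) * (q \<bullet> ey) + (sh - r) \<bullet> ey"
    unfolding e by (simp add: inner_add_left inner_diff_left algebra_simps)
  have po': "proj_omega S oh (- (uz \<bullet> ey)) * (oh - w) \<le> - ((oh - w) * (uz \<bullet> ey))"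
  proof -
    have "(oh - w) \<bullet> (proj_omega S oh (- (uz \<bullet> ey)) - (- (uz \<bullet> ey))) \<le> 0"
      using po w K(1) unfolding projection_operator_def by blast
    then show ?thesis by (simp add: algebra_simps)
  qed
  have pt': "proj_theta S th (- (nh *\<^sub>R ey)) \<bullet> (th - q) \<le> - (nh * ((th - q) \<bullet> ey))"
  proof -
    have "(th - q) \<bullet> (proj_theta S th (- (nh *\<^sub>R ey)) - (- (nh *\<^sub>R ey))) \<le> 0"
      using pt K(2) qr(1) unfolding projection_operator_def by blast
    then show ?thesis by (simp add: inner_add_right inner_commute)
  qed
  have ps': "proj_sigma S sh (- ey) \<bullet> (sh - r) \<le> - ((sh - r) \<bullet> ey)"
  proof -
    have "(sh - r) \<bullet> (proj_sigma S sh (- ey) - (- ey)) \<le> 0"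
      using ps K(3) qr(2) unfolding projection_operator_def by blast
    then show ?thesis by (simp add: inner_add_right inner_commute)
  qed
  have young: "2 * ((nh - n) * (q \<bullet> ey)) \<le> eps_q S * (v \<bullet> v) + alpha_phi S * ?Y"
  proof -
    define N where "N = onorm ((*v) (sqrtPy S ** Cm S ** Bbar S))"
    have eyn: "norm ey \<le> N * norm (sqrtPy S *v y)"
    proof -
      have "ey = transpose (sqrtPy S ** Cm S ** Bbar S) *v (sqrtPy S *v y)"
        unfolding ey Py(2) by (simp add: matrix_transpose_mul matrix_vector_mul_assoc matrix_mul_assoc)
      then show ?thesis unfolding N_def using adjoint_norm_bound by metis
    qed
    have d0: "d_bar S \<ge> 0" using K(2) infnorm_pos_le order_trans by blast
    have qn: "norm q \<le> sqrt (real CARD('m)) * d_bar S"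
    proof -
      have "norm q \<le> sqrt (real CARD('m)) * infnorm q" using norm_le_infnorm[of q] by simp
      also have "\<dots> \<le> sqrt (real CARD('m)) * d_bar S" by (intro mult_left_mono qr(1)) simp
      finally show ?thesis .
    qed
    define a where "a = norm v"
    define c where "c = sqrt (real CARD('m)) * d_bar S * norm ey"
    have c0: "c \<ge> 0" using d0 by (simp add: c_def)
    have "\<bar>(nh - n) * (q \<bullet> ey)\<bar> \<le> a * c"
    proof -
      have "\<bar>nh - n\<bar> \<le> a" using n infnorm_le_norm[of v] by (simp add: a_def)
      moreover have "\<bar>q \<bullet> ey\<bar> \<le> c"
        using Cauchy_Schwarz_ineq2[of q ey] mult_right_mono[OF qn, of "norm ey"] by (simp add: c_def)
      ultimately show ?thesis unfolding abs_mult by (intro mult_mono) (auto simp: a_def)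
    qed
    then have "2 * ((nh - n) * (q \<bullet> ey)) \<le> 2 * (a * c)" by linarith
    also have "2 * (a * c) \<le> eps_q S * a\<^sup>2 + c\<^sup>2 / eps_q S"
    proof -
      have "0 \<le> (eps_q S * a - c)\<^sup>2 / eps_q S" using eps(1) by simp
      also have "\<dots> = eps_q S * a\<^sup>2 + c\<^sup>2 / eps_q S - 2 * (a * c)"
      proof -
        have "(eps_q S * a - c)\<^sup>2 = eps_q S * (eps_q S * a\<^sup>2 - 2 * (a * c)) + c\<^sup>2"
          by (simp add: power2_eq_square algebra_simps)
        then show ?thesis using eps(1) by (simp add: add_divide_distrib)
      qed
      finally show ?thesis by simp
    qed
    \<comment> \<open>This is how \<open>alpha_phi\<close> arises: the mismatch uses up
      \<open>alpha_phi\<close> of the decay rate 2 \<alpha> of the output error, and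
      \<open>alpha_y\<close> is what remains.\<close>
    also have "c\<^sup>2 / eps_q S \<le> alpha_phi S * ?Y"
    proof -
      have "(norm ey)\<^sup>2 \<le> N\<^sup>2 * ?Y"
        using power_mono[OF eyn, of 2] by (simp add: Y power_mult_distrib)
      then have "real CARD('m) * (d_bar S)\<^sup>2 / eps_q S * (norm ey)\<^sup>2 \<le> real CARD('m) * (d_bar S)\<^sup>2 / eps_q S * (N\<^sup>2 * ?Y)"
        using eps(1) by (intro mult_left_mono) auto
      then show ?thesis by (simp add: alpha_phi_def N_def c_def power_mult_distrib mult_ac)
    qed
    finally show ?thesis by (simp add: a_def dot_square_norm)
  qed
  have Vq: "lambda_1 S * ?V \<le> v \<bullet> (Qmat S *v v) - eps_q S * (v \<bullet> v)"
  proof -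
    let ?L = "lambda_min (Qmat S - eps_q S *\<^sub>R mat 1)"
    have "lambda_1 S * ?V \<le> ?L / lambda_max (Pv S) * ?V"
      using V0 by (intro mult_right_mono) (simp_all add: lambda_1_def)
    also have "\<dots> \<le> ?L / lambda_max (Pv S) * (lambda_max (Pv S) * (v \<bullet> v))"
      using l1 lambda_pos_def(2)[OF Pv] by (intro mult_left_mono lambda_bounds(2) Pvs) auto
    also have "\<dots> = ?L * (v \<bullet> v)" using lambda_pos_def(2)[OF Pv] by simp
    also have "\<dots> \<le> v \<bullet> ((Qmat S - eps_q S *\<^sub>R mat 1) *v v)"
      by (rule lambda_bounds(1)[OF lambda_min_shift(1)[OF Qs]])
    also have "\<dots> = v \<bullet> (Qmat S *v v) - eps_q S * (v \<bullet> v)"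
      by (simp add: matrix_vector_mult_diff_rdistrib scaleR_matrix_vector_assoc[symmetric] inner_diff_right)
    finally show ?thesis .
  qed
  have Yq: "lambda_1 S * ?Y \<le> alpha_y S * ?Y"
    using Y0 by (intro mult_right_mono) (simp_all add: lambda_1_def)
  have "alpha_y S * ?Y = 2 * alpha S * ?Y - alpha_phi S * ?Y"
    by (simp add: alpha_y_def algebra_simps)
  then show "2 * ((- (alpha S *\<^sub>R y) + Cm S *v (Am S *v v) + Cm S *v (Bbar S *v e)) \<bullet> (Py S *v y))
     + 2 * ((A_v S *v v - matrix_inv (Pv S) *v (transpose (Am S) *v (transpose (Cm S) *v (Py S *v y)))) \<bullet> (Pv S *v v))
     + 2 * (proj_omega S oh (- (uz \<bullet> ey)) * (oh - w))
     + 2 * (proj_theta S th (- (nh *\<^sub>R ey)) \<bullet> (th - q))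
     + 2 * (proj_sigma S sh (- ey) \<bullet> (sh - r))
     \<le> - lambda_1 S * (?Y + ?V)"
    unfolding 1 inner_diff_left 2 using 3 4 po' pt' ps' young Vq Yq
    by (simp add: distrib_left) 
qed

lemma scaled_increment:
  fixes a b G g I c t :: real
  assumes "a - b \<le> 2 * I + 4 * M * c * t" "0 < g" "g \<le> G" "0 \<le> M" "0 \<le> c" "0 \<le> t"
  shows "a / G - b / G \<le> 2 / G * I + 4 * M * (c / g) * t"
proof -
  have "a / G - b / G = (a - b) / G" by (simp add: diff_divide_distrib)
  also have "\<dots> \<le> (2 * I + 4 * M * c * t) / G" using assms by (intro divide_right_mono) auto
  also have "\<dots> = 2 / G * I + 4 * M * (c / G) * t" by (simp add: add_divide_distrib)
  also have "\<dots> \<le> 2 / G * I + 4 * M * (c / g) * t"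
    using assms by (intro add_left_mono mult_right_mono mult_left_mono divide_left_mono) auto
  finally show ?thesis .
qed

text \<open>V adds to W the squared parameter errors divided by their gains, together at most
  \<open>theta_0 S / \<Gamma>\<close>. The threshold k consists of W(0) and
  \<open>theta_0 S / \<Gamma> + c / lambda_1 S\<close>, so V >= k forces W >= c /
  \<open>lambda_1 S\<close>. There the decay \<open>lambda_1 S * W\<close> outweighs c, the rate at
  which the moving \<theta> and \<sigma> can raise V. Hence V is nonincreasing wherever it is at
  least k.\<close>

lemma lyapunov_bound:
  fixes S :: "('n::finite,'m::finite,'p::{finite,linorder},'z::finite,'r::finite) l1_design"
  assumes D: "design_assumptions S" and wl: "0 < omega_l S" and w: "w \<in> C_omega S"
    and yt: "ode_sol yt (\<lambda>t. - (alpha S *\<^sub>R yt t) + Cm S *v (Am S *v vt t) + Cm S *v (Bbar S *v et t)) 0"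
    and vt: "ode_sol vt (\<lambda>t. A_v S *v vt t - matrix_inv (Pv S) *v (transpose (Am S) *v (transpose (Cm S) *v (Py S *v yt t)))) vt0"
    and ey: "\<And>t. t \<ge> 0 \<Longrightarrow> ey t = transpose (Bbar S) *v (transpose (Cm S) *v (Py S *v yt t))"
    and oh: "ode_sol oh (\<lambda>t. Go *\<^sub>R proj_omega S (oh t) (- (uz t \<bullet> ey t))) 1"
    and th: "ode_sol th (\<lambda>t. Gt *\<^sub>R proj_theta S (th t) (- (nh t *\<^sub>R ey t))) 0"
    and sh: "ode_sol sh (\<lambda>t. Gs *\<^sub>R proj_sigma S (sh t) (- ey t)) 0"
    and K: "\<And>t. t \<ge> 0 \<Longrightarrow> oh t \<in> C_omega S" "\<And>t. t \<ge> 0 \<Longrightarrow> infnorm (th t) \<le> d_bar S"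
      "\<And>t. t \<ge> 0 \<Longrightarrow> infnorm (sh t) \<le> b_bar S"
    and et: "\<And>t. t \<in> {0..\<tau>} \<Longrightarrow> et t = (oh t - w) *\<^sub>R uz t + (nh t *\<^sub>R th t - n t *\<^sub>R q t) + (sh t - r t)"
    and n: "\<And>t. t \<in> {0..\<tau>} \<Longrightarrow> \<bar>nh t - n t\<bar> \<le> infnorm (vt t)"
    and q: "pw_diff_bounded \<tau> (l_theta S) q" "\<And>t. t \<in> {0..\<tau>} \<Longrightarrow> infnorm (q t) \<le> d_bar S"
    and r: "pw_diff_bounded \<tau> (l_sigma S) r" "\<And>t. t \<in> {0..\<tau>} \<Longrightarrow> infnorm (r t) \<le> b_bar S"
    and l: "0 \<le> l_theta S" "0 \<le> l_sigma S" and G: "0 < Go" "0 < Gt" "0 < Gs"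
    and t: "t \<in> {0..\<tau>}"
  shows "yt t \<bullet> (Py S *v yt t) + vt t \<bullet> (Pv S *v vt t) \<le> vt0 \<bullet> (Pv S *v vt0) + theta_1 S / min Go (min Gt Gs)"
proof -
  define \<Gamma> where "\<Gamma> = min Go (min Gt Gs)"
  have \<Gamma>: "0 < \<Gamma>" "\<Gamma> \<le> Go" "\<Gamma> \<le> Gt" "\<Gamma> \<le> Gs" using G by (simp_all add: \<Gamma>_def)
  have Pys: "transpose (Py S) = Py S" and Pvs: "transpose (Pv S) = Pv S"
    using D unfolding design_assumptions_def pos_def_def by blast+
  let ?m = "real CARD('m)"
  have d0: "d_bar S \<ge> 0" "b_bar S \<ge> 0"
    using K(2,3)[of 0] infnorm_pos_le order_trans by (metis order_refl)+
  define wd where "wd t = 2 * ((- (alpha S *\<^sub>R yt t) + Cm S *v (Am S *v vt t) + Cm S *v (Bbar S *v et t)) \<bullet> (Py S *v yt t))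
     + 2 * ((A_v S *v vt t - matrix_inv (Pv S) *v (transpose (Am S) *v (transpose (Cm S) *v (Py S *v yt t)))) \<bullet> (Pv S *v vt t))" for t
  define W where "W t = yt t \<bullet> (Py S *v yt t) + vt t \<bullet> (Pv S *v vt t)" for t
  have Wode: "ode_sol W wd (vt0 \<bullet> (Pv S *v vt0))"
    using ode_sol_add[OF ode_sol_quadratic[OF yt Pys] ode_sol_quadratic[OF vt Pvs]]
    by (simp add: W_def[abs_def] wd_def[abs_def])
  define fo where "fo t = proj_omega S (oh t) (- (uz t \<bullet> ey t))" for t
  define ft where "ft t = proj_theta S (th t) (- (nh t *\<^sub>R ey t))" for t
  define fs where "fs t = proj_sigma S (sh t) (- ey t)" for t
  define V where "V t = W t + (oh t - w)\<^sup>2 / Go + ((th t - q t) \<bullet> (th t - q t)) / Gt + ((sh t - r t) \<bullet> (sh t - r t)) / Gs" for t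
  define c where "c = 4 * ?m * ((d_bar S * l_theta S + b_bar S * l_sigma S) / \<Gamma>)"
  define k where "k = vt0 \<bullet> (Pv S *v vt0) + theta_1 S / \<Gamma>"
  have lam: "lambda_1 S > 0" and W0: "W t \<ge> 0"
    and dec: "wd t + 2 * (fo t * (oh t - w)) + 2 * (ft t \<bullet> (th t - q t)) + 2 * (fs t \<bullet> (sh t - r t))
      \<le> - lambda_1 S * W t" if "t \<in> {0..\<tau>}" for t
  proof -
    have t0: "t \<ge> 0" using that by simp
    note L = lyapunov_pointwise[OF D w et[OF that] ey[OF t0] K(1)[OF t0] K(2)[OF t0] K(3)[OF t0] q(2)[OF that] r(2)[OF that] n[OF that]]
    show "lambda_1 S > 0" "W t \<ge> 0"
      "wd t + 2 * (fo t * (oh t - w)) + 2 * (ft t \<bullet> (th t - q t)) + 2 * (fs t \<bullet> (sh t - r t)) \<le> - lambda_1 S * W t"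
      using L unfolding wd_def W_def fo_def ft_def fs_def by auto
  qed
  have \<tau>0: "0 \<in> {0..\<tau>}" using t by simp
  note lam = lam[OF \<tau>0]
  have theta1: "theta_1 S / \<Gamma> = theta_0 S / \<Gamma> + c / lambda_1 S"
  proof -
    have "(a + b * (x / y)) / z = a / z + b * (x / z) / y" for a b x y z :: real
      by (simp add: add_divide_distrib mult.commute)
    then show ?thesis unfolding theta_1_def c_def .
  qed
  have c0: "c \<ge> 0" using d0 l \<Gamma>(1) by (simp add: c_def)
  \<comment> \<open>Estimate and true value lie in the same set, so each error is at most twice its
    radius; squaring gives the factor 4 of \<open>theta_0\<close>.\<close>
  have par: "(oh t - w)\<^sup>2 / Go + ((th t - q t) \<bullet> (th t - q t)) / Gt + ((sh t - r t) \<bullet> (sh t - r t)) / Gs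
      \<le> theta_0 S / \<Gamma>" if "t \<in> {0..\<tau>}" for t
  proof -
    have "\<bar>oh t - w\<bar> \<le> 2 * omega_u S"
      using K(1)[of t] w wl that by (auto simp: C_omega_def)
    from power_mono[OF this, of 2] have 1: "(oh t - w)\<^sup>2 \<le> 4 * (omega_u S)\<^sup>2"
      by (simp add: power_mult_distrib)
    have tri: "infnorm (a - b) \<le> 2 * x" if "infnorm a \<le> x" "infnorm b \<le> x" for a b :: "real^'m" and x
      using infnorm_triangle[of a "- b"] that by (simp add: infnorm_neg)
    have 2: "(th t - q t) \<bullet> (th t - q t) \<le> ?m * (2 * d_bar S)\<^sup>2"
      using K(2)[of t] q(2)[of t] that by (intro inner_self_le_infnorm tri) auto
    have 3: "(sh t - r t) \<bullet> (sh t - r t) \<le> ?m * (2 * b_bar S)\<^sup>2"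
      using K(3)[of t] r(2)[of t] that by (intro inner_self_le_infnorm tri) auto
    have "(oh t - w)\<^sup>2 / Go + ((th t - q t) \<bullet> (th t - q t)) / Gt + ((sh t - r t) \<bullet> (sh t - r t)) / Gs
        \<le> 4 * (omega_u S)\<^sup>2 / \<Gamma> + ?m * (2 * d_bar S)\<^sup>2 / \<Gamma> + ?m * (2 * b_bar S)\<^sup>2 / \<Gamma>"
      using \<Gamma> 1 2 3 by (intro add_mono frac_le) auto
    also have "\<dots> = theta_0 S / \<Gamma>"
      by (simp add: theta_0_def power_mult_distrib add_divide_distrib distrib_left mult_ac)
    finally show ?thesis .
  qed
  have "V t \<le> k"
  proof (rule stays_below[of \<tau> V k])
    have "continuous_on {0..\<tau>} q" "continuous_on {0..\<tau>} r" using q r by (auto simp: pw_diff_bounded_def)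
    then show "continuous_on {0..\<tau>} V"
      unfolding V_def
      by (intro continuous_intros continuous_on_subset[OF ode_sol_continuous[OF Wode]]
          continuous_on_subset[OF ode_sol_continuous[OF oh]] continuous_on_subset[OF ode_sol_continuous[OF th]]
          continuous_on_subset[OF ode_sol_continuous[OF sh]]) (use G in auto)
    have "theta_0 S / \<Gamma> \<le> theta_1 S / \<Gamma>" using theta1 c0 lam by simp
    then show "V 0 \<le> k"
      using par[OF \<tau>0] ode_sol_0[OF Wode] by (simp add: V_def k_def)
    fix s t assume st: "0 \<le> s" "s \<le> t" "t \<le> \<tau>" and ge: "\<And>x. s \<le> x \<Longrightarrow> x \<le> t \<Longrightarrow> k \<le> V x"
    have Wi: "wd integrable_on {s..t}" "W t - W s = integral {s..t} wd"
    proof -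
      have a: "wd integrable_on {0..t}"
        using set_lebesgue_integral_eq_integral(1)[OF loc_intD[OF ode_sol_loc_int[OF Wode], of t]] .
      then show "wd integrable_on {s..t}" by (rule integrable_on_subinterval) (use st in auto)
      show "W t - W s = integral {s..t} wd"
        using Henstock_Kurzweil_Integration.integral_combine[OF st(1,2) a] Wode st by (simp add: ode_sol_def)
    qed
    have to: "ode_sol oh (\<lambda>t. Go * fo t) 1" using oh by (simp add: fo_def)
    have tt: "ode_sol th (\<lambda>t. Gt *\<^sub>R ft t) 0" using th by (simp add: ft_def)
    have ts: "ode_sol sh (\<lambda>t. Gs *\<^sub>R fs t) 0" using sh by (simp add: fs_def)
    have o: "(\<lambda>x. (Go * fo x) * (oh x - w)) integrable_on {s..t}"
      "(oh t - w)\<^sup>2 - (oh s - w)\<^sup>2 \<le> 2 * integral {s..t} (\<lambda>x. (Go * fo x) * (oh x - w)) + 4 * 0 * 0 * (t - s)"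
    proof -
      show "(\<lambda>x. (Go * fo x) * (oh x - w)) integrable_on {s..t}"
      proof (rule set_lebesgue_integral_eq_integral(1)[OF loc_int_mult_continuous])
        show "(\<lambda>x. Go * fo x) absolutely_integrable_on {s..t}"
          by (rule set_integrable_subset[OF loc_intD[OF ode_sol_loc_int[OF to], of t]]) (use st in auto)
        show "continuous_on {s..t} (\<lambda>x. oh x - w)"
          by (intro continuous_intros continuous_on_subset[OF ode_sol_continuous[OF to]]) (use st in auto)
      qed
      have "\<bar>(oh t - w)\<^sup>2 - (oh s - w)\<^sup>2 - 2 * integral {s..t} (\<lambda>x. (Go * fo x) * (oh x - w))\<bar>
          \<le> 2 * 0 * (2 * omega_u S) * (t - s)"
        by (rule square_increment[OF to _ _ st, where q = "\<lambda>_. w"])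
          (use K(1) w wl in \<open>force simp: C_omega_def\<close>)+
      then show "(oh t - w)\<^sup>2 - (oh s - w)\<^sup>2 \<le> 2 * integral {s..t} (\<lambda>x. (Go * fo x) * (oh x - w)) + 4 * 0 * 0 * (t - s)"
        by simp
    qed
    note T = vec_square_increment[OF tt q(1) l(1) K(2) q(2) st]
    note R = vec_square_increment[OF ts r(1) l(2) K(3) r(2) st]
    have Ti: "(\<lambda>x. (Gt *\<^sub>R ft x) \<bullet> (th x - q x)) integrable_on {s..t}"
      and Tb: "(th t - q t) \<bullet> (th t - q t) - (th s - q s) \<bullet> (th s - q s)
        \<le> 2 * integral {s..t} (\<lambda>x. (Gt *\<^sub>R ft x) \<bullet> (th x - q x)) + 4 * ?m * (d_bar S * l_theta S) * (t - s)"
      using T by auto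
    have Ri: "(\<lambda>x. (Gs *\<^sub>R fs x) \<bullet> (sh x - r x)) integrable_on {s..t}"
      and Rb: "(sh t - r t) \<bullet> (sh t - r t) - (sh s - r s) \<bullet> (sh s - r s)
        \<le> 2 * integral {s..t} (\<lambda>x. (Gs *\<^sub>R fs x) \<bullet> (sh x - r x)) + 4 * ?m * (b_bar S * l_sigma S) * (t - s)"
      using R by auto
    let ?I1 = "integral {s..t} (\<lambda>x. (Go * fo x) * (oh x - w))"
    let ?I2 = "integral {s..t} (\<lambda>x. (Gt *\<^sub>R ft x) \<bullet> (th x - q x))"
    let ?I3 = "integral {s..t} (\<lambda>x. (Gs *\<^sub>R fs x) \<bullet> (sh x - r x))"
    have "V t - V s = (W t - W s) + ((oh t - w)\<^sup>2 / Go - (oh s - w)\<^sup>2 / Go)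
        + ((th t - q t) \<bullet> (th t - q t) / Gt - (th s - q s) \<bullet> (th s - q s) / Gt)
        + ((sh t - r t) \<bullet> (sh t - r t) / Gs - (sh s - r s) \<bullet> (sh s - r s) / Gs)"
      by (simp add: V_def)
    also have "\<dots> \<le> integral {s..t} wd + (2 / Go * ?I1 + 4 * 0 * (0 / \<Gamma>) * (t - s))
        + (2 / Gt * ?I2 + 4 * ?m * (d_bar S * l_theta S / \<Gamma>) * (t - s))
        + (2 / Gs * ?I3 + 4 * ?m * (b_bar S * l_sigma S / \<Gamma>) * (t - s))"
      unfolding Wi(2)
      by (intro add_mono order_refl scaled_increment o(2) Tb Rb \<Gamma>) (use d0 l st in auto)
    also have "\<dots> = (integral {s..t} wd + 2 / Go * ?I1 + 2 / Gt * ?I2 + 2 / Gs * ?I3) + c * (t - s)"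
      by (simp add: c_def add_divide_distrib distrib_left distrib_right)
    also have "integral {s..t} wd + 2 / Go * ?I1 + 2 / Gt * ?I2 + 2 / Gs * ?I3
        = integral {s..t} (\<lambda>x. wd x + 2 / Go * ((Go * fo x) * (oh x - w)) + 2 / Gt * ((Gt *\<^sub>R ft x) \<bullet> (th x - q x))
          + 2 / Gs * ((Gs *\<^sub>R fs x) \<bullet> (sh x - r x)))" (is "_ = integral _ ?g")
      using Wi(1) o(1) Ti Ri
      by (simp only: Henstock_Kurzweil_Integration.integral_add integrable_on_mult_right
          Henstock_Kurzweil_Integration.integrable_add Henstock_Kurzweil_Integration.integral_mult_right)
    also have "integral {s..t} ?g \<le> integral {s..t} (\<lambda>x. - c)"
    proof (rule integral_le)
      show "?g integrable_on {s..t}"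
        using Wi(1) o(1) Ti Ri
        by (intro integrable_on_mult_right Henstock_Kurzweil_Integration.integrable_add)
      fix x assume x: "x \<in> {s..t}"
      then have x': "x \<in> {0..\<tau>}" using st by auto
      \<comment> \<open>The parameter part cannot account for all of V >= k; the rest must be stored
        in W.\<close>
      have "W x \<ge> V x - theta_0 S / \<Gamma>" using par[OF x'] by (simp add: V_def)
      moreover have "V x \<ge> k" using ge[of x] x by simp
      moreover have "vt0 \<bullet> (Pv S *v vt0) \<ge> 0" using ode_sol_0[OF Wode] W0[OF \<tau>0] by simp
      ultimately have "W x \<ge> c / lambda_1 S" using theta1 by (simp add: k_def)
      then have "lambda_1 S * W x \<ge> c" using lam by (simp add: field_simps)
      moreover have "?g x = wd x + 2 * (fo x * (oh x - w)) + 2 * (ft x \<bullet> (th x - q x)) + 2 * (fs x \<bullet> (sh x - r x))"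
        using G by simp
      ultimately show "?g x \<le> - c" using dec[OF x'] by linarith
    qed (rule integrable_const_ivl)
    also have "\<dots> = - c * (t - s)" using st by simp
    finally show "V t \<le> V s" by simp
  qed (use t in auto)
  moreover have "W t \<le> V t"
    using G by (simp add: V_def)
  ultimately show ?thesis by (simp add: W_def k_def \<Gamma>_def)
qed

section \<open>Transfer matrices of the closed loop\<close>

lemma hurwitz_kernel:
  fixes A :: "real^'n^'n"
  assumes "hurwitz A"
  shows "invertible A"
proof -
  have "v = 0" if "A *v v = 0" for v
  proof (rule ccontr)
    assume "v \<noteq> 0"
    define z :: "complex^'n" where "z = (\<chi> i. of_real (v $ i))"
    have "z \<noteq> 0" using \<open>v \<noteq> 0\<close> by (simp add: z_def vec_eq_iff)
    moreover have "complex_mat A *v z = 0 *s z"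
      using that by (simp add: z_def vec_eq_iff complex_mat_def map_matrix_def matrix_vector_mult_def
          flip: of_real_mult of_real_sum)
    ultimately have "Re 0 < 0" using assms unfolding hurwitz_def by blast
    then show False by simp
  qed
  then show ?thesis using invertible_left_inverse matrix_left_invertible_ker by blast
qed

lemma rf_pole_const [simp]: "\<not> rf_pole (rf_const c) s"
  by (rule fin.const)

lemma resolvent_Rmat: "inf.Rmat (resolvent A)"
  using resolvent_proper by (auto simp: tf_strictly_proper_iff)

lemma rf_const_cancel: "w \<noteq> 0 \<Longrightarrow> rf_const (1 / w) * rf_const w = 1"
  unfolding rf_const_simps(5)[symmetric] by (simp add: rf_const_simps)

locale l1_setup =
  fixes S :: "('n::finite, 'm::finite, 'p::{finite,linorder}, 'z::finite, 'r::finite) l1_design" and w :: real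
  assumes plant: "plant_assumptions S" and inter: "interactor_assumptions S"
    and design: "design_assumptions S" and w: "w \<in> C_omega S"
begin

lemma omega_l_pos: "0 < omega_l S" and w_pos: "w > 0"
  using plant w by (auto simp: plant_assumptions_def C_omega_def)

lemma Am_hurwitz: "hurwitz (Am S)"
  using plant by (simp add: plant_assumptions_def)

text \<open>The relation C_m T_z = 0 is derived: multiplying the first interactor equation by C_m
  and comparing with the second leaves C_m T_z A_z = 0, and a Hurwitz A_z is invertible. It makes
  the output independent of the interactor states.\<close>

lemma interactor_relations:
  "Am S ** Tz S = Tz S ** Az S + Bbar S ** Cz S" "Bm S = Tz S ** Bz S + Bbar S ** Dz S"
  "Cm S ** Tz S = 0" "rank (Cm S ** Bbar S) = CARD('m)"
proof -
  have "Am S ** Tz S = Tz S ** Az S + Bbar S ** Cz S \<and> Bm S = Tz S ** Bz S + Bbar S ** Dz S \<and>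
    Cm S ** Tz S = 0 \<and> rank (Cm S ** Bbar S) = CARD('m)"
    using inter unfolding interactor_assumptions_def
  proof
    assume "state_absent S"
    then show ?thesis by (simp add: state_absent_def)
  next
    assume p: "state_present S"
    then have 1: "Am S ** Tz S = Tz S ** Az S + Bbar S ** Cz S" "Cm S ** Am S ** Tz S = Cm S ** Bbar S ** Cz S"
      and h: "hurwitz (Az S)" by (simp_all add: state_present_def)
    have "Cm S ** Tz S ** Az S + Cm S ** Bbar S ** Cz S = Cm S ** Bbar S ** Cz S"
      using arg_cong[OF 1(1), of "\<lambda>X. Cm S ** X"] 1(2) by (simp add: matrix_add_ldistrib matrix_mul_assoc)
    then have "Cm S ** Tz S ** Az S ** matrix_inv (Az S) = 0" by simp
    then have "Cm S ** Tz S = 0"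
      using matrix_inv_mult(1)[OF hurwitz_kernel[OF h]] by (metis matrix_mul_assoc matrix_mul_rid)
    then show ?thesis using p by (simp add: state_present_def)
  qed
  then show "Am S ** Tz S = Tz S ** Az S + Bbar S ** Cz S" "Bm S = Tz S ** Bz S + Bbar S ** Dz S"
    "Cm S ** Tz S = 0" "rank (Cm S ** Bbar S) = CARD('m)" by auto
qed

lemma CBinv_left: "CBinv S ** (Cm S ** Bbar S) = mat 1"
  unfolding CBinv_def by (rule pinv_left_inverse[OF interactor_relations(4)])

text \<open>The inverse interactor is free of finite poles but need not be proper. It is therefore
  only evaluated at finite points on its own and enters the operator calculus through products such
  as C Z^-1.\<close>

lemma Zinv_facts: "fin.Rmat s (Zinv_tf S)" "invertible (Z_tf S)"
proof -
  have "(\<forall>s. fin.Rmat s (Zinv_tf S)) \<and> invertible (Z_tf S)"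
    using inter unfolding interactor_assumptions_def
  proof
    assume a: "state_absent S"
    have "tf_const (0 :: real^'z^'m) = 0"
      by (simp add: tf_const_def map_matrix_def vec_eq_iff rf_const_simps)
    then have Z: "Z_tf S = mat 1"
      using a by (simp add: state_absent_def Z_tf_def tf_const_simps rf_const_simps matrix_matrix_mult_def[of 0])
    have "Zinv_tf S = mat 1" unfolding Zinv_tf_def Z by (rule matrix_inv_eqI) simp_all
    then show ?thesis using Z by (auto simp: fin.matrix_mat fin.one invertible_def intro!: exI[of _ "mat 1"])
  next
    assume "state_present S"
    then have "\<And>s. det (rosenbrock (Az S) (Bz S) (Cz S) (Dz S) s) \<noteq> 0" by (simp add: state_present_def)
    from rosenbrock_inverse[OF this] show ?thesis by (simp add: Zinv_tf_def Z_tf_def)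
  qed
  then show "fin.Rmat s (Zinv_tf S)" "invertible (Z_tf S)" by auto
qed

lemma Z_proper: "inf.Rmat (Z_tf S)"
  unfolding Z_tf_def by (intro inf.matrix_add inf.matrix_mult inf.matrix_const resolvent_Rmat)

section \<open>Stability and properness of the closed-loop transfer matrices\<close>

definition "wD = tf_scale (rf_const w) (Dtf S)"

lemma D_eq: "Dtf S = tf_scale (rf_const (1 / w)) wD"
  using w_pos by (simp add: wD_def tf_scale_simps rf_const_cancel)

lemma wD_inv: "(mat 1 + wD) ** matrix_inv (mat 1 + wD) = mat 1" "matrix_inv (mat 1 + wD) ** (mat 1 + wD) = mat 1"
  using design w by (auto simp: design_assumptions_def wD_def intro!: matrix_inv_mult)

lemma C_eq: "C_tf S w = wD ** matrix_inv (mat 1 + wD)"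
  by (simp add: C_tf_def C0_tf_def wD_def tf_scale_mult)

lemma one_minus_C: "mat 1 - C_tf S w = matrix_inv (mat 1 + wD)"
proof -
  have "C_tf S w + matrix_inv (mat 1 + wD) = (mat 1 + wD) ** matrix_inv (mat 1 + wD)"
    unfolding C_eq by (simp add: matrix_add_rdistrib)
  then have "C_tf S w + matrix_inv (mat 1 + wD) = mat 1" by (simp only: wD_inv)
  then show ?thesis by (metis add_diff_cancel_left')
qed

lemma wD_eq: "wD = (mat 1 + wD) ** C_tf S w"
proof -
  have c: "(mat 1 + wD) ** wD = wD ** (mat 1 + wD)"
    by (simp add: matrix_add_rdistrib matrix_add_ldistrib)
  have "(mat 1 + wD) ** C_tf S w = wD ** ((mat 1 + wD) ** matrix_inv (mat 1 + wD))"
    unfolding C_eq matrix_mul_assoc by (simp only: c)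
  then show ?thesis by (simp only: wD_inv matrix_mul_rid)
qed

lemma C_Zinv_strictly_proper: "tf_strictly_proper (C_tf S w ** Zinv_tf S)" and C_stable: "tf_stable (C_tf S w)"
  using design w by (auto simp: design_assumptions_def)

lemma C_strictly_proper: "tf_strictly_proper (C_tf S w)"
proof -
  have "C_tf S w = C_tf S w ** Zinv_tf S ** Z_tf S"
    using matrix_inv_mult(2)[OF Zinv_facts(2)] by (simp add: Zinv_tf_def flip: matrix_mul_assoc)
  then show ?thesis
    using tf_strictly_proper_mult_right[OF C_Zinv_strictly_proper Z_proper] by simp
qed

lemma C_proper: "inf.Rmat (C_tf S w)"
  using C_strictly_proper by (simp add: tf_strictly_proper_iff)

text \<open>The matrix 1 + \<omega> D is the inverse of 1 - C, which equals the identity at infinity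
  since C is strictly proper. Properness of D, and strict properness of D Z^-1, are obtained from
  this.\<close>

lemma one_plus_wD_proper: "inf.Rmat (mat 1 + wD)"
proof -
  have E: "inf.Rmat (mat 1 - C_tf S w)" by (intro inf.matrix_diff inf.matrix_mat inf.one C_proper)
  have "map_matrix feedthrough (mat 1 - C_tf S w) = mat 1"
    using C_strictly_proper unfolding inf.ev_matrix_diff[OF inf.matrix_mat[OF inf.one] C_proper]
    by (simp add: tf_strictly_proper_iff map_matrix_def[of _ "mat 1"] mat_def vec_eq_iff inf.ev_0 inf.ev_1)
  then have "inf.Rmat (matrix_inv (mat 1 - C_tf S w))"
    by (intro inf.matrix_inv E) (simp add: det_I)
  moreover have "matrix_inv (mat 1 - C_tf S w) = mat 1 + wD"
    unfolding one_minus_C by (rule matrix_inv_eqI) (rule wD_inv)+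
  ultimately show ?thesis by simp
qed

lemma D_proper: "inf.Rmat (Dtf S)"
  unfolding D_eq by (subst wD_eq) (intro inf.matrix_scale inf.const inf.matrix_mult one_plus_wD_proper C_proper)

lemma tf_strictly_proper_scale_const: "tf_strictly_proper G \<Longrightarrow> tf_strictly_proper (tf_scale (rf_const c) G)"
  unfolding tf_strictly_proper_iff
proof
  assume G: "inf.Rmat G \<and> map_matrix feedthrough G = 0"
  then show "inf.Rmat (tf_scale (rf_const c) G)" by (intro inf.matrix_scale inf.const) simp
  show "map_matrix feedthrough (tf_scale (rf_const c) G) = 0"
    using G by (simp add: map_matrix_def tf_scale_def vec_eq_iff inf.ev_mult inf.Rmat_def inf.const)
qed

lemma D_Zinv_strictly_proper: "tf_strictly_proper (Dtf S ** Zinv_tf S)"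
proof -
  have "Dtf S ** Zinv_tf S = tf_scale (rf_const (1 / w)) ((mat 1 + wD) ** (C_tf S w ** Zinv_tf S))"
    unfolding D_eq by (subst wD_eq) (simp add: tf_scale_mult(1) flip: matrix_mul_assoc)
  then show ?thesis
    using tf_strictly_proper_scale_const[OF tf_strictly_proper_mult_left[OF one_plus_wD_proper C_Zinv_strictly_proper]]
    by simp
qed

lemma C0_eq: "C0_tf S w = tf_scale (rf_const (1 / w)) (C_tf S w)"
  using w_pos by (simp add: C_tf_def tf_scale_simps rf_const_cancel)

text \<open>The push-through identity: D and (1 + \<omega> D)^-1 commute. The definition of
  \<open>C0_tf\<close> has the inverse on the right, whereas solving the loop for u produces it on
  the left.\<close>

lemma C0_left: "matrix_inv (mat 1 + wD) ** Dtf S = C0_tf S w"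
proof -
  have "matrix_inv (mat 1 + wD) ** wD = C_tf S w"
    by (subst wD_eq) (simp add: matrix_mul_assoc wD_inv)
  then show ?thesis unfolding C0_eq D_eq by (simp add: tf_scale_mult(2)[symmetric])
qed

lemma stable_proper_C: "stable_proper (C_tf S w)"
  using C_proper C_stable by (simp add: stable_proper_def)

lemma stable_proper_C0: "stable_proper (C0_tf S w)"
  unfolding C0_eq by (intro stable_proper_scale_const stable_proper_C)

lemma C0_Zinv: "tf_strictly_proper (C0_tf S w ** Zinv_tf S)" "stable_proper (C0_tf S w ** Zinv_tf S)"
proof -
  have e: "C0_tf S w ** Zinv_tf S = tf_scale (rf_const (1 / w)) (C_tf S w ** Zinv_tf S)"
    unfolding C0_eq by (simp add: tf_scale_mult)
  show sp: "tf_strictly_proper (C0_tf S w ** Zinv_tf S)"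
    unfolding e by (intro tf_strictly_proper_scale_const C_Zinv_strictly_proper)
  show "stable_proper (C0_tf S w ** Zinv_tf S)"
    using sp stable_proper_C0 Zinv_facts(1)
    by (auto simp: stable_proper_def tf_strictly_proper_iff tf_stable_iff fin.matrix_mult)
qed

lemma stable_proper_C1: "stable_proper (C1_tf S w)"
proof -
  let ?K = "C0_tf S w ** Zinv_tf S ** tf_const (CBinv S)"
  have "stable_proper ?K" by (intro stable_proper_mult C0_Zinv stable_proper_const)
  moreover have "tf_strictly_proper ?K"
    by (intro tf_strictly_proper_mult_right C0_Zinv inf.matrix_const)
  ultimately show ?thesis
    unfolding stable_proper_def C1_tf_def tf_stable_iff tf_strictly_proper_iff
    by (auto intro!: fin.matrix_scale fin.add[OF rf_s_eval(1) rf_pole_const])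
      (auto simp: inf.Rmat_def tf_scale_def map_matrix_def vec_eq_iff intro!: rf_proper_s_mult)
qed

lemma stable_proper_C2: "stable_proper (C2_tf S w)"
  unfolding C2_tf_def by (intro stable_proper_mult C0_Zinv stable_proper_const)

lemma stable_proper_H0: "stable_proper (H0_tf S)"
  unfolding H0_tf_def by (intro stable_proper_mult stable_proper_resolvent Am_hurwitz stable_proper_const)

lemma stable_proper_closed_loop: "stable_proper (G_tf S w)" "stable_proper (Hr_tf S w)"
  "stable_proper (H1_tf S w)" "stable_proper (H2_tf S w)" "stable_proper (C0_tf S w ** tf_const (Kg S))"
  unfolding G_tf_def Hr_tf_def H1_tf_def H2_tf_def
  by (intro stable_proper_mult stable_proper_H0 stable_proper_diff stable_proper_mat_1 stable_proper_C
      stable_proper_const stable_proper_scale_const stable_proper_C1 stable_proper_C2 stable_proper_C0)+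

end

section \<open>Signal identities\<close>

lemma stable_properD: "stable_proper G \<Longrightarrow> inf.Rmat G"
  by (simp add: stable_proper_def)

lemma linear_ode_response:
  assumes z: "ode_sol z (\<lambda>t. A *v z t + B *v v t) 0" and v: "loc_int v"
  shows "tf_response (resolvent A ** tf_const B) v z"
  by (rule tf_response_mult[OF resolvent_Rmat inf.matrix_const tf_response_const[OF v] ode_sol_imp_response[OF z loc_int_mat[OF v]]])

context l1_setup begin

lemma Z_response:
  assumes xu: "ode_sol xu (\<lambda>t. Az S *v xu t + Bz S *v u t) 0" and u: "loc_int u"
  shows "tf_response (Z_tf S) u (\<lambda>t. Cz S *v xu t + Dz S *v u t)"
proof -
  have R: "inf.Rmat (resolvent (Az S) ** tf_const (Bz S))"
    by (intro inf.matrix_mult resolvent_Rmat inf.matrix_const)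
  have "tf_response (tf_const (Cz S) ** (resolvent (Az S) ** tf_const (Bz S))) u (\<lambda>t. Cz S *v xu t)"
    by (rule tf_response_mult[OF inf.matrix_const R linear_ode_response[OF xu u] tf_response_const])
      (rule loc_int_continuous[OF ode_sol_continuous[OF xu]])
  from tf_response_add_left[OF inf.matrix_mult[OF inf.matrix_const R] inf.matrix_const this tf_response_const[OF u]]
  show ?thesis by (simp add: Z_tf_def matrix_mul_assoc)
qed

lemma tf_uminus: "- G = tf_scale (rf_const (-1)) G"
  by (simp add: tf_scale_def map_matrix_def vec_eq_iff rf_const_simps)

text \<open>Solving the loop \<open>u = - D Z\<^sup>-\<^sup>1 (Z q + \<eta>) \<close> with \<open>q = \<omega> u + f - K\<^sub>g r\<close> for \<open>u\<close>.\<close>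

lemma control_response:
  assumes u: "tf_response (- (Dtf S ** Zinv_tf S)) (\<lambda>t. zq t + et t) u"
    and zq: "tf_response (Z_tf S) (\<lambda>t. w *\<^sub>R u t - g t) zq" and et: "loc_int et"
    and g: "loc_int g"
    and a: "tf_response (C0_tf S w) g a" and b: "tf_response (C0_tf S w ** Zinv_tf S) et b"
    and t: "t \<ge> 0"
  shows "u t = a t - b t"
proof -
  let ?K = "Dtf S ** Zinv_tf S" and ?E = "matrix_inv (mat 1 + wD)"
  have Kp: "inf.Rmat ?K" using D_Zinv_strictly_proper by (simp add: tf_strictly_proper_iff)
  have Ep: "inf.Rmat ?E"
    unfolding one_minus_C[symmetric] by (intro inf.matrix_diff inf.matrix_mat inf.one C_proper)
  have ul: "loc_int u" using tf_response_loc_int(2)[OF u] Kp unfolding tf_uminus by (simp add: inf.matrix_scale inf.const)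
  have zl: "loc_int zq" by (rule tf_response_loc_int(2)[OF zq Z_proper])
  obtain k1 where k1: "tf_response ?K zq k1" using tf_response_exists[OF zl] .
  obtain k2 where k2: "tf_response ?K et k2" using tf_response_exists[OF et] .
  have "tf_response (- ?K) (\<lambda>t. zq t + et t) (\<lambda>t. (-1) *\<^sub>R (k1 t + k2 t))"
    unfolding tf_uminus by (intro tf_response_scale_const Kp tf_response_add k1 k2)
  then have uk: "u t = - (k1 t + k2 t)" if "t \<ge> 0" for t using tf_response_unique[OF u _ that] by simp
  have KZ: "?K ** Z_tf S = Dtf S"
    using matrix_inv_mult(2)[OF Zinv_facts(2)] by (simp add: Zinv_tf_def flip: matrix_mul_assoc)
  have k1D: "tf_response (Dtf S) (\<lambda>t. w *\<^sub>R u t - g t) k1"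
    using tf_response_mult[OF Kp Z_proper zq k1] unfolding KZ .
  obtain du where du: "tf_response (Dtf S) u du" using tf_response_exists[OF ul] .
  obtain dg where dg: "tf_response (Dtf S) g dg" using tf_response_exists[OF g] .
  have k1e: "k1 t = w *\<^sub>R du t - dg t" if "t \<ge> 0" for t
    using tf_response_unique[OF k1D tf_response_diff[OF D_proper tf_response_scaleR[OF du] dg] that] .
  have u1: "tf_response (mat 1) u u"
    using tf_response_const[OF ul, of "mat 1"] by (simp add: tf_const_simps rf_const_simps)
  have "tf_response wD u (\<lambda>t. w *\<^sub>R du t)"
    unfolding wD_def by (rule tf_response_scale_const[OF D_proper du])
  then have "tf_response (mat 1 + wD) u (\<lambda>t. u t + w *\<^sub>R du t)"
    by (intro tf_response_add_left u1 inf.matrix_mat inf.one) (auto simp: wD_def inf.matrix_scale inf.const D_proper)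
  \<comment> \<open>The loop now reads (1 + \<omega> D) u = D g - D Z^-1 e. Both sides are signals,
    so (1 + \<omega> D)^-1 = 1 - C may be applied as an operator.\<close>
  then have lhs: "tf_response (mat 1 + wD) u (\<lambda>t. dg t - k2 t)"
    by (rule tf_response_cong) (simp_all add: uk k1e)
  obtain eg where eg: "tf_response ?E dg eg"
    using tf_response_exists[OF tf_response_loc_int(2)[OF dg D_proper]] .
  obtain ek where ek: "tf_response ?E k2 ek"
    using tf_response_exists[OF tf_response_loc_int(2)[OF k2 Kp]] .
  have "tf_response (?E ** (mat 1 + wD)) u (\<lambda>t. eg t - ek t)"
    by (rule tf_response_mult[OF Ep one_plus_wD_proper lhs tf_response_diff[OF Ep eg ek]])
  then have "u t = eg t - ek t"
    unfolding wD_inv using tf_response_unique[OF u1 _ t] by blast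
  moreover have "tf_response (C0_tf S w) g eg"
    using tf_response_mult[OF Ep D_proper dg eg] by (simp add: C0_left)
  then have "eg t = a t" using tf_response_unique[OF _ a t] by blast
  moreover have "tf_response (C0_tf S w ** Zinv_tf S) et ek"
    using tf_response_mult[OF Ep Kp k2 ek] by (simp add: matrix_mul_assoc C0_left)
  then have "ek t = b t" using tf_response_unique[OF _ b t] by blast
  ultimately show ?thesis by simp
qed

text \<open>Eliminating \<open>\<eta> = (C\<^sub>m B)\<^sup>\<dagger> ((s + \<alpha>) y - C\<^sub>m A\<^sub>m v)\<close>.\<close>

lemma prediction_error_response:
  assumes yt: "ode_sol yt (\<lambda>t. - (alpha S *\<^sub>R yt t) + Cm S *v (Am S *v vt t) + Cm S *v (Bbar S *v et t)) 0"
    and vt: "loc_int vt" and et: "loc_int et"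
    and y1: "tf_response (C1_tf S w) yt y1" and y2: "tf_response (C2_tf S w) vt y2"
  shows "tf_response (C0_tf S w ** Zinv_tf S) et (\<lambda>t. y1 t - y2 t)"
proof -
  let ?L = "C0_tf S w ** Zinv_tf S" and ?A = "(- alpha S) *\<^sub>R (mat 1 :: real^('p::{finite,linorder})^('p::{finite,linorder}))"
  define \<phi> where "\<phi> t = Cm S *v (Am S *v vt t) + Cm S *v (Bbar S *v et t)" for t
  have \<phi>l: "loc_int \<phi>" unfolding \<phi>_def by (intro loc_int_add loc_int_mat vt et)
  have Lp: "inf.Rmat ?L" using C0_Zinv(2) by (rule stable_properD)
  have "ode_sol yt (\<lambda>t. ?A *v yt t + \<phi> t) 0"
  proof (rule ode_sol_cong[OF yt])
    fix t
    have "?A *v yt t = - (alpha S *\<^sub>R yt t)"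
      by (metis scaleR_matrix_vector_assoc matrix_vector_mul_lid scaleR_minus_left)
    then show "- (alpha S *\<^sub>R yt t) + Cm S *v (Am S *v vt t) + Cm S *v (Bbar S *v et t) = ?A *v yt t + \<phi> t"
      by (simp only: \<phi>_def add.assoc)
  qed simp_all
  then have "tf_response (resolvent ?A) \<phi> yt" by (rule ode_sol_imp_response[OF _ \<phi>l])
  from tf_response_mult[OF stable_properD[OF stable_proper_C1] resolvent_Rmat this y1]
  have "tf_response (C1_tf S w ** resolvent ?A) \<phi> y1" .
  \<comment> \<open>The error yt is (s + \<alpha>)^-1 applied to \<phi>, and this factor cancels
    against the one in \<open>C1_tf\<close>. Thus y1 is a filtered version of \<phi>, obtained
    without differentiating yt.\<close>
  moreover have "C1_tf S w ** resolvent ?A = ?L ** tf_const (CBinv S)"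
  proof -
    have "mat rf_s - tf_const ?A = tf_scale (rf_s + rf_const (alpha S)) (mat 1)"
      unfolding tf_const_simps(5) tf_const_simps(4) tf_scale_simps(5)
      by (simp add: rf_const_simps mat_def vec_eq_iff)
    then have "tf_scale (rf_s + rf_const (alpha S)) (resolvent ?A) = mat 1"
      using resolvent_inverse(1)[of ?A] by (metis tf_scale_mult(1) matrix_mul_lid)
    then show ?thesis
      unfolding C1_tf_def by (metis matrix_mul_rid tf_scale_mult)
  qed
  ultimately have 1: "tf_response (?L ** tf_const (CBinv S)) \<phi> y1" by simp
  obtain z where z: "tf_response ?L (\<lambda>t. CBinv S *v \<phi> t) z"
    using tf_response_exists[OF loc_int_mat[OF \<phi>l]] .
  have "tf_response (?L ** tf_const (CBinv S)) \<phi> z"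
    by (rule tf_response_mult[OF Lp inf.matrix_const tf_response_const[OF \<phi>l] z])
  then have zy: "z t = y1 t" if "t \<ge> 0" for t using tf_response_unique[OF _ 1 that] by blast
  have \<phi>e: "CBinv S *v \<phi> t = (CBinv S ** Cm S ** Am S) *v vt t + et t" for t
    unfolding \<phi>_def using CBinv_left
    by (simp add: matrix_vector_right_distrib matrix_vector_mul_assoc matrix_mul_assoc)
  obtain z2 where z2: "tf_response ?L (\<lambda>t. (CBinv S ** Cm S ** Am S) *v vt t) z2"
    using tf_response_exists[OF loc_int_mat[OF vt]] .
  have "tf_response (?L ** tf_const (CBinv S ** Cm S ** Am S)) vt z2"
    by (rule tf_response_mult[OF Lp inf.matrix_const tf_response_const[OF vt] z2])
  then have z2e: "z2 t = y2 t" if "t \<ge> 0" for t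
    using tf_response_unique[OF _ y2 that] unfolding C2_tf_def by blast
  have "tf_response ?L (\<lambda>t. CBinv S *v \<phi> t - (CBinv S ** Cm S ** Am S) *v vt t) (\<lambda>t. z t - z2 t)"
    by (rule tf_response_diff[OF Lp z z2])
  then show ?thesis by (rule tf_response_cong) (simp_all add: \<phi>e zy z2e)
qed

text \<open>The free response \<open>e\<^sup>A\<^sup>t x\<^sub>0\<close> is moved to the left.\<close>

lemma state_response:
  assumes dx: "ode_sol dx (\<lambda>t. Am S *v dx t + Bm S *v (w *\<^sub>R du t + dh t)) (- x0)"
    and dh: "loc_int dh" and c: "tf_response (C0_tf S w) dh c" and p: "loc_int p"
    and du: "\<And>t. t \<ge> 0 \<Longrightarrow> du t = p t - c t"
    and g: "tf_response (G_tf S w) dh g"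
    and h: "tf_response (H0_tf S) (\<lambda>t. w *\<^sub>R p t) h" and t: "t \<ge> 0"
  shows "dx t + mat_exp (t *\<^sub>R Am S) *v x0 = h t + g t"
proof -
  let ?e = "\<lambda>t. dx t + mat_exp (t *\<^sub>R Am S) *v x0"
  define v where "v t = w *\<^sub>R p t + (dh t - w *\<^sub>R c t)" for t
  have cl: "loc_int c" by (rule tf_response_loc_int(2)[OF c stable_properD[OF stable_proper_C0]])
  have vl: "loc_int v" unfolding v_def by (intro loc_int_add loc_int_diff loc_int_scaleR cl p dh)
  have "ode_sol ?e (\<lambda>t. Am S *v ?e t + Bm S *v v t) 0"
  proof (rule ode_sol_cong[OF ode_sol_add[OF dx mat_exp_ode_sol]])
    fix t :: real assume "t \<ge> 0"
    then have "w *\<^sub>R du t + dh t = v t" by (simp add: v_def du algebra_simps)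
    then show "Am S *v dx t + Bm S *v (w *\<^sub>R du t + dh t) + Am S *v (mat_exp (t *\<^sub>R Am S) *v x0) =
        Am S *v ?e t + Bm S *v v t" by (simp add: matrix_vector_right_distrib)
  qed simp_all
  then have e: "tf_response (H0_tf S) v ?e"
    unfolding H0_tf_def by (rule linear_ode_response[OF _ vl])
  note H0p = stable_properD[OF stable_proper_H0]
  have dh1: "tf_response (mat 1) dh dh"
    using tf_response_const[OF dh, of "mat 1"] by (simp add: tf_const_simps rf_const_simps)
  have "tf_response (tf_scale (rf_const (- w)) (C0_tf S w)) dh (\<lambda>t. (- w) *\<^sub>R c t)"
    by (rule tf_response_scale_const[OF stable_properD[OF stable_proper_C0] c])
  from tf_response_add_left[OF inf.matrix_mat[OF inf.one] _ dh1 this]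
  have "tf_response (mat 1 + tf_scale (rf_const (- w)) (C0_tf S w)) dh (\<lambda>t. dh t + (- w) *\<^sub>R c t)"
    by (simp add: inf.matrix_scale inf.const stable_properD[OF stable_proper_C0])
  moreover have "mat 1 + tf_scale (rf_const (- w)) (C0_tf S w) = mat 1 - C_tf S w"
    by (simp add: C_tf_def tf_scale_def map_matrix_def vec_eq_iff rf_const_simps)
  ultimately have d: "tf_response (mat 1 - C_tf S w) dh (\<lambda>t. dh t - w *\<^sub>R c t)" by simp
  have Ep: "inf.Rmat (mat 1 - C_tf S w)" by (intro inf.matrix_diff inf.matrix_mat inf.one C_proper)
  obtain g' where g': "tf_response (H0_tf S) (\<lambda>t. dh t - w *\<^sub>R c t) g'"
    using tf_response_exists[OF tf_response_loc_int(2)[OF d Ep]] .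
  have "g' t = g t"
    using tf_response_unique[OF tf_response_mult[OF H0p Ep d g', folded G_tf_def] g t] .
  moreover have "tf_response (H0_tf S) v (\<lambda>t. h t + g' t)"
    unfolding v_def by (intro tf_response_add H0p h g')
  then have "?e t = h t + g' t" by (rule tf_response_unique[OF e _ t])
  ultimately show ?thesis by simp
qed

lemma H_response:
  assumes y1: "tf_response (C1_tf S w) yt y1" and y2: "tf_response (C2_tf S w) vt y2"
    and h1: "tf_response (H1_tf S w) yt h1" and h2: "tf_response (H2_tf S w) vt h2"
  shows "tf_response (H0_tf S) (\<lambda>t. w *\<^sub>R (y1 t - y2 t)) (\<lambda>t. h1 t - h2 t)"
proof -
  note H0p = stable_properD[OF stable_proper_H0]
  note p = stable_properD[OF stable_proper_C1] stable_properD[OF stable_proper_C2]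
  obtain p1 where p1: "tf_response (H0_tf S) y1 p1" using tf_response_exists[OF tf_response_loc_int(2)[OF y1 p(1)]] .
  obtain p2 where p2: "tf_response (H0_tf S) y2 p2" using tf_response_exists[OF tf_response_loc_int(2)[OF y2 p(2)]] .
  have "tf_response (H1_tf S w) yt (\<lambda>t. w *\<^sub>R p1 t)"
    unfolding H1_tf_def
    by (intro tf_response_scale_const tf_response_mult[OF H0p _ y1 p1] inf.matrix_mult H0p p)
  then have 1: "w *\<^sub>R p1 t = h1 t" if "t \<ge> 0" for t using tf_response_unique[OF _ h1 that] by blast
  have "tf_response (H2_tf S w) vt (\<lambda>t. w *\<^sub>R p2 t)"
    unfolding H2_tf_def
    by (intro tf_response_scale_const tf_response_mult[OF H0p _ y2 p2] inf.matrix_mult H0p p)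
  then have 2: "w *\<^sub>R p2 t = h2 t" if "t \<ge> 0" for t using tf_response_unique[OF _ h2 that] by blast
  have "tf_response (H0_tf S) (\<lambda>t. w *\<^sub>R (y1 t - y2 t)) (\<lambda>t. w *\<^sub>R (p1 t - p2 t))"
    by (intro tf_response_scaleR tf_response_diff H0p p1 p2)
  then show ?thesis by (rule tf_response_cong) (simp_all add: 1 2 scaleR_diff_right)
qed

end

section \<open>The nonlinearity\<close>

lemma uncertainty_derivative:
  assumes "uncertainty S f" "\<delta> > 0" "t \<ge> 0" "infnorm x < \<delta>"
  obtains J where "((\<lambda>y. f y t) has_derivative (\<lambda>h. J *v h)) (at x)" "mat_infnorm J \<le> dfun S \<delta>"
  using assms unfolding uncertainty_def by blast

lemma uncertainty_continuous:
  assumes "uncertainty S f" "t \<ge> 0"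
  shows "isCont (\<lambda>y. f y t) x"
proof -
  have "infnorm x + 1 > 0" "infnorm x < infnorm x + 1" using infnorm_pos_le[of x] by linarith+
  then obtain J where "((\<lambda>y. f y t) has_derivative (\<lambda>h. J *v h)) (at x)"
    using uncertainty_derivative[OF assms(1) _ assms(2)] by metis
  then show ?thesis by (rule has_derivative_continuous)
qed

text \<open>The scalar mean value theorem is applied to each component along the segment, which
  stays in the convex ball. Taking components separately keeps the constant
  \<open>dfun S \<delta>\<close> for the infinity norm, with no factor depending on the
  dimension.\<close>

lemma uncertainty_Lipschitz_open:
  assumes f: "uncertainty S f" and \<delta>: "\<delta> > 0" and t: "t \<ge> 0" and x: "infnorm x < \<delta>" and y: "infnorm y < \<delta>"
  shows "infnorm (f x t - f y t) \<le> dfun S \<delta> * infnorm (x - y)"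
  unfolding infnorm_le_iff
proof
  fix i
  let ?p = "\<lambda>s. y + s *\<^sub>R (x - y)"
  have pin: "infnorm (?p s) < \<delta>" if "0 \<le> s" "s \<le> 1" for s
  proof -
    have "?p s = (1 - s) *\<^sub>R y + s *\<^sub>R x" by (simp add: algebra_simps)
    then have "infnorm (?p s) \<le> (1 - s) * infnorm y + s * infnorm x"
      using infnorm_triangle[of "(1 - s) *\<^sub>R y" "s *\<^sub>R x"] that by (simp add: infnorm_mul)
    also have "\<dots> < \<delta>"
      by (rule convex_bound_lt) (use x y that in auto)
    finally show ?thesis .
  qed
  have "\<forall>s\<in>{0..1}. \<exists>J. ((\<lambda>y. f y t) has_derivative (\<lambda>h. J *v h)) (at (?p s)) \<and> mat_infnorm J \<le> dfun S \<delta>"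
    using uncertainty_derivative[OF f \<delta> t pin] by (metis atLeastAtMost_iff)
  then obtain J where J: "\<And>s. s \<in> {0..1} \<Longrightarrow> ((\<lambda>y. f y t) has_derivative (\<lambda>h. J s *v h)) (at (?p s))"
    "\<And>s. s \<in> {0..1} \<Longrightarrow> mat_infnorm (J s) \<le> dfun S \<delta>" by metis
  have "((\<lambda>s. f (?p s) t $ i) has_real_derivative (J s *v (x - y)) $ i) (at s)" if "0 \<le> s" "s \<le> 1" for s
  proof -
    have "(?p has_vector_derivative (x - y)) (at s)"
      by (auto intro!: derivative_eq_intros)
    then have "((\<lambda>s. f (?p s) t) has_vector_derivative J s *v (x - y)) (at s)"
      using vector_derivative_diff_chain_within[of ?p "x - y" s UNIV "\<lambda>y. f y t" "\<lambda>h. J s *v h"] J(1)[of s] that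
      by (auto simp: comp_def intro: has_derivative_at_withinI)
    then have "((\<lambda>s. f (?p s) t $ i) has_vector_derivative (J s *v (x - y)) $ i) (at s)"
      by (rule bounded_linear.has_vector_derivative[OF bounded_linear_vec_nth])
    then show ?thesis by (simp add: has_real_derivative_iff_has_vector_derivative)
  qed
  from MVT2[OF zero_less_one this] obtain s where s: "0 < s" "s < 1"
    and e: "f (?p 1) t $ i - f (?p 0) t $ i = (1 - 0) * (J s *v (x - y)) $ i" by metis
  have "\<bar>(f x t - f y t) $ i\<bar> = \<bar>(J s *v (x - y)) $ i\<bar>" using e by simp
  also have "\<dots> \<le> infnorm (J s *v (x - y))" by (rule component_le_infnorm_cart)
  also have "\<dots> \<le> mat_infnorm (J s) * infnorm (x - y)" by (rule infnorm_mat_infnorm)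
  also have "\<dots> \<le> dfun S \<delta> * infnorm (x - y)"
    using J(2)[of s] s by (intro mult_right_mono infnorm_pos_le) auto
  finally show "\<bar>(f x t - f y t) $ i\<bar> \<le> dfun S \<delta> * infnorm (x - y)" .
qed

text \<open>Derivatives are bounded in the open ball only, while the a priori bound allows the plant
  state to reach its boundary. The point y is approached by s y with s tending to 1 from
  below.\<close>

lemma uncertainty_Lipschitz:
  assumes f: "uncertainty S f" and \<delta>: "\<delta> > 0" and t: "t \<ge> 0" and x: "infnorm x < \<delta>" and y: "infnorm y \<le> \<delta>"
  shows "infnorm (f x t - f y t) \<le> dfun S \<delta> * infnorm (x - y)"
proof -
  have lim: "((\<lambda>s. dfun S \<delta> * infnorm (x - s *\<^sub>R y)) \<longlongrightarrow> dfun S \<delta> * infnorm (x - 1 *\<^sub>R y)) (at_left 1)"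
    by (intro tendsto_intros)
  have "((\<lambda>s. f (s *\<^sub>R y) t) \<longlongrightarrow> f y t) (at_left 1)"
    by (rule isCont_tendsto_compose[OF uncertainty_continuous[OF f t]]) (auto intro!: tendsto_eq_intros)
  then have lim': "((\<lambda>s. infnorm (f x t - f (s *\<^sub>R y) t)) \<longlongrightarrow> infnorm (f x t - f y t)) (at_left 1)"
    by (intro tendsto_intros)
  have "\<forall>\<^sub>F s in at_left (1::real). 0 < s \<and> s < 1"
    by (auto simp: eventually_at_left[of 0 "1::real"] intro!: exI[of _ 0])
  then have "\<forall>\<^sub>F s in at_left 1. infnorm (f x t - f (s *\<^sub>R y) t) \<le> dfun S \<delta> * infnorm (x - s *\<^sub>R y)"
  proof eventually_elim
    case (elim s)
    have "s * infnorm y \<le> s * \<delta>" using y elim by (intro mult_left_mono) auto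
    also have "s * \<delta> < 1 * \<delta>" using elim \<delta> by (intro mult_strict_right_mono) auto
    finally have "infnorm (s *\<^sub>R y) < \<delta>" using elim by (simp add: infnorm_mul)
    then show ?case by (rule uncertainty_Lipschitz_open[OF f \<delta> t x])
  qed
  from tendsto_le[OF _ lim lim' this] show ?thesis by simp
qed

text \<open>The Lipschitz constant in the state is uniform in time, which controls f(x(t), t) -
  f(x(t0), t); the rest is continuity in time at the fixed state x(t0).\<close>

lemma uncertainty_comp_continuous:
  fixes f :: "real^'n \<Rightarrow> real \<Rightarrow> real^'m"
  assumes f: "uncertainty S f" and x: "continuous_on {0..} x"
  shows "continuous_on {0..} (\<lambda>t. f (x t) t)"
  unfolding continuous_on_def
proof
  fix t0 :: real assume t0: "t0 \<in> {0..}"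
  define \<delta> where "\<delta> = infnorm (x t0) + 1"
  have \<delta>: "\<delta> > 0" "infnorm (x t0) < \<delta>" using infnorm_pos_le[of "x t0"] by (auto simp: \<delta>_def)
  have xl: "(x \<longlongrightarrow> x t0) (at t0 within {0..})" using x t0 by (simp add: continuous_on_def)
  have "\<forall>\<^sub>F t in at t0 within {0..}. infnorm (x t) < \<delta>"
    using tendsto_infnorm[OF xl] \<delta>(2) by (rule order_tendstoD(2))
  moreover have "\<forall>\<^sub>F t in at t0 within {0..}. t \<in> {0..}" by (simp add: eventually_at_filter)
  ultimately have "\<forall>\<^sub>F t in at t0 within {0..}. infnorm (f (x t) t - f (x t0) t) \<le> dfun S \<delta> * infnorm (x t - x t0)"
    by eventually_elim (use uncertainty_Lipschitz_open[OF f \<delta>(1) _ _ \<delta>(2)] in auto)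
  then have "\<forall>\<^sub>F t in at t0 within {0..}. norm (f (x t) t - f (x t0) t)
      \<le> sqrt (real CARD('m)) * (dfun S \<delta> * infnorm (x t - x t0))"
  proof eventually_elim
    case (elim t)
    have "norm (f (x t) t - f (x t0) t) \<le> sqrt (real CARD('m)) * infnorm (f (x t) t - f (x t0) t)"
      using norm_le_infnorm[of "f (x t) t - f (x t0) t"] by simp
    also have "\<dots> \<le> sqrt (real CARD('m)) * (dfun S \<delta> * infnorm (x t - x t0))"
      by (intro mult_left_mono elim) simp
    finally show ?case .
  qed
  moreover have "((\<lambda>t. sqrt (real CARD('m)) * (dfun S \<delta> * infnorm (x t - x t0))) \<longlongrightarrow> 0) (at t0 within {0..})"
    by (auto intro!: tendsto_eq_intros xl simp: infnorm_0)
  ultimately have 1: "((\<lambda>t. f (x t) t - f (x t0) t) \<longlongrightarrow> 0) (at t0 within {0..})"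
    by (rule Lim_null_comparison)
  have "\<exists>v. ((\<lambda>s. f x s) has_vector_derivative v) (at t within {0..})"
    if "\<delta> > 0" "t \<ge> 0" "infnorm x < \<delta>" for \<delta> x t
    using f that unfolding uncertainty_def by blast
  from this[OF \<delta>(1) _ \<delta>(2)] t0 obtain v where "((\<lambda>s. f (x t0) s) has_vector_derivative v) (at t0 within {0..})"
    by auto
  then have "continuous (at t0 within {0..}) (\<lambda>s. f (x t0) s)"
    using has_vector_derivative_continuous by blast
  then have 2: "((\<lambda>t. f (x t0) t) \<longlongrightarrow> f (x t0) t0) (at t0 within {0..})"
    by (simp add: continuous_within)
  show "((\<lambda>t. f (x t) t) \<longlongrightarrow> f (x t0) t0) (at t0 within {0..})"
    using tendsto_add[OF 1 2] by simp
qed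

section \<open>Analysis of a closed-loop run\<close>

lemma vstack_nth: "vstack v w $ Inl i = v $ i" "vstack v w $ Inr j = w $ j"
  by (simp_all add: vstack_def)

lemma vstack_continuous:
  fixes v :: "real \<Rightarrow> real^'n" and w :: "real \<Rightarrow> real^'m"
  assumes "continuous_on T v" "continuous_on T w"
  shows "continuous_on T (\<lambda>t. vstack (v t) (w t))"
proof -
  have "continuous_on T (\<lambda>t. case i of Inl k \<Rightarrow> v t $ k | Inr k \<Rightarrow> w t $ k)" for i :: "'n + 'm"
    by (cases i) (auto intro!: continuous_intros assms)
  then show ?thesis unfolding vstack_def by (intro continuous_on_vec_lambda)
qed

text \<open>Estimated and true \<open>x_g\<close> share the component \<open>x_u\<close>, so the two
  regressors differ by at most the prediction error of \<open>x_v\<close>.\<close>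

lemma infnorm_vstack_diff: "\<bar>infnorm (vstack a c) - infnorm (vstack b c)\<bar> \<le> infnorm (a - b)"
  for a b :: "real^'n" and c :: "real^'m"
proof -
  have "infnorm (vstack a c - vstack b c) \<le> infnorm (a - b)"
    unfolding infnorm_le_iff
  proof
    fix i :: "'n + 'm"
    show "\<bar>(vstack a c - vstack b c) $ i\<bar> \<le> infnorm (a - b)"
      using component_le_infnorm_cart[of "a - b"] infnorm_pos_le[of "a - b"]
      by (cases i) (auto simp: vstack_nth)
  qed
  then show ?thesis using absdiff_infnorm order_trans by blast
qed

lemma hcat_vstack: "hcat A B *v vstack v w = A *v v + B *v (w :: real^'m)" for A :: "real^'n^'k"
  by (simp add: vec_eq_iff matrix_vector_mult_def hcat_def vstack_def sum_UNIV_sum)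

lemma Linf_on_le_iff: "Linf_on T x \<le> ereal b \<longleftrightarrow> (\<forall>t\<in>T. infnorm (x t) \<le> b)"
  by (simp add: Linf_on_def SUP_le_iff)

text \<open>At the first time where \<phi> is nonnegative, continuity makes it 0, and \<phi> is
  nonpositive up to there; the step then says that it is negative.\<close>

lemma continuation:
  fixes \<phi> :: "real \<Rightarrow> real"
  assumes c: "continuous_on {0..} \<phi>" and z: "\<phi> 0 < 0"
    and step: "\<And>\<tau>. \<tau> > 0 \<Longrightarrow> (\<And>t. t \<in> {0..\<tau>} \<Longrightarrow> \<phi> t \<le> 0) \<Longrightarrow> \<phi> \<tau> < 0" and t: "t \<ge> 0"
  shows "\<phi> t < 0"
proof (rule ccontr)
  assume neg: "\<not> \<phi> t < 0"
  define A where "A = {x \<in> {0..t}. - \<phi> x \<le> 0}"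
  have cab: "continuous_on {0..t} \<phi>" by (rule continuous_on_subset[OF c]) auto
  have "compact A" unfolding A_def by (intro compact_Collect_le continuous_intros cab)
  moreover have "t \<in> A" using neg t by (simp add: A_def)
  ultimately obtain s where s: "s \<in> A" "\<And>x. x \<in> A \<Longrightarrow> s \<le> x"
    by (metis compact_attains_inf empty_iff)
  have sb: "0 < s" "s \<le> t" "\<phi> s \<ge> 0" using s(1) z by (auto simp: A_def order_less_le)
  obtain x where x: "0 \<le> x" "x \<le> s" "\<phi> x = 0"
    using IVT'[of \<phi> 0 0 s] sb z continuous_on_subset[OF cab, of "{0..s}"] by auto
  then have "x = s" using s(2)[of x] sb by (simp add: A_def)
  have "\<phi> s < 0"
  proof (rule step[OF sb(1)])
    fix y assume y: "y \<in> {0..s}"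
    show "\<phi> y \<le> 0"
    proof (rule ccontr)
      assume "\<not> \<phi> y \<le> 0"
      then have "y \<in> A" using y sb by (simp add: A_def)
      then have "y = s" using s(2) y by fastforce
      then show False using \<open>\<not> \<phi> y \<le> 0\<close> x \<open>x = s\<close> by simp
    qed
  qed
  then show False using sb by simp
qed

text \<open>The passage from the 2-norm of x0 to its infinity norm costs the factor n, and
  subadditivity of the square root separates the initial state from the adaptation error. With L =
  \<open>lambda_max (Pv_bar S)\<close> the first coefficient is \<open>kappa_y\<close> or
  \<open>kappa_v\<close>.\<close>

lemma quadratic_form_bound:
  fixes z :: "real^'k" and x0 :: "real^'n"
  assumes P: "pos_def P" and z: "z \<bullet> (P *v z) \<le> L * (x0 \<bullet> x0) + T" and L: "L \<ge> 0" and T: "T \<ge> 0"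
  shows "infnorm z \<le> sqrt (real CARD('n) * (L / lambda_min P)) * infnorm x0 + sqrt T / sqrt (lambda_min P)"
proof -
  let ?l = "lambda_min P" and ?n = "real CARD('n)"
  have l: "?l > 0" by (rule lambda_pos_def(1)[OF P])
  have "?l * (z \<bullet> z) \<le> L * (x0 \<bullet> x0) + T"
    using lambda_bounds(1)[of P z] P z by (simp add: pos_def_def)
  also have "\<dots> \<le> L * (?n * (infnorm x0)\<^sup>2) + T"
    using inner_self_le_infnorm[of x0 "infnorm x0"] L by (simp add: mult_left_mono)
  finally have "z \<bullet> z \<le> ?n * (L / ?l) * (infnorm x0)\<^sup>2 + T / ?l"
    using l by (simp add: field_simps)
  then have "norm z \<le> sqrt (?n * (L / ?l) * (infnorm x0)\<^sup>2 + T / ?l)"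
    by (simp add: norm_eq_sqrt_inner)
  also have "\<dots> \<le> sqrt (?n * (L / ?l) * (infnorm x0)\<^sup>2) + sqrt (T / ?l)"
    using l L T by (intro sqrt_add_le_add_sqrt) auto
  also have "\<dots> = sqrt (?n * (L / ?l)) * infnorm x0 + sqrt T / sqrt ?l"
    by (simp add: real_sqrt_mult real_sqrt_divide infnorm_pos_le)
  finally show ?thesis using infnorm_le_norm[of z] by linarith
qed

context l1_setup begin

lemma lambda_1_pos: "lambda_1 S > 0"
proof -
  have "pos_def (Pv S)" "pos_def (Qmat S)" "eps_q S < lambda_min (Qmat S)" "0 < alpha_y S"
    using design unfolding design_assumptions_def by blast+
  then show ?thesis
    using lambda_min_shift(2)[of "Qmat S" "eps_q S"] lambda_pos_def(2)[of "Pv S"]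
    by (simp add: lambda_1_def pos_def_def)
qed

lemma lambda_max_Pv_bar: "transpose (Pv_bar S) = Pv_bar S" "lambda_max (Pv_bar S) \<ge> 0"
  "Pv_bar S = transpose (mat 1 - H_mat S ** Cm S) ** Pv S ** (mat 1 - H_mat S ** Cm S)"
proof -
  let ?N = "mat 1 - H_mat S ** Cm S"
  have Pv: "pos_def (Pv S)" using design unfolding design_assumptions_def by blast
  show e: "Pv_bar S = transpose ?N ** Pv S ** ?N" by (simp add: Pv_bar_def)
  show s: "transpose (Pv_bar S) = Pv_bar S"
    using Pv unfolding e by (simp add: matrix_transpose_mul matrix_mul_assoc pos_def_def)
  have "x \<bullet> (Pv_bar S *v x) \<ge> 0" for x
  proof -
    have "x \<bullet> (Pv_bar S *v x) = (?N *v x) \<bullet> (Pv S *v (?N *v x))"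
      unfolding e by (simp only: mat_adjoint matrix_vector_mul_assoc matrix_mul_assoc)
    also have "\<dots> \<ge> 0" using Pv by (cases "?N *v x = 0") (auto simp: pos_def_def intro: less_imp_le)
    finally show ?thesis .
  qed
  then show "lambda_max (Pv_bar S) \<ge> 0" by (rule lambda_max_nonneg[OF s])
qed

lemma kappa_nonneg: "kappa_y S \<ge> 0" "kappa_v S \<ge> 0" "kappa_x S w \<ge> 0" "kappa_m S \<ge> 1"
proof -
  have P: "pos_def (Py S)" "pos_def (Pv S)" using design unfolding design_assumptions_def by blast+
  show y: "kappa_y S \<ge> 0" and v: "kappa_v S \<ge> 0"
    using lambda_max_Pv_bar(2) lambda_pos_def(1)[OF P(1)] lambda_pos_def(1)[OF P(2)]
    by (auto simp: kappa_y_def kappa_v_def)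
  show "kappa_x S w \<ge> 0" using y v by (simp add: kappa_x_def L1_norm_nonneg)
  show "kappa_m S \<ge> 1" by (rule kappa_m_bounds(1)[OF Am_hurwitz])
qed

lemma ref_bounded: "t \<ge> 0 \<Longrightarrow> infnorm (ref_sig S t) \<le> r_Linf S"
proof -
  obtain B where B: "\<And>t. t \<ge> 0 \<Longrightarrow> norm (ref_sig S t) \<le> B"
    using plant by (auto simp: plant_assumptions_def bounded_iff)
  have le: "infnorm (ref_sig S t) \<le> B" if "t \<ge> 0" for t
    using B[OF that] infnorm_le_norm order_trans by blast
  have up: "Linf_on {0..} (ref_sig S) \<le> ereal B" by (simp add: Linf_on_le_iff le)
  have lo: "ereal (infnorm (ref_sig S t)) \<le> Linf_on {0..} (ref_sig S)" if "t \<ge> 0" for t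
    unfolding Linf_on_def by (rule SUP_upper) (use that in simp)
  have "\<bar>Linf_on {0..} (ref_sig S)\<bar> \<noteq> \<infinity>"
    using up lo[of 0] by auto
  then have "Linf_on {0..} (ref_sig S) = ereal (r_Linf S)"
    by (simp add: r_Linf_def ereal_real)
  then show "infnorm (ref_sig S t) \<le> r_Linf S" if "t \<ge> 0" using lo[OF that] by simp
qed

lemma ref_loc_int: "loc_int (ref_sig S)"
  unfolding loc_int_def
proof (intro allI impI)
  fix T :: real assume T: "T \<ge> 0"
  obtain B where B: "\<And>t. t \<ge> 0 \<Longrightarrow> norm (ref_sig S t) \<le> B"
    using plant by (auto simp: plant_assumptions_def bounded_iff)
  show "ref_sig S absolutely_integrable_on {0..T}"
  proof (rule measurable_bounded_by_integrable_imp_absolutely_integrable)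
    have "ref_sig S \<in> borel_measurable (lebesgue_on {0..})" using plant by (simp add: plant_assumptions_def)
    then show "ref_sig S \<in> borel_measurable (lebesgue_on {0..T})"
      by (rule measurable_restrict_mono) auto
    show "(\<lambda>t. B) integrable_on {0..T}" by (rule integrable_const_ivl)
  qed (use B in auto)
qed

section \<open>Consequences of the small-gain condition for the constants\<close>

lemma design_constants: "0 < gbar S" "0 < rho_r S" "0 < eps_gamma S" "0 < b0 S" "0 < rho0 S"
  "dfun S (rho_x S) > 0" "rho_x S > 0" "dfun S (rho_x S) \<le> L_delta S (rho_r S)" "L_delta S (rho_r S) > 0"
proof -
  show g: "0 < gbar S" and r: "0 < rho_r S" and "0 < eps_gamma S"
    using design unfolding design_assumptions_def by blast+
  show "0 < b0 S" "0 < rho0 S" using plant by (simp_all add: plant_assumptions_def)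
  show x: "rho_x S > 0" using g r by (simp add: rho_x_def)
  then show d: "dfun S (rho_x S) > 0" using plant by (simp add: plant_assumptions_def)
  have L: "L_delta S (rho_r S) = (rho_r S + gbar S) / rho_r S * dfun S (rho_x S)"
    by (simp add: L_delta_def rho_x_def)
  have "1 \<le> (rho_r S + gbar S) / rho_r S" using g r by simp
  from mult_right_mono[OF this, of "dfun S (rho_x S)"] d
  show le: "dfun S (rho_x S) \<le> L_delta S (rho_r S)" by (simp add: L)
  then show "L_delta S (rho_r S) > 0" using d by linarith
qed

lemma rho_nonneg: "rho_ext S w \<ge> 0" "rho_int S w \<ge> rho0 S"
proof -
  have "0 \<le> r_Linf S" using ref_bounded[of 0] infnorm_pos_le[of "ref_sig S 0"] by simp
  then show "rho_ext S w \<ge> 0"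
    using design_constants(4) by (simp add: rho_ext_def L1_norm_nonneg)
  have "1 * rho0 S \<le> (kappa_m S + kappa_x S w) * rho0 S"
    using kappa_nonneg design_constants(5) by (intro mult_right_mono) auto
  then show "rho_int S w \<ge> rho0 S" by (simp add: rho_int_def)
qed

text \<open>Multiplied out, the small-gain condition says that \<open>gain_gap\<close> times
  \<open>rho_r\<close> exceeds \<open>rho_ext + rho_int\<close>, from which the inequalities follow.
  The final identity is what makes the reference bound \<open>rho_rx\<close> and the deviation
  \<open>rho_dx\<close> add up to \<open>rho_x\<close>.\<close>

lemma gap: "gain_gap S w > 0" "rho_ext S w < gain_gap S w * rho_rx S w" "rho_rx S w \<le> rho_r S" "rho_rx S w > 0"
  "rho0 S < rho_r S" "rho_r S - rho_rx S w = gamma_x0 S w * rho0 S"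
proof -
  let ?G = "L1_norm (G_tf S w)" and ?L = "L_delta S (rho_r S)"
  have "?G < (rho_r S - rho_ext S w - rho_int S w) / (?L * rho_r S)"
    using design w unfolding design_assumptions_def by blast
  then have *: "?G * ?L * rho_r S < rho_r S - rho_ext S w - rho_int S w"
    using design_constants(2,9) by (simp add: pos_less_divide_eq mult.assoc)
  then have "gain_gap S w * rho_r S > rho_ext S w + rho_int S w"
    by (simp add: gain_gap_def algebra_simps)
  moreover from this have "gain_gap S w * rho_r S > 0"
    using rho_nonneg design_constants(5) by linarith
  ultimately show g: "gain_gap S w > 0"
    using design_constants(2) by (simp add: zero_less_mult_iff)
  have e: "gain_gap S w * rho_rx S w = gain_gap S w * rho_r S - rho_int S w"
    using g by (simp add: rho_rx_def algebra_simps)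
  then show l: "rho_ext S w < gain_gap S w * rho_rx S w"
    using \<open>gain_gap S w * rho_r S > rho_ext S w + rho_int S w\<close> by linarith
  show "rho_rx S w \<le> rho_r S"
    using g rho_nonneg(2) design_constants(5) by (simp add: rho_rx_def)
  show "rho_rx S w > 0"
    using l g rho_nonneg(1) by (smt (verit) zero_less_mult_iff)
  have "gain_gap S w * rho_r S \<le> 1 * rho_r S"
    using design_constants(2,9) L1_norm_nonneg[of "G_tf S w"]
    by (intro mult_right_mono) (auto simp: gain_gap_def)
  then show "rho0 S < rho_r S"
    using \<open>gain_gap S w * rho_r S > rho_ext S w + rho_int S w\<close> rho_nonneg by linarith
  show "rho_r S - rho_rx S w = gamma_x0 S w * rho0 S"
    by (simp add: rho_rx_def gamma_x0_def rho_int_def add.commute)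
qed

lemma gamma_nonneg: "gamma_x S w \<ge> 0" "gamma_u S w \<ge> 0" "gamma_x0 S w \<ge> 0" "gamma_u0 S w \<ge> 0"
proof -
  have P: "pos_def (Py S)" "pos_def (Pv S)" using design unfolding design_assumptions_def by blast+
  note p = lambda_pos_def(1)[OF P(1)] lambda_pos_def(1)[OF P(2)] gap(1) kappa_nonneg design_constants(9)
  show x: "gamma_x S w \<ge> 0" and x0: "gamma_x0 S w \<ge> 0"
    using p by (auto simp: gamma_x_def gamma_x0_def L1_norm_nonneg intro!: divide_nonneg_pos add_nonneg_nonneg)
  show "gamma_u S w \<ge> 0" "gamma_u0 S w \<ge> 0"
    using p x x0 by (auto simp: gamma_u_def gamma_u0_def L1_norm_nonneg intro!: divide_nonneg_pos add_nonneg_nonneg mult_nonneg_nonneg)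
qed

end

text \<open>The signals from \<open>xu\<close> to \<open>ey\<close> are the witnesses of the
  existential quantifier in \<open>closed_loop\<close>; here they are named, so that the internal
  state of the controller can be spoken about.\<close>

locale l1_run = l1_setup S w
  for S :: "('n::finite, 'm::finite, 'p::{finite,linorder}, 'z::finite, 'r::finite) l1_design" and w +
  fixes f :: "real^'n \<Rightarrow> real \<Rightarrow> real^'m" and x0 :: "real^'n" and Go Gt Gs :: real
    and x :: "real \<Rightarrow> real^'n" and u :: "real \<Rightarrow> real^'m" and y :: "real \<Rightarrow> real^('p::{finite,linorder})"
    and xr :: "real \<Rightarrow> real^'n" and ur :: "real \<Rightarrow> real^'m" and yr :: "real \<Rightarrow> real^('p::{finite,linorder})"
    and xu :: "real \<Rightarrow> real^'z" and uz :: "real \<Rightarrow> real^'m" and vh :: "real \<Rightarrow> real^'n" and yh :: "real \<Rightarrow> real^('p::{finite,linorder})"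
    and xvh :: "real \<Rightarrow> real^'n" and xgh :: "real \<Rightarrow> real^('n + 'z)" and oh :: "real \<Rightarrow> real"
    and th sh eh rz ey :: "real \<Rightarrow> real^'m"
  assumes unc: "uncertainty S f" and par: "parametrization S w f" and x0: "infnorm x0 \<le> rho0 S"
    and G: "0 < Go" "0 < Gt" "0 < Gs" "min Go (min Gt Gs) > theta_1 S / (eps_gamma S)\<^sup>2"
    and x_ode: "ode_sol x (\<lambda>t. Am S *v x t + Bm S *v (w *\<^sub>R u t + f (x t) t)) x0"
    and y: "\<And>t. t \<ge> 0 \<Longrightarrow> y t = Cm S *v x t"
    and xu_ode: "ode_sol xu (\<lambda>t. Az S *v xu t + Bz S *v u t) 0"
    and uz: "\<And>t. t \<ge> 0 \<Longrightarrow> uz t = Cz S *v xu t + Dz S *v u t"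
    and xvh: "\<And>t. t \<ge> 0 \<Longrightarrow> xvh t = vh t + H_mat S *v y t"
    and xgh: "\<And>t. t \<ge> 0 \<Longrightarrow> xgh t = vstack (xvh t) (xu t)"
    and eh: "\<And>t. t \<ge> 0 \<Longrightarrow> eh t = oh t *\<^sub>R uz t + infnorm (xgh t) *\<^sub>R th t + sh t"
    and ey: "\<And>t. t \<ge> 0 \<Longrightarrow> ey t = transpose (Bbar S) *v (transpose (Cm S) *v (Py S *v (yh t - y t)))"
    and rz: "tf_response (Z_tf S) (\<lambda>t. Kg S *v ref_sig S t) rz"
    and u_resp: "tf_response (- (Dtf S ** Zinv_tf S)) (\<lambda>t. eh t - rz t) u"
    and vh_ode: "ode_sol vh (\<lambda>t. A_v S *v xvh t - Kv S *v y t
          - matrix_inv (Pv S) *v (transpose (Am S) *v (transpose (Cm S) *v (Py S *v (yh t - y t))))) 0"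
    and yh_ode: "ode_sol yh (\<lambda>t. - (alpha S *\<^sub>R (yh t - y t)) + Cm S *v (Am S *v xvh t)
          + Cm S *v (Bbar S *v eh t)) (Cm S *v x0)"
    and oh_ode: "ode_sol oh (\<lambda>t. Go *\<^sub>R proj_omega S (oh t) (- (uz t \<bullet> ey t))) 1"
    and th_ode: "ode_sol th (\<lambda>t. Gt *\<^sub>R proj_theta S (th t) (- (infnorm (xgh t) *\<^sub>R ey t))) 0"
    and sh_ode: "ode_sol sh (\<lambda>t. Gs *\<^sub>R proj_sigma S (sh t) (- ey t)) 0"
    and xr_ode: "ode_sol xr (\<lambda>t. Am S *v xr t + Bm S *v (w *\<^sub>R ur t + f (xr t) t)) 0"
    and yr: "\<And>t. t \<ge> 0 \<Longrightarrow> yr t = Cm S *v xr t"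
    and ur_resp: "tf_response (C0_tf S w) (\<lambda>t. Kg S *v ref_sig S t - f (xr t) t) ur"
begin

section \<open>Filtered plant state and dynamics of the prediction errors\<close>

lemma x_cont: "continuous_on {0..} x" by (rule ode_sol_continuous[OF x_ode])
lemma xr_cont: "continuous_on {0..} xr" by (rule ode_sol_continuous[OF xr_ode])
lemma xu_cont: "continuous_on {0..} xu" by (rule ode_sol_continuous[OF xu_ode])

lemma u_cont: "continuous_on {0..} u" and u_0: "u 0 = 0"
  using tf_response_continuous[OF _ u_resp] D_Zinv_strictly_proper
  unfolding tf_uminus by (simp_all add: tf_strictly_proper_scale_const)

lemma mat_cont: "continuous_on T v \<Longrightarrow> continuous_on T (\<lambda>t. (A :: real^'i^'j) *v v t)"
  by (rule bounded_linear.continuous_on[OF matrix_vector_mul_bounded_linear])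

definition "eta t = f (x t) t"
definition "etar t = f (xr t) t"

lemma eta_cont: "continuous_on {0..} eta" and etar_cont: "continuous_on {0..} etar"
  unfolding eta_def[abs_def] etar_def[abs_def]
  by (intro uncertainty_comp_continuous[OF unc] x_cont xr_cont)+

text \<open>The filter state occurs only in the analysis, not in the loop. Driven by the already
  given signal f(x(t), t), its equation is linear, and the resolvent yields a solution.\<close>

definition "xf = (SOME xf. ode_sol xf (\<lambda>t. Az S *v xf t + Bz S *v eta t) 0)"

lemma xf_ode: "ode_sol xf (\<lambda>t. Az S *v xf t + Bz S *v eta t) 0"
proof -
  obtain z where "tf_response (resolvent (Az S)) (\<lambda>t. Bz S *v eta t) z"
    using tf_response_exists[OF loc_int_mat[OF loc_int_continuous[OF eta_cont]]] .
  then have "ode_sol z (\<lambda>t. Az S *v z t + Bz S *v eta t) 0" by (rule response_imp_ode_sol)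
  then show ?thesis
    unfolding xf_def by (rule someI[of "\<lambda>xf. ode_sol xf (\<lambda>t. Az S *v xf t + Bz S *v eta t) 0"])
qed

lemma xf_cont: "continuous_on {0..} xf" by (rule ode_sol_continuous[OF xf_ode])

text \<open>The algebraic relations in \<open>parametrization\<close> are required for all real t,
  whereas \<open>uz\<close> is specified only for t >= 0. This version satisfies them everywhere;
  the same holds for the definitions that follow from it.\<close>

definition "uz' t = Cz S *v xu t + Dz S *v u t"
definition "fbar t = Cz S *v xf t + Dz S *v f (x t) t"
definition "xv t = x t - w *\<^sub>R (Tz S *v xu t) - Tz S *v xf t"
definition "q t = w *\<^sub>R uz' t + fbar t"
definition "et t = eh t - q t"
definition "yt t = yh t - y t"
definition "vt t = xvh t - xv t"

lemma fbar_eta: "fbar t = Cz S *v xf t + Dz S *v eta t"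
  by (simp add: fbar_def eta_def)

lemma q_cont: "continuous_on {0..} q"
  unfolding q_def uz'_def fbar_eta by (intro continuous_intros mat_cont xu_cont u_cont xf_cont eta_cont)

lemma et_loc_int: "loc_int et"
proof -
  have "loc_int rz" by (rule tf_response_loc_int(2)[OF rz Z_proper])
  moreover have "loc_int (\<lambda>t. eh t - rz t)" using u_resp by (simp add: tf_response_iff)
  ultimately have "loc_int (\<lambda>t. (eh t - rz t) + rz t)" by (intro loc_int_add)
  then have e: "loc_int eh" by simp
  show ?thesis unfolding et_def by (intro loc_int_diff e loc_int_continuous q_cont)
qed

lemma Am_Tz: "Am S *v (Tz S *v a) = Tz S *v (Az S *v a) + Bbar S *v (Cz S *v a)"
  using arg_cong[OF interactor_relations(1), of "\<lambda>X. X *v a"]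
  by (simp add: matrix_vector_mul_assoc matrix_vector_mult_add_rdistrib)

lemma Bm_eq: "Bm S *v a = Tz S *v (Bz S *v a) + Bbar S *v (Dz S *v a)"
  using interactor_relations(2) by (simp add: matrix_vector_mul_assoc matrix_vector_mult_add_rdistrib)

lemma Cm_Tz: "Cm S *v (Tz S *v a) = 0"
  using interactor_relations(3) by (simp add: matrix_vector_mul_assoc)

text \<open>Subtracting T_z applied to the filter states of \<omega> u and f moves the input from
  B_m to the matrix \<open>Bbar S\<close>: by the interactor relations the terms with A_z and B_z
  cancel, and \<open>q\<close>, the filtered total input, remains.\<close>

lemma xv_ode: "ode_sol xv (\<lambda>t. Am S *v xv t + Bbar S *v q t) x0"
proof -
  have "ode_sol (\<lambda>t. x t - w *\<^sub>R (Tz S *v xu t) - Tz S *v xf t)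
     (\<lambda>t. (Am S *v x t + Bm S *v (w *\<^sub>R u t + f (x t) t)) - w *\<^sub>R (Tz S *v (Az S *v xu t + Bz S *v u t))
       - Tz S *v (Az S *v xf t + Bz S *v eta t)) (x0 - w *\<^sub>R (Tz S *v 0) - Tz S *v 0)"
    by (intro ode_sol_diff ode_sol_scaleR ode_sol_mat x_ode xu_ode xf_ode)
  then show ?thesis
  proof (rule ode_sol_cong)
    fix t
    show "(Am S *v x t + Bm S *v (w *\<^sub>R u t + f (x t) t)) - w *\<^sub>R (Tz S *v (Az S *v xu t + Bz S *v u t))
       - Tz S *v (Az S *v xf t + Bz S *v eta t) = Am S *v xv t + Bbar S *v q t"
      by (simp add: xv_def q_def uz'_def fbar_eta eta_def[symmetric] Bm_eq Am_Tz matrix_vector_right_distrib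
          matrix_vector_mult_diff_distrib matrix_vector_mult_scaleR scaleR_add_right scaleR_diff_right)
  qed (simp_all add: xv_def)
qed

lemma y_xv: "t \<ge> 0 \<Longrightarrow> y t = Cm S *v xv t"
  by (simp add: y xv_def matrix_vector_mult_diff_distrib matrix_vector_mult_scaleR Cm_Tz)

lemma yt_ode: "ode_sol yt (\<lambda>t. - (alpha S *\<^sub>R yt t) + Cm S *v (Am S *v vt t) + Cm S *v (Bbar S *v et t)) 0"
proof (rule ode_sol_cong[OF ode_sol_diff[OF yh_ode ode_sol_mat[OF xv_ode, of "Cm S"]]])
  fix t :: real
  show "- (alpha S *\<^sub>R (yh t - y t)) + Cm S *v (Am S *v xvh t) + Cm S *v (Bbar S *v eh t)
      - Cm S *v (Am S *v xv t + Bbar S *v q t)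
     = - (alpha S *\<^sub>R yt t) + Cm S *v (Am S *v vt t) + Cm S *v (Bbar S *v et t)"
    by (simp add: yt_def vt_def et_def matrix_vector_right_distrib matrix_vector_mult_diff_distrib)
qed (simp_all add: yt_def y_xv)

text \<open>The projector N = 1 - H C_m annihilates \<open>Bbar S\<close>, so N x_v obeys an
  equation free of the unknown input q. Moreover vt = vh - N x_v, and vh starts at 0; hence the
  initial error -N x0, whose quadratic form in P_v is that of \<open>Pv_bar S\<close> at x0.\<close>

lemma vt_ode: "ode_sol vt (\<lambda>t. A_v S *v vt t
    - matrix_inv (Pv S) *v (transpose (Am S) *v (transpose (Cm S) *v (Py S *v yt t)))) (- ((mat 1 - H_mat S ** Cm S) *v x0))"
proof -
  let ?N = "mat 1 - H_mat S ** Cm S"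
  have NB: "?N *v (Bbar S *v a) = 0" for a
  proof -
    have "H_mat S ** Cm S ** Bbar S = Bbar S ** (CBinv S ** (Cm S ** Bbar S))"
      by (simp add: H_mat_def matrix_mul_assoc)
    then have "H_mat S ** Cm S ** Bbar S = Bbar S" by (simp only: CBinv_left matrix_mul_rid)
    then have "(H_mat S ** Cm S) *v (Bbar S *v a) = Bbar S *v a" by (simp only: matrix_vector_mul_assoc)
    then show ?thesis
      by (simp only: matrix_vector_mult_diff_rdistrib matrix_vector_mul_lid diff_self)
  qed
  show ?thesis
  proof (rule ode_sol_cong[OF ode_sol_diff[OF vh_ode ode_sol_mat[OF xv_ode, of ?N]]])
    fix t :: real assume t: "t \<ge> 0"
    show "vh t - ?N *v xv t = vt t"
      using t by (simp add: vt_def xvh y_xv matrix_vector_mult_diff_rdistrib matrix_vector_mul_assoc)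
    have "A_v S *v xv t = ?N *v (Am S *v xv t) + Kv S *v y t"
      using t by (simp add: A_v_def A_H_def y_xv matrix_vector_mult_add_rdistrib matrix_vector_mul_assoc)
    then show "A_v S *v xvh t - Kv S *v y t - matrix_inv (Pv S) *v (transpose (Am S) *v (transpose (Cm S) *v (Py S *v (yh t - y t))))
      - ?N *v (Am S *v xv t + Bbar S *v q t)
      = A_v S *v vt t - matrix_inv (Pv S) *v (transpose (Am S) *v (transpose (Cm S) *v (Py S *v yt t)))"
      using NB by (simp add: vt_def yt_def matrix_vector_right_distrib matrix_vector_mult_diff_distrib)
  qed simp_all
qed

lemma vt_loc_int: "loc_int vt" and yt_cont: "continuous_on {0..} yt"
  by (rule loc_int_continuous[OF ode_sol_continuous[OF vt_ode]]) (rule ode_sol_continuous[OF yt_ode])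

section \<open>The Lyapunov bound along the run\<close>

definition "Gam = min Go (min Gt Gs)"
definition "mu = sqrt (theta_1 S / Gam)"

lemma ey_cont: "continuous_on {0..} ey"
proof (rule continuous_on_cong[THEN iffD1, OF refl])
  show "continuous_on {0..} (\<lambda>t. transpose (Bbar S) *v (transpose (Cm S) *v (Py S *v yt t)))"
    by (intro mat_cont yt_cont)
qed (simp add: ey yt_def)

lemma uz_cont: "continuous_on {0..} uz"
proof (rule continuous_on_cong[THEN iffD1, OF refl])
  show "continuous_on {0..} uz'"
    unfolding uz'_def by (intro continuous_intros mat_cont xu_cont u_cont)
qed (simp add: uz uz'_def)

lemma xgh_cont: "continuous_on {0..} xgh"
proof (rule continuous_on_cong[THEN iffD1, OF refl])
  have "continuous_on {0..} (\<lambda>t. vh t + H_mat S *v (Cm S *v x t))"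
    by (intro continuous_intros mat_cont x_cont ode_sol_continuous[OF vh_ode])
  then show "continuous_on {0..} (\<lambda>t. vstack (vh t + H_mat S *v (Cm S *v x t)) (xu t))"
    by (intro vstack_continuous xu_cont)
qed (simp add: xgh xvh y)

text \<open>Invariance under the projected laws is granted for continuous driving signals, hence the
  continuity of the regressors and of \<open>ey\<close>. Nonnegative radii put the initial value 0
  into the two balls.\<close>

lemma estimates_in_sets:
  assumes "d_bar S \<ge> 0" "b_bar S \<ge> 0" and t: "t \<ge> 0"
  shows "oh t \<in> C_omega S" "infnorm (th t) \<le> d_bar S" "infnorm (sh t) \<le> b_bar S"
proof -
  have p: "projection_operator (C_omega S) (proj_omega S)"
    "projection_operator {q. infnorm q \<le> d_bar S} (proj_theta S)"
    "projection_operator {q. infnorm q \<le> b_bar S} (proj_sigma S)" "1 \<in> C_omega S"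
    using design unfolding design_assumptions_def by blast+
  have inv: "qh t \<in> K" if "projection_operator K P" "g > 0" "continuous_on {0..} z" "q0 \<in> K"
    "ode_sol qh (\<lambda>t. g *\<^sub>R P (qh t) (z t)) q0" for K P g z qh q0
    using that t unfolding projection_operator_def by blast
  show "oh t \<in> C_omega S"
    by (rule inv[OF p(1) G(1) _ p(4) oh_ode]) (intro continuous_intros uz_cont ey_cont)
  have "th t \<in> {q. infnorm q \<le> d_bar S}"
    by (rule inv[OF p(2) G(2) _ _ th_ode]) (use assms in \<open>auto intro!: continuous_intros xgh_cont ey_cont simp: infnorm_0\<close>)
  then show "infnorm (th t) \<le> d_bar S" by simp
  have "sh t \<in> {q. infnorm q \<le> b_bar S}"
    by (rule inv[OF p(3) G(3) _ _ sh_ode]) (use assms in \<open>auto intro!: continuous_intros ey_cont simp: infnorm_0\<close>)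
  then show "infnorm (sh t) \<le> b_bar S" by simp
qed

lemma lyapunov_on_interval:
  assumes \<tau>: "\<tau> > 0" and xb: "\<And>t. t \<in> {0..\<tau>} \<Longrightarrow> infnorm (x t) \<le> rho_x S"
    and ub: "\<And>t. t \<in> {0..\<tau>} \<Longrightarrow> infnorm (u t) \<le> rho_u S w" and t: "t \<in> {0..\<tau>}"
  shows "yt t \<bullet> (Py S *v yt t) + vt t \<bullet> (Pv S *v vt t)
      \<le> lambda_max (Pv_bar S) * (x0 \<bullet> x0) + theta_1 S / Gam"
    and "theta_1 S \<ge> 0"
proof -
  let ?xg = "\<lambda>t. vstack (xv t) (xu t)"
  have l: "0 \<le> l_theta S" "0 \<le> l_sigma S" using par by (simp_all add: parametrization_def)
  have "\<exists>\<theta> \<sigma>. pw_diff_bounded \<tau> (l_theta S) \<theta> \<and> pw_diff_bounded \<tau> (l_sigma S) \<sigma> \<and>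
     (\<forall>t\<in>{0..\<tau>}. fbar t = infnorm (?xg t) *\<^sub>R \<theta> t + \<sigma> t \<and> infnorm (\<theta> t) \<le> d_bar S \<and> infnorm (\<sigma> t) \<le> b_bar S)"
  proof -
    have 1: "x t = T_g S w *v ?xg t + Tz S *v xf t" for t
      by (simp add: T_g_def hcat_vstack xv_def scaleR_matrix_vector_assoc[symmetric])
    have 2: "ode_sol xv (\<lambda>t. Am S *v xv t + Bbar S *v (w *\<^sub>R uz' t + fbar t)) x0"
      using xv_ode by (simp add: q_def[abs_def])
    have 3: "ode_sol xf (\<lambda>t. Az S *v xf t + Bz S *v f (x t) t) 0"
      using xf_ode by (simp add: eta_def)
    have 4: "Linf_on {0..\<tau>} x \<le> ereal (rho_x S)" "Linf_on {0..\<tau>} u \<le> ereal (rho_u S w)"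
      using xb ub by (simp_all add: Linf_on_le_iff)
    have prem: "infnorm x0 \<le> rho0 S \<and> continuous_on {0..} u \<and>
        (\<forall>t. ?xg t = vstack (xv t) (xu t)) \<and>
        (\<forall>t. x t = T_g S w *v ?xg t + Tz S *v xf t) \<and>
        (\<forall>t. uz' t = Cz S *v xu t + Dz S *v u t) \<and>
        (\<forall>t. fbar t = Cz S *v xf t + Dz S *v f (x t) t) \<and>
        ode_sol xu (\<lambda>t. Az S *v xu t + Bz S *v u t) 0 \<and>
        ode_sol xv (\<lambda>t. Am S *v xv t + Bbar S *v (w *\<^sub>R uz' t + fbar t)) x0 \<and>
        ode_sol xf (\<lambda>t. Az S *v xf t + Bz S *v f (x t) t) 0"
      using x0 u_cont 1 uz'_def fbar_def xu_ode 2 3 by blast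
    show ?thesis
      using par[unfolded parametrization_def, THEN conjunct2, THEN conjunct2, rule_format, OF prem \<tau>] 4 by blast
  qed
  then obtain \<theta> \<sigma> where par: "pw_diff_bounded \<tau> (l_theta S) \<theta>" "pw_diff_bounded \<tau> (l_sigma S) \<sigma>"
    "\<And>t. t \<in> {0..\<tau>} \<Longrightarrow> fbar t = infnorm (?xg t) *\<^sub>R \<theta> t + \<sigma> t"
    "\<And>t. t \<in> {0..\<tau>} \<Longrightarrow> infnorm (\<theta> t) \<le> d_bar S" "\<And>t. t \<in> {0..\<tau>} \<Longrightarrow> infnorm (\<sigma> t) \<le> b_bar S"
    by blast
  \<comment> \<open>The parametrization itself shows this: the radii bound the norms of \<theta>(0)
    and \<sigma>(0).\<close>
  have d0: "d_bar S \<ge> 0" "b_bar S \<ge> 0"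
    using par(4,5)[of 0] \<tau> infnorm_pos_le[of "\<theta> 0"] infnorm_pos_le[of "\<sigma> 0"] by auto
  then show "theta_1 S \<ge> 0"
    using l lambda_1_pos unfolding theta_1_def theta_0_def
    by (intro add_nonneg_nonneg mult_nonneg_nonneg divide_nonneg_pos) auto
  let ?N = "mat 1 - H_mat S ** Cm S"
  have "yt t \<bullet> (Py S *v yt t) + vt t \<bullet> (Pv S *v vt t) \<le> (- (?N *v x0)) \<bullet> (Pv S *v (- (?N *v x0))) + theta_1 S / min Go (min Gt Gs)"
  proof (rule lyapunov_bound[OF design omega_l_pos w yt_ode vt_ode _ oh_ode th_ode sh_ode
        estimates_in_sets(1)[OF d0] estimates_in_sets(2)[OF d0] estimates_in_sets(3)[OF d0] _ _ par(1) par(4) par(2) par(5) l G(1-3) t])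
    show "ey t = transpose (Bbar S) *v (transpose (Cm S) *v (Py S *v yt t))" if "t \<ge> 0" for t
      using that by (simp add: ey yt_def)
    fix t assume t: "t \<in> {0..\<tau>}"
    then have t0: "t \<ge> 0" by simp
    show "et t = (oh t - w) *\<^sub>R uz t + (infnorm (xgh t) *\<^sub>R th t - infnorm (?xg t) *\<^sub>R \<theta> t) + (sh t - \<sigma> t)"
      using t0 by (simp add: et_def q_def eh par(3)[OF t] uz uz'_def algebra_simps)
    show "\<bar>infnorm (xgh t) - infnorm (?xg t)\<bar> \<le> infnorm (vt t)"
      using infnorm_vstack_diff[of "xvh t" "xu t" "xv t"] t0 by (simp add: xgh vt_def)
  qed
  also have "(- (?N *v x0)) \<bullet> (Pv S *v (- (?N *v x0))) = x0 \<bullet> (Pv_bar S *v x0)"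
  proof -
    have "Pv S *v (- (?N *v x0)) = - (Pv S *v (?N *v x0))"
      using matrix_vector_mult_diff_distrib[of "Pv S" 0 "?N *v x0"] by simp
    then show ?thesis
      unfolding lambda_max_Pv_bar(3) by (simp only: inner_minus_left inner_minus_right minus_minus mat_adjoint matrix_vector_mul_assoc matrix_mul_assoc)
  qed
  also have "\<dots> \<le> lambda_max (Pv_bar S) * (x0 \<bullet> x0)"
    by (rule lambda_bounds(2)[OF lambda_max_Pv_bar(1)])
  finally show "yt t \<bullet> (Py S *v yt t) + vt t \<bullet> (Pv S *v vt t)
      \<le> lambda_max (Pv_bar S) * (x0 \<bullet> x0) + theta_1 S / Gam"
    by (simp add: Gam_def)
qed

lemma prediction_error_bounds:
  assumes \<tau>: "\<tau> > 0" and xb: "\<And>t. t \<in> {0..\<tau>} \<Longrightarrow> infnorm (x t) \<le> rho_x S"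
    and ub: "\<And>t. t \<in> {0..\<tau>} \<Longrightarrow> infnorm (u t) \<le> rho_u S w" and t: "t \<in> {0..\<tau>}"
  shows "infnorm (yt t) \<le> kappa_y S * infnorm x0 + mu / sqrt (lambda_min (Py S))"
    and "infnorm (vt t) \<le> kappa_v S * infnorm x0 + mu / sqrt (lambda_min (Pv S))"
proof -
  have P: "pos_def (Py S)" "pos_def (Pv S)" using design unfolding design_assumptions_def by blast+
  have "Gam > 0" using G by (simp add: Gam_def)
  then have T: "theta_1 S / Gam \<ge> 0" using lyapunov_on_interval(2)[OF assms] by simp
  note b = lyapunov_on_interval(1)[OF assms]
  have nn: "z \<bullet> (P *v z) \<ge> 0" if "pos_def P" for P :: "real^'k^'k" and z
    using that by (cases "z = 0") (auto simp: pos_def_def intro: less_imp_le)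
  have "yt t \<bullet> (Py S *v yt t) \<le> lambda_max (Pv_bar S) * (x0 \<bullet> x0) + theta_1 S / Gam"
    using b nn[OF P(2), of "vt t"] by linarith
  from quadratic_form_bound[OF P(1) this lambda_max_Pv_bar(2) T]
  show "infnorm (yt t) \<le> kappa_y S * infnorm x0 + mu / sqrt (lambda_min (Py S))"
    by (simp add: kappa_y_def mu_def)
  have "vt t \<bullet> (Pv S *v vt t) \<le> lambda_max (Pv_bar S) * (x0 \<bullet> x0) + theta_1 S / Gam"
    using b nn[OF P(1), of "yt t"] by linarith
  from quadratic_form_bound[OF P(2) this lambda_max_Pv_bar(2) T]
  show "infnorm (vt t) \<le> kappa_v S * infnorm x0 + mu / sqrt (lambda_min (Pv S))"
    by (simp add: kappa_v_def mu_def)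
qed

lemma mu_less: "mu < eps_gamma S"
proof -
  have "Gam > 0" "theta_1 S / (eps_gamma S)\<^sup>2 < Gam" using G by (simp_all add: Gam_def)
  then have "theta_1 S / Gam < (eps_gamma S)\<^sup>2"
    using design_constants(3) by (simp add: field_simps)
  then have "mu < sqrt ((eps_gamma S)\<^sup>2)" unfolding mu_def by (rule real_sqrt_less_mono)
  then show ?thesis using design_constants(3) by simp
qed

subsection \<open>The reference system\<close>

text \<open>The reference system is the case x0 = 0 of \<open>state_response\<close>, with p the
  response of C0 to K_g r in place of the prediction error; \<omega> H0 C0 K_g is
  \<open>Hr_tf\<close>.\<close>

lemma reference_decomposition:
  obtains h g p c where "tf_response (Hr_tf S w) (ref_sig S) h" "tf_response (G_tf S w) etar g"
    "\<And>t. t \<ge> 0 \<Longrightarrow> xr t = h t + g t"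
    "tf_response (C0_tf S w ** tf_const (Kg S)) (ref_sig S) p" "tf_response (C0_tf S w) etar c"
    "\<And>t. t \<ge> 0 \<Longrightarrow> ur t = p t - c t"
proof -
  note C0p = stable_properD[OF stable_proper_C0] and H0p = stable_properD[OF stable_proper_H0]
  have rl: "loc_int (\<lambda>t. Kg S *v ref_sig S t)" by (rule loc_int_mat[OF ref_loc_int])
  have el: "loc_int etar" by (rule loc_int_continuous[OF etar_cont])
  obtain p where p0: "tf_response (C0_tf S w) (\<lambda>t. Kg S *v ref_sig S t) p" using tf_response_exists[OF rl] .
  obtain c where c: "tf_response (C0_tf S w) etar c" using tf_response_exists[OF el] .
  have p: "tf_response (C0_tf S w ** tf_const (Kg S)) (ref_sig S) p"
    by (rule tf_response_mult[OF C0p inf.matrix_const tf_response_const[OF ref_loc_int] p0])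
  have "tf_response (C0_tf S w) (\<lambda>t. Kg S *v ref_sig S t - etar t) ur" using ur_resp by (simp add: etar_def)
  then have uc: "ur t = p t - c t" if "t \<ge> 0" for t
    using tf_response_unique[OF _ tf_response_diff[OF C0p p0 c] that] by blast
  have pl: "loc_int p" by (rule tf_response_loc_int(2)[OF p0 C0p])
  obtain h where h: "tf_response (H0_tf S) (\<lambda>t. w *\<^sub>R p t) h" using tf_response_exists[OF loc_int_scaleR[OF pl]] .
  obtain g where g: "tf_response (G_tf S w) etar g" using tf_response_exists[OF el] .
  let ?K = "tf_scale (rf_const w) (C0_tf S w ** tf_const (Kg S))"
  have Kp: "inf.Rmat (C0_tf S w ** tf_const (Kg S))" by (intro inf.matrix_mult C0p inf.matrix_const)
  have "tf_response (H0_tf S ** ?K) (ref_sig S) h"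
    by (rule tf_response_mult[OF H0p _ tf_response_scale_const[OF Kp p] h]) (intro inf.matrix_scale inf.const Kp)
  moreover have "H0_tf S ** ?K = Hr_tf S w"
    by (simp add: Hr_tf_def C_tf_def tf_scale_mult(1) matrix_mul_assoc)
  ultimately have hr: "tf_response (Hr_tf S w) (ref_sig S) h" by simp
  have "xr t = h t + g t" if "t \<ge> 0" for t
  proof -
    have "ode_sol xr (\<lambda>t. Am S *v xr t + Bm S *v (w *\<^sub>R ur t + etar t)) (- 0)"
      using xr_ode by (simp add: etar_def)
    from state_response[OF this el c pl uc g h that] show ?thesis by simp
  qed
  with hr g p c uc show ?thesis using that by blast
qed

lemma etar_bound:
  assumes t: "t \<ge> 0" and b: "infnorm (xr t) \<le> rho_r S"
  shows "infnorm (etar t) \<le> L_delta S (rho_r S) * infnorm (xr t) + b0 S"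
proof -
  have lt: "infnorm (xr t) < rho_x S" using b design_constants(1) by (simp add: rho_x_def)
  have "infnorm (f (xr t) t - f 0 t) \<le> dfun S (rho_x S) * infnorm (xr t - 0)"
    by (rule uncertainty_Lipschitz[OF unc design_constants(7) t lt]) (use design_constants(7) in \<open>simp add: infnorm_0\<close>)
  also have "\<dots> \<le> L_delta S (rho_r S) * infnorm (xr t)"
    using design_constants(8) by (simp add: mult_right_mono infnorm_pos_le)
  finally have "infnorm (f (xr t) t - f 0 t) \<le> L_delta S (rho_r S) * infnorm (xr t)" .
  moreover have "infnorm (f 0 t) < b0 S" using unc t by (simp add: uncertainty_def)
  moreover have "infnorm (etar t) \<le> infnorm (f (xr t) t - f 0 t) + infnorm (f 0 t)"
    using infnorm_triangle[of "f (xr t) t - f 0 t" "f 0 t"] by (simp add: etar_def)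
  ultimately show ?thesis by linarith
qed

lemma max_on_interval:
  fixes z :: "real \<Rightarrow> real^'k"
  assumes "continuous_on {0..} z" "\<tau> \<ge> 0"
  obtains s where "s \<in> {0..\<tau>}" "\<And>t. t \<in> {0..\<tau>} \<Longrightarrow> infnorm (z t) \<le> infnorm (z s)"
proof -
  have "continuous_on {0..\<tau>} (\<lambda>t. infnorm (z t))"
    by (intro continuous_intros continuous_on_subset[OF assms(1)]) auto
  then have "\<exists>s\<in>{0..\<tau>}. \<forall>t\<in>{0..\<tau>}. infnorm (z t) \<le> infnorm (z s)"
    using assms(2) by (intro continuous_attains_sup) auto
  then show ?thesis using that by blast
qed

text \<open>Let M be the maximum of the state on the interval. The Lipschitz bound and the gain of G
  give M <= \<open>rho_ext\<close> + |G| L M, so \<open>gain_gap\<close> times M is at most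
  \<open>rho_ext\<close>, which is below \<open>gain_gap\<close> times \<open>rho_rx\<close>.
  Assuming the bound \<open>rho_r\<close> thus returns the strict bound \<open>rho_rx\<close>, at
  most \<open>rho_r\<close>, and the continuation closes.\<close>

lemma xr_step:
  assumes \<tau>: "\<tau> \<ge> 0" and b: "\<And>t. t \<in> {0..\<tau>} \<Longrightarrow> infnorm (xr t) \<le> rho_r S"
  shows "infnorm (xr \<tau>) < rho_rx S w"
proof -
  obtain h g p c where d: "tf_response (Hr_tf S w) (ref_sig S) h" "tf_response (G_tf S w) etar g"
    "\<And>t. t \<ge> 0 \<Longrightarrow> xr t = h t + g t"
    using reference_decomposition by metis
  obtain s where s: "s \<in> {0..\<tau>}" "\<And>t. t \<in> {0..\<tau>} \<Longrightarrow> infnorm (xr t) \<le> infnorm (xr s)"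
    using max_on_interval[OF xr_cont \<tau>] by metis
  define M where "M = infnorm (xr s)"
  let ?L = "L_delta S (rho_r S)" and ?G = "L1_norm (G_tf S w)"
  have 1: "infnorm (h s) \<le> L1_norm (Hr_tf S w) * r_Linf S"
    by (rule tf_response_L1_bound[OF stable_proper_closed_loop(2) d(1)]) (use s(1) ref_bounded in auto)
  have 2: "infnorm (g s) \<le> ?G * (?L * M + b0 S)"
  proof (rule tf_response_L1_bound[OF stable_proper_closed_loop(1) d(2)])
    fix t assume t: "0 \<le> t" "t \<le> s"
    then have t': "t \<in> {0..\<tau>}" using s(1) by auto
    have "infnorm (etar t) \<le> ?L * infnorm (xr t) + b0 S" by (rule etar_bound[OF t(1) b[OF t']])
    also have "\<dots> \<le> ?L * M + b0 S"
      using s(2)[OF t'] design_constants(9) by (simp add: M_def)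
    finally show "infnorm (etar t) \<le> ?L * M + b0 S" .
  qed (use s(1) in simp)
  have "M \<le> infnorm (h s) + infnorm (g s)"
    using d(3)[of s] s(1) infnorm_triangle[of "h s" "g s"] by (simp add: M_def)
  also have "\<dots> \<le> rho_ext S w + ?G * ?L * M"
    using 1 2 by (simp add: rho_ext_def algebra_simps)
  finally have "gain_gap S w * M \<le> rho_ext S w" by (simp add: gain_gap_def algebra_simps)
  also have "\<dots> < gain_gap S w * rho_rx S w" by (rule gap(2))
  finally have "M < rho_rx S w" using gap(1) by simp
  moreover have "infnorm (xr \<tau>) \<le> M" using s(2)[of \<tau>] \<tau> by (simp add: M_def)
  ultimately show ?thesis by simp
qed

lemma xr_bound: "t \<ge> 0 \<Longrightarrow> infnorm (xr t) < rho_rx S w"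
proof -
  have "infnorm (xr t) - rho_r S < 0" if "t \<ge> 0" for t
  proof (rule continuation[of "\<lambda>t. infnorm (xr t) - rho_r S", OF _ _ _ that])
    show "continuous_on {0..} (\<lambda>t. infnorm (xr t) - rho_r S)" by (intro continuous_intros xr_cont)
    show "infnorm (xr 0) - rho_r S < 0" using ode_sol_0[OF xr_ode] design_constants(2) by (simp add: infnorm_0)
    fix \<tau> :: real assume "\<tau> > 0" "\<And>t. t \<in> {0..\<tau>} \<Longrightarrow> infnorm (xr t) - rho_r S \<le> 0"
    then have "infnorm (xr \<tau>) < rho_rx S w" by (intro xr_step) auto
    then show "infnorm (xr \<tau>) - rho_r S < 0" using gap(3) by simp
  qed
  then show "infnorm (xr t) < rho_rx S w" if "t \<ge> 0"
    by (intro xr_step that) (use less_imp_le in force)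
qed

lemma ur_bound: "t \<ge> 0 \<Longrightarrow> infnorm (ur t) \<le> rho_ru S w"
proof -
  assume t: "t \<ge> 0"
  obtain h g p c where d: "tf_response (C0_tf S w ** tf_const (Kg S)) (ref_sig S) p" "tf_response (C0_tf S w) etar c"
    "\<And>t. t \<ge> 0 \<Longrightarrow> ur t = p t - c t"
    using reference_decomposition by metis
  have "infnorm (p t) \<le> L1_norm (C0_tf S w ** tf_const (Kg S)) * r_Linf S"
    by (rule tf_response_L1_bound[OF stable_proper_closed_loop(5) d(1) t]) (use ref_bounded in auto)
  moreover have "infnorm (c t) \<le> L1_norm (C0_tf S w) * (L_delta S (rho_r S) * rho_rx S w + b0 S)"
  proof (rule tf_response_L1_bound[OF stable_proper_C0 d(2) t])
    fix s :: real assume "0 \<le> s" "s \<le> t"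
    then have s: "s \<ge> 0" by simp
    have "infnorm (etar s) \<le> L_delta S (rho_r S) * infnorm (xr s) + b0 S"
      using xr_bound[OF s] gap(3) by (intro etar_bound s) simp
    also have "\<dots> \<le> L_delta S (rho_r S) * rho_rx S w + b0 S"
      using xr_bound[OF s] design_constants(9) by simp
    finally show "infnorm (etar s) \<le> L_delta S (rho_r S) * rho_rx S w + b0 S" .
  qed
  moreover have "infnorm (ur t) \<le> infnorm (p t) + infnorm (c t)"
    using d(3)[OF t] infnorm_triangle[of "p t" "- c t"] by (simp add: infnorm_neg)
  ultimately show ?thesis by (simp add: rho_ru_def)
qed

subsection \<open>Comparison with the reference system\<close>

text \<open>Small gain for the difference of the two systems: with M the maximal state error on the
  interval, the error identity bounds M by the contributions of yt, vt and the free response plus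
  |G| L M. Division by \<open>gain_gap\<close> produces exactly \<open>gamma_x0\<close> and
  \<open>gamma_x\<close>; the input error is then estimated with the same M.\<close>

lemma error_step:
  assumes \<tau>: "\<tau> > 0" and xb: "\<And>t. t \<in> {0..\<tau>} \<Longrightarrow> infnorm (x t) \<le> rho_x S"
    and ub: "\<And>t. t \<in> {0..\<tau>} \<Longrightarrow> infnorm (u t) \<le> rho_u S w" and t: "t \<in> {0..\<tau>}"
  shows "infnorm (xr t - x t) \<le> gamma_x0 S w * infnorm x0 + gamma_x S w * mu"
    and "infnorm (ur t - u t) \<le> gamma_u0 S w * infnorm x0 + gamma_u S w * mu"
proof -
  note C0p = stable_properD[OF stable_proper_C0]
  have rl: "loc_int (\<lambda>t. Kg S *v ref_sig S t)" by (rule loc_int_mat[OF ref_loc_int])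
  have el: "loc_int eta" "loc_int etar"
    by (rule loc_int_continuous[OF eta_cont], rule loc_int_continuous[OF etar_cont])
  define dh where "dh t = etar t - eta t" for t
  have dhl: "loc_int dh" unfolding dh_def by (intro loc_int_diff el)
  have gl: "loc_int (\<lambda>t. Kg S *v ref_sig S t - eta t)" by (intro loc_int_diff rl el)
  have ytl: "loc_int yt" by (rule loc_int_continuous[OF yt_cont])
  obtain c where c: "tf_response (C0_tf S w) dh c" using tf_response_exists[OF dhl] .
  obtain a where a: "tf_response (C0_tf S w) (\<lambda>t. Kg S *v ref_sig S t - eta t) a" using tf_response_exists[OF gl] .
  obtain y1 where y1: "tf_response (C1_tf S w) yt y1" using tf_response_exists[OF ytl] .
  obtain y2 where y2: "tf_response (C2_tf S w) vt y2" using tf_response_exists[OF vt_loc_int] .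
  have b: "tf_response (C0_tf S w ** Zinv_tf S) et (\<lambda>t. y1 t - y2 t)"
    by (rule prediction_error_response[OF yt_ode vt_loc_int et_loc_int y1 y2])
  \<comment> \<open>Since q = Z (\<omega> u + f), the controller input eh - rz is the sum of Z
    applied to \<omega> u - (K_g r - f) and the mismatch et = eh - q, which is the form in which the
    loop is solved.\<close>
  define zq where "zq t = w *\<^sub>R uz' t - (rz t - fbar t)" for t
  have Zu: "tf_response (Z_tf S) u uz'"
    using Z_response[OF xu_ode loc_int_continuous[OF u_cont]] by (simp add: uz'_def[abs_def])
  have Ze: "tf_response (Z_tf S) eta fbar"
    using Z_response[OF xf_ode el(1)] by (simp add: fbar_eta[abs_def])
  have zq: "tf_response (Z_tf S) (\<lambda>t. w *\<^sub>R u t - (Kg S *v ref_sig S t - eta t)) zq"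
    unfolding zq_def by (intro tf_response_diff tf_response_scaleR Z_proper Zu Ze rz)
  have ur1: "tf_response (- (Dtf S ** Zinv_tf S)) (\<lambda>t. zq t + et t) u"
    using u_resp by (simp add: zq_def et_def q_def algebra_simps)
  have ua: "u t = a t - (y1 t - y2 t)" if "t \<ge> 0" for t
    by (rule control_response[OF ur1 zq et_loc_int gl a b that])
  have "tf_response (C0_tf S w) (\<lambda>t. (Kg S *v ref_sig S t - eta t) - dh t) (\<lambda>t. a t - c t)"
    by (rule tf_response_diff[OF C0p a c])
  then have "tf_response (C0_tf S w) (\<lambda>t. Kg S *v ref_sig S t - f (xr t) t) (\<lambda>t. a t - c t)"
    by (simp add: dh_def etar_def)
  then have ura: "ur t = a t - c t" if "t \<ge> 0" for t using tf_response_unique[OF ur_resp _ that] by blast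
  have du: "ur t - u t = (y1 t - y2 t) - c t" if "t \<ge> 0" for t
    using ua[OF that] ura[OF that] by simp
  have dx: "ode_sol (\<lambda>t. xr t - x t) (\<lambda>t. Am S *v (xr t - x t) + Bm S *v (w *\<^sub>R (ur t - u t) + dh t)) (- x0)"
    by (rule ode_sol_cong[OF ode_sol_diff[OF xr_ode x_ode]])
      (simp_all add: dh_def eta_def etar_def matrix_vector_mult_diff_distrib matrix_vector_right_distrib
        matrix_vector_mult_scaleR scaleR_diff_right)
  obtain g where g: "tf_response (G_tf S w) dh g" using tf_response_exists[OF dhl] .
  obtain h1 where h1: "tf_response (H1_tf S w) yt h1" using tf_response_exists[OF ytl] .
  obtain h2 where h2: "tf_response (H2_tf S w) vt h2" using tf_response_exists[OF vt_loc_int] .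
  have pl: "loc_int (\<lambda>t. y1 t - y2 t)"
    by (rule tf_response_loc_int(2)[OF b stable_properD[OF C0_Zinv(2)]])
  have xe: "(xr t - x t) + mat_exp (t *\<^sub>R Am S) *v x0 = (h1 t - h2 t) + g t" if "t \<ge> 0" for t
    by (rule state_response[OF dx dhl c pl du g H_response[OF y1 y2 h1 h2] that])
  define Y where "Y = kappa_y S * infnorm x0 + mu / sqrt (lambda_min (Py S))"
  define V where "V = kappa_v S * infnorm x0 + mu / sqrt (lambda_min (Pv S))"
  have Yb: "infnorm (yt t) \<le> Y" and Vb: "infnorm (vt t) \<le> V" if "t \<in> {0..\<tau>}" for t
    using prediction_error_bounds[OF \<tau> xb ub that] by (simp_all add: Y_def V_def)
  obtain s where s: "s \<in> {0..\<tau>}" "\<And>t. t \<in> {0..\<tau>} \<Longrightarrow> infnorm (xr t - x t) \<le> infnorm (xr s - x s)"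
    using max_on_interval[of "\<lambda>t. xr t - x t" \<tau>] \<tau> continuous_on_diff[OF xr_cont x_cont] by auto
  define M where "M = infnorm (xr s - x s)"
  let ?L = "L_delta S (rho_r S)"
  \<comment> \<open>The reference state is strictly inside the ball of radius \<open>rho_x\<close>,
    but the plant state may touch its boundary; the Lipschitz bound covers precisely this
    combination.\<close>
  have dhb: "infnorm (dh t) \<le> ?L * M" if t: "t \<in> {0..\<tau>}" for t
  proof -
    have "infnorm (xr t) < rho_x S"
      using xr_bound[of t] t gap(3) design_constants(1) by (simp add: rho_x_def)
    then have "infnorm (dh t) \<le> dfun S (rho_x S) * infnorm (xr t - x t)"
      unfolding dh_def eta_def etar_def
      by (intro uncertainty_Lipschitz unc design_constants(7) xb) (use t in auto)
    also have "\<dots> \<le> ?L * M"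
      unfolding M_def using design_constants(8,9) s(2)[OF t] by (intro mult_mono infnorm_pos_le) auto
    finally show ?thesis .
  qed
  have s0: "0 \<le> s" "s \<le> \<tau>" using s(1) by auto
  have 1: "infnorm (g s) \<le> L1_norm (G_tf S w) * (?L * M)"
    by (rule tf_response_L1_bound[OF stable_proper_closed_loop(1) g s0(1)]) (use s0 in \<open>auto intro: dhb\<close>)
  have 2: "infnorm (h1 s) \<le> L1_norm (H1_tf S w) * Y"
    by (rule tf_response_L1_bound[OF stable_proper_closed_loop(3) h1 s0(1)]) (use s0 in \<open>auto intro: Yb\<close>)
  have 3: "infnorm (h2 s) \<le> L1_norm (H2_tf S w) * V"
    by (rule tf_response_L1_bound[OF stable_proper_closed_loop(4) h2 s0(1)]) (use s0 in \<open>auto intro: Vb\<close>)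
  have 4: "infnorm (mat_exp (s *\<^sub>R Am S) *v x0) \<le> kappa_m S * infnorm x0"
    by (rule kappa_m_bounds(2)[OF Am_hurwitz s0(1)])
  have "xr s - x s = h1 s + (- h2 s) + g s + (- (mat_exp (s *\<^sub>R Am S) *v x0))"
    using xe[OF s0(1)] by (simp add: algebra_simps)
  then have "M \<le> infnorm (h1 s) + infnorm (h2 s) + infnorm (g s) + infnorm (mat_exp (s *\<^sub>R Am S) *v x0)"
    unfolding M_def \<open>xr s - x s = _\<close>
    using infnorm_triangle[of "h1 s + (- h2 s) + g s" "- (mat_exp (s *\<^sub>R Am S) *v x0)"]
      infnorm_triangle[of "h1 s + (- h2 s)" "g s"] infnorm_triangle[of "h1 s" "- h2 s"]
    unfolding infnorm_neg by linarith
  also have "\<dots> \<le> L1_norm (H1_tf S w) * Y + L1_norm (H2_tf S w) * V + L1_norm (G_tf S w) * (?L * M) + kappa_m S * infnorm x0"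
    by (intro add_mono 1 2 3 4)
  also have "\<dots> = L1_norm (G_tf S w) * ?L * M + (kappa_x S w + kappa_m S) * infnorm x0
      + (L1_norm (H1_tf S w) / sqrt (lambda_min (Py S)) + L1_norm (H2_tf S w) / sqrt (lambda_min (Pv S))) * mu"
    by (simp add: Y_def V_def kappa_x_def distrib_left distrib_right)
  finally have "gain_gap S w * M \<le> (kappa_x S w + kappa_m S) * infnorm x0
      + (L1_norm (H1_tf S w) / sqrt (lambda_min (Py S)) + L1_norm (H2_tf S w) / sqrt (lambda_min (Pv S))) * mu"
    by (simp add: gain_gap_def left_diff_distrib)
  also have "\<dots> = gain_gap S w * (gamma_x0 S w * infnorm x0 + gamma_x S w * mu)"
    using gap(1) by (simp add: gamma_x0_def gamma_x_def distrib_left)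
  finally have Mb: "M \<le> gamma_x0 S w * infnorm x0 + gamma_x S w * mu" using gap(1) by simp
  then show "infnorm (xr t - x t) \<le> gamma_x0 S w * infnorm x0 + gamma_x S w * mu"
    using s(2)[OF t] by (simp add: M_def)
  have t0: "0 \<le> t" "t \<le> \<tau>" using t by auto
  have 5: "infnorm (c t) \<le> L1_norm (C0_tf S w) * (?L * M)"
    by (rule tf_response_L1_bound[OF stable_proper_C0 c t0(1)]) (use t0 in \<open>auto intro: dhb\<close>)
  have 6: "infnorm (y1 t) \<le> L1_norm (C1_tf S w) * Y"
    by (rule tf_response_L1_bound[OF stable_proper_C1 y1 t0(1)]) (use t0 in \<open>auto intro: Yb\<close>)
  have 7: "infnorm (y2 t) \<le> L1_norm (C2_tf S w) * V"
    by (rule tf_response_L1_bound[OF stable_proper_C2 y2 t0(1)]) (use t0 in \<open>auto intro: Vb\<close>)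
  have "ur t - u t = y1 t + (- y2 t) + (- c t)" using du[OF t0(1)] by simp
  then have "infnorm (ur t - u t) \<le> infnorm (y1 t) + infnorm (y2 t) + infnorm (c t)"
    unfolding \<open>ur t - u t = _\<close>
    using infnorm_triangle[of "y1 t + (- y2 t)" "- c t"] infnorm_triangle[of "y1 t" "- y2 t"]
    unfolding infnorm_neg by linarith
  also have "\<dots> \<le> L1_norm (C1_tf S w) * Y + L1_norm (C2_tf S w) * V
      + L1_norm (C0_tf S w) * (?L * (gamma_x0 S w * infnorm x0 + gamma_x S w * mu))"
    using 5 6 7 Mb design_constants(9) L1_norm_nonneg[of "C0_tf S w"]
    by (intro add_mono) (auto intro: order_trans[OF _ mult_left_mono] mult_left_mono)
  also have "\<dots> = gamma_u0 S w * infnorm x0 + gamma_u S w * mu"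
    by (simp add: Y_def V_def gamma_u0_def gamma_u_def distrib_left distrib_right)
  finally show "infnorm (ur t - u t) \<le> gamma_u0 S w * infnorm x0 + gamma_u S w * mu" .
qed

lemma gamma_mu: "gamma_x S w * mu < gbar S" "gamma_u S w * mu < gbar S"
proof -
  have g: "gamma_x S w * eps_gamma S < gbar S" "gamma_u S w * eps_gamma S < gbar S"
    using design w unfolding design_assumptions_def by blast+
  have "gamma_x S w * mu \<le> gamma_x S w * eps_gamma S" "gamma_u S w * mu \<le> gamma_u S w * eps_gamma S"
    using mu_less gamma_nonneg by (auto intro!: mult_left_mono)
  then show "gamma_x S w * mu < gbar S" "gamma_u S w * mu < gbar S" using g by linarith+
qed

lemma error_less:
  "gamma_x0 S w * infnorm x0 + gamma_x S w * mu < rho_dx S w"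
  "gamma_u0 S w * infnorm x0 + gamma_u S w * mu < rho_du S w"
  using gamma_mu mult_left_mono[OF x0 gamma_nonneg(3)] mult_left_mono[OF x0 gamma_nonneg(4)]
  by (simp_all add: rho_dx_def rho_du_def)

text \<open>By the triangle inequality the plant is bounded by the reference bound plus the error,
  and the error is strictly below \<open>rho_dx\<close> and \<open>rho_du\<close>. The a priori
  bounds are therefore never attained. At time 0 the input vanishes because D Z^-1 is strictly
  proper. The maximum \<phi> treats state and input in one continuation, as the estimate of either
  needs both.\<close>

lemma run_bounds:
  assumes t: "t \<ge> 0"
  shows "infnorm (x t) \<le> rho_x S" "infnorm (u t) \<le> rho_u S w"
proof -
  define \<phi> where "\<phi> t = max (infnorm (x t) - rho_x S) (infnorm (u t) - rho_u S w)" for t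
  have sum: "rho_rx S w + rho_dx S w = rho_x S"
    using gap(6) by (simp add: rho_x_def rho_dx_def)
  have "\<phi> t < 0"
  proof (rule continuation[OF _ _ _ t])
    show "continuous_on {0..} \<phi>" unfolding \<phi>_def by (intro continuous_intros x_cont u_cont)
    have "infnorm (x 0) < rho_x S"
      using ode_sol_0[OF x_ode] x0 gap(5) design_constants(1) by (simp add: rho_x_def)
    moreover have "0 < rho_u S w"
    proof -
      have "0 \<le> rho_ru S w" using ur_bound[of 0] infnorm_pos_le[of "ur 0"] by linarith
      moreover have "0 < rho_du S w"
        using gamma_nonneg(4) design_constants by (simp add: rho_du_def add_nonneg_pos)
      ultimately show ?thesis by (simp add: rho_u_def)
    qed
    ultimately show "\<phi> 0 < 0" by (simp add: \<phi>_def u_0 infnorm_0)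
    fix \<tau> :: real assume \<tau>: "\<tau> > 0" and le: "\<And>t. t \<in> {0..\<tau>} \<Longrightarrow> \<phi> t \<le> 0"
    have b: "infnorm (x t) \<le> rho_x S" "infnorm (u t) \<le> rho_u S w" if "t \<in> {0..\<tau>}" for t
      using le[OF that] by (simp_all add: \<phi>_def)
    have \<tau>': "\<tau> \<in> {0..\<tau>}" using \<tau> by simp
    note e = error_step[OF \<tau> b \<tau>']
    have "infnorm (x \<tau>) \<le> infnorm (xr \<tau>) + infnorm (xr \<tau> - x \<tau>)"
      using infnorm_triangle[of "xr \<tau>" "- (xr \<tau> - x \<tau>)"] by (simp only: infnorm_neg) simp
    moreover have "infnorm (u \<tau>) \<le> infnorm (ur \<tau>) + infnorm (ur \<tau> - u \<tau>)"
      using infnorm_triangle[of "ur \<tau>" "- (ur \<tau> - u \<tau>)"] by (simp only: infnorm_neg) simp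
    ultimately show "\<phi> \<tau> < 0"
      using e error_less xr_bound[of \<tau>] ur_bound[of \<tau>] \<tau> sum by (simp add: \<phi>_def rho_u_def)
  qed
  then show "infnorm (x t) \<le> rho_x S" "infnorm (u t) \<le> rho_u S w" by (simp_all add: \<phi>_def)
qed

lemma run_errors:
  assumes t: "t \<ge> 0"
  shows "infnorm (xr t - x t) \<le> gamma_x0 S w * infnorm x0 + gamma_x S w * mu"
    and "infnorm (ur t - u t) \<le> gamma_u0 S w * infnorm x0 + gamma_u S w * mu"
    and "infnorm (yr t - y t) \<le> mat_infnorm (Cm S) * infnorm (xr t - x t)"
proof -
  \<comment> \<open>The interval [0, t + 1] has positive length even for t = 0.\<close>
  show "infnorm (xr t - x t) \<le> gamma_x0 S w * infnorm x0 + gamma_x S w * mu"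
    "infnorm (ur t - u t) \<le> gamma_u0 S w * infnorm x0 + gamma_u S w * mu"
    by (rule error_step[of "t + 1"]; use t run_bounds in auto)+
  show "infnorm (yr t - y t) \<le> mat_infnorm (Cm S) * infnorm (xr t - x t)"
    using infnorm_mat_infnorm[of "Cm S" "xr t - x t"] t by (simp add: y yr matrix_vector_mult_diff_distrib)
qed

end

lemma (in l1_setup) admissible_run_errors:
  assumes run: "admissible_run S w f x0 Go Gt Gs x u y xr ur yr" and t: "t \<ge> 0"
  shows "infnorm (xr t - x t) \<le> gamma_x0 S w * infnorm x0 + gamma_x S w * sqrt (theta_1 S) / sqrt (min Go (min Gt Gs))"
    and "infnorm (xr t - x t) \<le> rho_dx S w" and "infnorm (ur t - u t) \<le> rho_du S w"
    and "infnorm (yr t - y t) \<le> mat_infnorm (Cm S) * infnorm (xr t - x t)"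
    and "infnorm (x t) \<le> rho_x S" and "infnorm (u t) \<le> rho_u S w"
proof -
  have r: "uncertainty S f" "parametrization S w f" "infnorm x0 \<le> rho0 S"
    "0 < Go" "0 < Gt" "0 < Gs" "min Go (min Gt Gs) > theta_1 S / (eps_gamma S)\<^sup>2"
    and cl: "closed_loop S w f x0 Go Gt Gs x u y" and rs: "reference_system S w f xr ur yr"
    using run unfolding admissible_run_def by blast+
  obtain xu uz vh yh xvh xgh oh th sh eh rz ey where
    "l1_run S w f x0 Go Gt Gs x u y xr ur yr xu uz vh yh xvh xgh oh th sh eh rz ey"
  proof -
    from r cl rs show thesis
      unfolding closed_loop_def reference_system_def
      apply (elim conjE exE)
      subgoal for xu uz vh yh xvh xgh oh th sh eh rz ey
        by (rule that, rule l1_run.intro[OF l1_setup_axioms l1_run_axioms.intro])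
          (assumption | (erule allE, erule impE, assumption, assumption))+
      done
  qed
  then interpret l1_run S w f x0 Go Gt Gs x u y xr ur yr xu uz vh yh xvh xgh oh th sh eh rz ey .
  have mu: "mu = sqrt (theta_1 S) / sqrt (min Go (min Gt Gs))"
    by (simp add: mu_def Gam_def real_sqrt_divide)
  show "infnorm (xr t - x t) \<le> gamma_x0 S w * infnorm x0 + gamma_x S w * sqrt (theta_1 S) / sqrt (min Go (min Gt Gs))"
    using run_errors(1)[OF t] by (simp add: mu)
  show "infnorm (xr t - x t) \<le> rho_dx S w" "infnorm (ur t - u t) \<le> rho_du S w"
    using run_errors[OF t] error_less by linarith+
  show "infnorm (yr t - y t) \<le> mat_infnorm (Cm S) * infnorm (xr t - x t)" by (rule run_errors(3)[OF t])
  show "infnorm (x t) \<le> rho_x S" "infnorm (u t) \<le> rho_u S w" by (rule run_bounds[OF t])+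
qed

theorem theorem2:
  fixes S :: "('n::finite, 'm::finite, 'p::{finite,linorder}, 'z::finite, 'r::finite) l1_design"
  assumes "plant_assumptions S"
    and "interactor_assumptions S"
    and "design_assumptions S"
  shows "\<forall>w\<in>C_omega S.
    (\<forall>f x0 \<Gamma>\<omega> \<Gamma>\<theta> \<Gamma>\<sigma> x u y xr ur yr.
       admissible_run S w f x0 \<Gamma>\<omega> \<Gamma>\<theta> \<Gamma>\<sigma> x u y xr ur yr \<longrightarrow>
         Linf_on {0..} (\<lambda>t. xr t - x t) \<le> ereal (rho_dx S w) \<and>
         Linf_on {0..} (\<lambda>t. ur t - u t) \<le> ereal (rho_du S w) \<and>
         Linf_on {0..} (\<lambda>t. yr t - y t) \<le> ereal (mat_infnorm (Cm S) * rho_dx S w) \<and>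
         Linf_on {0..} x \<le> ereal (rho_x S) \<and>
         Linf_on {0..} u \<le> ereal (rho_u S w)) \<and>
    (\<exists>\<gamma>dx>0. \<exists>\<gamma>dy>0. \<exists>\<upsilon>dx \<upsilon>dy :: real \<Rightarrow> real.
       strict_antimono_on {0..} \<upsilon>dx \<and> strict_antimono_on {0..} \<upsilon>dy \<and>
       (\<forall>f x0 \<Gamma>\<omega> \<Gamma>\<theta> \<Gamma>\<sigma> x u y xr ur yr.
          admissible_run S w f x0 \<Gamma>\<omega> \<Gamma>\<theta> \<Gamma>\<sigma> x u y xr ur yr \<longrightarrow>
            (\<forall>t\<ge>0.
               infnorm (xr t - x t)
                 \<le> \<upsilon>dx t * infnorm x0 + \<gamma>dx / sqrt (min \<Gamma>\<omega> (min \<Gamma>\<theta> \<Gamma>\<sigma>)) \<and>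
               infnorm (yr t - y t)
                 \<le> \<upsilon>dy t * infnorm x0 + \<gamma>dy / sqrt (min \<Gamma>\<omega> (min \<Gamma>\<theta> \<Gamma>\<sigma>)))))"
proof
  fix w assume "w \<in> C_omega S"
  then interpret l1_setup S w using assms by unfold_locales
  let ?c = "mat_infnorm (Cm S)"
  \<comment> \<open>The constants precede the choice of a run, and nonnegativity of
    \<open>theta_1\<close> is known only along a run. As \<open>sqrt\<close> of a negative number is
    negative, the absolute value is taken.\<close>
  define gd where "gd = gamma_x S w * \<bar>sqrt (theta_1 S)\<bar>"
  \<comment> \<open>The coefficient \<open>gamma_x0\<close> already bounds the effect of the initial
    state at all times. The summand e^(-t) makes the function strictly decreasing, just as the
    summand 1 below makes the constants positive.\<close>
  define vd :: "real \<Rightarrow> real" where "vd t = gamma_x0 S w + exp (- t)" for t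
  define vy :: "real \<Rightarrow> real" where "vy t = ?c * gamma_x0 S w + exp (- t)" for t
  have c0: "?c \<ge> 0" by (rule mat_infnorm_nonneg)
  have gd0: "gd \<ge> 0" using gamma_nonneg by (simp add: gd_def)
  have bounds: "infnorm (xr t - x t) \<le> vd t * infnorm x0 + (gd + 1) / sqrt (min \<Gamma>\<omega> (min \<Gamma>\<theta> \<Gamma>\<sigma>)) \<and>
     infnorm (yr t - y t) \<le> vy t * infnorm x0 + (?c * gd + 1) / sqrt (min \<Gamma>\<omega> (min \<Gamma>\<theta> \<Gamma>\<sigma>))"
    if run: "admissible_run S w f x0 \<Gamma>\<omega> \<Gamma>\<theta> \<Gamma>\<sigma> x u y xr ur yr" and t: "t \<ge> 0"
    for f x0 \<Gamma>\<omega> \<Gamma>\<theta> \<Gamma>\<sigma> x u y xr ur yr t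
  proof -
    define s where "s = sqrt (min \<Gamma>\<omega> (min \<Gamma>\<theta> \<Gamma>\<sigma>))"
    have s: "s > 0" using run by (simp add: s_def admissible_run_def)
    note e = admissible_run_errors[OF run t, folded s_def]
    have "gamma_x S w * sqrt (theta_1 S) / s \<le> gd / s"
      unfolding gd_def using s gamma_nonneg(1) by (intro divide_right_mono mult_left_mono) auto
    then have 1: "infnorm (xr t - x t) \<le> gamma_x0 S w * infnorm x0 + gd / s" using e(1) by linarith
    have x: "exp (- t) * infnorm x0 \<ge> 0" "1 / s \<ge> 0" using s by (auto simp: infnorm_pos_le)
    have "infnorm (yr t - y t) \<le> ?c * (gamma_x0 S w * infnorm x0 + gd / s)"
      using e(4) mult_left_mono[OF 1 c0] by linarith
    moreover have "vy t * infnorm x0 + (?c * gd + 1) / s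
        = ?c * (gamma_x0 S w * infnorm x0 + gd / s) + exp (- t) * infnorm x0 + 1 / s"
      by (simp add: vy_def distrib_left distrib_right add_divide_distrib mult.assoc)
    ultimately have "infnorm (yr t - y t) \<le> vy t * infnorm x0 + (?c * gd + 1) / s"
      using x by linarith
    moreover have "vd t * infnorm x0 + (gd + 1) / s
        = gamma_x0 S w * infnorm x0 + gd / s + exp (- t) * infnorm x0 + 1 / s"
      by (simp add: vd_def distrib_right add_divide_distrib)
    then have "infnorm (xr t - x t) \<le> vd t * infnorm x0 + (gd + 1) / s" using 1 x by linarith
    ultimately show ?thesis by (simp add: s_def)
  qed
  show "(\<forall>f x0 \<Gamma>\<omega> \<Gamma>\<theta> \<Gamma>\<sigma> x u y xr ur yr.
       admissible_run S w f x0 \<Gamma>\<omega> \<Gamma>\<theta> \<Gamma>\<sigma> x u y xr ur yr \<longrightarrow>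
         Linf_on {0..} (\<lambda>t. xr t - x t) \<le> ereal (rho_dx S w) \<and>
         Linf_on {0..} (\<lambda>t. ur t - u t) \<le> ereal (rho_du S w) \<and>
         Linf_on {0..} (\<lambda>t. yr t - y t) \<le> ereal (mat_infnorm (Cm S) * rho_dx S w) \<and>
         Linf_on {0..} x \<le> ereal (rho_x S) \<and>
         Linf_on {0..} u \<le> ereal (rho_u S w)) \<and>
    (\<exists>\<gamma>dx>0. \<exists>\<gamma>dy>0. \<exists>\<upsilon>dx \<upsilon>dy :: real \<Rightarrow> real.
       strict_antimono_on {0..} \<upsilon>dx \<and> strict_antimono_on {0..} \<upsilon>dy \<and>
       (\<forall>f x0 \<Gamma>\<omega> \<Gamma>\<theta> \<Gamma>\<sigma> x u y xr ur yr.
          admissible_run S w f x0 \<Gamma>\<omega> \<Gamma>\<theta> \<Gamma>\<sigma> x u y xr ur yr \<longrightarrow>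
            (\<forall>t\<ge>0.
               infnorm (xr t - x t)
                 \<le> \<upsilon>dx t * infnorm x0 + \<gamma>dx / sqrt (min \<Gamma>\<omega> (min \<Gamma>\<theta> \<Gamma>\<sigma>)) \<and>
               infnorm (yr t - y t)
                 \<le> \<upsilon>dy t * infnorm x0 + \<gamma>dy / sqrt (min \<Gamma>\<omega> (min \<Gamma>\<theta> \<Gamma>\<sigma>)))))"
  proof (intro conjI allI impI)
    fix f x0 \<Gamma>\<omega> \<Gamma>\<theta> \<Gamma>\<sigma> x u y xr ur yr
    assume run: "admissible_run S w f x0 \<Gamma>\<omega> \<Gamma>\<theta> \<Gamma>\<sigma> x u y xr ur yr"
    note e = admissible_run_errors[OF run]
    show "Linf_on {0..} (\<lambda>t. xr t - x t) \<le> ereal (rho_dx S w)"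
      "Linf_on {0..} (\<lambda>t. ur t - u t) \<le> ereal (rho_du S w)"
      "Linf_on {0..} x \<le> ereal (rho_x S)" "Linf_on {0..} u \<le> ereal (rho_u S w)"
      unfolding Linf_on_le_iff using e by auto
    show "Linf_on {0..} (\<lambda>t. yr t - y t) \<le> ereal (mat_infnorm (Cm S) * rho_dx S w)"
      unfolding Linf_on_le_iff
      using order_trans[OF e(4) mult_left_mono[OF e(2) c0]] by auto
  next
    have "strict_antimono_on {0..} vd" "strict_antimono_on {0..} vy"
      by (auto simp: monotone_on_def vd_def vy_def)
    moreover have "gd + 1 > 0" "?c * gd + 1 > 0" using gd0 c0 by (auto intro: add_nonneg_pos)
    ultimately show "\<exists>\<gamma>dx>0. \<exists>\<gamma>dy>0. \<exists>\<upsilon>dx \<upsilon>dy :: real \<Rightarrow> real.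
       strict_antimono_on {0..} \<upsilon>dx \<and> strict_antimono_on {0..} \<upsilon>dy \<and>
       (\<forall>f x0 \<Gamma>\<omega> \<Gamma>\<theta> \<Gamma>\<sigma> x u y xr ur yr.
          admissible_run S w f x0 \<Gamma>\<omega> \<Gamma>\<theta> \<Gamma>\<sigma> x u y xr ur yr \<longrightarrow>
            (\<forall>t\<ge>0.
               infnorm (xr t - x t)
                 \<le> \<upsilon>dx t * infnorm x0 + \<gamma>dx / sqrt (min \<Gamma>\<omega> (min \<Gamma>\<theta> \<Gamma>\<sigma>)) \<and>
               infnorm (yr t - y t)
                 \<le> \<upsilon>dy t * infnorm x0 + \<gamma>dy / sqrt (min \<Gamma>\<omega> (min \<Gamma>\<theta> \<Gamma>\<sigma>))))"
      using bounds
      by (intro exI[of _ "gd + 1"] exI[of _ "?c * gd + 1"] exI[of _ vd] exI[of _ vy] conjI allI impI) auto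
  qed
qed

end
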